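(* Let $\lambda>\aleph_1$ be a regular cardinal with $\lambda^{<\lambda}=\lambda$. Let $\langle\mathbb{P}_\alpha,\dot{\mathbb{Q}}_\alpha:\alpha<\omega_1\rangle$ be a finite support forcing iteration such that for every $\alpha<\omega_1$, $\Vdash_\alpha$ "$\dot{\mathbb{Q}}_\alpha$ is ccc and $|\dot{\mathbb{Q}}_\alpha|\le\lambda$", and for every even $\alpha<\omega_1$, $\Vdash_\alpha\dot{\mathbb{Q}}_\alpha=\mathbb{C}_\lambda$. Then $\Vdash_{\omega_1}\mathrm{KT}(\aleph_1)$.
   Context: $\mathbb{C}_\lambda$ denotes the Cohen forcing adding $\lambda$ Cohen reals (finite partial functions from $\lambda\times\omega$ to $\omega$, or equivalently to $2$). $\mathbb{P}_{\omega_1}$ is the finite support limit of the iteration. All ultrafilters are nonprincipal. $\mathrm{KT}(\aleph_1)$ is the statement: for every countable first-order language $L$ and all $L$-structures $\mathcal{A},\mathcal{B}$ of size $\le\aleph_1$ with $\mathcal{A}\equiv\mathcal{B}$, there exists a nonprincipal ultrafilter $U$ over $\omega$ with $\mathcal{A}^\omega/U\cong\mathcal{B}^\omega/U$. *)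

theory Defs
  imports Main
begin

section \<open>The ground universe\<close>

text \<open>
  The set-theoretic universe in which the theorem is stated is an arbitrary type \<open>'a\<close> whose
  elements behave like the sets of ZFC. The axioms are those of Paulson's AFP entry
  ZFC-in-HOL, here as a type class; choice is inherited from HOL. ``Set'' below
  means an element of such a type.
\<close>

class zfc =
  fixes elts :: "'a \<Rightarrow> 'a set"
  assumes ext_ax: "elts x = elts y \<Longrightarrow> x = y"
    and down_ax: "Y \<subseteq> elts x \<Longrightarrow> Y \<in> range elts"
    and Union_ax: "X \<in> range elts \<Longrightarrow> \<Union> (elts ` X) \<in> range elts"
    and Pow_ax: "X \<in> range elts \<Longrightarrow> {x. elts x \<subseteq> X} \<in> range elts"
    and replacement_ax: "X \<in> range elts \<Longrightarrow> f ` X \<in> range elts"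
    and inf_ax: "range (g :: nat \<Rightarrow> 'a) \<in> range elts"
    and foundation_ax: "wf {(x, y). x \<in> elts y}"

text \<open>The set with a given extension; meaningful only when the extension is not a proper class.\<close>

definition vset :: "'a::zfc set \<Rightarrow> 'a"
  where "vset X = (THE x. elts x = X)"

definition vpair :: "'a::zfc \<Rightarrow> 'a \<Rightarrow> 'a"
  where "vpair x y = vset {vset {x}, vset {x, y}}"

definition vsucc :: "'a::zfc \<Rightarrow> 'a"
  where "vsucc x = vset (insert x (elts x))"

definition vfunction :: "'a::zfc \<Rightarrow> 'a \<Rightarrow> bool"
  where "vfunction p d \<longleftrightarrow>
    (\<forall>z\<in>elts p. \<exists>x\<in>elts d. \<exists>y. z = vpair x y) \<and> (\<forall>x\<in>elts d. \<exists>!y. vpair x y \<in> elts p)"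

definition vapp :: "'a::zfc \<Rightarrow> 'a \<Rightarrow> 'a"
  where "vapp p x = (THE y. vpair x y \<in> elts p)"

definition vrestrict :: "'a::zfc \<Rightarrow> 'a \<Rightarrow> 'a"
  where "vrestrict p d = vset {z \<in> elts p. \<exists>x\<in>elts d. \<exists>y. z = vpair x y}"

definition vdom :: "'a::zfc \<Rightarrow> 'a set"
  where "vdom r = {x. \<exists>y. vpair x y \<in> elts r}"

lemma elts_vset:
  assumes "X \<in> range elts"
  shows "elts (vset X) = X"
proof -
  from assms obtain x where x: "elts x = X" by blast
  have "vset X = x" unfolding vset_def
  proof (rule the_equality)
    show "elts x = X" by (rule x)
    show "y = x" if "elts y = X" for y using that x by (intro ext_ax) simp
  qed
  with x show ?thesis by simp
qed

lemma small_pair: "{x, y} \<in> range elts"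
proof -
  have "range (\<lambda>n::nat. if n = 0 then x else y) = {x, y}"
    by (auto simp: image_iff intro: exI[of _ "1::nat"])
  with inf_ax[of "\<lambda>n::nat. if n = 0 then x else y"] show ?thesis by simp
qed

lemma elts_vpair: "elts (vpair x y) = {vset {x}, vset {x, y}}"
  unfolding vpair_def by (rule elts_vset[OF small_pair])

lemma elts_singleton: "elts (vset {x}) = {x}"
  using elts_vset[OF small_pair[of x x]] by simp

lemma elts_doubleton: "elts (vset {x, y}) = {x, y}"
  by (rule elts_vset[OF small_pair])

abbreviation mem_rel :: "('a::zfc \<times> 'a) set"
  where "mem_rel \<equiv> {(x, y). x \<in> elts y}"

lemma vpair_fst_trancl:
  assumes "vpair z s \<in> elts x"
  shows "(z, x) \<in> mem_rel\<^sup>+"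
proof -
  have "(z, vset {z}) \<in> mem_rel" by (simp add: elts_singleton)
  moreover have "(vset {z}, vpair z s) \<in> mem_rel" by (simp add: elts_vpair)
  moreover have "(vpair z s, x) \<in> mem_rel" using assms by simp
  ultimately show ?thesis by (blast intro: trancl_into_trancl)
qed

section \<open>The language of set theory\<close>

text \<open>
  First-order formulas with one binary predicate, in higher-order abstract syntax: the parameter
  type \<open>'a\<close> holds the values of free variables. The notions of set theory below are defined once,
  as formulas parametric in \<open>'a\<close>, and are then read either in the ground universe
  (\<open>sat\<close>) or in a forcing extension (\<open>forces\<close>).
\<close>

datatype 'a fm =
    Mem 'a 'a  (infix "\<^bold>\<in>" 50)
  | Equ 'a 'a  (infix "\<^bold>=" 50)
  | Neg "'a fm"  ("\<^bold>\<not> _" [40] 40)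
  | Conj "'a fm" "'a fm"  (infixr "\<^bold>\<and>" 35)
  | FAll "'a \<Rightarrow> 'a fm"  (binder "\<^bold>\<forall>" 10)

definition Disj :: "'a fm \<Rightarrow> 'a fm \<Rightarrow> 'a fm"  (infixr "\<^bold>\<or>" 30)
  where "(A \<^bold>\<or> B) = (\<^bold>\<not> (\<^bold>\<not> A \<^bold>\<and> \<^bold>\<not> B))"

definition Imp :: "'a fm \<Rightarrow> 'a fm \<Rightarrow> 'a fm"  (infixr "\<^bold>\<longrightarrow>" 25)
  where "(A \<^bold>\<longrightarrow> B) = (\<^bold>\<not> (A \<^bold>\<and> \<^bold>\<not> B))"

definition Iff :: "'a fm \<Rightarrow> 'a fm \<Rightarrow> 'a fm"  (infixr "\<^bold>\<longleftrightarrow>" 25)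
  where "(A \<^bold>\<longleftrightarrow> B) = ((A \<^bold>\<longrightarrow> B) \<^bold>\<and> (B \<^bold>\<longrightarrow> A))"

definition FEx :: "('a \<Rightarrow> 'a fm) \<Rightarrow> 'a fm"  (binder "\<^bold>\<exists>" 10)
  where "FEx F = (\<^bold>\<not> (\<^bold>\<forall>x. \<^bold>\<not> F x))"

definition AllIn :: "'a \<Rightarrow> ('a \<Rightarrow> 'a fm) \<Rightarrow> 'a fm"
  where "AllIn X F = (\<^bold>\<forall>x. x \<^bold>\<in> X \<^bold>\<longrightarrow> F x)"

definition ExIn :: "'a \<Rightarrow> ('a \<Rightarrow> 'a fm) \<Rightarrow> 'a fm"
  where "ExIn X F = (\<^bold>\<exists>x. x \<^bold>\<in> X \<^bold>\<and> F x)"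

syntax
  "_AllIn" :: "pttrn \<Rightarrow> 'a \<Rightarrow> 'a fm \<Rightarrow> 'a fm"  ("(3\<^bold>\<forall>_\<^bold>\<in>_./ _)" [0, 0, 10] 10)
  "_ExIn" :: "pttrn \<Rightarrow> 'a \<Rightarrow> 'a fm \<Rightarrow> 'a fm"  ("(3\<^bold>\<exists>_\<^bold>\<in>_./ _)" [0, 0, 10] 10)
translations
  "\<^bold>\<forall>x\<^bold>\<in>X. F" \<rightleftharpoons> "CONST AllIn X (\<lambda>x. F)"
  "\<^bold>\<exists>x\<^bold>\<in>X. F" \<rightleftharpoons> "CONST ExIn X (\<lambda>x. F)"

primrec sat :: "'a::zfc fm \<Rightarrow> bool"
  where
    "sat (Mem x y) \<longleftrightarrow> x \<in> elts y"
  | "sat (Equ x y) \<longleftrightarrow> x = y"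
  | "sat (Neg A) \<longleftrightarrow> \<not> sat A"
  | "sat (Conj A B) \<longleftrightarrow> sat A \<and> sat B"
  | "sat (FAll F) \<longleftrightarrow> (\<forall>x. sat (F x))"

lemma sat_simps [simp]:
  "sat (A \<^bold>\<or> B) \<longleftrightarrow> sat A \<or> sat B"
  "sat (A \<^bold>\<longrightarrow> B) \<longleftrightarrow> (sat A \<longrightarrow> sat B)"
  "sat (A \<^bold>\<longleftrightarrow> B) \<longleftrightarrow> (sat A \<longleftrightarrow> sat B)"
  "sat (FEx F) \<longleftrightarrow> (\<exists>x. sat (F x))"
  "sat (AllIn X F) \<longleftrightarrow> (\<forall>x\<in>elts X. sat (F x))"
  "sat (ExIn X F) \<longleftrightarrow> (\<exists>x\<in>elts X. sat (F x))"
  by (auto simp: Disj_def Imp_def Iff_def FEx_def AllIn_def ExIn_def)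

section \<open>Basic set theory, as formulas\<close>

definition is_subset :: "'a \<Rightarrow> 'a \<Rightarrow> 'a fm"
  where "is_subset x y = (\<^bold>\<forall>z\<^bold>\<in>x. z \<^bold>\<in> y)"

definition is_empty :: "'a \<Rightarrow> 'a fm"
  where "is_empty x = (\<^bold>\<forall>z. \<^bold>\<not> z \<^bold>\<in> x)"

definition is_upair :: "'a \<Rightarrow> 'a \<Rightarrow> 'a \<Rightarrow> 'a fm"
  where "is_upair u a b = (\<^bold>\<forall>z. z \<^bold>\<in> u \<^bold>\<longleftrightarrow> (z \<^bold>= a \<^bold>\<or> z \<^bold>= b))"

definition is_pair :: "'a \<Rightarrow> 'a \<Rightarrow> 'a \<Rightarrow> 'a fm"
  where "is_pair z a b = (\<^bold>\<exists>u. \<^bold>\<exists>v. is_upair u a a \<^bold>\<and> is_upair v a b \<^bold>\<and> is_upair z u v)"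

lemma sat_is_upair: "sat (is_upair u a b) \<longleftrightarrow> u = vset {a, b}"
proof
  assume "sat (is_upair u a b)"
  then have "elts u = {a, b}" by (auto simp: is_upair_def)
  then show "u = vset {a, b}" by (intro ext_ax) (simp add: elts_doubleton)
qed (simp add: is_upair_def elts_doubleton)

lemma sat_is_pair: "sat (is_pair z a b) \<longleftrightarrow> z = vpair a b"
  by (simp add: is_pair_def sat_is_upair vpair_def)

text \<open>When \<open>r\<close> is a function, \<open>\<langle>a, b\<rangle> \<^bold>\<in> r\<close> expresses \<open>r(a) = b\<close>.\<close>

definition pair_in :: "'a \<Rightarrow> 'a \<Rightarrow> 'a \<Rightarrow> 'a fm"  ("\<langle>_,/ _\<rangle> \<^bold>\<in> _" [0, 0, 51] 50)
  where "(\<langle>a, b\<rangle> \<^bold>\<in> r) = (\<^bold>\<exists>z\<^bold>\<in>r. is_pair z a b)"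

lemma sat_pair_in: "sat (\<langle>a, b\<rangle> \<^bold>\<in> r) \<longleftrightarrow> vpair a b \<in> elts r"
  by (auto simp: pair_in_def sat_is_pair)

definition is_union :: "'a \<Rightarrow> 'a \<Rightarrow> 'a \<Rightarrow> 'a fm"
  where "is_union z x y = (\<^bold>\<forall>u. u \<^bold>\<in> z \<^bold>\<longleftrightarrow> (u \<^bold>\<in> x \<^bold>\<or> u \<^bold>\<in> y))"

definition is_inter :: "'a \<Rightarrow> 'a \<Rightarrow> 'a \<Rightarrow> 'a fm"
  where "is_inter z x y = (\<^bold>\<forall>u. u \<^bold>\<in> z \<^bold>\<longleftrightarrow> (u \<^bold>\<in> x \<^bold>\<and> u \<^bold>\<in> y))"

definition is_diff :: "'a \<Rightarrow> 'a \<Rightarrow> 'a \<Rightarrow> 'a fm"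
  where "is_diff z x y = (\<^bold>\<forall>u. u \<^bold>\<in> z \<^bold>\<longleftrightarrow> (u \<^bold>\<in> x \<^bold>\<and> \<^bold>\<not> u \<^bold>\<in> y))"

definition is_succ :: "'a \<Rightarrow> 'a \<Rightarrow> 'a fm"
  where "is_succ y x = (\<^bold>\<forall>z. z \<^bold>\<in> y \<^bold>\<longleftrightarrow> (z \<^bold>\<in> x \<^bold>\<or> z \<^bold>= x))"

definition is_transitive :: "'a \<Rightarrow> 'a fm"
  where "is_transitive x = (\<^bold>\<forall>y\<^bold>\<in>x. is_subset y x)"

definition is_ordinal :: "'a \<Rightarrow> 'a fm"
  where "is_ordinal x = (is_transitive x \<^bold>\<and> (\<^bold>\<forall>y\<^bold>\<in>x. is_transitive y))"

definition is_omega :: "'a \<Rightarrow> 'a fm"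
  where "is_omega w = (is_ordinal w \<^bold>\<and> (\<^bold>\<exists>e\<^bold>\<in>w. is_empty e)
    \<^bold>\<and> (\<^bold>\<forall>x\<^bold>\<in>w. \<^bold>\<exists>y\<^bold>\<in>w. is_succ y x)
    \<^bold>\<and> (\<^bold>\<forall>x\<^bold>\<in>w. is_empty x \<^bold>\<or> (\<^bold>\<exists>y\<^bold>\<in>w. is_succ x y)))"

definition is_function_on :: "'a \<Rightarrow> 'a \<Rightarrow> 'a fm"
  where "is_function_on f X = ((\<^bold>\<forall>z\<^bold>\<in>f. \<^bold>\<exists>x\<^bold>\<in>X. \<^bold>\<exists>y. is_pair z x y)
    \<^bold>\<and> (\<^bold>\<forall>x\<^bold>\<in>X. \<^bold>\<exists>y. \<langle>x, y\<rangle> \<^bold>\<in> f \<^bold>\<and> (\<^bold>\<forall>y'. \<langle>x, y'\<rangle> \<^bold>\<in> f \<^bold>\<longrightarrow> y' \<^bold>= y)))"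

definition is_fun :: "'a \<Rightarrow> 'a \<Rightarrow> 'a \<Rightarrow> 'a fm"
  where "is_fun f X Y = (is_function_on f X \<^bold>\<and> (\<^bold>\<forall>x. \<^bold>\<forall>y. \<langle>x, y\<rangle> \<^bold>\<in> f \<^bold>\<longrightarrow> y \<^bold>\<in> Y))"

definition is_inj :: "'a \<Rightarrow> 'a \<Rightarrow> 'a \<Rightarrow> 'a fm"
  where "is_inj f X Y = (is_fun f X Y
    \<^bold>\<and> (\<^bold>\<forall>x. \<^bold>\<forall>x'. \<^bold>\<forall>y. \<langle>x, y\<rangle> \<^bold>\<in> f \<^bold>\<and> \<langle>x', y\<rangle> \<^bold>\<in> f \<^bold>\<longrightarrow> x \<^bold>= x'))"

definition is_bij :: "'a \<Rightarrow> 'a \<Rightarrow> 'a \<Rightarrow> 'a fm"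
  where "is_bij f X Y = (is_inj f X Y \<^bold>\<and> (\<^bold>\<forall>y\<^bold>\<in>Y. \<^bold>\<exists>x. \<langle>x, y\<rangle> \<^bold>\<in> f))"

text \<open>\<open>h = g \<circ> f\<close> (first \<open>f\<close>, then \<open>g\<close>); applied to a tuple \<open>f\<close>, this maps \<open>g\<close> over it.\<close>

definition is_comp :: "'a \<Rightarrow> 'a \<Rightarrow> 'a \<Rightarrow> 'a fm"
  where "is_comp h g f = (\<^bold>\<forall>z. z \<^bold>\<in> h \<^bold>\<longleftrightarrow>
    (\<^bold>\<exists>k. \<^bold>\<exists>x. \<^bold>\<exists>y. \<langle>k, x\<rangle> \<^bold>\<in> f \<^bold>\<and> \<langle>x, y\<rangle> \<^bold>\<in> g \<^bold>\<and> is_pair z k y))"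

definition is_funspace :: "'a \<Rightarrow> 'a \<Rightarrow> 'a \<Rightarrow> 'a fm"
  where "is_funspace D X Y = (\<^bold>\<forall>f. f \<^bold>\<in> D \<^bold>\<longleftrightarrow> is_fun f X Y)"

definition card_le :: "'a \<Rightarrow> 'a \<Rightarrow> 'a fm"
  where "card_le X Y = (\<^bold>\<exists>f. is_inj f X Y)"

definition equipotent :: "'a \<Rightarrow> 'a \<Rightarrow> 'a fm"
  where "equipotent X Y = (\<^bold>\<exists>f. is_bij f X Y)"

definition is_finite :: "'a \<Rightarrow> 'a fm"
  where "is_finite X = (\<^bold>\<exists>w. is_omega w \<^bold>\<and> (\<^bold>\<exists>n\<^bold>\<in>w. card_le X n))"

definition is_countable :: "'a \<Rightarrow> 'a fm"
  where "is_countable X = (\<^bold>\<exists>w. is_omega w \<^bold>\<and> card_le X w)"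

definition is_cardinal :: "'a \<Rightarrow> 'a fm"
  where "is_cardinal k = (is_ordinal k \<^bold>\<and> (\<^bold>\<forall>a\<^bold>\<in>k. \<^bold>\<not> card_le k a))"

definition is_aleph1 :: "'a \<Rightarrow> 'a fm"
  where "is_aleph1 k =
    (is_ordinal k \<^bold>\<and> \<^bold>\<not> is_countable k \<^bold>\<and> (\<^bold>\<forall>a\<^bold>\<in>k. is_countable a))"

definition is_regular_cardinal :: "'a \<Rightarrow> 'a fm"
  where "is_regular_cardinal k = (is_cardinal k \<^bold>\<and> \<^bold>\<not> is_finite k
    \<^bold>\<and> (\<^bold>\<forall>a\<^bold>\<in>k. \<^bold>\<forall>f. is_fun f a k \<^bold>\<longrightarrow>
          (\<^bold>\<exists>b\<^bold>\<in>k. \<^bold>\<forall>x. \<^bold>\<forall>y. \<langle>x, y\<rangle> \<^bold>\<in> f \<^bold>\<longrightarrow> y \<^bold>\<in> b)))"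

text \<open>\<open>k\<^bsup><k\<^esup> = k\<close>: the set of all functions from an ordinal below \<open>k\<close> to \<open>k\<close> has cardinality \<open>k\<close>.\<close>

definition power_below_eq :: "'a \<Rightarrow> 'a fm"
  where "power_below_eq k =
    (\<^bold>\<exists>S. (\<^bold>\<forall>f. f \<^bold>\<in> S \<^bold>\<longleftrightarrow> (\<^bold>\<exists>a\<^bold>\<in>k. is_fun f a k)) \<^bold>\<and> equipotent S k)"

section \<open>Forcing notions, as formulas\<close>

text \<open>
  A forcing notion is a set \<open>Q\<close> with a preorder \<open>le\<close> (a set of pairs, smaller conditions
  being stronger) and a largest element \<open>t\<close>.
\<close>

definition is_forcing_notion :: "'a \<Rightarrow> 'a \<Rightarrow> 'a \<Rightarrow> 'a fm"
  where "is_forcing_notion Q le t = ((\<^bold>\<forall>z\<^bold>\<in>le. \<^bold>\<exists>x\<^bold>\<in>Q. \<^bold>\<exists>y\<^bold>\<in>Q. is_pair z x y)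
    \<^bold>\<and> (\<^bold>\<forall>x\<^bold>\<in>Q. \<langle>x, x\<rangle> \<^bold>\<in> le)
    \<^bold>\<and> (\<^bold>\<forall>x. \<^bold>\<forall>y. \<^bold>\<forall>z. \<langle>x, y\<rangle> \<^bold>\<in> le \<^bold>\<and> \<langle>y, z\<rangle> \<^bold>\<in> le \<^bold>\<longrightarrow> \<langle>x, z\<rangle> \<^bold>\<in> le)
    \<^bold>\<and> t \<^bold>\<in> Q \<^bold>\<and> (\<^bold>\<forall>x\<^bold>\<in>Q. \<langle>x, t\<rangle> \<^bold>\<in> le))"

definition is_ccc :: "'a \<Rightarrow> 'a \<Rightarrow> 'a fm"
  where "is_ccc Q le = (\<^bold>\<forall>A. is_subset A Q
    \<^bold>\<and> (\<^bold>\<forall>x\<^bold>\<in>A. \<^bold>\<forall>y\<^bold>\<in>A. \<^bold>\<not> x \<^bold>= y \<^bold>\<longrightarrow> \<^bold>\<not> (\<^bold>\<exists>z\<^bold>\<in>Q. \<langle>z, x\<rangle> \<^bold>\<in> le \<^bold>\<and> \<langle>z, y\<rangle> \<^bold>\<in> le))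
    \<^bold>\<longrightarrow> is_countable A)"

text \<open>
  The conditions \<open>p\<close> are the finite partial functions from \<open>l \<times> w\<close> to \<open>w\<close>.
\<close>

definition is_cohen_condition :: "'a \<Rightarrow> 'a \<Rightarrow> 'a \<Rightarrow> 'a fm"
  where "is_cohen_condition w l p = (is_finite p
    \<^bold>\<and> (\<^bold>\<forall>z\<^bold>\<in>p. \<^bold>\<exists>a\<^bold>\<in>l. \<^bold>\<exists>n\<^bold>\<in>w. \<^bold>\<exists>m\<^bold>\<in>w. \<^bold>\<exists>u. is_pair u a n \<^bold>\<and> is_pair z u m)
    \<^bold>\<and> (\<^bold>\<forall>u. \<^bold>\<forall>m. \<^bold>\<forall>m'. \<langle>u, m\<rangle> \<^bold>\<in> p \<^bold>\<and> \<langle>u, m'\<rangle> \<^bold>\<in> p \<^bold>\<longrightarrow> m \<^bold>= m'))"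

definition is_cohen_forcing :: "'a \<Rightarrow> 'a \<Rightarrow> 'a \<Rightarrow> 'a \<Rightarrow> 'a fm"
  where "is_cohen_forcing l Q le t =
    ((\<^bold>\<exists>w. is_omega w \<^bold>\<and> (\<^bold>\<forall>p. p \<^bold>\<in> Q \<^bold>\<longleftrightarrow> is_cohen_condition w l p))
    \<^bold>\<and> (\<^bold>\<forall>z. z \<^bold>\<in> le \<^bold>\<longleftrightarrow> (\<^bold>\<exists>p\<^bold>\<in>Q. \<^bold>\<exists>q\<^bold>\<in>Q. is_pair z p q \<^bold>\<and> is_subset q p))
    \<^bold>\<and> is_empty t)"

section \<open>First-order model theory, as formulas\<close>

text \<open>
  A language is given by sets \<open>R\<close> and \<open>F\<close> of relation and function symbols and an arity function
  \<open>ar\<close> (constants are function symbols of arity \<open>0\<close>). A structure is a nonempty set \<open>A\<close> with an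
  interpretation function \<open>I\<close>. An \<open>n\<close>-tuple over \<open>A\<close> is a function \<open>n \<rightarrow> A\<close>.
\<close>

definition is_countable_language :: "'a \<Rightarrow> 'a \<Rightarrow> 'a \<Rightarrow> 'a fm"
  where "is_countable_language R F ar = ((\<^bold>\<forall>x\<^bold>\<in>R. \<^bold>\<not> x \<^bold>\<in> F)
    \<^bold>\<and> (\<^bold>\<exists>w. \<^bold>\<exists>X. is_omega w \<^bold>\<and> is_union X R F \<^bold>\<and> is_fun ar X w \<^bold>\<and> is_countable X))"

definition is_structure :: "'a \<Rightarrow> 'a \<Rightarrow> 'a \<Rightarrow> 'a \<Rightarrow> 'a \<Rightarrow> 'a fm"
  where "is_structure R F ar A I = ((\<^bold>\<exists>a. a \<^bold>\<in> A)
    \<^bold>\<and> (\<^bold>\<exists>X. is_union X R F \<^bold>\<and> is_function_on I X)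
    \<^bold>\<and> (\<^bold>\<forall>r\<^bold>\<in>R. \<^bold>\<forall>n. \<^bold>\<forall>V. \<langle>r, n\<rangle> \<^bold>\<in> ar \<^bold>\<and> \<langle>r, V\<rangle> \<^bold>\<in> I \<^bold>\<longrightarrow> (\<^bold>\<forall>s\<^bold>\<in>V. is_fun s n A))
    \<^bold>\<and> (\<^bold>\<forall>f\<^bold>\<in>F. \<^bold>\<forall>n. \<^bold>\<forall>V. \<langle>f, n\<rangle> \<^bold>\<in> ar \<^bold>\<and> \<langle>f, V\<rangle> \<^bold>\<in> I \<^bold>\<longrightarrow>
          (\<^bold>\<exists>D. is_funspace D n A \<^bold>\<and> is_fun V D A)))"

text \<open>
  Terms and formulas are coded as tagged tuples:
  variables \<open>\<langle>0,i\<rangle>\<close>, function terms \<open>\<langle>1,\<langle>f,s\<rangle>\<rangle>\<close>, atoms \<open>\<langle>2,\<langle>r,s\<rangle>\<rangle>\<close>, equations \<open>\<langle>3,\<langle>t,u\<rangle>\<rangle>\<close>,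
  negations \<open>\<langle>4,x\<rangle>\<close>, conjunctions \<open>\<langle>5,\<langle>x,y\<rangle>\<rangle>\<close> and universal quantifications \<open>\<langle>6,\<langle>i,x\<rangle>\<rangle>\<close>, where
  \<open>s\<close> is a tuple of terms.
\<close>

primrec is_numeral :: "nat \<Rightarrow> 'a \<Rightarrow> 'a fm"
  where
    "is_numeral 0 x = is_empty x"
  | "is_numeral (Suc k) x = (\<^bold>\<exists>y. is_numeral k y \<^bold>\<and> is_succ x y)"

definition is_tagged :: "nat \<Rightarrow> 'a \<Rightarrow> 'a \<Rightarrow> 'a fm"
  where "is_tagged k z x = (\<^bold>\<exists>t. is_numeral k t \<^bold>\<and> is_pair z t x)"

definition is_tagged2 :: "nat \<Rightarrow> 'a \<Rightarrow> 'a \<Rightarrow> 'a \<Rightarrow> 'a fm"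
  where "is_tagged2 k z x y = (\<^bold>\<exists>u. is_pair u x y \<^bold>\<and> is_tagged k z u)"

definition "is_Var = is_tagged 0"
definition "is_App = is_tagged2 1"
definition "is_Rel = is_tagged2 2"
definition "is_Eqn = is_tagged2 3"
definition "is_Not = is_tagged 4"
definition "is_And = is_tagged2 5"
definition "is_Forall = is_tagged2 6"

definition closed_terms :: "'a \<Rightarrow> 'a \<Rightarrow> 'a \<Rightarrow> 'a \<Rightarrow> 'a fm"
  where "closed_terms w F ar T = ((\<^bold>\<forall>i\<^bold>\<in>w. \<^bold>\<forall>z. is_Var z i \<^bold>\<longrightarrow> z \<^bold>\<in> T)
    \<^bold>\<and> (\<^bold>\<forall>f\<^bold>\<in>F. \<^bold>\<forall>n. \<^bold>\<forall>s. \<^bold>\<forall>z.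
          \<langle>f, n\<rangle> \<^bold>\<in> ar \<^bold>\<and> is_fun s n T \<^bold>\<and> is_App z f s \<^bold>\<longrightarrow> z \<^bold>\<in> T))"

definition is_terms :: "'a \<Rightarrow> 'a \<Rightarrow> 'a \<Rightarrow> 'a \<Rightarrow> 'a fm"
  where "is_terms w F ar T =
    (closed_terms w F ar T \<^bold>\<and> (\<^bold>\<forall>T'. closed_terms w F ar T' \<^bold>\<longrightarrow> is_subset T T'))"

definition closed_formulas :: "'a \<Rightarrow> 'a \<Rightarrow> 'a \<Rightarrow> 'a \<Rightarrow> 'a \<Rightarrow> 'a fm"
  where "closed_formulas w R ar T X =
    ((\<^bold>\<forall>r\<^bold>\<in>R. \<^bold>\<forall>n. \<^bold>\<forall>s. \<^bold>\<forall>z.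
        \<langle>r, n\<rangle> \<^bold>\<in> ar \<^bold>\<and> is_fun s n T \<^bold>\<and> is_Rel z r s \<^bold>\<longrightarrow> z \<^bold>\<in> X)
    \<^bold>\<and> (\<^bold>\<forall>t\<^bold>\<in>T. \<^bold>\<forall>u\<^bold>\<in>T. \<^bold>\<forall>z. is_Eqn z t u \<^bold>\<longrightarrow> z \<^bold>\<in> X)
    \<^bold>\<and> (\<^bold>\<forall>x\<^bold>\<in>X. \<^bold>\<forall>z. is_Not z x \<^bold>\<longrightarrow> z \<^bold>\<in> X)
    \<^bold>\<and> (\<^bold>\<forall>x\<^bold>\<in>X. \<^bold>\<forall>y\<^bold>\<in>X. \<^bold>\<forall>z. is_And z x y \<^bold>\<longrightarrow> z \<^bold>\<in> X)
    \<^bold>\<and> (\<^bold>\<forall>i\<^bold>\<in>w. \<^bold>\<forall>x\<^bold>\<in>X. \<^bold>\<forall>z. is_Forall z i x \<^bold>\<longrightarrow> z \<^bold>\<in> X))"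

definition is_formulas :: "'a \<Rightarrow> 'a \<Rightarrow> 'a \<Rightarrow> 'a \<Rightarrow> 'a \<Rightarrow> 'a fm"
  where "is_formulas w R ar T X =
    (closed_formulas w R ar T X \<^bold>\<and> (\<^bold>\<forall>X'. closed_formulas w R ar T X' \<^bold>\<longrightarrow> is_subset X X'))"

text \<open>\<open>\<langle>z, j\<rangle> \<^bold>\<in> G\<close> expresses that variable \<open>j\<close> occurs free in the term or formula \<open>z\<close>.\<close>

definition is_free_vars :: "'a \<Rightarrow> 'a \<Rightarrow> 'a \<Rightarrow> 'a \<Rightarrow> 'a fm"
  where "is_free_vars w T X G = (\<^bold>\<forall>j\<^bold>\<in>w.
      (\<^bold>\<forall>i\<^bold>\<in>w. \<^bold>\<forall>z. is_Var z i \<^bold>\<longrightarrow> (\<langle>z, j\<rangle> \<^bold>\<in> G \<^bold>\<longleftrightarrow> j \<^bold>= i))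
    \<^bold>\<and> (\<^bold>\<forall>z\<^bold>\<in>T. \<^bold>\<forall>f. \<^bold>\<forall>s. is_App z f s \<^bold>\<longrightarrow>
        (\<langle>z, j\<rangle> \<^bold>\<in> G \<^bold>\<longleftrightarrow> (\<^bold>\<exists>k. \<^bold>\<exists>t. \<langle>k, t\<rangle> \<^bold>\<in> s \<^bold>\<and> \<langle>t, j\<rangle> \<^bold>\<in> G)))
    \<^bold>\<and> (\<^bold>\<forall>z\<^bold>\<in>X. \<^bold>\<forall>r. \<^bold>\<forall>s. is_Rel z r s \<^bold>\<longrightarrow>
        (\<langle>z, j\<rangle> \<^bold>\<in> G \<^bold>\<longleftrightarrow> (\<^bold>\<exists>k. \<^bold>\<exists>t. \<langle>k, t\<rangle> \<^bold>\<in> s \<^bold>\<and> \<langle>t, j\<rangle> \<^bold>\<in> G)))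
    \<^bold>\<and> (\<^bold>\<forall>z\<^bold>\<in>X. \<^bold>\<forall>t. \<^bold>\<forall>u. is_Eqn z t u \<^bold>\<longrightarrow>
        (\<langle>z, j\<rangle> \<^bold>\<in> G \<^bold>\<longleftrightarrow> (\<langle>t, j\<rangle> \<^bold>\<in> G \<^bold>\<or> \<langle>u, j\<rangle> \<^bold>\<in> G)))
    \<^bold>\<and> (\<^bold>\<forall>z\<^bold>\<in>X. \<^bold>\<forall>x. is_Not z x \<^bold>\<longrightarrow> (\<langle>z, j\<rangle> \<^bold>\<in> G \<^bold>\<longleftrightarrow> \<langle>x, j\<rangle> \<^bold>\<in> G))
    \<^bold>\<and> (\<^bold>\<forall>z\<^bold>\<in>X. \<^bold>\<forall>x. \<^bold>\<forall>y. is_And z x y \<^bold>\<longrightarrow>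
        (\<langle>z, j\<rangle> \<^bold>\<in> G \<^bold>\<longleftrightarrow> (\<langle>x, j\<rangle> \<^bold>\<in> G \<^bold>\<or> \<langle>y, j\<rangle> \<^bold>\<in> G)))
    \<^bold>\<and> (\<^bold>\<forall>z\<^bold>\<in>X. \<^bold>\<forall>i. \<^bold>\<forall>x. is_Forall z i x \<^bold>\<longrightarrow>
        (\<langle>z, j\<rangle> \<^bold>\<in> G \<^bold>\<longleftrightarrow> (\<^bold>\<not> j \<^bold>= i \<^bold>\<and> \<langle>x, j\<rangle> \<^bold>\<in> G))))"

text \<open>\<open>v' = v(i := a)\<close>\<close>

definition is_update :: "'a \<Rightarrow> 'a \<Rightarrow> 'a \<Rightarrow> 'a \<Rightarrow> 'a fm"
  where "is_update v' v i a = (\<^bold>\<forall>z. z \<^bold>\<in> v' \<^bold>\<longleftrightarrow>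
    ((z \<^bold>\<in> v \<^bold>\<and> \<^bold>\<not> (\<^bold>\<exists>b. is_pair z i b)) \<^bold>\<or> is_pair z i a))"

text \<open>\<open>e : T \<rightarrow> A\<close> is the evaluation of terms under the assignment \<open>v : w \<rightarrow> A\<close>.\<close>

definition is_evaluation :: "'a \<Rightarrow> 'a \<Rightarrow> 'a \<Rightarrow> 'a \<Rightarrow> 'a \<Rightarrow> 'a \<Rightarrow> 'a fm"
  where "is_evaluation w T A I v e = (is_fun e T A
    \<^bold>\<and> (\<^bold>\<forall>i\<^bold>\<in>w. \<^bold>\<forall>z. \<^bold>\<forall>a. is_Var z i \<^bold>\<and> \<langle>i, a\<rangle> \<^bold>\<in> v \<^bold>\<longrightarrow> \<langle>z, a\<rangle> \<^bold>\<in> e)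
    \<^bold>\<and> (\<^bold>\<forall>z\<^bold>\<in>T. \<^bold>\<forall>f. \<^bold>\<forall>s. \<^bold>\<forall>c. \<^bold>\<forall>V. \<^bold>\<forall>a.
        is_App z f s \<^bold>\<and> is_comp c e s \<^bold>\<and> \<langle>f, V\<rangle> \<^bold>\<in> I \<^bold>\<and> \<langle>c, a\<rangle> \<^bold>\<in> V \<^bold>\<longrightarrow> \<langle>z, a\<rangle> \<^bold>\<in> e))"

text \<open>Tarski's clauses: \<open>\<langle>z, v\<rangle> \<^bold>\<in> S\<close> expresses that the formula \<open>z\<close> holds under the assignment \<open>v\<close>.\<close>

definition is_satisfaction :: "'a \<Rightarrow> 'a \<Rightarrow> 'a \<Rightarrow> 'a \<Rightarrow> 'a \<Rightarrow> 'a \<Rightarrow> 'a fm"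
  where "is_satisfaction w T X A I S = (\<^bold>\<forall>v. \<^bold>\<forall>e.
    is_fun v w A \<^bold>\<and> is_evaluation w T A I v e \<^bold>\<longrightarrow>
      (\<^bold>\<forall>z\<^bold>\<in>X. \<^bold>\<forall>r. \<^bold>\<forall>s. \<^bold>\<forall>c. \<^bold>\<forall>V. is_Rel z r s \<^bold>\<and> is_comp c e s \<^bold>\<and> \<langle>r, V\<rangle> \<^bold>\<in> I \<^bold>\<longrightarrow>
        (\<langle>z, v\<rangle> \<^bold>\<in> S \<^bold>\<longleftrightarrow> c \<^bold>\<in> V))
    \<^bold>\<and> (\<^bold>\<forall>z\<^bold>\<in>X. \<^bold>\<forall>t. \<^bold>\<forall>u. is_Eqn z t u \<^bold>\<longrightarrow>
        (\<langle>z, v\<rangle> \<^bold>\<in> S \<^bold>\<longleftrightarrow> (\<^bold>\<exists>a. \<langle>t, a\<rangle> \<^bold>\<in> e \<^bold>\<and> \<langle>u, a\<rangle> \<^bold>\<in> e)))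
    \<^bold>\<and> (\<^bold>\<forall>z\<^bold>\<in>X. \<^bold>\<forall>x. is_Not z x \<^bold>\<longrightarrow> (\<langle>z, v\<rangle> \<^bold>\<in> S \<^bold>\<longleftrightarrow> \<^bold>\<not> \<langle>x, v\<rangle> \<^bold>\<in> S))
    \<^bold>\<and> (\<^bold>\<forall>z\<^bold>\<in>X. \<^bold>\<forall>x. \<^bold>\<forall>y. is_And z x y \<^bold>\<longrightarrow>
        (\<langle>z, v\<rangle> \<^bold>\<in> S \<^bold>\<longleftrightarrow> (\<langle>x, v\<rangle> \<^bold>\<in> S \<^bold>\<and> \<langle>y, v\<rangle> \<^bold>\<in> S)))
    \<^bold>\<and> (\<^bold>\<forall>z\<^bold>\<in>X. \<^bold>\<forall>i. \<^bold>\<forall>x. is_Forall z i x \<^bold>\<longrightarrow>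
        (\<langle>z, v\<rangle> \<^bold>\<in> S \<^bold>\<longleftrightarrow> (\<^bold>\<forall>a\<^bold>\<in>A. \<^bold>\<forall>v'. is_update v' v i a \<^bold>\<longrightarrow> \<langle>x, v'\<rangle> \<^bold>\<in> S))))"

definition true_in :: "'a \<Rightarrow> 'a \<Rightarrow> 'a \<Rightarrow> 'a \<Rightarrow> 'a fm"
  where "true_in w A S z = (\<^bold>\<forall>v. is_fun v w A \<^bold>\<longrightarrow> \<langle>z, v\<rangle> \<^bold>\<in> S)"

definition elementarily_equivalent :: "'a \<Rightarrow> 'a \<Rightarrow> 'a \<Rightarrow> 'a \<Rightarrow> 'a \<Rightarrow> 'a \<Rightarrow> 'a \<Rightarrow> 'a fm"
  where "elementarily_equivalent R F ar A I B J =
    (\<^bold>\<exists>w. \<^bold>\<exists>T. \<^bold>\<exists>X. \<^bold>\<exists>G. \<^bold>\<exists>S. \<^bold>\<exists>S'. is_omega w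
      \<^bold>\<and> is_terms w F ar T \<^bold>\<and> is_formulas w R ar T X \<^bold>\<and> is_free_vars w T X G
      \<^bold>\<and> is_satisfaction w T X A I S \<^bold>\<and> is_satisfaction w T X B J S'
      \<^bold>\<and> (\<^bold>\<forall>z\<^bold>\<in>X. (\<^bold>\<forall>j\<^bold>\<in>w. \<^bold>\<not> \<langle>z, j\<rangle> \<^bold>\<in> G) \<^bold>\<longrightarrow> (true_in w A S z \<^bold>\<longleftrightarrow> true_in w B S' z)))"

definition isomorphic :: "'a \<Rightarrow> 'a \<Rightarrow> 'a \<Rightarrow> 'a \<Rightarrow> 'a \<Rightarrow> 'a \<Rightarrow> 'a \<Rightarrow> 'a fm"
  where "isomorphic R F ar A I B J = (\<^bold>\<exists>h. is_bij h A B
    \<^bold>\<and> (\<^bold>\<forall>r\<^bold>\<in>R. \<^bold>\<forall>n. \<^bold>\<forall>V. \<^bold>\<forall>V'. \<^bold>\<forall>s. \<^bold>\<forall>t.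
        \<langle>r, n\<rangle> \<^bold>\<in> ar \<^bold>\<and> \<langle>r, V\<rangle> \<^bold>\<in> I \<^bold>\<and> \<langle>r, V'\<rangle> \<^bold>\<in> J \<^bold>\<and> is_fun s n A \<^bold>\<and> is_comp t h s \<^bold>\<longrightarrow>
        (s \<^bold>\<in> V \<^bold>\<longleftrightarrow> t \<^bold>\<in> V'))
    \<^bold>\<and> (\<^bold>\<forall>f\<^bold>\<in>F. \<^bold>\<forall>V. \<^bold>\<forall>V'. \<^bold>\<forall>s. \<^bold>\<forall>t. \<^bold>\<forall>a. \<^bold>\<forall>b.
        \<langle>f, V\<rangle> \<^bold>\<in> I \<^bold>\<and> \<langle>f, V'\<rangle> \<^bold>\<in> J \<^bold>\<and> is_comp t h s \<^bold>\<and> \<langle>s, a\<rangle> \<^bold>\<in> V \<^bold>\<and> \<langle>t, b\<rangle> \<^bold>\<in> V' \<^bold>\<longrightarrow>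
        \<langle>a, b\<rangle> \<^bold>\<in> h))"

section \<open>Ultrapowers, as formulas\<close>

definition is_nonprincipal_ultrafilter :: "'a \<Rightarrow> 'a \<Rightarrow> 'a fm"
  where "is_nonprincipal_ultrafilter w U = ((\<^bold>\<forall>X\<^bold>\<in>U. is_subset X w) \<^bold>\<and> w \<^bold>\<in> U
    \<^bold>\<and> (\<^bold>\<forall>X\<^bold>\<in>U. \<^bold>\<forall>Y. is_subset X Y \<^bold>\<and> is_subset Y w \<^bold>\<longrightarrow> Y \<^bold>\<in> U)
    \<^bold>\<and> (\<^bold>\<forall>X\<^bold>\<in>U. \<^bold>\<forall>Y\<^bold>\<in>U. \<^bold>\<forall>Z. is_inter Z X Y \<^bold>\<longrightarrow> Z \<^bold>\<in> U)
    \<^bold>\<and> (\<^bold>\<forall>X. \<^bold>\<forall>Y. is_subset X w \<^bold>\<and> is_diff Y w X \<^bold>\<longrightarrow> (X \<^bold>\<in> U \<^bold>\<longleftrightarrow> \<^bold>\<not> Y \<^bold>\<in> U))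
    \<^bold>\<and> (\<^bold>\<forall>n\<^bold>\<in>w. \<^bold>\<forall>Z. is_upair Z n n \<^bold>\<longrightarrow> \<^bold>\<not> Z \<^bold>\<in> U))"

text \<open>\<open>{m \<in> w. P m} \<in> U\<close>\<close>

definition almost_all :: "'a \<Rightarrow> 'a \<Rightarrow> ('a \<Rightarrow> 'a fm) \<Rightarrow> 'a fm"
  where "almost_all w U P = (\<^bold>\<exists>Z\<^bold>\<in>U. \<^bold>\<forall>m. m \<^bold>\<in> Z \<^bold>\<longleftrightarrow> (m \<^bold>\<in> w \<^bold>\<and> P m))"

text \<open>\<open>c\<close> is the equivalence class of \<open>f : w \<rightarrow> A\<close> modulo \<open>U\<close>.\<close>

definition is_ultra_class :: "'a \<Rightarrow> 'a \<Rightarrow> 'a \<Rightarrow> 'a \<Rightarrow> 'a \<Rightarrow> 'a fm"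
  where "is_ultra_class w U A f c = (\<^bold>\<forall>g. g \<^bold>\<in> c \<^bold>\<longleftrightarrow>
    (is_fun g w A \<^bold>\<and> almost_all w U (\<lambda>m. \<^bold>\<exists>a. \<langle>m, a\<rangle> \<^bold>\<in> f \<^bold>\<and> \<langle>m, a\<rangle> \<^bold>\<in> g)))"

text \<open>\<open>s\<close> is a tuple of representatives for the tuple of classes \<open>c\<close>.\<close>

definition is_representatives :: "'a \<Rightarrow> 'a \<Rightarrow> 'a \<Rightarrow> 'a fm"
  where "is_representatives n c s = (is_function_on s n
    \<^bold>\<and> (\<^bold>\<forall>j. \<^bold>\<forall>g. \<^bold>\<forall>x. \<langle>j, g\<rangle> \<^bold>\<in> s \<^bold>\<and> \<langle>j, x\<rangle> \<^bold>\<in> c \<^bold>\<longrightarrow> g \<^bold>\<in> x))"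

text \<open>For a tuple \<open>s\<close> of functions on \<open>w\<close>, \<open>t\<close> is the tuple of their values at \<open>m\<close>.\<close>

definition is_slice :: "'a \<Rightarrow> 'a \<Rightarrow> 'a \<Rightarrow> 'a fm"
  where "is_slice s m t = (\<^bold>\<forall>z. z \<^bold>\<in> t \<^bold>\<longleftrightarrow>
    (\<^bold>\<exists>j. \<^bold>\<exists>g. \<^bold>\<exists>a. \<langle>j, g\<rangle> \<^bold>\<in> s \<^bold>\<and> \<langle>m, a\<rangle> \<^bold>\<in> g \<^bold>\<and> is_pair z j a))"

text \<open>The structure \<open>(C, K)\<close> is the ultrapower of \<open>(A, I)\<close> by \<open>U\<close>.\<close>

definition is_ultrapower ::
    "'a \<Rightarrow> 'a \<Rightarrow> 'a \<Rightarrow> 'a \<Rightarrow> 'a \<Rightarrow> 'a \<Rightarrow> 'a \<Rightarrow> 'a \<Rightarrow> 'a \<Rightarrow> 'a fm"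
  where "is_ultrapower w U R F ar A I C K = (is_structure R F ar C K
    \<^bold>\<and> (\<^bold>\<forall>c. c \<^bold>\<in> C \<^bold>\<longleftrightarrow> (\<^bold>\<exists>f. is_fun f w A \<^bold>\<and> is_ultra_class w U A f c))
    \<^bold>\<and> (\<^bold>\<forall>r\<^bold>\<in>R. \<^bold>\<forall>n. \<^bold>\<forall>V. \<^bold>\<forall>V'. \<^bold>\<forall>c. \<^bold>\<forall>s.
        \<langle>r, n\<rangle> \<^bold>\<in> ar \<^bold>\<and> \<langle>r, V\<rangle> \<^bold>\<in> I \<^bold>\<and> \<langle>r, V'\<rangle> \<^bold>\<in> K \<^bold>\<and> is_fun c n C \<^bold>\<and> is_representatives n c s \<^bold>\<longrightarrow>
        (c \<^bold>\<in> V' \<^bold>\<longleftrightarrow> almost_all w U (\<lambda>m. \<^bold>\<exists>t\<^bold>\<in>V. is_slice s m t)))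
    \<^bold>\<and> (\<^bold>\<forall>f\<^bold>\<in>F. \<^bold>\<forall>n. \<^bold>\<forall>V. \<^bold>\<forall>V'. \<^bold>\<forall>c. \<^bold>\<forall>s. \<^bold>\<forall>d.
        \<langle>f, n\<rangle> \<^bold>\<in> ar \<^bold>\<and> \<langle>f, V\<rangle> \<^bold>\<in> I \<^bold>\<and> \<langle>f, V'\<rangle> \<^bold>\<in> K \<^bold>\<and> is_fun c n C \<^bold>\<and> is_representatives n c s
          \<^bold>\<and> \<langle>c, d\<rangle> \<^bold>\<in> V' \<^bold>\<longrightarrow>
        (\<^bold>\<exists>g\<^bold>\<in>d. \<^bold>\<forall>m\<^bold>\<in>w. \<^bold>\<exists>t. \<^bold>\<exists>a. is_slice s m t \<^bold>\<and> \<langle>t, a\<rangle> \<^bold>\<in> V \<^bold>\<and> \<langle>m, a\<rangle> \<^bold>\<in> g)))"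

definition KT :: "'a \<Rightarrow> 'a fm"
  where "KT k = (\<^bold>\<forall>R. \<^bold>\<forall>F. \<^bold>\<forall>ar. is_countable_language R F ar \<^bold>\<longrightarrow>
    (\<^bold>\<forall>A. \<^bold>\<forall>I. \<^bold>\<forall>B. \<^bold>\<forall>J.
      is_structure R F ar A I \<^bold>\<and> card_le A k \<^bold>\<and> is_structure R F ar B J \<^bold>\<and> card_le B k
        \<^bold>\<and> elementarily_equivalent R F ar A I B J \<^bold>\<longrightarrow>
      (\<^bold>\<exists>w. \<^bold>\<exists>U. is_omega w \<^bold>\<and> is_nonprincipal_ultrafilter w U
        \<^bold>\<and> (\<^bold>\<exists>C. \<^bold>\<exists>K. \<^bold>\<exists>D. \<^bold>\<exists>M. is_ultrapower w U R F ar A I C K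
              \<^bold>\<and> is_ultrapower w U R F ar B J D M \<^bold>\<and> isomorphic R F ar C K D M))))"

definition KT_aleph1 :: "'a fm"
  where "KT_aleph1 = (\<^bold>\<exists>k. is_aleph1 k \<^bold>\<and> KT k)"

section \<open>Names and the forcing relation\<close>

record 'a forcing =
  conds :: "'a set"
  stronger :: "'a \<Rightarrow> 'a \<Rightarrow> bool"
  weakest :: 'a

inductive is_name :: "'a::zfc forcing \<Rightarrow> 'a \<Rightarrow> bool"
  for P :: "'a forcing"
  where "(\<forall>z\<in>elts x. \<exists>y. \<exists>p\<in>conds P. z = vpair y p \<and> is_name P y) \<Longrightarrow> is_name P x"

text \<open>
  The atomic clauses are Kunen's: \<open>p\<close> forces \<open>x \<^bold>= y\<close> iff for every \<open>\<langle>z, s\<rangle> \<in> x\<close> it is dense below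
  \<open>p\<close> that if \<open>r \<le> s\<close> then \<open>r \<le> t\<close> and \<open>r\<close> forces \<open>z \<^bold>= w\<close> for some \<open>\<langle>w, t\<rangle> \<in> y\<close>,
  and symmetrically.
\<close>

context
  notes imp_cong [fundef_cong] conj_cong [fundef_cong]
begin

function (sequential) forces_eq :: "'a::zfc forcing \<Rightarrow> 'a \<Rightarrow> 'a \<Rightarrow> 'a \<Rightarrow> bool"
  where "forces_eq P x y p \<longleftrightarrow>
    (\<forall>z s. vpair z s \<in> elts x \<longrightarrow>
      (\<forall>q. q \<in> conds P \<and> stronger P q p \<longrightarrow>
        (\<exists>r. r \<in> conds P \<and> stronger P r q \<and> (stronger P r s \<longrightarrow>
          (\<exists>w t. vpair w t \<in> elts y \<and> stronger P r t \<and> forces_eq P z w r))))) \<and>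
    (\<forall>w t. vpair w t \<in> elts y \<longrightarrow>
      (\<forall>q. q \<in> conds P \<and> stronger P q p \<longrightarrow>
        (\<exists>r. r \<in> conds P \<and> stronger P r q \<and> (stronger P r t \<longrightarrow>
          (\<exists>z s. vpair z s \<in> elts x \<and> stronger P r s \<and> forces_eq P z w r)))))"
  by pat_completeness auto
termination
proof (relation "inv_image (mem_rel\<^sup>+) (\<lambda>(P, x, y, p). x)")
  show "wf (inv_image (mem_rel\<^sup>+) (\<lambda>(P :: 'a forcing, x :: 'a, y :: 'a, p :: 'a). x))"
    by (intro wf_inv_image wf_trancl foundation_ax)
qed (simp_all only: in_inv_image prod.case vpair_fst_trancl)

end

declare forces_eq.simps [simp del]

primrec forces :: "'a::zfc forcing \<Rightarrow> 'a \<Rightarrow> 'a fm \<Rightarrow> bool"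
  where
    forces_Mem: "forces P p (Mem x y) \<longleftrightarrow>
      (\<forall>q\<in>conds P. stronger P q p \<longrightarrow>
        (\<exists>r\<in>conds P. stronger P r q \<and>
          (\<exists>z s. vpair z s \<in> elts y \<and> stronger P r s \<and> forces_eq P x z r)))"
  | forces_Equ: "forces P p (Equ x y) \<longleftrightarrow> forces_eq P x y p"
  | forces_Neg: "forces P p (Neg A) \<longleftrightarrow> (\<forall>q\<in>conds P. stronger P q p \<longrightarrow> \<not> forces P q A)"
  | forces_Conj: "forces P p (Conj A B) \<longleftrightarrow> forces P p A \<and> forces P p B"
  | forces_All: "forces P p (FAll F) \<longleftrightarrow> (\<forall>x. is_name P x \<longrightarrow> forces P p (F x))"

definition forced :: "'a::zfc forcing \<Rightarrow> 'a fm \<Rightarrow> bool"  (infix "\<tturnstile>" 49)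
  where "P \<tturnstile> A \<longleftrightarrow> (\<forall>p\<in>conds P. forces P p A)"

text \<open>The canonical name of a ground-model set\<close>

function check :: "'a::zfc forcing \<Rightarrow> 'a \<Rightarrow> 'a"
  where "check P x = vset ((\<lambda>y. vpair (check P y) (weakest P)) ` elts x)"
  by pat_completeness auto
termination
  by (relation "inv_image mem_rel snd") (simp_all add: foundation_ax)

declare check.simps [simp del]

section \<open>Finite support iterations\<close>

text \<open>A name for a forcing notion is a triple of names.\<close>

record 'a forcing_name =
  nm_conds :: 'a
  nm_le :: 'a
  nm_top :: 'a

text \<open>
  A condition in \<open>P \<alpha>\<close> is a sequence \<open>p\<close> of length \<open>\<alpha>\<close> such that \<open>p(\<beta>) \<in> dom (Q \<beta>)\<close> and
  \<open>p\<restriction>\<beta>\<close> forces \<open>p(\<beta>) \<in> Q \<beta>\<close>; the requirement \<open>p(\<beta>) \<in> dom (Q \<beta>)\<close> is what makes \<open>P \<alpha>\<close> a set. The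
  clause covers \<open>0\<close>, successors, and (as finite support limits) limit ordinals.
\<close>

definition fs_conds ::
    "('a::zfc \<Rightarrow> 'a forcing) \<Rightarrow> ('a \<Rightarrow> 'a forcing_name) \<Rightarrow> 'a \<Rightarrow> 'a set"
  where "fs_conds P Q \<alpha> = {p. vfunction p \<alpha> \<and>
    (\<forall>\<beta>\<in>elts \<alpha>. vrestrict p \<beta> \<in> conds (P \<beta>) \<and>
      vapp p \<beta> \<in> vdom (nm_conds (Q \<beta>)) \<and>
      forces (P \<beta>) (vrestrict p \<beta>) (vapp p \<beta> \<^bold>\<in> nm_conds (Q \<beta>))) \<and>
    finite {\<beta> \<in> elts \<alpha>. vapp p \<beta> \<noteq> nm_top (Q \<beta>)}}"

definition fs_stronger ::
    "('a::zfc \<Rightarrow> 'a forcing) \<Rightarrow> ('a \<Rightarrow> 'a forcing_name) \<Rightarrow> 'a \<Rightarrow> 'a \<Rightarrow> 'a \<Rightarrow> bool"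
  where "fs_stronger P Q \<alpha> p q \<longleftrightarrow> p \<in> fs_conds P Q \<alpha> \<and> q \<in> fs_conds P Q \<alpha> \<and>
    (\<forall>\<beta>\<in>elts \<alpha>. forces (P \<beta>) (vrestrict p \<beta>) (\<langle>vapp p \<beta>, vapp q \<beta>\<rangle> \<^bold>\<in> nm_le (Q \<beta>)))"

definition fs_weakest :: "('a::zfc \<Rightarrow> 'a forcing_name) \<Rightarrow> 'a \<Rightarrow> 'a"
  where "fs_weakest Q \<alpha> = vset ((\<lambda>\<beta>. vpair \<beta> (nm_top (Q \<beta>))) ` elts \<alpha>)"

definition fs_iteration ::
    "'a::zfc \<Rightarrow> ('a \<Rightarrow> 'a forcing) \<Rightarrow> ('a \<Rightarrow> 'a forcing_name) \<Rightarrow> bool"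
  where "fs_iteration \<delta> P Q \<longleftrightarrow>
    (\<forall>\<alpha>\<in>elts (vsucc \<delta>).
      P \<alpha> = \<lparr>conds = fs_conds P Q \<alpha>, stronger = fs_stronger P Q \<alpha>, weakest = fs_weakest Q \<alpha>\<rparr>) \<and>
    (\<forall>\<alpha>\<in>elts \<delta>.
      is_name (P \<alpha>) (nm_conds (Q \<alpha>)) \<and> is_name (P \<alpha>) (nm_le (Q \<alpha>)) \<and>
      nm_top (Q \<alpha>) \<in> vdom (nm_conds (Q \<alpha>)) \<and>
      P \<alpha> \<tturnstile> is_forcing_notion (nm_conds (Q \<alpha>)) (nm_le (Q \<alpha>)) (nm_top (Q \<alpha>)))"

text \<open>Every ordinal is uniquely \<open>\<delta> + n\<close> with \<open>\<delta>\<close> zero or a limit; it is even iff \<open>n\<close> is.\<close>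

inductive even_ordinal :: "'a::zfc \<Rightarrow> bool"
  where
    "sat (is_ordinal \<delta>) \<Longrightarrow> (\<nexists>\<beta>. \<delta> = vsucc \<beta>) \<Longrightarrow> even_ordinal \<delta>"
  | "even_ordinal \<alpha> \<Longrightarrow> even_ordinal (vsucc (vsucc \<alpha>))"

end

(*
Truth in the extension is handled through two-valued structures read off ultrafilters on the set of
conditions, so that model-theoretic arguments take place in ordinary structures. A function from
omega into either structure has a name coded by countably many pairs of a condition and an ordinal
below omega_1; there are at most lam such codes, and each lives at some stage below omega_1. The
function with code tt is matched with a function into the other structure that reads a Cohen real
added at that stage, through an enumeration of the stage, as answers in an Ehrenfeucht game. By
genericity any finitely many matched pairs play correctly against each other at infinitely many
indices, so the sets of such indices generate a proper filter. A maximal family of names extending it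
gives a nonprincipal ultrafilter modulo which the matching respects all atomic formulas, and so
induces an isomorphism of the ultrapowers.
*)
theory Submission
  imports Defs "HOL-Library.Equipollence" "HOL-Library.Countable_Set"
begin

text \<open>The iteration has only \<omega>1 stages while the ultrapowers may have size
  \<open>lam\<close>, so no back-and-forth construction of length \<open>lam\<close> can follow the
  stages; each pair of functions is matched on its own, and only finitely many pairs are ever
  compared at once. What makes this possible is the size of the structures. They are enumerated by
  \<omega>1, so by the chain condition all data of a code lie below a stage \<open>w\<close>, which
  can be chosen closed under the answers in all games with positions below \<open>w\<close>. Such a
  \<open>w\<close> is countable, hence a function from \<omega> to \<omega> can list the answers,
  and it is a limit, hence even, so Cohen forcing is used there. Finitely many pairs are handled by
  recursion on the latest stage: its Cohen reals are still free at almost all indices when the game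
  below it has been decided. Saturation is replaced by games of finite length on finitely many
  atomic formulas, which elementary equivalence wins from the empty position. The filter is made
  maximal among families of ground objects, since subsets of \<omega> in the extension are available
  only as names.\<close>

notation (input) iff (infixr "<->" 25)
notation (input) Mem (infix ":." 50) and Equ (infix "=." 50) and Neg ("~. _" [40] 40) and
  Conj (infixr "&." 35) and Disj (infixr "|." 30) and Imp (infixr "->." 25) and Iff (infixr "<->." 25) and
  FAll (binder "!." 10) and FEx (binder "?." 10) and pair_in ("<|_,/ _|> :. _" [0, 0, 51] 50)

syntax
  "_All_in" :: "pttrn => 'a => 'a fm => 'a fm"  ("(3!._:._./ _)" [0, 0, 10] 10)
  "_Ex_in" :: "pttrn => 'a => 'a fm => 'a fm"  ("(3?._:._./ _)" [0, 0, 10] 10)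
translations
  "!.x:.X. F" => "CONST AllIn X (%x. F)"
  "?.x:.X. F" => "CONST ExIn X (%x. F)"

section \<open>Sets and ordinals of the ground universe\<close>

definition small :: "'a::zfc set => bool" where "small X <-> X:range elts"

lemma small_elts [simp, intro]: "small (elts x)" by (simp add: small_def)

lemma elts_vset': "small X ==> elts (vset X) = X" by (simp add: small_def elts_vset)

lemma small_subset: "small Y ==> X<=Y ==> small X" unfolding small_def using down_ax by blast

lemma small_image [simp, intro]: "small X ==> small (f ` X)" for f :: "'a::zfc => 'a" unfolding small_def by (rule replacement_ax)

lemma small_UN [intro]: "small X ==> (!!x. x:X ==> small (F x)) ==> small (UN x:X. F x)" for F :: "'a::zfc => 'a set"
proof -
 assume X: "small X" and F: "!!x. x:X ==> small (F x)"
 have "(UN x:X. F x) = \<Union> (elts ` ((%x. vset (F x)) ` X))" using F by (auto simp: elts_vset')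
 thus ?thesis using Union_ax small_image[OF X] unfolding small_def by metis
qed

lemma small_countable: "countable X ==> small X"
proof (cases "X = {}")
 case True
 thus ?thesis using small_subset[OF small_elts] by blast
next
 case False
 assume "countable X"
 then obtain g :: "nat => 'a" where "X = range g" using False by (metis range_from_nat_into)
 thus ?thesis unfolding small_def using inf_ax by simp
qed

lemma small_finite [simp, intro]: "finite X ==> small X" by (simp add: small_countable countable_finite)

text \<open>The union axiom takes a family indexed by a set, so the binary case needs an index set
  with two provably different elements: the empty set and its singleton.\<close>

lemma small_Un [simp, intro]:
 fixes X :: "'a::zfc set"
 assumes "small X" "small Y"
 shows "small (X Un Y)"
proof -
 have ne: "vset {vset {}} ~= (vset {} :: 'a)" by (metis elts_vset' empty_iff singletonI small_finite finite.emptyI finite_insert)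
 have "small (UN b:{vset {}, vset {vset {}} :: 'a}. if b = vset {} then X else Y)" using assms by (intro small_UN) auto
 thus ?thesis using ne by (simp add: Un_commute)
qed

lemma vset_elts [simp]: "vset (elts x) = x" by (rule ext_ax) (simp add: elts_vset')

lemma elts_eq_iff: "elts x = elts y <-> x = y" using ext_ax by blast

lemma vpair_inject [simp]: "vpair x y = vpair x' y' <-> x = x' & y = y'"
proof
 assume "vpair x y = vpair x' y'"
 hence eq: "{vset {x}, vset {x, y}} = {vset {x'}, vset {x', y'}}" by (metis elts_vpair)
 have inj: "vset {a, b} = vset {c, d} <-> {a, b} = {c, d}" for a b c d :: 'a by (metis elts_doubleton)
 have inj1: "vset {a} = vset {c, d} <-> {a} = {c, d}" for a c d :: 'a using inj[of a a c d] by simp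
 have inj2: "vset {c, d} = vset {a} <-> {a} = {c, d}" for a c d :: 'a using inj[of a a c d] by auto
 have inj3: "vset {c} = vset {a} <-> c = a" for a c :: 'a using inj[of a a c c] by auto
 show "x = x' & y = y'" using eq unfolding doubleton_eq_iff[of "vset {x}"] inj inj1 inj2 inj3
 by (smt (verit) doubleton_eq_iff insert_absorb2)
qed simp

lemma small_vpairs: "small A ==> small B ==> small ((%(x, y). vpair x y) ` (A \<times> B))"
proof -
 assume "small A" "small B"
 hence "small (UN x:A. (%y. vpair x y) ` B)" by blast
 also have "(UN x:A. (%y. vpair x y) ` B) = (%(x, y). vpair x y) ` (A \<times> B)" by force
 finally show ?thesis .
qed

lemma small_Pow: "small A ==> small (vset ` Pow A)"
proof -
 assume A: "small A"
 have "elts (vset X)<=A" if "X<=A" for X using elts_vset'[OF small_subset[OF A that]] that by simp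
 hence "vset ` Pow A<={x. elts x<=A}" by blast
 moreover have "small {x. elts x<=A}" using Pow_ax[of A] A by (simp add: small_def)
 ultimately show ?thesis by (rule small_subset[rotated])
qed

lemma small_vdom: "small (vdom r)"
proof -
 have "vdom r<=\<Union> (elts ` (UN z:elts r. elts z))"
 proof
 fix x assume "x:vdom r"
 then obtain y where y: "vpair x y:elts r" by (auto simp: vdom_def)
 have "vset {x}:elts (vpair x y)" "x:elts (vset {x})" by (simp_all add: elts_vpair elts_singleton)
 thus "x:\<Union> (elts ` (UN z:elts r. elts z))" using y by blast
 qed
 moreover have "small (\<Union> (elts ` (UN z:elts r. elts z)))"
 using small_UN[OF small_UN[OF small_elts[of r], of elts], of elts] by simp
 ultimately show ?thesis using small_subset by blast
qed

lemma wf_mem: "wf mem_rel" by (rule foundation_ax)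

lemma mem_irrefl [simp]: "x~:elts x" using wf_not_refl[OF wf_mem, of x] by simp

lemma mem_asym: "x:elts y ==> y~:elts x" using wf_not_sym[OF wf_mem, of x y] by simp

lemma mem_induct [case_names step]: "(!!x. (!!y. y:elts x ==> Ph y) ==> Ph x) ==> Ph x"
 using wf_induct_rule[OF wf_mem, of Ph x] by auto

lemma elts_vsucc [simp]: "elts (vsucc x) = insert x (elts x)"
proof -
 have "small ({x} Un elts x)" by (intro small_Un) auto
 thus ?thesis by (simp add: vsucc_def elts_vset')
qed

section \<open>Functions and restrictions as sets of pairs\<close>

definition vlam :: "'a::zfc => ('a => 'a) => 'a" where "vlam d f = vset ((%x. vpair x (f x)) ` elts d)"

lemma elts_vlam: "elts (vlam d f) = (%x. vpair x (f x)) ` elts d" by (simp add: vlam_def elts_vset')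

lemma vfunction_vlam [simp]: "vfunction (vlam d f) d" by (auto simp: vfunction_def elts_vlam)

lemma vapp_vlam [simp]: "x:elts d ==> vapp (vlam d f) x = f x" by (auto simp: vapp_def elts_vlam)

lemma vapp_in: "vfunction p d ==> x:elts d ==> vpair x (vapp p x):elts p"
 unfolding vfunction_def vapp_def by (metis (no_types, lifting) theI')

lemma vapp_eq: "vfunction p d ==> vpair x y:elts p ==> vapp p x = y & x:elts d" unfolding vfunction_def vapp_def
 by (smt (verit, best) the1_equality vpair_inject)

lemma vfunction_eq_vlam: "vfunction p d ==> p = vlam d (vapp p)"
proof (rule ext_ax)
 assume p: "vfunction p d"
 show "elts p = elts (vlam d (vapp p))"
 proof
 show "elts p<=elts (vlam d (vapp p))"
 proof
 fix z assume z: "z:elts p"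
 then obtain x y where xy: "x:elts d" "z = vpair x y" using p by (auto simp: vfunction_def)
 thus "z:elts (vlam d (vapp p))" using vapp_eq[OF p, of x y] z by (auto simp: elts_vlam)
 qed
 show "elts (vlam d (vapp p))<=elts p" using vapp_in[OF p] by (auto simp: elts_vlam)
 qed
qed

lemma vlam_cong: "(!!x. x:elts d ==> f x = g x) ==> vlam d f = vlam d g" by (rule ext_ax) (auto simp: elts_vlam)

lemma vfunction_eqI:
 "vfunction p d ==> vfunction q d ==> (!!x. x:elts d ==> vapp p x = vapp q x) ==> p = q"
 using vfunction_eq_vlam vlam_cong by metis

abbreviation rst :: "'a::zfc => 'a => 'a" where "rst == vrestrict"

lemma elts_vrestrict: "elts (rst p d) = {z:elts p. EX x:elts d. EX y. z = vpair x y}"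
 unfolding vrestrict_def by (rule elts_vset') (rule small_subset[of "elts p"], auto)

lemma rst_vlam: "elts e<=elts d ==> rst (vlam d f) e = vlam e f" by (rule ext_ax) (auto simp: elts_vrestrict elts_vlam)

lemma
 assumes "vfunction p d" "elts e<=elts d"
 shows vfunction_vrestrict: "vfunction (rst p e) e"
 and vapp_vrestrict: "x:elts e ==> vapp (rst p e) x = vapp p x"
proof -
 have eq: "rst p e = vlam e (vapp p)" using rst_vlam[OF assms(2)] vfunction_eq_vlam[OF assms(1)] by metis
 show "vfunction (rst p e) e" by (simp add: eq)
 show "x:elts e ==> vapp (rst p e) x = vapp p x" by (simp add: eq)
qed

lemma vrestrict_self: "vfunction p d ==> rst p d = p"
 by (rule vfunction_eqI[of _ d]) (auto simp: vfunction_vrestrict vapp_vrestrict)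

lemma vrestrict_vrestrict:
 "vfunction p d ==> elts e<=elts d ==> elts e'<=elts e ==>
 rst (rst p e) e' = rst p e'" using rst_vlam[of e d] rst_vlam[of e' e] rst_vlam[of e' d] vfunction_eq_vlam[of p d]
 by (metis subset_trans)

text \<open>This is what keeps the conditions of an iteration a set: their coordinates range over
  the domains of the names for the iterands.\<close>

lemma small_vfunctions:
 assumes "!!x. x:elts d ==> small (B x)"
 shows "small {p. vfunction p d & (!x:elts d. vapp p x:B x)}"
proof -
 have "small (UN x:elts d. (%y. vpair x y) ` B x)" using assms by blast
 hence "small (vset ` Pow (UN x:elts d. (%y. vpair x y) ` B x))" by (rule small_Pow)
 moreover have "{p. vfunction p d & (!x:elts d. vapp p x:B x)}
 <=vset ` Pow (UN x:elts d. (%y. vpair x y) ` B x)"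
 proof
 fix p assume "p:{p. vfunction p d & (!x:elts d. vapp p x:B x)}"
 hence "elts p<=(UN x:elts d. (%y. vpair x y) ` B x)" using vfunction_eq_vlam[of p d] elts_vlam[of d "vapp p"] by auto
 thus "p:vset ` Pow (UN x:elts d. (%y. vpair x y) ` B x)" by (metis PowI imageI vset_elts)
 qed
 ultimately show ?thesis using small_subset by blast
qed

section \<open>Ordinals and natural numbers of the ground universe\<close>

definition vord :: "'a::zfc => bool" where "vord x <-> (!y:elts x. elts y<=elts x) & (!y:elts x. !z:elts y. elts z<=elts y)"

lemma sat_is_ordinal: "sat (is_ordinal x) <-> vord x"
 unfolding is_ordinal_def is_transitive_def is_subset_def vord_def subset_iff by (simp add: Ball_def)

lemma vord_trans: "vord x ==> y:elts x ==> z:elts y ==> z:elts x" by (auto simp: vord_def)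

lemma vord_subset: "vord x ==> y:elts x ==> elts y<=elts x" by (auto simp: vord_def)

lemma vord_in: "vord x ==> y:elts x ==> vord y" unfolding vord_def by blast

lemma vord_linear: "vord x ==> vord y ==> x:elts y \<or> x = y \<or> y:elts x"
proof (induction x arbitrary: y rule: mem_induct)
 case (step x)
 note IHx = step.IH and ox = step.prems(1)
 from step.prems(2) show ?case
 proof (induction y rule: mem_induct)
 case (step y)
 show ?case
 proof (rule ccontr)
 assume no: "~ (x:elts y \<or> x = y \<or> y:elts x)"
 have "elts x<=elts y" using IHx[OF _ vord_in[OF ox] step.prems] vord_trans[OF ox] no by blast
 moreover have "elts y<=elts x" using step.IH vord_in[OF step.prems] vord_trans[OF step.prems] no by blast
 ultimately show False using no ext_ax by blast
 qed
 qed
qed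

lemma vord_vsucc: "vord x ==> vord (vsucc x)" by (auto simp: vord_def)

lemma vord_subset_cases: "vord x ==> vord y ==> elts x<=elts y <-> x:elts y \<or> x = y"
 by (metis vord_linear vord_subset mem_irrefl subsetD subset_refl)

primrec vnat :: "nat => 'a::zfc" where "vnat 0 = vset {}" | "vnat (Suc n) = vsucc (vnat n)"

lemma elts_vnat_0 [simp]: "elts (vset {}) = {}" by (simp add: elts_vset')

lemma elts_vnat: "elts (vnat n) = vnat ` {..<n}" by (induction n) (auto simp: lessThan_Suc)

lemma vnat_inject [simp]: "vnat m = vnat n <-> m = n"
proof (induction m n rule: linorder_wlog)
 case (le a b)
 show ?case
 proof
 assume eq: "vnat a = (vnat b :: 'a)"
 show "a = b"
 proof (rule ccontr)
 assume "a ~= b"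
 hence "vnat a:elts (vnat b :: 'a)" using le by (simp add: elts_vnat)
 thus False using eq by simp
 qed
 qed simp
qed auto

definition vomega :: "'a::zfc" where "vomega = vset (range vnat)"

lemma elts_vomega: "elts vomega = range vnat" by (simp add: vomega_def elts_vset' small_countable)

lemma vord_vomega: "vord vomega" by (auto simp: vord_def elts_vomega elts_vnat)

lemma sat_is_empty: "sat (is_empty x) <-> x = vset {}"
proof -
 have "sat (is_empty x) <-> elts x = elts (vset {})" by (auto simp: is_empty_def)
 thus ?thesis by (simp add: elts_eq_iff del: elts_vnat_0)
qed

lemma sat_is_succ: "sat (is_succ y x) <-> y = vsucc x"
proof -
 have "sat (is_succ y x) <-> elts y = elts (vsucc x)" by (auto simp: is_succ_def)
 thus ?thesis by (simp only: elts_eq_iff)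
qed

text \<open>Induction on membership shows that \<open>w\<close> contains only numerals, since a
  nonempty element is the successor of a smaller element of \<open>w\<close>.\<close>

lemma sat_is_omega: "sat (is_omega w) <-> w = vomega"
proof
 assume w: "sat (is_omega w)"
 have "x:elts w ==> x:range vnat" for x
 proof (induction x rule: mem_induct)
 case (step x)
 then consider "x = vset {}" | y where "y:elts w" "x = vsucc y" using w by (auto simp: is_omega_def sat_is_empty sat_is_succ)
 thus ?case
 proof cases
 case 1
 hence "x = vnat 0" by simp
 thus ?thesis by blast
 next
 case 2
 then obtain n where "y = vnat n" using step.IH[of y] by auto
 hence "x = vnat (Suc n)" using 2 by simp
 thus ?thesis by blast
 qed
 qed
 moreover have "vnat n:elts w" for n using w by (induction n) (auto simp: is_omega_def sat_is_empty sat_is_succ)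
 ultimately have "elts w = elts vomega" by (auto simp: elts_vomega)
 thus "w = vomega" by (rule ext_ax)
next
 assume "w = vomega"
 moreover have "!x:elts (vomega::'a). x = vset {} \<or> (EX y:elts vomega. x = vsucc y)"
 proof
 fix x :: 'a assume "x:elts vomega"
 then obtain n where "x = vnat n" by (auto simp: elts_vomega)
 thus "x = vset {} \<or> (EX y:elts vomega. x = vsucc y)" by (cases n) (auto simp: elts_vomega)
 qed
 moreover have "vset {}:elts (vomega::'a)" using elts_vomega vnat.simps(1) by (metis rangeI)
 moreover have "!x:elts (vomega::'a). vsucc x:elts vomega" by (auto simp: elts_vomega simp flip: vnat.simps(2))
 ultimately show "sat (is_omega w)" using vord_vomega by (simp add: is_omega_def sat_is_ordinal sat_is_empty sat_is_succ)
qed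

lemma sat_is_function_on: "sat (is_function_on f X) <-> vfunction f X"
 unfolding is_function_on_def vfunction_def sat_simps sat.simps sat_is_pair sat_pair_in by (auto simp: Ex1_def)

lemma sat_is_fun: "sat (is_fun f X Y) <-> vfunction f X & (!x:elts X. vapp f x:elts Y)"
 unfolding is_fun_def sat.simps sat_simps sat_is_function_on sat_pair_in using vapp_in vapp_eq by metis

section \<open>Cardinality: injections of the universe against injections of HOL\<close>

lemma sat_card_le: "sat (card_le X Y) <-> elts X \<lesssim> elts Y"
proof
 assume "sat (card_le X Y)"
 then obtain f where f: "sat (is_inj f X Y)" by (auto simp: card_le_def)
 hence fn: "vfunction f X" "!x:elts X. vapp f x:elts Y"
 and inj: "!!x x' y. vpair x y:elts f ==> vpair x' y:elts f ==> x = x'" by (auto simp: is_inj_def sat_is_fun sat_pair_in)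
 have "inj_on (vapp f) (elts X)" using vapp_in[OF fn(1)] inj by (metis inj_onI)
 thus "elts X \<lesssim> elts Y" using fn(2) unfolding lepoll_def by blast
next
 assume "elts X \<lesssim> elts Y"
 then obtain g where g: "inj_on g (elts X)" "g ` elts X<=elts Y" unfolding lepoll_def by blast
 have "sat (is_inj (vlam X g) X Y)" using g unfolding is_inj_def sat.simps sat_simps sat_is_fun sat_pair_in elts_vlam
 by (force simp: image_iff inj_on_def)
 thus "sat (card_le X Y)" by (auto simp: card_le_def)
qed

lemma lepoll_vomega: "X \<lesssim> elts (vomega::'a::zfc) <-> countable X"
proof
 assume "X \<lesssim> elts (vomega::'a)"
 moreover have "countable (elts (vomega::'a))" by (simp add: elts_vomega)
 ultimately show "countable X" by (metis countable_image_inj_on countable_subset lepoll_def)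
next
 assume "countable X"
 then obtain f :: "'b => nat" where "inj_on f X" by (auto simp: countable_def)
 hence "inj_on (%x. vnat (f x) :: 'a) X" by (auto simp: inj_on_def)
 thus "X \<lesssim> elts (vomega::'a)" unfolding lepoll_def elts_vomega by blast
qed

lemma sat_is_countable: "sat (is_countable X) <-> countable (elts X)"
 by (simp add: is_countable_def sat_is_omega sat_card_le lepoll_vomega)

lemma sat_is_aleph1:
 "sat (is_aleph1 k) <-> vord k & ~ countable (elts k) & (!a:elts k. countable (elts a))"
 by (simp add: is_aleph1_def sat_is_ordinal sat_is_countable)

text \<open>Otherwise \<omega>1 would be covered by the countably many countable sets
  \<open>insert x (elts x)\<close> with \<open>x\<close> in \<open>X\<close>.\<close>

lemma aleph1_bounded:
 assumes "sat (is_aleph1 k)" "countable X" "X<=elts k"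
 shows "EX a:elts k. X<=elts a"
proof (rule ccontr)
 have k: "vord k" "~ countable (elts k)" "!!a. a:elts k ==> countable (elts a)" using assms(1) by (auto simp: sat_is_aleph1)
 assume "~ (EX a:elts k. X<=elts a)"
 hence "elts k<=(UN x:X. insert x (elts x))" using assms(3) vord_linear[OF vord_in[OF k(1)] vord_in[OF k(1)]] by blast
 moreover have "countable (UN x:X. insert x (elts x))" using assms k(3) by (intro countable_UN) auto
 ultimately show False using k(2) countable_subset by blast
qed

lemma aleph1_succ: "sat (is_aleph1 k) ==> a:elts k ==> vsucc a:elts k"
proof -
 assume k: "sat (is_aleph1 k)" and a: "a:elts k"
 hence k': "vord k" "~ countable (elts k)" "countable (elts (vsucc a))" by (auto simp: sat_is_aleph1)
 hence "~ elts k<=elts (vsucc a)" using countable_subset by blast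
 moreover have "vord (vsucc a)" using k'(1) a vord_in vord_vsucc by blast
 ultimately show ?thesis using vord_linear[of "vsucc a" k] vord_subset[of "vsucc a" k] k'(1) by blast
qed

lemma aleph1_nonempty: "sat (is_aleph1 k) ==> vset {}:elts k"
proof -
 assume k: "sat (is_aleph1 k)"
 hence k': "vord k" "elts k ~= {}" by (auto simp: sat_is_aleph1)
 have "vord (vset {} :: 'a)" by (simp add: vord_def)
 thus ?thesis using vord_linear[of "vset {}" k] k' by fastforce
qed

text \<open>Infinite sequences are functions on \<open>vomega\<close>, which lies below
  \<open>lam\<close> because it lies below \<open>\<omega>1\<close>; so the power of
  \<open>lam\<close> below \<open>lam\<close> counts them. This bounds the number of codes of
  functions.\<close>

lemma lam_sequences:
 fixes lam :: "'a::zfc"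
 assumes "sat (is_aleph1 \<omega>1)" "sat (is_regular_cardinal lam)" "\<omega>1:elts lam"
 "sat (power_below_eq lam)"
 shows "{f :: nat => 'a. range f<=elts lam} \<lesssim> elts lam"
proof -
 have ol: "vord lam" using assms(2) by (auto simp: is_regular_cardinal_def is_cardinal_def sat_is_ordinal)
 hence o1: "vord \<omega>1" using assms(3) vord_in by blast
 have "\<omega>1 ~= vomega" using assms(1) by (auto simp: sat_is_aleph1 elts_vomega)
 moreover have "\<omega>1~:elts vomega" using assms(1) by (auto simp: sat_is_aleph1 elts_vomega elts_vnat)
 ultimately have "vomega:elts \<omega>1" using vord_linear[OF o1 vord_vomega] by blast
 hence om: "vomega:elts lam" using assms(3) ol vord_trans by blast
 obtain S where S: "!!f. f:elts S <-> (EX a:elts lam. sat (is_fun f a lam))" "sat (equipotent S lam)"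
 using assms(4) by (auto simp: power_below_eq_def)
 have SL: "elts S \<lesssim> elts lam"
 using S(2) unfolding sat_card_le[symmetric] by (auto simp: equipotent_def card_le_def is_bij_def)
 let ?g = "%f::nat => 'a. vlam vomega (%x. f (inv vnat x))"
 have iv: "inv vnat (vnat n :: 'a) = n" for n by (rule inv_f_f) (simp add: inj_def)
 have "inj_on ?g {f. range f<=elts lam}"
 proof (rule inj_onI)
 fix f f' :: "nat => 'a" assume "?g f = ?g f'"
 hence "vapp (?g f) (vnat n) = vapp (?g f') (vnat n)" for n by simp
 hence "f n = f' n" for n by (simp add: elts_vomega iv)
 thus "f = f'" by blast
 qed
 moreover have "?g ` {f. range f<=elts lam}<=elts S"
 proof
 fix h assume "h:?g ` {f. range f<=elts lam}"
 then obtain f where f: "range f<=elts lam" "h = ?g f" by blast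
 have "sat (is_fun h vomega lam)" using f by (auto simp: sat_is_fun)
 thus "h:elts S" using om S(1) by blast
 qed
 ultimately have "{f :: nat => 'a. range f<=elts lam} \<lesssim> elts S" unfolding lepoll_def by blast
 thus ?thesis using SL lepoll_trans by blast
qed

lemma infinite_lepoll_times: "infinite A ==> A \<times> A \<lesssim> A"
proof -
 assume "infinite A"
 hence "(card_of (A \<times> A), card_of A):ordLeq" by (intro ordIso_imp_ordLeq card_of_Times_same_infinite)
 thus ?thesis unfolding lepoll_def card_of_ordLeq[symmetric] by auto
qed

lemma lepoll_times_same: "infinite C ==> A \<lesssim> C ==> B \<lesssim> C ==> A \<times> B \<lesssim> C"
proof -
 assume C: "infinite C" "A \<lesssim> C" "B \<lesssim> C"
 obtain f g where "inj_on f A" "f ` A<=C" "inj_on g B" "g ` B<=C" using C unfolding lepoll_def by blast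
 hence "inj_on (map_prod f g) (A \<times> B)" "map_prod f g ` (A \<times> B)<=C \<times> C" by (auto simp: map_prod_inj_on)
 hence "A \<times> B \<lesssim> C \<times> C" unfolding lepoll_def by blast
 thus ?thesis using infinite_lepoll_times[OF C(1)] lepoll_trans by blast
qed

text \<open>Zorn's lemma for families that are pairwise in a symmetric relation. It yields maximal
  antichains, and in \<open>ccc_aleph1\<close> a maximal family of conditions whose supports meet
  only below a fixed stage.\<close>

lemma maximal_pairwise:
 fixes S :: "'b set"
 assumes "!!s t. R s t ==> R t s"
 obtains A where "A<=S" "!!s t. s:A ==> t:A ==> s ~= t ==> R s t"
 "!!s. s:S ==> s~:A ==> EX a:A. ~ R s a"
proof -
 define Z where "Z = {A. A<=S & (!s:A. !t:A. s ~= t --> R s t)}"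
 have "EX M:Z. !X:Z. M<=X --> X = M"
 proof (rule subset_Zorn')
 fix C assume C: "subset.chain Z C"
 have 1: "A<=S & (!s:A. !t:A. s ~= t --> R s t)" if "A:C" for A using C that unfolding subset_chain_def Z_def by blast
 have "R s t" if st: "s:\<Union>C" "t:\<Union>C" "s ~= t" for s t
 proof -
 obtain X Y where XY: "X:C" "Y:C" "s:X" "t:Y" using st by blast
 moreover have "X<=Y \<or> Y<=X" using C XY unfolding subset_chain_def by blast
 ultimately show ?thesis using 1[OF XY(1)] 1[OF XY(2)] st(3) by blast
 qed
 moreover have "\<Union>C<=S" using 1 by blast
 ultimately show "\<Union>C:Z" by (simp add: Z_def)
 qed
 then obtain M where M: "M:Z" "!X:Z. M<=X --> X = M" by (rule bexE)
 hence MS: "M<=S" "!!s t. s:M ==> t:M ==> s ~= t ==> R s t" by (simp_all add: Z_def)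
 have "EX a:M. ~ R s a" if s: "s:S" "s~:M" for s
 proof (rule ccontr)
 assume "~ (EX a:M. ~ R s a)"
 hence no: "!!a. a:M ==> R s a" "!!a. a:M ==> R a s" using assms by blast+
 have "insert s M:Z" unfolding Z_def using MS no s by simp
 hence "insert s M = M" using M(2) subset_insertI[of M s] by (meson bspec)
 thus False using s by blast
 qed
 thus ?thesis using that MS by blast
qed

section \<open>Forcing\<close>

declare forces_Mem [simp del] forces_Neg [simp del] forces_Equ [simp del] forces_All [simp del]

text \<open>\<open>le_conds\<close> lets \<open>q <~ p\<close> carry membership in the set of
  conditions, which removes these side conditions from the forcing clauses.\<close>

locale forcing =
 fixes P :: "'a::zfc forcing"
 assumes le_refl: "p:conds P ==> stronger P p p"
 and le_tr: "stronger P p q ==> stronger P q r ==> stronger P p r"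
 and le_conds: "stronger P p q ==> p:conds P & q:conds P"
 and top_in: "weakest P:conds P"
 and le_top: "p:conds P ==> stronger P p (weakest P)"
 and small_conds: "small (conds P)"
begin

abbreviation le (infix "<~" 50) where "p<~q == stronger P p q"
abbreviation fo (infix "||-" 49) where "p||-A == forces P p A"
abbreviation feq where "feq p x y == forces_eq P x y p"
abbreviation nm where "nm == is_name P"
abbreviation chk where "chk == check P"
abbreviation cn where "cn m == chk (vnat m)"
abbreviation cw where "cw == chk vomega"
abbreviation CP where "CP == conds P"

lemma le_self: "q<~p ==> q<~q" using le_conds le_refl by blast

text \<open>An element of the domain of a name lies several membership steps below it, so the
  induction runs along the transitive closure.\<close>

lemma name_induct [case_names step]:
 "(!!x::'a. (!!z s. vpair z s:elts x ==> Ph z) ==> Ph x) ==> Ph x"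
proof -
 assume step: "!!x. (!!z s. vpair z s:elts x ==> Ph z) ==> Ph x"
 have "wf (mem_rel\<^sup>+ :: ('a \<times> 'a) set)" by (intro wf_trancl wf_mem)
 from wf_induct_rule[OF this, of Ph x] show "Ph x" using step vpair_fst_trancl by blast
qed

lemma nm_elts: "nm x ==> vpair z s:elts x ==> nm z & s:CP" by (erule is_name.cases) auto

lemma nmI: "(!!z. z:elts x ==> EX y p. p:CP & z = vpair y p & nm y) ==> nm x" by (rule is_name.intros) blast

lemma feq_iff: "feq p x y <->
 (!z s q. vpair z s:elts x --> q<~p -->
 (EX r. r<~q & (r<~s --> (EX w t. vpair w t:elts y & r<~t & feq r z w)))) &
 (!w t q. vpair w t:elts y --> q<~p -->
 (EX r. r<~q & (r<~t --> (EX z s. vpair z s:elts x & r<~s & feq r z w))))"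
 unfolding forces_eq.simps[of P x y p] using le_conds by meson

lemma feqD1:
 assumes "feq p x y" "vpair z s:elts x" "q<~p" "q<~s"
 shows "EX r w t. r<~q & vpair w t:elts y & r<~t & feq r z w"
proof -
 obtain r where "r<~q" "r<~s --> (EX w t. vpair w t:elts y & r<~t & feq r z w)" using assms unfolding feq_iff[of x y p] by blast
 thus ?thesis using le_tr assms(4) by blast
qed

lemma feqD2:
 assumes "feq p x y" "vpair w t:elts y" "q<~p" "q<~t"
 shows "EX r z s. r<~q & vpair z s:elts x & r<~s & feq r z w"
proof -
 obtain r where "r<~q" "r<~t --> (EX z s. vpair z s:elts x & r<~s & feq r z w)" using assms unfolding feq_iff[of x y p] by blast
 thus ?thesis using le_tr assms(4) by blast
qed

text \<open>Where no extension of \<open>q\<close> lies below \<open>s\<close>, the implication in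
  Kunen's clause holds vacuously at \<open>q\<close> itself, so only conditions below
  \<open>s\<close> have to be treated.\<close>

lemma feqI:
 assumes "!!z s q. vpair z s:elts x ==> q<~p ==> q<~s ==>
 EX r w t. r<~q & vpair w t:elts y & r<~t & feq r z w"
 and "!!w t q. vpair w t:elts y ==> q<~p ==> q<~t ==>
 EX r z s. r<~q & vpair z s:elts x & r<~s & feq r z w"
 shows "feq p x y"
proof -
 have 1: "EX r. r<~q & (r<~s --> (EX w t. vpair w t:elts y & r<~t & feq r z w))" if h: "vpair z s:elts x" "q<~p" for z s q
 proof (cases "EX q'. q'<~q & q'<~s")
 case True
 then obtain q' where q': "q'<~q" "q'<~s" by blast
 hence "q'<~p" using h le_tr by blast
 then obtain r w t where "r<~q'" "vpair w t:elts y" "r<~t" "feq r z w" using assms(1)[OF h(1) _ q'(2)] by blast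
 thus ?thesis using q' le_tr by blast
 next
 case False
 thus ?thesis using h le_self by blast
 qed
 have 2: "EX r. r<~q & (r<~t --> (EX z s. vpair z s:elts x & r<~s & feq r z w))" if h: "vpair w t:elts y" "q<~p" for w t q
 proof (cases "EX q'. q'<~q & q'<~t")
 case True
 then obtain q' where q': "q'<~q" "q'<~t" by blast
 hence "q'<~p" using h le_tr by blast
 then obtain r z s where "r<~q'" "vpair z s:elts x" "r<~s" "feq r z w" using assms(2)[OF h(1) _ q'(2)] by blast
 thus ?thesis using q' le_tr by blast
 next
 case False
 thus ?thesis using h le_self by blast
 qed
 show ?thesis unfolding feq_iff[of x y p] using 1 2 by simp
qed

lemma feq_mono: "feq p x y ==> q<~p ==> feq q x y" unfolding feq_iff[of x y p] feq_iff[of x y q] using le_tr by meson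

lemma feq_dense: "(!!q. q<~p ==> EX r. r<~q & feq r x y) ==> feq p x y"
proof (rule feqI)
 assume d: "!!q. q<~p ==> EX r. r<~q & feq r x y"
 show "EX r w t. r<~q & vpair w t:elts y & r<~t & feq r z w" if "vpair z s:elts x" "q<~p" "q<~s" for z s q
 proof -
 obtain r where r: "r<~q" "feq r x y" using d[OF \<open>q<~p\<close>] by blast
 hence "r<~s" "r<~r" using that le_tr le_self by blast+
 thus ?thesis using feqD1[OF r(2) that(1)] r(1) le_tr by blast
 qed
 show "EX r z s. r<~q & vpair z s:elts x & r<~s & feq r z w" if "vpair w t:elts y" "q<~p" "q<~t" for w t q
 proof -
 obtain r where r: "r<~q" "feq r x y" using d[OF \<open>q<~p\<close>] by blast
 hence "r<~t" "r<~r" using that le_tr le_self by blast+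
 thus ?thesis using feqD2[OF r(2) that(1)] r(1) le_tr by blast
 qed
qed

lemma feq_refl [simp]: "feq p x x"
proof (induction x arbitrary: p rule: name_induct)
 case (step x)
 show ?case by (rule feqI) (use step le_self in blast)+
qed

lemma feq_sym: "feq p x y ==> feq p y x"
proof (induction x arbitrary: y p rule: name_induct)
 case (step x)
 show ?case
 proof (rule feqI)
 fix z s q assume "vpair z s:elts y" "q<~p" "q<~s"
 from feqD2[OF step.prems this] show "EX r w t. r<~q & vpair w t:elts x & r<~t & feq r z w" using step.IH by blast
 next
 fix w t q assume "vpair w t:elts x" "q<~p" "q<~t"
 from feqD1[OF step.prems this] show "EX r z s. r<~q & vpair z s:elts y & r<~s & feq r z w"
 using step.IH \<open>vpair w t:elts x\<close> by blast
 qed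
qed

lemma feq_trans: "feq p x y ==> feq p y z ==> feq p x z"
proof (induction x arbitrary: y z p rule: name_induct)
 case (step x)
 note xy = step.prems(1) and yz = step.prems(2)
 show ?case
 proof (rule feqI)
 fix u s q assume u: "vpair u s:elts x" "q<~p" "q<~s"
 obtain r w t where r: "r<~q" "vpair w t:elts y" "r<~t" "feq r u w" using feqD1[OF xy u] by blast
 have "r<~p" using r u le_tr by blast
 then obtain r' v t' where r': "r'<~r" "vpair v t':elts z" "r'<~t'" "feq r' w v" using feqD1[OF yz r(2) _ r(3)] by blast
 have "feq r' u v" using step.IH[OF u(1) feq_mono[OF r(4) r'(1)] r'(4)] .
 thus "EX r w t. r<~q & vpair w t:elts z & r<~t & feq r u w" using r' r(1) le_tr by blast
 next
 fix v t q assume v: "vpair v t:elts z" "q<~p" "q<~t"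
 obtain r w s where r: "r<~q" "vpair w s:elts y" "r<~s" "feq r w v" using feqD2[OF yz v] by blast
 have "r<~p" using r v le_tr by blast
 then obtain r' u s' where r': "r'<~r" "vpair u s':elts x" "r'<~s'" "feq r' u w" using feqD2[OF xy r(2) _ r(3)] by blast
 have "feq r' u v" using step.IH[OF r'(2) r'(4) feq_mono[OF r(4) r'(1)]] .
 thus "EX r z s. r<~q & vpair z s:elts x & r<~s & feq r z v" using r' r(1) le_tr by blast
 qed
qed

lemma fo_Equ: "p||-x =. y <-> feq p x y" by (rule forces_Equ)

lemma fo_Mem: "p||-x:.y <->
 (!q. q<~p --> (EX r z s. r<~q & vpair z s:elts y & r<~s & feq r x z))" unfolding forces_Mem using le_conds by meson

lemma fo_Neg: "p||-(~. A) <-> (!q. q<~p --> ~ q||-A)" unfolding forces_Neg using le_conds by meson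

lemma fo_mono: "p||-A ==> q<~p ==> q||-A"
proof (induction A)
 case (Mem x y) thus ?case unfolding fo_Mem using le_tr by meson
next
 case (Equ x y) thus ?case unfolding fo_Equ using feq_mono by meson
next
 case (Neg A) thus ?case unfolding fo_Neg using le_tr by meson
next
 case (Conj A B) thus ?case by simp
next
 case (FAll F) thus ?case unfolding forces_All by blast
qed

text \<open>Together with \<open>fo_mono\<close> this says that the conditions forcing a formula
  form a regular open set. Later arguments rely on it whenever they pass to extensions that decide
  more.\<close>

lemma fo_dense: "(!!q. q<~p ==> EX r. r<~q & r||-A) ==> p||-A"
proof (induction A)
 case (Mem x y)
 thus ?case unfolding fo_Mem using le_tr le_self by meson
next
 case (Equ x y) thus ?case unfolding fo_Equ using feq_dense by meson
next
 case (Neg A)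
 thus ?case unfolding fo_Neg using fo_mono le_self by meson
next
 case (Conj A B) thus ?case by (metis forces_Conj)
next
 case (FAll F) thus ?case unfolding forces_All by (metis rangeI)
qed

text \<open>Implication is a negated conjunction. The forward direction turns the fact that no
  extension forcing the premise forces the negated conclusion into density of the conditions forcing
  the conclusion.\<close>

lemma fo_Imp: "p||-(A ->. B) <-> (!q. q<~p --> q||-A --> q||-B)"
proof
 assume h: "p||-(A ->. B)"
 show "!q. q<~p --> q||-A --> q||-B"
 proof (intro allI impI)
 fix q assume q: "q<~p" "q||-A"
 show "q||-B"
 proof (rule fo_dense)
 fix q' assume "q'<~q"
 thus "EX r. r<~q' & r||-B" using h q fo_mono[OF q(2)] le_tr unfolding Imp_def fo_Neg forces_Conj by meson
 qed
 qed
next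
 assume "!q. q<~p --> q||-A --> q||-B"
 thus "p||-(A ->. B)" unfolding Imp_def fo_Neg forces_Conj using le_self by meson
qed

lemma fo_Disj: "p||-(A |. B) <-> (!q. q<~p --> (EX r. r<~q & (r||-A \<or> r||-B)))"
 unfolding Disj_def fo_Neg forces_Conj using le_tr le_self by (smt (verit) fo_mono)

lemma fo_Iff: "p||-(A <->. B) <-> (!q. q<~p --> (q||-A <-> q||-B))" unfolding Iff_def forces_Conj fo_Imp by blast

lemma fo_Ex: "p||-FEx F <-> (!q. q<~p --> (EX r x. r<~q & nm x & r||-F x))" unfolding FEx_def fo_Neg forces_All by blast

lemma fo_AllIn: "p||-AllIn X F <-> (!x q. nm x --> q<~p --> q||-x:.X --> q||-F x)" unfolding AllIn_def forces_All fo_Imp by blast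

lemma fo_ExIn: "p||-ExIn X F <->
 (!q. q<~p --> (EX r x. r<~q & nm x & r||-x:.X & r||-F x))" unfolding ExIn_def fo_Ex forces_Conj by blast

lemma fo_decide: "p:CP ==> EX q. q<~p & (q||-A \<or> q||-(~. A))" unfolding fo_Neg using le_refl by blast

lemma Mem_eq1: "p||-x:.y ==> feq p x x' ==> p||-x':.y" unfolding fo_Mem by (meson feq_mono feq_sym feq_trans le_tr)

lemma Mem_eq2:
 assumes "p||-x:.y" "feq p y y'"
 shows "p||-x:.y'" unfolding fo_Mem
proof (intro allI impI)
 fix q assume q: "q<~p"
 then obtain r z s where r: "r<~q" "vpair z s:elts y" "r<~s" "feq r x z" using assms(1) unfolding fo_Mem by blast
 have "r<~p" using q r le_tr by blast
 then obtain r' w t where r': "r'<~r" "vpair w t:elts y'" "r'<~t" "feq r' z w" using feqD1[OF assms(2) r(2) _ r(3)] by blast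
 thus "EX r z s. r<~q & vpair z s:elts y' & r<~s & feq r x z" using r feq_trans[OF feq_mono[OF r(4) r'(1)] r'(4)] le_tr by blast
qed

lemma elts_forced: "vpair z s:elts x ==> p<~s ==> p||-z:.x" unfolding fo_Mem using le_self le_tr feq_refl by meson

lemma fo_ext:
 assumes "nm x" "nm y" "!!z q. nm z ==> q<~p ==> q||-z:.x <-> q||-z:.y"
 shows "feq p x y"
proof (rule feqI)
 fix z s q assume h: "vpair z s:elts x" "q<~p" "q<~s"
 hence "q||-z:.y" using assms nm_elts elts_forced by blast
 thus "EX r w t. r<~q & vpair w t:elts y & r<~t & feq r z w" unfolding fo_Mem using h le_self by blast
next
 fix w t q assume h: "vpair w t:elts y" "q<~p" "q<~t"
 hence "q||-w:.x" using assms nm_elts elts_forced by blast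
 thus "EX r z s. r<~q & vpair z s:elts x & r<~s & feq r z w" unfolding fo_Mem using h le_self feq_sym by blast
qed

lemma Mem_obtain:
 assumes "p||-x:.y" "q<~p"
 obtains r z s where "r<~q" "vpair z s:elts y" "r<~s" "feq r x z" using assms unfolding fo_Mem by blast

subsection \<open>Extensional families of formulas\<close>

text \<open>The higher-order binder \<^const>\<open>FAll\<close> admits families that do not respect forced equality; the
  following predicates single out the families, and the operations on names, that do.\<close>

definition ext where "ext F <-> (!p x y. nm x --> nm y --> feq p x y --> p||-F x --> p||-F y)"

definition tm where "tm u <-> (!x. nm x --> nm (u x)) &
 (!p x y. nm x --> nm y --> feq p x y --> feq p (u x) (u y))"

lemma tm_id [simp]: "tm (%x. x)" by (simp add: tm_def)
lemma tm_const [simp]: "nm c ==> tm (%x. c)" by (simp add: tm_def)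

lemma extD: "ext F ==> nm x ==> nm y ==> feq p x y ==> p||-F x ==> p||-F y" by (auto simp: ext_def)

lemma ext_const [simp]: "ext (%x. A)" by (simp add: ext_def)

lemma ext_Mem [simp]: "tm u ==> tm v ==> ext (%x. Mem (u x) (v x))" unfolding ext_def tm_def by (metis Mem_eq1 Mem_eq2)

lemma ext_Equ [simp]: "tm u ==> tm v ==> ext (%x. Equ (u x) (v x))"
 unfolding ext_def tm_def fo_Equ using feq_trans feq_sym by meson

lemma ext_Neg [simp]: "ext F ==> ext (%x. Neg (F x))" unfolding ext_def fo_Neg by (meson feq_mono feq_sym)

lemma ext_Conj [simp]: "ext F ==> ext G ==> ext (%x. Conj (F x) (G x))" unfolding ext_def by simp

lemma ext_All [simp]: "(!!y. nm y ==> ext (%x. F x y)) ==> ext (%x. FAll (F x))" unfolding ext_def forces_All by blast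

lemma ext_Disj [simp]: "ext F ==> ext G ==> ext (%x. Disj (F x) (G x))" by (simp add: Disj_def)
lemma ext_Imp [simp]: "ext F ==> ext G ==> ext (%x. Imp (F x) (G x))" by (simp add: Imp_def)
lemma ext_Iff [simp]: "ext F ==> ext G ==> ext (%x. Iff (F x) (G x))" by (simp add: Iff_def)
lemma ext_Ex [simp]: "(!!y. nm y ==> ext (%x. F x y)) ==> ext (%x. FEx (F x))" by (simp add: FEx_def)
lemma ext_AllIn [simp]: "tm u ==> (!!y. nm y ==> ext (%x. F x y)) ==> ext (%x. AllIn (u x) (F x))" by (simp add: AllIn_def)
lemma ext_ExIn [simp]: "tm u ==> (!!y. nm y ==> ext (%x. F x y)) ==> ext (%x. ExIn (u x) (F x))" by (simp add: ExIn_def)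

text \<open>Most names below have this shape: a HOL predicate selects pairs from \<open>D\<close>
  times the conditions, so it only remains to check that \<open>D\<close> is small and consists of
  names.\<close>

definition mkname where "mkname D Ph = vset {vpair z q |z q. z:D & q:CP & Ph z q}"

lemma elts_mkname: "small D ==> elts (mkname D Ph) = {vpair z q |z q. z:D & q:CP & Ph z q}" unfolding mkname_def
proof (rule elts_vset')
 assume "small D"
 hence "small ((%(x, y). vpair x y) ` (D \<times> CP))" by (rule small_vpairs[OF _ small_conds])
 thus "small {vpair z q |z q. z:D & q:CP & Ph z q}" by (rule small_subset) auto
qed

lemma nm_mkname: "small D ==> (!!z. z:D ==> nm z) ==> nm (mkname D Ph)" by (rule nmI) (auto simp: elts_mkname)

lemma fo_mkname: "small D ==> p||-x:.mkname D Ph <->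
 (!q. q<~p --> (EX r z s. r<~q & z:D & Ph z s & r<~s & feq r x z))"
proof -
 assume "small D"
 hence "vpair z s:elts (mkname D Ph) <-> z:D & s:CP & Ph z s" for z s by (auto simp: elts_mkname)
 thus ?thesis unfolding fo_Mem using le_conds by meson
qed

lemma nm_vdom: "nm x ==> z:vdom x ==> nm z" unfolding vdom_def using nm_elts by blast

section \<open>Separation, pairing, union, power set and foundation in the extension\<close>

definition ncomp where "ncomp a F = mkname (vdom a) (%z q. q||-(z:.a &. F z))"

lemma nm_ncomp [simp]: "nm a ==> nm (ncomp a F)" unfolding ncomp_def by (rule nm_mkname[OF small_vdom nm_vdom])

text \<open>It suffices to test the elements of \<open>vdom a\<close>: densely, a member of
  \<open>a\<close> is forced equal to one of them, and \<open>ext F\<close> moves \<open>F\<close>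
  across that equality.\<close>

lemma fo_ncomp:
 assumes "nm a" "ext F" "nm x"
 shows "p||-x:.ncomp a F <-> p||-x:.a & p||-F x"
proof
 assume h: "p||-x:.ncomp a F"
 have "EX r. r<~q & r||-(x:.a &. F x)" if "q<~p" for q
 proof -
 obtain r z s where r: "r<~q" "z:vdom a" "s||-(z:.a &. F z)" "r<~s" "feq r x z"
 using h \<open>q<~p\<close> unfolding ncomp_def fo_mkname[OF small_vdom] by blast
 hence "r||-(z:.a &. F z)" using fo_mono by blast
 hence "r||-(x:.a &. F x)" using extD[OF assms(2) nm_vdom[OF assms(1) r(2)] assms(3) feq_sym[OF r(5)]]
 Mem_eq1[OF _ feq_sym[OF r(5)]] by simp
 thus ?thesis using r by blast
 qed
 hence "p||-(x:.a &. F x)" by (rule fo_dense)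
 thus "p||-x:.a & p||-F x" by simp
next
 assume h: "p||-x:.a & p||-F x"
 show "p||-x:.ncomp a F" unfolding ncomp_def fo_mkname[OF small_vdom]
 proof (intro allI impI)
 fix q assume "q<~p"
 then obtain r z s where r: "r<~q" "vpair z s:elts a" "r<~s" "feq r x z" using h Mem_obtain by blast
 hence nz: "nm z" "z:vdom a" using nm_elts[OF assms(1)] by (auto simp: vdom_def)
 have rp: "r<~p" using r \<open>q<~p\<close> le_tr by blast
 have "r||-F z" using extD[OF assms(2,3) nz(1) r(4)] h fo_mono rp by blast
 moreover have "r||-z:.a" using elts_forced r by blast
 ultimately show "EX r z s. r<~q & z:vdom a & s||-(z:.a &. F z) & r<~s & feq r x z" using r nz le_self by (metis forces_Conj)
 qed
qed

definition nup where "nup x y = mkname {x, y} (%_ _. True)"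

lemma nm_nup [simp]: "nm x ==> nm y ==> nm (nup x y)" unfolding nup_def by (rule nm_mkname) auto

lemma fo_nup: "p||-z:.nup x y <-> p||-(z =. x |. z =. y)"
proof -
 have "small {x, y}" by simp
 thus ?thesis unfolding nup_def fo_Disj fo_Equ fo_mkname[OF \<open>small {x, y}\<close>]
 using le_self by (metis insert_iff singletonD)
qed

lemma nup_upair: "p||-is_upair (nup x y) x y" unfolding is_upair_def forces_All fo_Iff fo_nup by blast

definition nunion where "nunion a = mkname (UN x:vdom a. vdom x) (%z q. q||-(?.y:.a. z:.y))"

lemma small_dom2: "small (UN x:vdom a. vdom x)" by (intro small_UN small_vdom)

lemma nm_nunion [simp]: "nm a ==> nm (nunion a)" unfolding nunion_def by (rule nm_mkname[OF small_dom2]) (auto intro: nm_vdom)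

lemma fo_nunion:
 assumes "nm a" "nm x"
 shows "p||-x:.nunion a <-> p||-(?.y:.a. x:.y)"
proof
 assume h: "p||-x:.nunion a"
 show "p||-(?.y:.a. x:.y)"
 proof (rule fo_dense)
 fix q assume "q<~p"
 then obtain r z s where r: "r<~q" "z:(UN x:vdom a. vdom x)" "s||-(?.y:.a. z:.y)"
 "r<~s" "feq r x z" using h unfolding nunion_def fo_mkname[OF small_dom2] by blast
 have "ext (%x. ?.y:.a. x:.y)" using assms by simp
 moreover have "nm z" using r(2) assms(1) nm_vdom by blast
 ultimately have "r||-(?.y:.a. x:.y)" using extD[OF _ _ assms(2) feq_sym[OF r(5)]] fo_mono[OF r(3,4)] by blast
 thus "EX r. r<~q & r||-(?.y:.a. x:.y)" using r by blast
 qed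
next
 assume h: "p||-(?.y:.a. x:.y)"
 show "p||-x:.nunion a" unfolding nunion_def fo_mkname[OF small_dom2]
 proof (intro allI impI)
 fix q assume "q<~p"
 then obtain r y where r: "r<~q" "nm y" "r||-y:.a" "r||-x:.y" using h unfolding fo_ExIn by blast
 have "r<~r" using r le_self by blast
 then obtain r1 y' s where r1: "r1<~r" "vpair y' s:elts a" "r1<~s" "feq r1 y y'" using Mem_obtain[OF r(3)] by blast
 hence "r1||-x:.y'" using Mem_eq2 fo_mono r by blast
 moreover have "r1<~r1" using r1 le_self by blast
 ultimately obtain r2 z t where r2: "r2<~r1" "vpair z t:elts y'" "r2<~t" "feq r2 x z" using Mem_obtain by blast
 have "z:(UN x:vdom a. vdom x)" using r1 r2 unfolding vdom_def by blast
 moreover have "r2||-(?.y:.a. z:.y)" unfolding fo_ExIn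
 proof (intro allI impI)
 fix q' assume q': "q'<~r2"
 have n: "nm y'" using nm_elts[OF assms(1) r1(2)] by blast
 have "q'<~s" "q'<~t" "q'<~q'" using q' r1 r2 le_tr le_self by blast+
 thus "EX r x. r<~q' & nm x & r||-x:.a & r||-z:.x" using n elts_forced r1 r2 by blast
 qed
 ultimately show "EX r z s. r<~q & z:(UN x:vdom a. vdom x) & s||-(?.y:.a. z:.y) &
 r<~s & feq r x z" using le_tr[OF r2(1) le_tr[OF r1(1) r(1)]] le_refl[OF conjunct1[OF le_conds[OF r2(1)]]] r2(4) by meson
 qed
qed

definition npow where "npow a = mkname (mkname (vdom a) ` UNIV) (%x q. q||-is_subset x a)"

lemma small_mknames: "small D ==> small (mkname D ` UNIV)"
proof -
 assume D: "small D"
 have "mkname D ` UNIV<=vset ` Pow ((%(x, y). vpair x y) ` (D \<times> CP))"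
 proof
 fix x assume "x:mkname D ` UNIV"
 then obtain Ph where x: "x = mkname D Ph" by blast
 have "x = vset (elts x)" by simp
 moreover have "elts x<=(%(x, y). vpair x y) ` (D \<times> CP)" unfolding x elts_mkname[OF D] by auto
 ultimately show "x:vset ` Pow ((%(x, y). vpair x y) ` (D \<times> CP))" by blast
 qed
 thus ?thesis using small_Pow[OF small_vpairs[OF D small_conds]] small_subset by blast
qed

lemma nm_npow [simp]: "nm a ==> nm (npow a)" unfolding npow_def
 by (rule nm_mkname[OF small_mknames[OF small_vdom]]) (auto intro: nm_mkname small_vdom nm_vdom)

lemma ext_is_subset [simp]: "tm u ==> tm v ==> ext (%x. is_subset (u x) (v x))" by (simp add: is_subset_def)

text \<open>A subset \<open>x\<close> of \<open>a\<close> is forced equal to the name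
  \<open>?z\<close>, which pairs elements \<open>z\<close> of \<open>vdom a\<close> with the
  conditions forcing \<open>z\<close> into \<open>x\<close>. Names of that kind form a set, so they
  can serve as the domain of the power set.\<close>

lemma fo_npow:
 assumes "nm a" "nm x"
 shows "p||-x:.npow a <-> p||-is_subset x a"
proof
 assume h: "p||-x:.npow a"
 show "p||-is_subset x a"
 proof (rule fo_dense)
 fix q assume "q<~p"
 then obtain r z s where r: "r<~q" "z:mkname (vdom a) ` UNIV" "s||-is_subset z a"
 "r<~s" "feq r x z" using h unfolding npow_def fo_mkname[OF small_mknames[OF small_vdom]] by blast
 have "nm z" using r(2) assms(1) nm_vdom by (auto intro: nm_mkname small_vdom)
 hence "r||-is_subset x a" using extD[of "%x. is_subset x a", OF _ _ assms(2) feq_sym[OF r(5)]] fo_mono[OF r(3,4)] assms(1)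
 by simp
 thus "EX r. r<~q & r||-is_subset x a" using r by blast
 qed
next
 assume h: "p||-is_subset x a"
 let ?z = "mkname (vdom a) (%z q. q||-z:.x)"
 have nz: "nm ?z" using assms(1) nm_vdom by (auto intro: nm_mkname small_vdom)
 have eq: "feq p x ?z"
 proof (rule fo_ext[OF assms(2) nz])
 fix z q assume zq: "nm z" "q<~p"
 show "q||-z:.x <-> q||-z:.?z"
 proof
 assume "q||-z:.x"
 hence za: "q||-z:.a" using h zq unfolding is_subset_def fo_AllIn by blast
 show "q||-z:.?z" unfolding fo_mkname[OF small_vdom]
 proof (intro allI impI)
 fix q' assume "q'<~q"
 then obtain r w s where r: "r<~q'" "vpair w s:elts a" "r<~s" "feq r z w" using za Mem_obtain by blast
 hence "r||-w:.x" using \<open>q||-z:.x\<close> \<open>q'<~q\<close> fo_mono le_tr Mem_eq1 by meson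
 moreover have "w:vdom a" "r<~r" using r le_self by (auto simp: vdom_def)
 ultimately show "EX r za s. r<~q' & za:vdom a & s||-za:.x & r<~s & feq r z za" using r by blast
 qed
 next
 assume hz: "q||-z:.?z"
 show "q||-z:.x"
 proof (rule fo_dense)
 fix q' assume "q'<~q"
 then obtain r w s where "r<~q'" "s||-w:.x" "r<~s" "feq r z w" using hz unfolding fo_mkname[OF small_vdom] by blast
 thus "EX r. r<~q' & r||-z:.x" using fo_mono Mem_eq1 feq_sym by blast
 qed
 qed
 qed
 show "p||-x:.npow a" unfolding npow_def fo_mkname[OF small_mknames[OF small_vdom]]
 proof (intro allI impI)
 fix q assume q: "q<~p"
 have "q||-is_subset ?z a" using extD[of "%x. is_subset x a", OF _ assms(2) nz feq_mono[OF eq q]] fo_mono[OF h q] assms(1)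
 by simp
 thus "EX r z s. r<~q & z:range (mkname (vdom a)) & s||-is_subset z a & r<~s & feq r x z" using q eq le_self feq_mono by blast
 qed
qed

text \<open>Take a name that is minimal, for the transitive closure of membership, among those that
  an extension of \<open>q\<close> forces into \<open>a\<close>. A member of it lying in
  \<open>a\<close> would be forced equal to an element of its domain, against minimality.\<close>

lemma fo_regularity:
 assumes "nm a" "nm x" "p||-x:.a"
 shows "p||-(?.y:.a. !.z:.y. ~. z:.a)" unfolding fo_ExIn
proof (intro allI impI)
 fix q assume "q<~p"
 have "wf (mem_rel\<^sup>+ :: ('a \<times> 'a) set)" by (intro wf_trancl wf_mem)
 moreover have "x:{y. nm y & (EX r. r<~q & r||-y:.a)}"
 using assms fo_mono[OF assms(3) \<open>q<~p\<close>] \<open>q<~p\<close> le_self by blast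
 ultimately obtain y where y: "y:{y. nm y & (EX r. r<~q & r||-y:.a)}"
 and min: "!!z. (z, y):mem_rel\<^sup>+ ==> z~:{y. nm y & (EX r. r<~q & r||-y:.a)}" by (rule wfE_min) blast
 then obtain r where r: "nm y" "r<~q" "r||-y:.a" by blast
 have "r||-(!.z:.y. ~. z:.a)" unfolding fo_AllIn fo_Neg
 proof (intro allI impI notI)
 fix z q1 q2 assume h: "nm z" "q1<~r" "q1||-z:.y" "q2<~q1" "q2||-z:.a"
 obtain r' w s where r': "r'<~q2" "vpair w s:elts y" "r'<~s" "feq r' z w" using Mem_obtain[OF h(3,4)] by blast
 hence "r'||-w:.a" "r'<~q" using h r fo_mono le_tr Mem_eq1 by meson+
 thus False using min[OF vpair_fst_trancl[OF r'(2)]] nm_elts[OF r(1) r'(2)] by blast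
 qed
 thus "EX r x. r<~q & nm x & r||-x:.a & r||-(!.z:.x. ~. z:.a)" using r by blast
qed

definition compat where "compat p q <-> (EX r. r<~p & r<~q)"

lemma maximal_antichain:
 fixes S :: "'b set" and f :: "'b => 'a"
 assumes "!!s. s:S ==> f s:CP"
 obtains A where "A<=S" "!!s t. s:A ==> t:A ==> s ~= t ==> ~ compat (f s) (f t)"
 "!!s. s:S ==> EX a:A. compat (f s) (f a)"
proof -
 have r: "compat q q" if "q:CP" for q using le_refl[OF that] unfolding compat_def by blast
 obtain A where "A<=S" "!!s t. s:A ==> t:A ==> s ~= t ==> ~ compat (f s) (f t)"
 "!!s. s:S ==> s~:A ==> EX a:A. ~ ~ compat (f s) (f a)"
 by (rule maximal_pairwise[of "%s t. ~ compat (f s) (f t)" S]) (auto simp: compat_def)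
 thus ?thesis using that r assms by metis
qed

text \<open>Fullness: witnesses chosen on a maximal antichain of the conditions that have one are
  glued to a single name. Extensionality of \<open>F\<close> carries each local witness to the glued
  name.\<close>

lemma max_principle:
 assumes "ext F"
 obtains x where "nm x" "!!p. p||-FEx F ==> p||-F x"
proof -
 let ?S = "{q:CP. EX x. nm x & q||-F x}"
 obtain A where A: "A<=?S" "!!s t. s:A ==> t:A ==> s ~= t ==> ~ compat s t"
 "!!s. s:?S ==> EX a:A. compat s a" using maximal_antichain[of ?S "%x. x"] by blast
 have "!q:A. EX x. nm x & q||-F x" using A by blast
 then obtain X where X: "!!q. q:A ==> nm (X q)" "!!q. q:A ==> q||-F (X q)" by metis
 let ?D = "UN q:A. vdom (X q)"
 \<comment> \<open>Below a member of the antichain only the pairs coming from its own witness count,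
   since all other pairs carry conditions incompatible with it.\<close>
 let ?Ph = "%z r. EX q:A. z:vdom (X q) & r<~q & r||-z:.X q"
 have "small A" using A(1) small_conds small_subset by blast
 hence D: "small ?D" by (intro small_UN small_vdom)
 let ?x = "mkname ?D ?Ph"
 have nx: "nm ?x" using X(1) nm_vdom by (intro nm_mkname D) blast
 have eq: "feq a (X a) ?x" if a: "a:A" for a
 proof (rule fo_ext[OF X(1)[OF a] nx])
 fix z q assume z: "nm z" "q<~a"
 show "q||-z:.X a <-> q||-z:.?x"
 proof
 assume h: "q||-z:.X a"
 show "q||-z:.?x" unfolding fo_mkname[OF D]
 proof (intro allI impI)
 fix q' assume "q'<~q"
 then obtain r w s where r: "r<~q'" "vpair w s:elts (X a)" "r<~s" "feq r z w" using Mem_obtain[OF h] by blast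
 have "w:vdom (X a)" using r by (auto simp: vdom_def)
 moreover have "r||-w:.X a" using r elts_forced by blast
 moreover have "r<~a" "r<~r" using r z \<open>q'<~q\<close> le_tr le_self by blast+
 ultimately show "EX r za s. r<~q' & za:?D & ?Ph za s & r<~s & feq r z za" using r a by blast
 qed
 next
 assume h: "q||-z:.?x"
 show "q||-z:.X a"
 proof (rule fo_dense)
 fix q' assume q': "q'<~q"
 obtain r w s b where r: "r<~q'" "b:A" "s<~b" "s||-w:.X b" "r<~s" "feq r z w" using h q' unfolding fo_mkname[OF D] by blast
 have "r<~a" "r<~b" using r q' z le_tr by blast+
 hence "b = a" using A(2)[OF r(2) a] unfolding compat_def by blast
 thus "EX r. r<~q' & r||-z:.X a" using r fo_mono Mem_eq1 feq_sym by blast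
 qed
 qed
 qed
 have "p||-F ?x" if p: "p||-FEx F" for p
 proof (rule fo_dense)
 fix q assume "q<~p"
 then obtain r x where r: "r<~q" "nm x" "r||-F x" using p unfolding fo_Ex by blast
 hence "r:?S" using le_conds by blast
 then obtain a r' where a: "a:A" "r'<~r" "r'<~a" using A(3) unfolding compat_def by blast
 have "r'||-F ?x" using extD[OF assms X(1)[OF a(1)] nx feq_mono[OF eq[OF a(1)] a(3)]] fo_mono X(2) a by blast
 thus "EX r. r<~q & r||-F ?x" using a r le_tr by blast
 qed
 thus ?thesis using that[of ?x] nx by blast
qed

section \<open>Canonical names of ground sets\<close>

lemma elts_check: "elts (chk x) = (%y. vpair (chk y) (weakest P)) ` elts x" by (subst check.simps) (simp add: elts_vset')

lemma nm_check [simp]: "nm (chk x)"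
proof (induction x rule: mem_induct)
 case (step x)
 show ?case by (rule nmI) (use step top_in elts_check[of x] in blast)
qed

lemma fo_Mem_check: "p||-z:.chk x <-> (!q. q<~p --> (EX r y. r<~q & y:elts x & feq r z (chk y)))"
proof -
 have "vpair w s:elts (chk x) <-> (EX y:elts x. w = chk y & s = weakest P)" for w s unfolding elts_check by auto
 thus ?thesis unfolding fo_Mem using le_top le_conds by metis
qed

lemma check_mem: "y:elts x ==> p||-chk y:.chk x" unfolding fo_Mem_check using le_self feq_refl by blast

lemma check_eq: "p:CP ==> feq p (chk x) (chk y) <-> x = y"
proof (induction x arbitrary: y p rule: mem_induct)
 case (step x)
 show ?case
 proof
 assume h: "feq p (chk x) (chk y)"
 have pp: "p<~p" using step le_refl by blast
 show "x = y"
 proof (rule ext_ax, rule set_eqI, rule iffI)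
 fix z assume z: "z:elts x"
 hence "p||-chk z:.chk y" using check_mem Mem_eq2 h by blast
 then obtain r w where r: "r<~p" "w:elts y" "feq r (chk z) (chk w)" unfolding fo_Mem_check using pp by blast
 hence "r:CP" using le_conds by blast
 hence "z = w" using step.IH[OF z, of r w] r(3) by simp
 thus "z:elts y" using r by simp
 next
 fix z assume z: "z:elts y"
 hence "p||-chk z:.chk x" using check_mem Mem_eq2 feq_sym[OF h] by blast
 then obtain r w where r: "r<~p" "w:elts x" "feq r (chk z) (chk w)" unfolding fo_Mem_check using pp by blast
 hence "r:CP" using le_conds by blast
 hence "w = z" using step.IH[OF r(2), of r z] feq_sym[OF r(3)] by simp
 thus "z:elts x" using r by simp
 qed
 qed simp
qed

lemma check_mem_iff: "p:CP ==> p||-chk y:.chk x <-> y:elts x"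
proof
 assume p: "p:CP" and h: "p||-chk y:.chk x"
 then obtain r w where r: "r<~p" "w:elts x" "feq r (chk y) (chk w)" unfolding fo_Mem_check using le_refl by blast
 hence "y = w" using check_eq[of r y w] le_conds by simp
 thus "y:elts x" using r by simp
qed (rule check_mem)

end

context forcing
begin

lemma ext_1 [simp]:
 assumes "tm u"
 shows "ext (%x. is_empty (u x))" "ext (%x. is_transitive (u x))" "ext (%x. is_ordinal (u x))"
 by (simp_all add: assms is_empty_def is_transitive_def is_ordinal_def)

lemma ext_3 [simp]:
 assumes "tm u" "tm v" "tm w"
 shows "ext (%x. is_upair (u x) (v x) (w x))" "ext (%x. is_pair (u x) (v x) (w x))" "ext (%x. pair_in (u x) (v x) (w x))"
 "ext (%x. is_union (u x) (v x) (w x))" "ext (%x. is_inter (u x) (v x) (w x))" "ext (%x. is_diff (u x) (v x) (w x))"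
 "ext (%x. is_fun (u x) (v x) (w x))" "ext (%x. is_inj (u x) (v x) (w x))" "ext (%x. is_bij (u x) (v x) (w x))"
 "ext (%x. is_comp (u x) (v x) (w x))" "ext (%x. is_funspace (u x) (v x) (w x))"
 by (simp_all add: assms is_upair_def is_pair_def pair_in_def is_union_def is_inter_def is_diff_def is_function_on_def is_fun_def
 is_inj_def is_bij_def is_comp_def is_funspace_def)

lemma ext_2 [simp]:
 assumes "tm u" "tm v"
 shows "ext (%x. is_succ (u x) (v x))" "ext (%x. is_function_on (u x) (v x))" "ext (%x. card_le (u x) (v x))"
 by (simp_all add: assms is_succ_def is_function_on_def card_le_def)

lemma ext_1' [simp]:
 assumes "tm u"
 shows "ext (%x. is_omega (u x))" "ext (%x. is_finite (u x))" "ext (%x. is_countable (u x))"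
 by (simp_all add: assms is_omega_def is_finite_def is_countable_def)

lemma fo_AllIn_check: "ext F ==> p||-AllIn (chk X) F <-> (!y:elts X. p||-F (chk y))"
proof
 assume F: "ext F" and h: "p||-AllIn (chk X) F"
 show "!y:elts X. p||-F (chk y)"
 proof
 fix y assume y: "y:elts X"
 have "q||-F (chk y)" if "q<~p" for q using h that check_mem[OF y] unfolding fo_AllIn by simp
 thus "p||-F (chk y)" using fo_dense le_self by metis
 qed
next
 assume F: "ext F" and h: "!y:elts X. p||-F (chk y)"
 show "p||-AllIn (chk X) F" unfolding fo_AllIn
 proof (intro allI impI)
 fix x q assume x: "nm x" "q<~p" "q||-x:.chk X"
 show "q||-F x"
 proof (rule fo_dense)
 fix q' assume "q'<~q"
 then obtain r y where r: "r<~q'" "y:elts X" "feq r x (chk y)" using x(3) unfolding fo_Mem_check by blast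
 have "r<~p" using r(1) \<open>q'<~q\<close> x(2) le_tr by blast
 hence "r||-F (chk y)" using h r(2) fo_mono by blast
 hence "r||-F x" using extD[OF F nm_check x(1) feq_sym[OF r(3)]] by blast
 thus "EX r. r<~q' & r||-F x" using r by blast
 qed
 qed
qed

lemma fo_ExIn_checkI: "y:elts X ==> p||-F (chk y) ==> p||-ExIn (chk X) F"
 unfolding fo_ExIn using le_self fo_mono check_mem nm_check by meson

lemma fo_DisjI1: "p||-A ==> p||-(A |. B)" and fo_DisjI2: "p||-B ==> p||-(A |. B)"
 unfolding fo_Disj using le_self fo_mono by blast+

lemma fo_succ_check: "p||-is_succ (chk (vsucc x)) (chk x)" unfolding is_succ_def forces_All fo_Iff fo_Disj fo_Equ
proof (intro allI impI)
 fix z q assume z: "nm z" "q<~p"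
 show "q||-z:.chk (vsucc x) <->
 (!q'. q'<~q --> (EX r. r<~q' & (r||-z:.chk x \<or> feq r z (chk x))))"
 proof
 assume h: "q||-z:.chk (vsucc x)"
 show "!q'. q'<~q --> (EX r. r<~q' & (r||-z:.chk x \<or> feq r z (chk x)))"
 proof (intro allI impI)
 fix q' assume "q'<~q"
 then obtain r y where r: "r<~q'" "y = x \<or> y:elts x" "feq r z (chk y)"
 using h unfolding fo_Mem_check elts_vsucc by (metis insertE)
 hence "r||-z:.chk x \<or> feq r z (chk x)" using check_mem Mem_eq1[OF _ feq_sym] by blast
 thus "EX r. r<~q' & (r||-z:.chk x \<or> feq r z (chk x))" using r by blast
 qed
 next
 assume h: "!q'. q'<~q --> (EX r. r<~q' & (r||-z:.chk x \<or> feq r z (chk x)))"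
 show "q||-z:.chk (vsucc x)"
 proof (rule fo_dense)
 fix q' assume "q'<~q"
 then obtain r where r: "r<~q'" "r||-z:.chk x \<or> feq r z (chk x)" using h by blast
 have "r||-z:.chk (vsucc x)" using r(2)
 proof
 assume "r||-z:.chk x"
 moreover have "elts x<=elts (vsucc x)" by auto
 ultimately show ?thesis unfolding fo_Mem_check by blast
 next
 assume "feq r z (chk x)"
 moreover have "r||-chk x:.chk (vsucc x)" by (rule check_mem) simp
 ultimately show ?thesis using Mem_eq1 feq_sym by blast
 qed
 thus "EX r. r<~q' & r||-z:.chk (vsucc x)" using r by blast
 qed
 qed
qed

lemma fo_empty_check: "p||-is_empty (chk (vset {}))"
 unfolding is_empty_def forces_All fo_Neg fo_Mem_check using le_self by fastforce

lemma fo_ordinal_check: "vord a ==> p||-is_ordinal (chk a)"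
proof -
 assume a: "vord a"
 have "p||-is_transitive (chk x)" if "!y:elts x. elts y<=elts x" for x
 unfolding is_transitive_def is_subset_def using that check_mem by (simp add: fo_AllIn_check subset_iff)
 hence "p||-is_transitive (chk a)" "!y:elts a. p||-is_transitive (chk y)" using a by (simp_all add: vord_def)
 thus ?thesis by (simp add: is_ordinal_def fo_AllIn_check)
qed

lemma fo_omega_check: "p||-is_omega cw"
proof -
 have 1: "p||-(?.e:.cw. is_empty e)" using fo_ExIn_checkI[of "vset {}" vomega p is_empty] fo_empty_check
 by (metis elts_vomega rangeI vnat.simps(1))
 have 2: "p||-(?.y:.cw. is_succ y (cn n))" for n using fo_ExIn_checkI[of "vsucc (vnat n)" vomega p] fo_succ_check
 by (metis elts_vomega rangeI vnat.simps(2))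
 have 3: "p||-(is_empty (cn n) |. (?.y:.cw. is_succ (cn n) y))" for n
 proof (cases n)
 case 0
 thus ?thesis using fo_DisjI1 fo_empty_check by simp
 next
 case (Suc m)
 have "p||-(?.y:.cw. is_succ (cn n) y)" using fo_ExIn_checkI[of "vnat m" vomega p] fo_succ_check Suc by (simp add: elts_vomega)
 thus ?thesis by (rule fo_DisjI2)
 qed
 show ?thesis unfolding is_omega_def forces_Conj
 using fo_ordinal_check[OF vord_vomega] 1 2 3 by (simp add: fo_AllIn_check elts_vomega)
qed

end

section \<open>Two-valued models\<close>

definition pfilter :: "'b set set => bool"
 where "pfilter F <-> UNIV:F & {}~:F & (!X:F. !Y:F. X Int Y:F) & (!X:F. !Y. X<=Y --> Y:F)"

lemma pfilter_Union:
 assumes "C ~= {}" "!!F. F:C ==> pfilter F" "!!F G. F:C ==> G:C ==> F<=G \<or> G<=F"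
 shows "pfilter (\<Union>C)" unfolding pfilter_def
proof (intro conjI ballI allI impI)
 show "UNIV:\<Union>C" "{}~:\<Union>C" using assms(1,2) unfolding pfilter_def by blast+
next
 fix X Y assume "X:\<Union>C" "Y:\<Union>C"
 then obtain F G where FG: "F:C" "G:C" "X:F" "Y:G" by blast
 then obtain H where "H:C" "X:H" "Y:H" using assms(3)[OF FG(1,2)] by blast
 thus "X Int Y:\<Union>C" using assms(2)[of H] unfolding pfilter_def by blast
next
 fix X Y assume "X:\<Union>C" "X<=Y"
 then obtain F where F: "F:C" "X:F" by blast
 hence "Y:F" using assms(2)[of F] \<open>X<=Y\<close> unfolding pfilter_def by blast
 thus "Y:\<Union>C" using F by blast
qed

lemma pfilter_extend:
 assumes "pfilter M" "- X~:M"
 shows "pfilter {Y. EX A:M. A Int X<=Y}" unfolding pfilter_def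
proof (intro conjI ballI allI impI)
 show "UNIV:{Y. EX A:M. A Int X<=Y}" using assms(1) unfolding pfilter_def by blast
 have "A Int X ~= {}" if "A:M" for A
 proof
 assume "A Int X = {}"
 hence "A<=- X" by blast
 thus False using assms that unfolding pfilter_def by blast
 qed
 thus "{}~:{Y. EX A:M. A Int X<=Y}" by blast
next
 fix Y Z assume "Y:{Y. EX A:M. A Int X<=Y}" "Z:{Y. EX A:M. A Int X<=Y}"
 then obtain A B where AB: "A:M" "B:M" "A Int X<=Y" "B Int X<=Z" by blast
 hence "A Int B:M" using assms(1) unfolding pfilter_def by blast
 thus "Y Int Z:{Y. EX A:M. A Int X<=Y}" using AB by blast
next
 fix Y Z assume "Y:{Y. EX A:M. A Int X<=Y}" "Y<=Z"
 thus "Z:{Y. EX A:M. A Int X<=Y}" by blast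
qed

lemma ultrafilter_exists:
 assumes "pfilter D"
 shows "EX W. D<=W & pfilter W & (!X. X:W \<or> - X:W)"
proof -
 define Z where "Z = {F. D<=F & pfilter F}"
 have "EX M:Z. !X:Z. M<=X --> X = M"
 proof (rule subset_Zorn_nonempty)
 show "Z ~= {}" using assms unfolding Z_def by blast
 fix C assume C: "C ~= {}" "subset.chain Z C"
 have 1: "D<=F & pfilter F" if "F:C" for F using C(2) that unfolding subset_chain_def Z_def by blast
 have 2: "F:C ==> G:C ==> F<=G \<or> G<=F" for F G using C(2) unfolding subset_chain_def by blast
 obtain F0 where "F0:C" using C(1) by blast
 hence "D<=\<Union>C" using 1[of F0] by blast
 thus "\<Union>C:Z" using pfilter_Union[of C] C(1) 1 2 by (simp add: Z_def)
 qed
 then obtain M where M: "M:Z" "!X:Z. M<=X --> X = M" by (rule bexE)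
 hence pM: "D<=M" "pfilter M" by (simp_all add: Z_def)
 have "X:M \<or> - X:M" for X
 proof (rule ccontr)
 assume no: "~ (X:M \<or> - X:M)"
 let ?F = "{Y. EX A:M. A Int X<=Y}"
 have sub: "M<=?F" by blast
 have "?F:Z" using pfilter_extend[OF pM(2)] no sub pM(1) unfolding Z_def by simp
 hence "?F = M" using M(2) sub by simp
 moreover have "X:?F" using pM(2) unfolding pfilter_def by blast
 ultimately show False using no by simp
 qed
 thus ?thesis using pM by blast
qed

text \<open>An ultrafilter \<open>W\<close> on the set of conditions containing the sets that are open and dense below
  \<open>p0\<close> yields a two-valued structure: a formula is true if almost all conditions force it. By the
  maximum principle quantifiers are evaluated in the usual way.\<close>

locale gmodel = forcing P for P :: "'a::zfc forcing" +
 fixes p0 :: 'a and W :: "'a set set"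
 assumes p0: "p0:CP"
 and W_filter: "pfilter W"
 and W_ultra: "X:W \<or> - X:W"
 and W_dense: "(!!q. q<~p0 ==> EX r. r<~q & (!r'. r'<~r --> r':X)) ==> X:W"
begin

lemma W_empty: "{}~:W"
 and W_Int: "X:W ==> Y:W ==> X Int Y:W"
 and W_up: "X:W ==> X<=Y ==> Y:W" using W_filter unfolding pfilter_def by blast+

definition tr where "tr A <-> {q:CP. q||-A}:W"

lemma tr_fo: "p0||-A ==> tr A" unfolding tr_def using fo_mono le_tr le_conds le_self by (intro W_dense) blast

text \<open>The cone below \<open>p0\<close> is open and dense below \<open>p0\<close>, hence a
  member of \<open>W\<close>; so the implication has to hold only there.\<close>

lemma tr_consequence:
 assumes "!!q. q<~p0 ==> q||-A ==> q||-B" "tr A"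
 shows "tr B"
proof -
 have "{q. q<~p0}:W" using le_tr le_self by (intro W_dense) blast
 hence "{q. q<~p0} Int {q:CP. q||-A}:W" using assms(2) W_Int unfolding tr_def by blast
 thus ?thesis unfolding tr_def by (rule W_up) (use assms(1) in blast)
qed

lemma tr_Conj [simp]: "tr (Conj A B) <-> tr A & tr B"
proof
 assume "tr (Conj A B)"
 thus "tr A & tr B" unfolding tr_def by (auto elim: W_up)
next
 assume "tr A & tr B"
 hence "{q:CP. q||-A} Int {q:CP. q||-B}:W" using W_Int unfolding tr_def by blast
 thus "tr (Conj A B)" unfolding tr_def by (rule W_up) auto
qed

lemma tr_Neg [simp]: "tr (Neg A) <-> ~ tr A"
proof
 assume h: "tr (Neg A)"
 show "~ tr A"
 proof
 assume "tr A"
 hence "{q:CP. q||-A} Int {q:CP. q||-Neg A}:W" using h W_Int unfolding tr_def by blast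
 moreover have "{q:CP. q||-A} Int {q:CP. q||-Neg A} = {}" unfolding fo_Neg using le_refl by blast
 ultimately show False using W_empty by simp
 qed
next
 assume h: "~ tr A"
 \<comment> \<open>The conditions deciding \<open>A\<close> are open and dense, so \<open>W\<close>
   concentrates on them.\<close>
 have "{q:CP. q||-A \<or> q||-Neg A}:W"
 proof (rule W_dense)
 fix q assume "q<~p0"
 then obtain r where "r<~q" "r||-A \<or> r||-Neg A" using fo_decide le_conds by blast
 thus "EX r. r<~q & (!r'. r'<~r --> r':{q:CP. q||-A \<or> q||-Neg A})" using fo_mono le_conds by blast
 qed
 moreover have "- {q:CP. q||-A}:W" using h W_ultra unfolding tr_def by blast
 ultimately have "{q:CP. q||-A \<or> q||-Neg A} Int - {q:CP. q||-A}:W" by (rule W_Int)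
 thus "tr (Neg A)" unfolding tr_def by (rule W_up) auto
qed

lemma tr_prop [simp]:
 "tr (Disj A B) <-> tr A \<or> tr B"
 "tr (Imp A B) <-> (tr A --> tr B)"
 "tr (Iff A B) <-> (tr A <-> tr B)" by (auto simp: Disj_def Imp_def Iff_def)

text \<open>The maximum principle gives one name that works for all conditions forcing the
  existential statement; witnesses varying with the condition could not be tied together by
  \<open>W\<close>.\<close>

lemma tr_Ex_names: "ext F ==> tr (FEx F) <-> (EX x. nm x & tr (F x))"
proof
 assume F: "ext F" and h: "tr (FEx F)"
 obtain x where "nm x" "!!p. p||-FEx F ==> p||-F x" using max_principle[OF F] by blast
 thus "EX x. nm x & tr (F x)" using tr_consequence[OF _ h] by blast
next
 assume "EX x. nm x & tr (F x)"
 then obtain x where x: "nm x" "tr (F x)" by blast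
 show "tr (FEx F)" by (rule tr_consequence[OF _ x(2)]) (use x(1) fo_mono le_self in "unfold fo_Ex, blast")
qed

lemma tr_Equ_refl: "tr (Equ x x)" by (rule tr_fo) (simp add: fo_Equ)
lemma tr_Equ_sym: "tr (Equ x y) ==> tr (Equ y x)" by (rule tr_consequence) (auto simp: fo_Equ feq_sym)
lemma tr_Equ_trans: "tr (Equ x y) ==> tr (Equ y z) ==> tr (Equ x z)"
proof -
 assume "tr (Equ x y)" "tr (Equ y z)"
 hence "tr (Conj (Equ x y) (Equ y z))" by simp
 thus "tr (Equ x z)" by (rule tr_consequence[rotated]) (use feq_trans in "auto simp: fo_Equ")
qed

lemma tr_ext: "ext F ==> nm x ==> nm y ==> tr (Equ x y) ==> tr (F x) ==> tr (F y)"
proof -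
 assume F: "ext F" "nm x" "nm y" "tr (Equ x y)" "tr (F x)"
 hence "tr (Conj (Equ x y) (F x))" by simp
 thus "tr (F y)" by (rule tr_consequence[rotated]) (use extD[OF F(1-3)] in "auto simp: fo_Equ")
qed

text \<open>Every type in the class is as large as the quotient of the names by \<open>tr (x \<^bold>= y)\<close>, so that
  the elements of the model can be enumerated by the type itself.\<close>

lemma nu_exists: "EX nv::'a => 'a. (!m. nm (nv m)) & (!x. nm x --> (EX! m. tr (Equ x (nv m))))"
proof -
 define cl where "cl x = {y. nm y & tr (Equ x y)}" for x
 have cl_eq: "cl x = cl y <-> tr (Equ x y)" if "nm x" "nm y" for x y
 using that tr_Equ_refl tr_Equ_sym tr_Equ_trans unfolding cl_def by blast
 let ?B = "cl ` {x. nm x}"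
 \<comment> \<open>Schroeder-Bernstein is prepared: the type injects into the classes by canonical
   names, and the classes inject into the type by a choice of representatives.\<close>
 have "inj_on (%x. cl (chk x)) UNIV"
 proof (rule inj_onI)
 fix x y :: 'a assume "cl (chk x) = cl (chk y)"
 hence t: "tr (Equ (chk x) (chk y))" using cl_eq by simp
 show "x = y"
 proof (rule ccontr)
 assume "x ~= y"
 hence "p0||-(~. chk x =. chk y)" unfolding fo_Neg fo_Equ using check_eq le_conds by blast
 thus False using t tr_fo by fastforce
 qed
 qed
 moreover have "(%x. cl (chk x)) ` UNIV<=?B" by auto
 moreover have ne: "EX y. y:c" if "c:?B" for c using that tr_Equ_refl unfolding cl_def by blast
 have some: "(SOME y. y:c):c" if "c:?B" for c using someI_ex[OF ne[OF that]] .
 have some_cl: "cl (SOME y. y:c) = c" if c: "c:?B" for c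
 proof -
 obtain x where x: "nm x" "c = cl x" using c by blast
 hence "nm (SOME y. y:c)" "tr (Equ x (SOME y. y:c))" using some[OF c] unfolding cl_def by auto
 hence "cl x = cl (SOME y. y:c)" using cl_eq[OF x(1)] by blast
 thus ?thesis using x by simp
 qed
 hence "inj_on (%c. SOME y. y:c) ?B" by (rule inj_on_inverseI)
 moreover have "(%c. SOME y. y:c) ` ?B<=UNIV" by simp
 ultimately obtain h where h: "bij_betw h (UNIV::'a set) ?B" using Schroeder_Bernstein by metis
 let ?nu = "%m. SOME y. y:h m"
 have hB: "h m:?B" for m using h unfolding bij_betw_def by blast
 have nn: "nm (?nu m)" for m using some[OF hB] hB[of m] unfolding cl_def by blast
 have un: "EX! m. tr (Equ x (?nu m))" if x: "nm x" for x
 proof -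
 have iff: "tr (Equ x (?nu m)) <-> h m = cl x" for m using cl_eq[OF x nn[of m]] some_cl[OF hB[of m]] by auto
 have "cl x:?B" using x by blast
 then obtain m where m: "h m = cl x" using h unfolding bij_betw_def by (metis imageE)
 have "inj h" using h unfolding bij_betw_def by blast
 thus ?thesis unfolding iff unfolding m[symmetric] inj_eq[OF \<open>inj h\<close>] by simp
 qed
 show ?thesis by (rule exI[of _ ?nu]) (simp add: nn un)
qed

text \<open>\<open>nu\<close> gives each element of the two-valued structure a name,
  \<open>kap\<close> is the element that a name denotes, and \<open>el\<close> is the membership
  relation of the structure.\<close>

definition nu :: "'a => 'a" where "nu = (SOME nv. (!m. nm (nv m)) & (!x. nm x --> (EX! m. tr (Equ x (nv m)))))"

definition kap :: "'a => 'a" where "kap x = (THE m. tr (Equ x (nu m)))"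

definition el where "el b = {a. tr (Mem (nu a) (nu b))}"

lemma nm_nu [simp]: "nm (nu m)" and nu_unique: "nm x ==> EX! m. tr (Equ x (nu m))"
 using someI_ex[OF nu_exists] unfolding nu_def by blast+

lemma tr_kap: "nm x ==> tr (Equ x (nu (kap x)))" unfolding kap_def by (rule theI') (rule nu_unique)

lemma kap_eqI: "nm x ==> tr (Equ x (nu m)) ==> kap x = m" using nu_unique tr_kap by blast

lemma kap_nu [simp]: "kap (nu m) = m" by (rule kap_eqI) (simp_all add: tr_Equ_refl)

lemma tr_Equ: "nm x ==> nm y ==> tr (Equ x y) <-> kap x = kap y" using tr_kap kap_eqI tr_Equ_trans tr_Equ_sym by metis

lemma tr_kap_ext: "ext F ==> nm x ==> tr (F (nu (kap x))) <-> tr (F x)"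
 using tr_ext[OF _ _ nm_nu tr_kap] tr_ext[OF _ nm_nu _ tr_Equ_sym[OF tr_kap]] by blast

lemma tr_Mem: "nm x ==> nm y ==> tr (Mem x y) <-> kap x:el (kap y)"
 using tr_kap_ext[of "%z. Mem z y" x] tr_kap_ext[of "%z. Mem (nu (kap x)) z" y] by (simp add: el_def)

lemma tr_Ex: "ext F ==> tr (FEx F) <-> (EX m. tr (F (nu m)))" using tr_Ex_names tr_kap_ext nm_nu by metis

text \<open>The universal quantifier is primitive, so its duality with \<open>FEx\<close> is proved
  at the level of forcing, where the direction from the negated existential statement uses
  density.\<close>

lemma tr_All: "ext F ==> tr (FAll F) <-> (!m. tr (F (nu m)))"
proof -
 assume F: "ext F"
 have "tr (FAll F) <-> ~ tr (FEx (%x. Neg (F x)))"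
 proof -
 have "q||-FAll F <-> q||-Neg (FEx (%x. Neg (F x)))" for q
 proof
 assume "q||-FAll F"
 thus "q||-Neg (FEx (%x. Neg (F x)))" unfolding fo_Neg fo_Ex forces_All using fo_mono le_tr le_self by meson
 next
 assume h: "q||-Neg (FEx (%x. Neg (F x)))"
 show "q||-FAll F" unfolding forces_All
 proof (intro allI impI, rule fo_dense)
 fix x q' assume x: "nm x" "q'<~q"
 show "EX r. r<~q' & r||-F x"
 proof (rule ccontr)
 assume "~ (EX r. r<~q' & r||-F x)"
 hence "q'||-Neg (F x)" unfolding fo_Neg by blast
 hence "q'||-FEx (%x. Neg (F x))" unfolding fo_Ex using x fo_mono le_self by blast
 thus False using h x unfolding fo_Neg by blast
 qed
 qed
 qed
 hence "tr (FAll F) <-> tr (Neg (FEx (%x. Neg (F x))))" unfolding tr_def by simp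
 thus ?thesis by simp
 qed
 thus ?thesis using tr_Ex[OF ext_Neg[OF F]] by simp
qed

lemma tr_AllIn: "ext F ==> nm X ==> tr (AllIn X F) <-> (!m:el (kap X). tr (F (nu m)))"
 unfolding AllIn_def by (simp add: tr_All tr_Mem Ball_def)

lemma tr_ExIn: "ext F ==> nm X ==> tr (ExIn X F) <-> (EX m:el (kap X). tr (F (nu m)))"
 unfolding ExIn_def by (simp add: tr_Ex tr_Mem Bex_def)

text \<open>From here on the simplifier translates the truth of a formula into a HOL statement about
  \<open>el\<close> and \<open>kap\<close>, discharging the \<open>ext\<close> side conditions on
  the way.\<close>

lemmas tr_simps [simp] = tr_Equ tr_Mem tr_Ex tr_All tr_AllIn tr_ExIn

end

context forcing
begin

text \<open>If \<open>p\<close> does not force \<open>A\<close>, some \<open>q\<close> below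
  \<open>p\<close> has no extension forcing \<open>A\<close> and hence forces the negation. An
  ultrafilter extending the filter generated by the sets open and dense below \<open>q\<close> makes
  \<open>A\<close> false, and it also contains the sets open and dense below
  \<open>p\<close>.\<close>

lemma gmodel_exists:
 assumes "p:CP" "~ p||-A"
 shows "EX W. gmodel P p W & ~ gmodel.tr P W A"
proof -
 obtain q where q: "q<~p" "!!r. r<~q ==> ~ r||-A" using assms fo_dense by blast
 define D where "D = {X. !q'. q'<~q --> (EX r. r<~q' & (!r'. r'<~r --> r':X))}"
 have "pfilter D" unfolding pfilter_def
 proof (intro conjI ballI allI impI)
 show "{}~:D" unfolding D_def using le_self[OF q(1)] le_self by blast
 show "UNIV:D" unfolding D_def using le_self by blast
 show "Y:D" if "X:D" "X<=Y" for X Y using that unfolding D_def by blast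
 fix X Y assume XY: "X:D" "Y:D"
 show "X Int Y:D" unfolding D_def
 proof (clarify)
 fix q' assume "q'<~q"
 then obtain r where r: "r<~q'" "!r'. r'<~r --> r':X" using \<open>X:D\<close> unfolding D_def by blast
 hence "r<~q" using \<open>q'<~q\<close> le_tr by blast
 then obtain s where "s<~r" "!r'. r'<~s --> r':Y" using \<open>Y:D\<close> unfolding D_def by blast
 thus "EX r. r<~q' & (!r'. r'<~r --> r':X Int Y)" using r le_tr by blast
 qed
 qed
 then obtain W where W: "D<=W" "pfilter W" "!!X. X:W \<or> - X:W" using ultrafilter_exists[of D] by blast
 have dense: "X:W" if "!!q'. q'<~q ==> EX r. r<~q' & (!r'. r'<~r --> r':X)" for X using that W(1) unfolding D_def by blast
 have g: "gmodel P p W"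
 proof
 show "X:W" if "!!q. q<~p ==> EX r. r<~q & (!r'. r'<~r --> r':X)" for X by (rule dense) (use that q(1) le_tr in blast)
 qed (use assms W in blast)+
 interpret gmodel P p W by (rule g)
 have "q||-Neg A" unfolding fo_Neg using q by blast
 hence "{r:CP. r||-Neg A}:W" by (intro dense) (use le_self le_tr le_conds fo_mono in blast)
 hence "tr (Neg A)" unfolding tr_def .
 thus ?thesis using g by auto
qed

text \<open>Completeness, the main device of the forcing arguments below: a formula is forced as
  soon as it can be derived in each two-valued structure over \<open>p\<close>, by ordinary HOL
  reasoning.\<close>

lemma by_model:
 assumes "p:CP" "!!W. gmodel P p W ==> gmodel.tr P W A"
 shows "p||-A" using assms gmodel_exists by blast

lemma by_model_le: "q<~p ==> (!!W. gmodel P q W ==> gmodel.tr P W A) ==> q||-A" using by_model le_conds by blast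

end

context gmodel
begin

subsection \<open>Set theory inside the model\<close>

lemma el_inject [simp]: "el a = el b <-> a = b"
proof
 assume h: "el a = el b"
 have "p0||-((!.z. z:.nu a <->. z:.nu b) ->. nu a =. nu b)"
 unfolding fo_Imp forces_All fo_Iff fo_Equ by (intro allI impI fo_ext) auto
 from tr_fo[OF this] h show "a = b" by (simp add: set_eq_iff)
qed simp

lemma el_eqI: "(!!x. x:el a <-> x:el b) ==> a = b" using el_inject by blast

text \<open>A structure need not contain all HOL subsets of its sets; a subset is known to exist
  only when a formula defines it. This is why the constructions below keep a formula next to every
  HOL predicate.\<close>

lemma comp_ex: "ext F ==> EX s. el s = {x:el a. tr (F (nu x))}"
proof -
 assume F: "ext F"
 have "p0||-(!.x. x:.ncomp (nu a) F <->. (x:.nu a &. F x))" unfolding forces_All fo_Iff by (auto simp: fo_ncomp[OF nm_nu F])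
 from tr_fo[OF this] have "el (kap (ncomp (nu a) F)) = {x:el a. tr (F (nu x))}" using F by (auto simp: set_eq_iff)
 thus ?thesis by blast
qed

definition icomp where "icomp a F = (SOME s. el s = {x:el a. tr (F (nu x))})"

lemma el_icomp: "ext F ==> el (icomp a F) = {x:el a. tr (F (nu x))}" unfolding icomp_def by (rule someI_ex) (rule comp_ex)

definition ipow where "ipow a = kap (npow (nu a))"
definition iup where "iup a b = kap (nup (nu a) (nu b))"
definition iop where "iop a b = iup (iup a a) (iup a b)"
definition iun where "iun a = kap (nunion (nu a))"
definition iins where "iins a s = iun (iup s (iup a a))"

lemma tr_is_subset [simp]: "nm x ==> nm y ==> tr (is_subset x y) <-> el (kap x)<=el (kap y)" by (auto simp: is_subset_def)

lemma el_ipow [simp]: "el (ipow a) = {x. el x<=el a}"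
proof -
 have "p0||-(!.x. x:.npow (nu a) <->. is_subset x (nu a))" unfolding forces_All fo_Iff by (auto simp: fo_npow)
 from tr_fo[OF this] show ?thesis by (auto simp: ipow_def)
qed

lemma el_iup [simp]: "el (iup a b) = {a, b}"
proof -
 have "p0||-(!.x. x:.nup (nu a) (nu b) <->. (x =. nu a |. x =. nu b))" unfolding forces_All fo_Iff by (auto simp: fo_nup)
 from tr_fo[OF this] show ?thesis by (auto simp: iup_def)
qed

lemma el_iun [simp]: "el (iun a) = (UN x:el a. el x)"
proof -
 have "p0||-(!.x. x:.nunion (nu a) <->. (?.y:.nu a. x:.y))" unfolding forces_All fo_Iff by (auto simp: fo_nunion)
 from tr_fo[OF this] show ?thesis by (auto simp: iun_def)
qed

lemma el_iins [simp]: "el (iins a s) = insert a (el s)" by (auto simp: iins_def)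

lemma iup_inject: "iup a b = iup c d <-> {a, b} = {c, d}" by (metis el_iup el_inject)

lemma iop_inject [simp]: "iop a b = iop c d <-> a = c & b = d"
 unfolding iop_def iup_inject by (auto simp: doubleton_eq_iff iup_inject)

lemma regularity: "x:el a ==> EX y:el a. el y Int el a = {}"
proof -
 assume "x:el a"
 have "p0||-(nu x:.nu a ->. (?.y:.nu a. !.z:.y. ~. z:.nu a))" unfolding fo_Imp using fo_regularity[OF nm_nu nm_nu] by blast
 from tr_fo[OF this] \<open>x:el a\<close> show ?thesis by auto
qed

lemma tr_is_empty [simp]: "nm x ==> tr (is_empty x) <-> el (kap x) = {}" by (auto simp: is_empty_def)

lemma tr_is_upair [simp]: "nm u ==> nm a ==> nm b ==> tr (is_upair u a b) <-> kap u = iup (kap a) (kap b)"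
proof -
 assume "nm u" "nm a" "nm b"
 hence "tr (is_upair u a b) <-> el (kap u) = el (iup (kap a) (kap b))" by (auto simp: is_upair_def set_eq_iff)
 thus ?thesis by (simp only: el_inject)
qed

lemma tr_is_pair [simp]: "nm u ==> nm a ==> nm b ==> tr (is_pair u a b) <-> kap u = iop (kap a) (kap b)"
 by (simp add: is_pair_def iop_def)

lemma tr_pair_in [simp]: "nm a ==> nm b ==> nm r ==> tr (pair_in a b r) <-> iop (kap a) (kap b):el (kap r)"
 by (simp add: pair_in_def)

lemma tr_is_union [simp]: "nm u ==> nm a ==> nm b ==> tr (is_union u a b) <-> el (kap u) = el (kap a) Un el (kap b)"
 by (auto simp: is_union_def)

lemma tr_is_inter [simp]: "nm u ==> nm a ==> nm b ==> tr (is_inter u a b) <-> el (kap u) = el (kap a) Int el (kap b)"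
 by (auto simp: is_inter_def)

lemma tr_is_succ [simp]: "nm y ==> nm x ==> tr (is_succ y x) <-> kap y = iins (kap x) (kap x)"
proof -
 assume "nm y" "nm x"
 hence "tr (is_succ y x) <-> el (kap y) = el (iins (kap x) (kap x))" by (auto simp: is_succ_def)
 thus ?thesis by (simp only: el_inject)
qed

lemma tr_is_transitive [simp]: "nm x ==> tr (is_transitive x) <-> (!y:el (kap x). el y<=el (kap x))"
 by (simp add: is_transitive_def)

lemma tr_is_ordinal [simp]: "nm x ==> tr (is_ordinal x) <->
 (!y:el (kap x). el y<=el (kap x)) & (!z:el (kap x). !y:el z. el y<=el z)" by (simp add: is_ordinal_def)

lemma iprod_ex: "EX s. el s = {iop a b |a b. a:el A & b:el B}"
proof -
 let ?U = "iun (iup A B)"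
 let ?F = "%z. ?.a:.nu A. ?.b:.nu B. is_pair z a b"
 have "el (icomp (ipow (ipow ?U)) ?F) = {iop a b |a b. a:el A & b:el B}" by (subst el_icomp) (auto simp: iop_def)
 thus ?thesis by blast
qed

definition iprod where "iprod A B = (SOME s. el s = {iop a b |a b. a:el A & b:el B})"

lemma el_iprod: "el (iprod A B) = {iop a b |a b. a:el A & b:el B}" unfolding iprod_def by (rule someI_ex) (rule iprod_ex)

definition irel where "irel A B F = icomp (iprod A B) (%z. ?.a b. is_pair z a b &. F a b)"

lemma el_irel:
 assumes "!!y. nm y ==> ext (%x. F x y)" "!!x. nm x ==> ext (F x)"
 shows "el (irel A B F) = {iop a b |a b. a:el A & b:el B & tr (F (nu a) (nu b))}"
 unfolding irel_def using assms by (subst el_icomp) (auto simp: el_iprod)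

section \<open>Functions inside a two-valued structure\<close>

definition isf where "isf f X <-> (!z:el f. EX x:el X. EX y. z = iop x y) & (!x:el X. EX! y. iop x y:el f)"

definition ap where "ap f x = (THE y. iop x y:el f)"

definition Fn where "Fn f X Y <-> isf f X & (!x:el X. ap f x:el Y)"

lemma isf_iff: "isf f X ==> iop x y:el f <-> x:el X & y = ap f x"
proof -
 assume f: "isf f X"
 have 1: "iop x (ap f x):el f" if "x:el X" for x unfolding ap_def by (rule theI') (use f that in "simp add: isf_def")
 have 2: "x:el X" if "iop x y:el f" for x y
 proof -
 have "!z:el f. EX x:el X. EX y. z = iop x y" using f by (simp add: isf_def)
 from bspec[OF this that] show ?thesis by auto
 qed
 have 3: "y = ap f x" if "iop x y:el f" for x y
 proof -
 have "EX! y. iop x y:el f" using f 2[OF that] by (simp add: isf_def)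
 from the1_equality[OF this that] show ?thesis by (simp add: ap_def)
 qed
 show ?thesis using 1 2 3 by blast
qed

lemma el_isf: "isf f X ==> el f = (%x. iop x (ap f x)) ` el X"
proof
 assume f: "isf f X"
 show "el f<=(%x. iop x (ap f x)) ` el X"
 proof
 fix z assume z: "z:el f"
 then obtain x y where "z = iop x y" using f unfolding isf_def by blast
 thus "z:(%x. iop x (ap f x)) ` el X" using isf_iff[OF f, of x y] z by blast
 qed
 show "(%x. iop x (ap f x)) ` el X<=el f" using isf_iff[OF f] by blast
qed

lemma isf_eqI: "isf f X ==> isf g X ==> (!!x. x:el X ==> ap f x = ap g x) ==> f = g"
 by (rule iffD1[OF el_inject]) (simp add: el_isf)

lemma isfI:
 assumes "el f = (%x. iop x (g x)) ` el X"
 shows "isf f X" "!!x. x:el X ==> ap f x = g x"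
proof -
 show f: "isf f X" unfolding isf_def assms by auto
 show "ap f x = g x" if "x:el X" for x using isf_iff[OF f, of x "g x"] assms that by auto
qed

lemma tr_is_function_on [simp]: "nm f ==> nm X ==> tr (is_function_on f X) <-> isf (kap f) (kap X)"
 by (auto simp: is_function_on_def isf_def Ex1_def)

lemma tr_is_fun [simp]: "nm f ==> nm X ==> nm Y ==> tr (is_fun f X Y) <-> Fn (kap f) (kap X) (kap Y)"
 by (auto simp: is_fun_def Fn_def isf_iff)

lemma tr_is_inj [simp]: "nm f ==> nm X ==> nm Y ==>
 tr (is_inj f X Y) <-> Fn (kap f) (kap X) (kap Y) & inj_on (ap (kap f)) (el (kap X))"
 by (auto simp: is_inj_def Fn_def isf_iff inj_on_def)

lemma tr_is_bij [simp]: "nm f ==> nm X ==> nm Y ==>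
 tr (is_bij f X Y) <-> Fn (kap f) (kap X) (kap Y) & bij_betw (ap (kap f)) (el (kap X)) (el (kap Y))"
proof -
 assume n: "nm f" "nm X" "nm Y"
 have "tr (is_bij f X Y) <-> Fn (kap f) (kap X) (kap Y) & inj_on (ap (kap f)) (el (kap X)) &
 (!y:el (kap Y). EX x:el (kap X). y = ap (kap f) x)" using n by (auto simp: is_bij_def Fn_def isf_iff Bex_def)
 moreover have "Fn (kap f) (kap X) (kap Y) ==> ap (kap f) ` el (kap X) = el (kap Y) <->
 (!y:el (kap Y). EX x:el (kap X). y = ap (kap f) x)" unfolding Fn_def by (simp add: set_eq_iff image_iff) blast
 ultimately show ?thesis unfolding bij_betw_def by blast
qed

lemma tr_is_funspace [simp]: "nm D ==> nm X ==> nm Y ==>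
 tr (is_funspace D X Y) <-> el (kap D) = {f. Fn f (kap X) (kap Y)}" by (auto simp: is_funspace_def)

lemma tr_card_le [simp]: "nm X ==> nm Y ==>
 tr (card_le X Y) <-> (EX f. Fn f (kap X) (kap Y) & inj_on (ap f) (el (kap X)))" by (simp add: card_le_def)

lemma Fn_ap: "Fn f X Y ==> x:el X ==> ap f x:el Y" by (simp add: Fn_def)

definition ifs where "ifs X Y = icomp (ipow (iprod X Y)) (%f. is_fun f (nu X) (nu Y))"

lemma el_ifs [simp]: "el (ifs X Y) = {f. Fn f X Y}"
proof -
 have "el f<=el (iprod X Y)" if "Fn f X Y" for f using that el_isf[of f X] unfolding Fn_def el_iprod by auto
 thus ?thesis unfolding ifs_def by (subst el_icomp) auto
qed

text \<open>HOL functions are not elements of the structure. One becomes an internal function as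
  soon as a formula, here \<open>F\<close>, defines its graph.\<close>

lemma lam_ex:
 assumes "!!y. nm y ==> ext (%x. F x y)" "!!x. nm x ==> ext (F x)"
 and "!!x. x:el X ==> g x:el Y & (!y:el Y. tr (F (nu x) (nu y)) <-> y = g x)"
 shows "EX f. Fn f X Y & (!x:el X. ap f x = g x)"
proof -
 have "el (irel X Y F) = (%x. iop x (g x)) ` el X" using assms(3) by (auto simp: el_irel[OF assms(1,2)])
 from isfI[OF this] assms(3) show ?thesis unfolding Fn_def by metis
qed

lemma tr_is_comp_iff: "nm h ==> nm g ==> nm f ==>
 tr (is_comp h g f) <-> el (kap h) = {iop k y |k x y. iop k x:el (kap f) & iop x y:el (kap g)}"
 unfolding is_comp_def by (simp add: set_eq_iff) (metis (no_types))

lemma tr_is_comp: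
 assumes "nm h" "nm g" "nm f" "Fn (kap f) X Y" "Fn (kap g) Y Z"
 shows "tr (is_comp h g f) <-> isf (kap h) X & (!x:el X. ap (kap h) x = ap (kap g) (ap (kap f) x))"
proof -
 have "{iop k y |k x y. iop k x:el (kap f) & iop x y:el (kap g)} =
 (%x. iop x (ap (kap g) (ap (kap f) x))) ` el X" using assms(4,5) by (auto simp: Fn_def isf_iff)
 moreover have "el (kap h) = (%x. iop x (ap (kap g) (ap (kap f) x))) ` el X <->
 isf (kap h) X & (!x:el X. ap (kap h) x = ap (kap g) (ap (kap f) x))"
 using isfI[of "kap h" "%x. ap (kap g) (ap (kap f) x)" X] el_isf[of "kap h" X] by auto
 ultimately show ?thesis using assms(1-3) by (simp add: tr_is_comp_iff)
qed

lemma upd_ex: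
 assumes "Fn v X Y" "a:el Y"
 shows "EX v'. Fn v' X Y & (!x:el X. ap v' x = (if x = i then a else ap v x))"
proof (rule lam_ex[of "%x y. (x =. nu i &. y =. nu a) |. (~. x =. nu i &. pair_in x y (nu v))"])
 fix x assume "x:el X"
 thus "(if x = i then a else ap v x):el Y & (!y:el Y.
 tr ((nu x =. nu i &. nu y =. nu a) |. (~. nu x =. nu i &. pair_in (nu x) (nu y) (nu v)))
 <-> y = (if x = i then a else ap v x))" using assms by (auto simp: Fn_def isf_iff)
qed simp_all

lemma const_ex:
 assumes "a:el Y"
 shows "EX v. Fn v X Y & (!x:el X. ap v x = a)" by (rule lam_ex[of "%x y. y =. nu a"]) (use assms in auto)

section \<open>The natural numbers of a two-valued structure\<close>

definition om :: 'a where "om = kap cw"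
definition num where "num n = kap (cn n)"
abbreviation isuc where "isuc x == iins x x"

lemma num_Suc: "num (Suc n) = isuc (num n)" using tr_fo[OF fo_succ_check, of "vnat n"] by (simp add: num_def)

lemma el_num_0 [simp]: "el (num 0) = {}" using tr_fo[OF fo_empty_check] by (simp add: num_def)

lemma el_num: "el (num n) = num ` {..<n}" by (induction n) (auto simp: num_Suc lessThan_Suc)

lemma check_kap_eq: "kap (chk x) = kap (chk y) <-> x = y"
proof
 assume h: "kap (chk x) = kap (chk y)"
 show "x = y"
 proof (rule ccontr)
 assume "x ~= y"
 hence "p0||-(~. chk x =. chk y)" unfolding fo_Neg fo_Equ using check_eq le_conds by blast
 from tr_fo[OF this] h show False by simp
 qed
qed simp

lemma check_kap_mem: "kap (chk x):el (kap (chk y)) <-> x:elts y"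
proof
 assume h: "kap (chk x):el (kap (chk y))"
 show "x:elts y"
 proof (rule ccontr)
 assume "x~:elts y"
 hence "p0||-(~. chk x:.chk y)" unfolding fo_Neg using check_mem_iff le_conds by blast
 from tr_fo[OF this] h show False by simp
 qed
next
 assume "x:elts y"
 from tr_fo[OF check_mem[OF this]] show "kap (chk x):el (kap (chk y))" by simp
qed

lemma num_inject [simp]: "num m = num n <-> m = n" by (simp add: num_def check_kap_eq)

definition Omega where "Omega w <-> (!y:el w. el y<=el w) & (!z:el w. !y:el z. el y<=el z)
 & (EX e:el w. el e = {}) & (!x:el w. isuc x:el w) & (!x:el w. el x = {} \<or> (EX y:el w. x = isuc y))"

lemma tr_is_omega_Omega: "nm w ==> tr (is_omega w) <-> Omega (kap w)" by (auto simp: is_omega_def Omega_def)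

lemma Omega_om: "Omega om" using tr_fo[OF fo_omega_check] by (simp add: tr_is_omega_Omega om_def)

text \<open>The natural numbers of a structure may be nonstandard, so induction is available only
  for internal sets: by \<open>regularity\<close> there would be a minimal element of
  \<open>w\<close> outside \<open>s\<close>, but it is empty or the successor of an element of
  \<open>s\<close>.\<close>

lemma Omega_subset:
 assumes "Omega w" "EX e:el s. el e = {}" "!!x. x:el w ==> x:el s ==> isuc x:el s"
 shows "el w<=el s"
proof (rule ccontr)
 assume "~ el w<=el s"
 let ?d = "icomp w (%x. ~. x:.nu s)"
 have d: "el ?d = {x:el w. x~:el s}" by (subst el_icomp) simp_all
 then obtain x where x: "x:el ?d" "el x Int el ?d = {}" using \<open>~ el w<=el s\<close> regularity[of _ ?d] by blast
 hence xw: "x:el w" "x~:el s" using d by auto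
 show False
 proof (cases "el x = {}")
 case True
 thus False using assms(2) xw el_inject by metis
 next
 case False
 then obtain y where y: "y:el w" "x = isuc y" using assms(1) xw unfolding Omega_def by blast
 hence "y:el x" by simp
 hence "y:el s" using x(2) y(1) d by blast
 thus False using assms(3) y xw by blast
 qed
qed

lemma Omega_unique: "Omega w ==> w = om"
proof -
 assume w: "Omega w"
 have "el w<=el om" using Omega_om by (intro Omega_subset[OF w]) (auto simp: Omega_def)
 moreover have "el om<=el w" using w by (intro Omega_subset[OF Omega_om]) (auto simp: Omega_def)
 ultimately show ?thesis using el_inject by blast
qed

lemma tr_is_omega [simp]: "nm w ==> tr (is_omega w) <-> kap w = om" using tr_is_omega_Omega Omega_unique Omega_om by metis

lemma isuc_om: "x:el om ==> isuc x:el om" using Omega_om by (simp add: Omega_def)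

lemma num_in_om [simp]: "num n:el om" by (simp add: num_def om_def check_kap_mem elts_vomega)

lemma om_trans: "n:el om ==> m:el n ==> m:el om" using Omega_om unfolding Omega_def by blast

lemma om_induct:
 assumes "n:el om" "ext F" "tr (F (nu (num 0)))"
 and "!!n. n:el om ==> tr (F (nu n)) ==> tr (F (nu (isuc n)))"
 shows "tr (F (nu n))"
proof -
 have s: "el (icomp om F) = {x:el om. tr (F (nu x))}" by (rule el_icomp[OF assms(2)])
 have "num 0:el (icomp om F)" using s assms(3) by simp
 hence "el om<=el (icomp om F)" using s assms(4) isuc_om el_num_0 by (intro Omega_subset[OF Omega_om]) blast+
 thus ?thesis using s assms(1) by blast
qed

lemma om_irrefl: "n:el om ==> n~:el n"
proof
 assume n: "n:el om" "n:el n"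
 obtain y where "y:el (iup n n)" "el y Int el (iup n n) = {}" using regularity[of n "iup n n"] by auto
 thus False using n by auto
qed

lemma tr_is_countable [simp]: "nm X ==>
 tr (is_countable X) <-> (EX f. Fn f (kap X) om & inj_on (ap f) (el (kap X)))" by (auto simp: is_countable_def)

end

context forcing
begin

lemma ext_is_numeral [simp]: "tm u ==> ext (%x. is_numeral k (u x))" by (induction k arbitrary: u) simp_all
lemma ext_is_tagged [simp]: "tm u ==> tm v ==> ext (%x. is_tagged k (u x) (v x))" by (simp add: is_tagged_def)
lemma ext_is_tagged2 [simp]: "tm u ==> tm v ==> tm w ==> ext (%x. is_tagged2 k (u x) (v x) (w x))" by (simp add: is_tagged2_def)

text \<open>Under forcing, numbers are standard: densely a member of \<omega> is forced equal to
  some numeral. A single two-valued structure does not guarantee this, so arguments that need a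
  standard number decide it by forcing before entering a structure.\<close>

lemma omega_elements:
 assumes "p||-is_omega w" "nm w" "nm x" "p||-x:.w" "q<~p"
 shows "EX r n. r<~q & feq r x (cn n)"
proof -
 have p: "p:CP" using assms le_conds by blast
 have "p||-w =. cw"
 proof (rule by_model[OF p])
 fix W assume "gmodel P p W"
 then interpret gmodel P p W .
 show "tr (w =. cw)" using tr_fo[OF assms(1)] assms(2) by (simp flip: om_def)
 qed
 hence "p||-x:.cw" using Mem_eq2 assms(4) by (simp add: fo_Equ)
 thus ?thesis using assms(5) unfolding fo_Mem_check by (auto simp: elts_vomega)
qed

end

context gmodel
begin

lemma tr_is_numeral [simp]: "nm x ==> tr (is_numeral k x) <-> kap x = num k"
proof (induction k arbitrary: x)
 case 0
 thus ?case by (simp flip: el_inject)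
next
 case (Suc k)
 thus ?case by (simp add: num_Suc)
qed

lemma tr_is_tagged [simp]: "nm z ==> nm x ==> tr (is_tagged k z x) <-> kap z = iop (num k) (kap x)" by (simp add: is_tagged_def)

lemma tr_is_tagged2 [simp]: "nm z ==> nm x ==> nm y ==>
 tr (is_tagged2 k z x y) <-> kap z = iop (num k) (iop (kap x) (kap y))" by (simp add: is_tagged2_def)

end

section \<open>Finite support iterations\<close>

definition ccc where "ccc P <-> (\<forall>S\<subseteq>conds P. (!s:S. !t:S. s ~= t --> ~ forcing.compat P s t) --> countable S)"

context forcing
begin

text \<open>The family need not be injective: two indices with the same condition are compatible,
  and otherwise its range would be an uncountable antichain.\<close>

lemma ccc_family:
 assumes "ccc P" "uncountable I" "!!i. i:I ==> f i:CP"
 shows "EX i:I. EX j:I. i ~= j & compat (f i) (f j)"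
proof (rule ccontr)
 assume no: "~ (EX i:I. EX j:I. i ~= j & compat (f i) (f j))"
 have self: "compat (f i) (f i)" if "i:I" for i using assms(3)[OF that] le_refl unfolding compat_def by blast
 have "inj_on f I" by (rule inj_onI) (use no self in metis)
 moreover have "countable (f ` I)" using assms(1,3) no unfolding ccc_def by (smt (verit) image_iff subsetI)
 ultimately show False using assms(2) countable_image_inj_on by blast
qed

lemma inj_value:
 assumes "p||-is_inj f X Y" "p||-x:.X" "nm f" "nm X" "nm Y" "nm x" "p:CP"
 shows "p||-(?.y:.Y. <|x, y|>:.f)"
proof (rule by_model[OF assms(7)])
 fix W assume "gmodel P p W"
 then interpret gmodel P p W .
 show "tr (?.y:.Y. <|x, y|>:.f)" using tr_fo[OF assms(1)] tr_fo[OF assms(2)] assms by (auto simp: Fn_def isf_iff)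
qed

lemma inj_eq:
 assumes "p||-is_inj f X Y" "p||-<|x, y|>:.f" "p||-<|x', y|>:.f"
 "nm f" "nm X" "nm Y" "nm x" "nm x'" "nm y" "p:CP"
 shows "feq p x x'" unfolding fo_Equ[symmetric]
proof (rule by_model[OF assms(10)])
 fix W assume "gmodel P p W"
 then interpret gmodel P p W .
 show "tr (x =. x')" using tr_fo[OF assms(1)] tr_fo[OF assms(2)] tr_fo[OF assms(3)] assms
 by (auto simp: Fn_def isf_iff inj_on_def)
qed

lemma forcing_notion_props:
 assumes h: "p||-is_forcing_notion Q l t" and n: "nm Q" "nm l" "nm t" and p: "p:CP"
 shows "nm x ==> p||-x:.Q ==> p||-<|x, x|>:.l"
 and "nm x ==> nm y ==> nm z ==> p||-<|x, y|>:.l ==> p||-<|y, z|>:.l ==> p||-<|x, z|>:.l"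
 and "p||-t:.Q"
 and "nm x ==> p||-x:.Q ==> p||-<|x, t|>:.l"
proof -
 show "p||-<|x, x|>:.l" if "nm x" "p||-x:.Q" using h that p le_refl unfolding is_forcing_notion_def forces_Conj fo_AllIn by blast
 show "p||-<|x, z|>:.l" if "nm x" "nm y" "nm z" "p||-<|x, y|>:.l" "p||-<|y, z|>:.l"
 using h that p le_refl unfolding is_forcing_notion_def forces_Conj forces_All fo_Imp by blast
 show "p||-t:.Q" using h unfolding is_forcing_notion_def forces_Conj by blast
 show "p||-<|x, t|>:.l" if "nm x" "p||-x:.Q" using h that p le_refl unfolding is_forcing_notion_def forces_Conj fo_AllIn by blast
qed

end

lemma fs_condsD:
 assumes "p:fs_conds P Q w"
 shows "vfunction p w" "!!v. v:elts w ==> rst p v:conds (P v)"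
 "!!v. v:elts w ==> vapp p v:vdom (nm_conds (Q v))"
 "!!v. v:elts w ==> forces (P v) (rst p v) (vapp p v:.nm_conds (Q v))"
 "finite {v:elts w. vapp p v ~= nm_top (Q v)}" using assms unfolding fs_conds_def by auto

locale fsi =
 fixes de :: "'a::zfc" and P :: "'a => 'a forcing" and Q :: "'a => 'a forcing_name"
 assumes ord_de: "vord de" and iter: "fs_iteration de P Q"
begin

abbreviation "stages == elts (vsucc de)"
abbreviation "dl == elts de"
abbreviation "nP v == is_name (P v)"
abbreviation "kP v == check (P v)"
abbreviation "eP v == forces_eq (P v)"
abbreviation "wP v == weakest (P v)"
abbreviation "cP v == conds (P v)"
abbreviation "sP v == stronger (P v)"
abbreviation "fP v == forces (P v)"
abbreviation "cQ v == nm_conds (Q v)"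
abbreviation "lQ v == nm_le (Q v)"
abbreviation "tQ v == nm_top (Q v)"

lemma P_eq:
 assumes "w:stages"
 shows "cP w = fs_conds P Q w" "sP w = fs_stronger P Q w" "wP w = fs_weakest Q w"
proof -
 have "P w = \<lparr>conds = fs_conds P Q w, stronger = fs_stronger P Q w, weakest = fs_weakest Q w\<rparr>"
 using iter assms unfolding fs_iteration_def by blast
 thus "cP w = fs_conds P Q w" "sP w = fs_stronger P Q w"
 "wP w = fs_weakest Q w" by simp_all
qed

lemma ord_succ: "vord (vsucc de)" by (rule vord_vsucc[OF ord_de])
lemma ord_le: "w:stages ==> vord w" by (rule vord_in[OF ord_succ])
lemma in_le: "w:stages ==> v:elts w ==> v:stages" using vord_trans[OF ord_succ] by blast
lemma in_lt: "w:stages ==> v:elts w ==> v:dl" using vord_trans[OF ord_de] by auto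
lemma lt_le: "v:dl ==> v:stages" by simp
lemma succ_le: "v:dl ==> vsucc v:stages"
 using vord_linear[OF vord_vsucc[OF vord_in[OF ord_de]] ord_de, of v] mem_asym[of v de] by auto

lemma names: "v:dl ==> nP v (cQ v)" "v:dl ==> nP v (lQ v)"
 "v:dl ==> tQ v:vdom (cQ v)"
 "v:dl ==> p:cP v ==> fP v p (is_forcing_notion (cQ v) (lQ v) (tQ v))" using iter unfolding fs_iteration_def forced_def by blast+

lemma rst_conds: "w:stages ==> p:cP w ==> v:elts w ==> rst p v:cP v" using P_eq(1) fs_condsD(2) by blast

lemma restrict_restrict:
 "w:stages ==> p:cP w ==> v:elts w ==> z:elts v ==>
 rst (rst p v) z = rst p z" using P_eq(1) fs_condsD(1) ord_le vord_subset vord_in by (metis vrestrict_vrestrict)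

lemma app_restrict:
 "w:stages ==> p:cP w ==> v:elts w ==> z:elts v ==>
 vapp (rst p v) z = vapp p z" using P_eq(1) fs_condsD(1) ord_le vord_subset by (metis vapp_vrestrict)

lemma restrict_le:
 assumes "w:stages" "sP w p q" "v:elts w"
 shows "sP v (rst p v) (rst q v)"
proof -
 have h: "p:cP w" "q:cP w"
 "!!z. z:elts w ==> fP z (rst p z) (<|vapp p z, vapp q z|>:.lQ z)"
 using assms(2) unfolding P_eq[OF assms(1)] fs_stronger_def by blast+
 have b: "v:stages" using in_le assms by blast
 have "z:elts w" if "z:elts v" for z using that vord_trans[OF ord_le] assms by blast
 thus ?thesis using rst_conds[OF assms(1) h(1) assms(3)] rst_conds[OF assms(1) h(2) assms(3)] h(3)
 restrict_restrict[OF assms(1) h(1) assms(3)] app_restrict[OF assms(1) h(1) assms(3)]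
 app_restrict[OF assms(1) h(2) assms(3)] unfolding P_eq[OF b] fs_stronger_def by simp
qed

text \<open>Membership induction is needed because transitivity of the order at \<open>w\<close>
  uses monotonicity of forcing at the earlier stages, and reflexivity uses what those stages force
  about the iterands.\<close>

lemma forcing_P: "w:stages ==> forcing (P w)"
proof (induction w rule: mem_induct)
 case (step w)
 note a = step.prems
 have F: "forcing (P v)" if "v:elts w" for v using step.IH[OF that] in_le[OF a that] by blast
 have lt: "v:dl" if "v:elts w" for v using in_lt[OF a that] .
 have nmQ: "nP v x" if "v:elts w" "x:vdom (cQ v)" for v x
 using forcing.nm_vdom[OF F[OF that(1)] names(1)[OF lt[OF that(1)]] that(2)] .
 have props: "nP v x ==> fP v p (x:.cQ v) ==> fP v p (<|x, x|>:.lQ v)"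
 "nP v x ==> nP v y ==> nP v z ==> fP v p (<|x, y|>:.lQ v) ==>
 fP v p (<|y, z|>:.lQ v) ==> fP v p (<|x, z|>:.lQ v)"
 "fP v p (tQ v:.cQ v)"
 "nP v x ==> fP v p (x:.cQ v) ==> fP v p (<|x, tQ v|>:.lQ v)" if b: "v:elts w" "p:cP v" for v p x y z
 using forcing.forcing_notion_props[OF F[OF b(1)] names(4)[OF lt[OF b(1)] b(2)] names(1)[OF lt[OF b(1)]]
 names(2)[OF lt[OF b(1)]] nmQ[OF b(1) names(3)[OF lt[OF b(1)]]] b(2)] by blast+
 note Pa = P_eq[OF a]
 have cl: "v:elts w ==> elts v<=elts w" for v using vord_subset[OF ord_le[OF a]] by blast
 have wr: "rst (fs_weakest Q w) v = wP v" if "v:elts w" for v unfolding P_eq[OF in_le[OF a that]] fs_weakest_def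
 using rst_vlam[OF cl[OF that], of tQ] unfolding vlam_def by blast
 have wa: "vapp (fs_weakest Q w) v = tQ v" if "v:elts w" for v unfolding fs_weakest_def vlam_def[symmetric] using that by simp
 have wc: "fs_weakest Q w:cP w" unfolding Pa fs_conds_def
 proof (rule CollectI, intro conjI ballI)
 show "vfunction (fs_weakest Q w) w" unfolding fs_weakest_def vlam_def[symmetric] by simp
 show "finite {v:elts w. vapp (fs_weakest Q w) v ~= tQ v}"
 using wa by (metis (mono_tags, lifting) Collect_empty_eq finite.emptyI)
 fix v assume b: "v:elts w"
 show "rst (fs_weakest Q w) v:cP v" unfolding wr[OF b] by (rule forcing.top_in[OF F[OF b]])
 from this show "fP v (rst (fs_weakest Q w) v) (vapp (fs_weakest Q w) v:.cQ v)" unfolding wa[OF b] by (rule props(3)[OF b])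
 show "vapp (fs_weakest Q w) v:vdom (cQ v)" unfolding wa[OF b] by (rule names(3)[OF lt[OF b]])
 qed
 have leI: "sP w p q" if "p:cP w" "q:cP w"
 "!!v. v:elts w ==> fP v (rst p v) (<|vapp p v, vapp q v|>:.lQ v)" for p q using that unfolding Pa fs_stronger_def by blast
 have D: "rst p v:cP v" "vapp p v:vdom (cQ v)"
 "fP v (rst p v) (vapp p v:.cQ v)" "nP v (vapp p v)" if "p:cP w" "v:elts w" for p v
 using fs_condsD(2,3,4) nmQ that unfolding Pa by blast+
 show ?case
 proof
 show "sP w p p" if "p:cP w" for p by (rule leI[OF that that]) (use props(1) D[OF that] in blast)
 show c: "p:cP w & q:cP w" if "sP w p q" for p q using that unfolding Pa fs_stronger_def by blast
 show "sP w p r" if pq: "sP w p q" and qr: "sP w q r" for p q r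
 proof (rule leI)
 show pc: "p:cP w" and rc: "r:cP w" using c[OF pq] c[OF qr] by blast+
 have qc: "q:cP w" using c[OF pq] by blast
 fix v assume b: "v:elts w"
 have 1: "fP v (rst p v) (<|vapp p v, vapp q v|>:.lQ v)" using pq b unfolding Pa fs_stronger_def by blast
 have "fP v (rst q v) (<|vapp q v, vapp r v|>:.lQ v)" using qr b unfolding Pa fs_stronger_def by blast
 hence "fP v (rst p v) (<|vapp q v, vapp r v|>:.lQ v)" using forcing.fo_mono[OF F[OF b]] restrict_le[OF a pq b] by blast
 thus "fP v (rst p v) (<|vapp p v, vapp r v|>:.lQ v)"
 using props(2)[OF b D(1)[OF pc b] D(4)[OF pc b] D(4)[OF qc b] D(4)[OF rc b] 1] by blast
 qed
 show "wP w:cP w" unfolding Pa(3) by (rule wc)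
 show "sP w p (wP w)" if "p:cP w" for p unfolding Pa(3) by (rule leI[OF that wc]) (use props(4) D[OF that] wa in simp)
 have "small {p. vfunction p w & (!v:elts w. vapp p v:vdom (cQ v))}" by (rule small_vfunctions) (rule small_vdom)
 thus "small (cP w)" by (rule small_subset) (auto simp: Pa fs_conds_def)
 qed
qed

end

lemma vord_cases:
 assumes "vord w"
 obtains (succ) v where "w = vsucc v" | (lim) "!!v. v:elts w ==> vsucc v:elts w"
proof (cases "EX v. w = vsucc v")
 case False
 have "vsucc v:elts w" if b: "v:elts w" for v
 using vord_linear[OF vord_vsucc[OF vord_in[OF assms b]] assms] False mem_asym[OF b] b by auto
 thus ?thesis using lim by blast
qed (use succ in blast)

lemma limit_finite_bound:
 assumes "vord w" "finite F" "F<=elts w" "!!v. v:elts w ==> vsucc v:elts w" "w ~= vset {}"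
 shows "EX v:elts w. F<=elts v" using assms(2,3)
proof (induction F)
 case empty
 have "elts w ~= {}" using assms(5) vset_elts by metis
 thus ?case by blast
next
 case (insert x F)
 then obtain v where b: "v:elts w" "F<=elts v" by auto
 have x: "x:elts w" using insert by simp
 have "x:elts v \<or> x = v \<or> v:elts x" by (rule vord_linear[OF vord_in[OF assms(1) x] vord_in[OF assms(1) b(1)]])
 thus ?case
 proof (elim disjE)
 assume "x:elts v"
 thus ?thesis using b by blast
 next
 assume "x = v"
 hence "insert x F<=elts (vsucc v)" using b by auto
 thus ?thesis using assms(4)[OF b(1)] by blast
 next
 assume "v:elts x"
 hence "insert x F<=elts (vsucc x)" using b vord_subset[OF vord_in[OF assms(1) x]] by auto
 thus ?thesis using assms(4)[OF x] by blast
 qed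
qed

context fsi
begin

lemma res_self: "w:stages ==> p:cP w ==> rst p w = p" using P_eq(1) fs_condsD(1) vrestrict_self by blast

lemma res_c: "w:stages ==> p:cP w ==> v:elts (vsucc w) ==> rst p v:cP v" using rst_conds res_self by auto

lemma res_le: "w:stages ==> sP w p q ==> v:elts (vsucc w) ==>
 sP v (rst p v) (rst q v)" using restrict_le res_self forcing.le_conds[OF forcing_P] by auto

lemma res_res: "w:stages ==> p:cP w ==> v:elts (vsucc w) ==> z:elts (vsucc v) ==>
 rst (rst p v) z = rst p z" using restrict_restrict[of w p v z] res_self[of w p] res_self[of v "rst p v"] res_c[of w p v]
 in_le[of w v] by auto

lemma res_app: "w:stages ==> p:cP w ==> v:elts (vsucc w) ==> z:elts v ==>
 vapp (rst p v) z = vapp p z" using app_restrict res_self by auto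

lemma le_in: "w:stages ==> v:elts (vsucc w) ==> v:stages" using in_le by auto

lemma cond_app:
 assumes "w:stages" "p:cP w" "v:elts w"
 shows "vapp p v:vdom (cQ v)" "nP v (vapp p v)"
 "fP v (rst p v) (vapp p v:.cQ v)"
proof -
 show 1: "vapp p v:vdom (cQ v)" "fP v (rst p v) (vapp p v:.cQ v)" using fs_condsD(3,4) assms P_eq(1) by blast+
 show "nP v (vapp p v)" using forcing.nm_vdom[OF forcing_P[OF in_le[OF assms(1,3)]] names(1)[OF in_lt[OF assms(1,3)]] 1(1)] .
qed

lemma nm_dom: "v:dl ==> x:vdom (cQ v) ==> nP v x" using forcing.nm_vdom[OF forcing_P[OF lt_le] names(1)] by blast

lemma le_app: "w:stages ==> sP w p q ==> v:elts w ==>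
 fP v (rst p v) (<|vapp p v, vapp q v|>:.lQ v)" unfolding P_eq fs_stronger_def by blast

lemma condI:
 assumes "w:stages" "vfunction p w" "finite {v:elts w. vapp p v ~= tQ v}"
 "!!v. v:elts w ==> rst p v:cP v"
 "!!v. v:elts w ==> vapp p v:vdom (cQ v)"
 "!!v. v:elts w ==> fP v (rst p v) (vapp p v:.cQ v)"
 shows "p:cP w" using assms unfolding P_eq[OF assms(1)] fs_conds_def by blast

lemma leI:
 assumes "w:stages" "p:cP w" "q:cP w"
 "!!v. v:elts w ==> fP v (rst p v) (<|vapp p v, vapp q v|>:.lQ v)"
 shows "sP w p q" using assms unfolding P_eq[OF assms(1)] fs_stronger_def by blast

lemma Q_props:
 assumes "v:dl" "p:cP v"
 shows "nP v x ==> fP v p (x:.cQ v) ==> fP v p (<|x, x|>:.lQ v)"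
 "fP v p (tQ v:.cQ v)"
 "nP v x ==> fP v p (x:.cQ v) ==> fP v p (<|x, tQ v|>:.lQ v)"
 using forcing.forcing_notion_props[OF forcing_P[OF lt_le] names(4) names(1,2) nm_dom[OF _ names(3)]] assms by blast+

lemma weakest_app:
 assumes "w:stages" "v:elts w"
 shows "vapp (wP w) v = tQ v" unfolding P_eq[OF assms(1)] fs_weakest_def vlam_def[symmetric] using assms by simp

section \<open>Gluing conditions of an iteration\<close>

definition supp where "supp w p = {v:elts w. vapp p v ~= tQ v}"

lemma finite_supp: "w:stages ==> p:cP w ==> finite (supp w p)" unfolding supp_def using fs_condsD(5) P_eq(1) by blast

text \<open>Below \<open>v\<close> the glued condition is \<open>r\<close>; above, it takes the
  nontrivial one of the two coordinates. That a coordinate is admissible must be forced by the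
  initial segment of the glued condition itself, so membership and order are proved together by
  induction on initial segments.\<close>

lemma amalgamation:
 assumes a: "w:stages" and b: "v:elts (vsucc w)"
 and p: "p:cP w" and q: "q:cP w"
 and rp: "sP v r (rst p v)" and rq: "sP v r (rst q v)"
 and dis: "!!z. z:elts w ==> z~:elts v ==> vapp p z = tQ z \<or> vapp q z = tQ z"
 shows "EX c. sP w c p & sP w c q & rst c v = r &
 (!z:elts w. z~:elts v --> vapp c z = (if vapp p z = tQ z then vapp q z else vapp p z))"
proof -
 define f where "f z = (if z:elts v then vapp r z else if vapp p z = tQ z then vapp q z else vapp p z)" for z
 define c where "c = vlam w f"
 have ba: "elts v<=elts w" using b vord_subset[OF ord_le[OF a]] by auto
 have bd: "v:stages" using le_in[OF a b] .
 have r: "r:cP v" using forcing.le_conds[OF forcing_P[OF bd] rp] by blast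
 have rr: "r = vlam v (vapp r)" using r P_eq(1)[OF bd] fs_condsD(1) vfunction_eq_vlam by blast
 have sub: "elts z<=elts w" if "z:elts (vsucc w)" for z using that vord_subset[OF ord_le[OF a]] by auto
 have cr: "rst c z = vlam z f" if "z:elts (vsucc w)" for z unfolding c_def by (rule rst_vlam[OF sub[OF that]])
 have "vlam v f = vlam v (vapp r)" by (rule vlam_cong) (simp add: f_def)
 hence cb: "rst c v = r" unfolding cr[OF b] using rr by simp
 have main: "vlam z f:cP z & sP z (vlam z f) (rst p z) &
 sP z (vlam z f) (rst q z)" if "z:elts (vsucc w)" for z using that
 proof (induction z rule: mem_induct)
 case (step z)
 note g = step.prems
 have gd: "z:stages" using le_in[OF a g] .
 have xa: "xx:elts w" if "xx:elts z" for xx using sub[OF g] that by blast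
 have xd: "xx:dl" if "xx:elts z" for xx using in_lt[OF a xa[OF that]] .
 have IH: "vlam xx f:cP xx" "sP xx (vlam xx f) (rst p xx)"
 "sP xx (vlam xx f) (rst q xx)" if "xx:elts z" for xx using step.IH[OF that] xa[OF that] by auto
 have vr: "rst (vlam z f) xx = vlam xx f" if "xx:elts z" for xx
 by (rule rst_vlam) (use vord_subset[OF ord_le[OF gd] that] in blast)
 have va: "vapp (vlam z f) xx = f xx" if "xx:elts z" for xx using that by simp
 have rx: "rst r xx = vlam xx f" if "xx:elts v" for xx
 proof -
 have "elts xx<=elts v" using vord_subset[OF ord_le[OF bd] that] .
 thus ?thesis by (subst rr) (simp add: rst_vlam f_def subset_iff cong: vlam_cong)
 qed
 have dom: "f xx:vdom (cQ xx) & fP xx (vlam xx f) (f xx:.cQ xx)" if "xx:elts z" for xx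
 proof (cases "xx:elts v")
 case True
 thus ?thesis using cond_app[OF bd r True] rx[OF True] by (simp add: f_def)
 next
 case False
 thus ?thesis using cond_app[OF a p xa[OF that]] cond_app[OF a q xa[OF that]] IH[OF that]
 forcing.fo_mono[OF forcing_P[OF lt_le[OF xd[OF that]]]] unfolding f_def by auto
 qed
 have nmf: "nP xx (f xx)" if "xx:elts z" for xx using nm_dom[OF xd[OF that]] dom[OF that] by blast
 have mem: "vlam z f:cP z"
 proof (rule condI[OF gd])
 have "{xx:elts z. vapp (vlam z f) xx ~= tQ xx}<=supp v r Un supp w p Un supp w q"
 using xa unfolding supp_def f_def by (auto split: if_splits)
 thus "finite {xx:elts z. vapp (vlam z f) xx ~= tQ xx}"
 using finite_supp[OF bd r] finite_supp[OF a p] finite_supp[OF a q] by (simp add: finite_subset)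
 qed (use vr IH dom in auto)
 have pc: "rst p z:cP z" "rst q z:cP z" using res_c[OF a p g] res_c[OF a q g] .
 have st: "fP xx (vlam xx f) (<|f xx, vapp p xx|>:.lQ xx) & fP xx (vlam xx f) (<|f xx, vapp q xx|>:.lQ xx)" if "xx:elts z" for xx
 proof (cases "xx:elts v")
 case True
 thus ?thesis using le_app[OF bd rp True] le_app[OF bd rq True] rx[OF True] res_app[OF a p b True] res_app[OF a q b True]
 by (simp add: f_def)
 next
 case False
 note pr = Q_props[OF xd[OF that] IH(1)[OF that]]
 have "vapp p xx = tQ xx \<or> vapp q xx = tQ xx" using dis[OF xa[OF that] False] .
 thus ?thesis using pr(1,3)[OF nmf[OF that]] dom[OF that] False unfolding f_def by auto
 qed
 show ?case using mem leI[OF gd mem pc(1)] leI[OF gd mem pc(2)] st vr res_app[OF a p g] res_app[OF a q g] by simp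
 qed
 have "c:cP w & sP w c p & sP w c q" using main[of w] cr[of w] res_self[OF a p] res_self[OF a q] unfolding c_def by simp
 moreover have "!z:elts w. z~:elts v --> vapp c z = (if vapp p z = tQ z then vapp q z else vapp p z)"
 unfolding c_def by (simp add: f_def)
 ultimately show ?thesis using cb by blast
qed

text \<open>Amalgamation with the weakest condition, whose coordinates are all trivial.\<close>

lemma merge:
 assumes a: "w:stages" and b: "v:elts (vsucc w)"
 and p: "p:cP w" and rp: "sP v r (rst p v)"
 shows "EX c. sP w c p & rst c v = r & (!z:elts w. z~:elts v --> vapp c z = vapp p z)"
proof -
 have F: "forcing (P w)" "forcing (P v)" using forcing_P le_in a b by blast+
 let ?t = "wP w"
 have t: "?t:cP w" using forcing.top_in[OF F(1)] .
 have ta: "vapp ?t z = tQ z" if "z:elts w" for z using weakest_app[OF a that] .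
 have "sP w p ?t" using forcing.le_top[OF F(1) p] .
 hence "sP v r (rst ?t v)" using forcing.le_tr[OF F(2) rp] res_le[OF a _ b] by blast
 from amalgamation[OF a b p t rp this] ta obtain c where c: "sP w c p" "rst c v = r"
 "!z:elts w. z~:elts v --> vapp c z = (if vapp p z = tQ z then vapp ?t z else vapp p z)" by blast
 have "!z:elts w. z~:elts v --> vapp c z = vapp p z" using c(3) ta by simp
 thus ?thesis using c by blast
qed

text \<open>A condition of length \<open>vsucc v\<close> is assembled from \<open>r\<close> and
  \<open>x\<close>, and \<open>merge\<close> adds the coordinates of \<open>p\<close> above
  \<open>v\<close>. Only elements of the domain of the iterand's name may stand as coordinates,
  hence the hypothesis on \<open>x\<close>.\<close>

lemma extend_at:
 assumes a: "w:stages" and b: "v:elts w"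
 and p: "p:cP w" and rp: "sP v r (rst p v)"
 and x: "x:vdom (cQ v)" "fP v r (x:.cQ v)" "fP v r (<|x, vapp p v|>:.lQ v)"
 shows "EX c. sP w c p & rst c v = r & vapp c v = x"
proof -
 have bd: "v:dl" using in_lt[OF a b] .
 have sa: "vsucc v:elts (vsucc w)"
 using vord_linear[OF vord_vsucc[OF vord_in[OF ord_le[OF a] b]] ord_le[OF a]] mem_asym[OF b] b by auto
 have sd: "vsucc v:stages" using le_in[OF a sa] .
 have r: "r:cP v" using forcing.le_conds[OF forcing_P[OF lt_le[OF bd]] rp] by blast
 have fr: "vfunction r v" using r P_eq(1)[OF lt_le[OF bd]] fs_condsD(1) by blast
 define f where "f z = (if z = v then x else vapp r z)" for z
 define c1 where "c1 = vlam (vsucc v) f"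
 have nb: "z ~= v" if "z:elts v" for z using that by auto
 have c1b: "rst c1 v = r" unfolding c1_def
 by (subst rst_vlam, force, subst vfunction_eq_vlam[OF fr]) (rule vlam_cong, auto simp: f_def)
 have c1r: "rst c1 z = rst r z" if "z:elts v" for z unfolding c1b[symmetric] c1_def
 using vord_subset[OF ord_le[OF lt_le[OF bd]] that] that by (subst vrestrict_vrestrict[of _ "vsucc v"]) auto
 have c1a: "vapp c1 v = x" "!!z. z:elts v ==> vapp c1 z = vapp r z" unfolding c1_def by (auto simp: f_def)
 have c1: "c1:cP (vsucc v)"
 proof (rule condI[OF sd])
 show "vfunction c1 (vsucc v)" unfolding c1_def by simp
 have "{z:elts (vsucc v). vapp c1 z ~= tQ z}<=insert v (supp v r)" using c1a unfolding supp_def by auto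
 thus "finite {z:elts (vsucc v). vapp c1 z ~= tQ z}" using finite_supp[OF lt_le[OF bd] r] by (simp add: finite_subset)
 fix z assume g: "z:elts (vsucc v)"
 show "rst c1 z:cP z" using g c1b c1r r rst_conds[OF lt_le[OF bd] r] by auto
 show "vapp c1 z:vdom (cQ z)" using g c1a x cond_app(1)[OF lt_le[OF bd] r] by auto
 show "fP z (rst c1 z) (vapp c1 z:.cQ z)" using g c1a c1b c1r x cond_app(3)[OF lt_le[OF bd] r] by auto
 qed
 have "sP (vsucc v) c1 (rst p (vsucc v))"
 proof (rule leI[OF sd c1 res_c[OF a p sa]])
 fix z assume g: "z:elts (vsucc v)"
 show "fP z (rst c1 z) (<|vapp c1 z, vapp (rst p (vsucc v)) z|>:.lQ z)" unfolding res_app[OF a p sa g]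
 proof (cases "z = v")
 case True
 thus "fP z (rst c1 z) (<|vapp c1 z, vapp p z|>:.lQ z)" using c1a c1b x by simp
 next
 case False
 hence gb: "z:elts v" using g by simp
 have "v:elts (vsucc w)" using b by simp
 from res_app[OF a p this gb] show "fP z (rst c1 z) (<|vapp c1 z, vapp p z|>:.lQ z)"
 using le_app[OF lt_le[OF bd] rp gb] c1a(2)[OF gb] c1r[OF gb] by simp
 qed
 qed
 from merge[OF a sa p this] obtain c where c: "sP w c p" "rst c (vsucc v) = c1" by blast
 have cc: "c:cP w" using forcing.le_conds[OF forcing_P[OF a] c(1)] by blast
 have "rst c v = r" using res_res[OF a cc sa, of v] c(2) c1b by simp
 moreover have "vapp c v = x" using res_app[OF a cc sa, of v] c(2) c1a(1) by simp
 ultimately show ?thesis using c(1) by blast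
qed

text \<open>Coordinates of a condition must come from the domain of the iterand's name. An arbitrary
  name forced into the iterand is replaced by an equal one from the domain, at the cost of an
  extension.\<close>

lemma dom_dense:
 assumes "v:dl" "fP v r (y:.cQ v)" "r:cP v"
 shows "EX r' x. sP v r' r & x:vdom (cQ v) & fP v r' (x:.cQ v) & eP v y x r'"
proof -
 interpret forcing "P v" by (rule forcing_P[OF lt_le[OF assms(1)]])
 obtain r' x s where "sP v r' r" "vpair x s:elts (cQ v)" "sP v r' s"
 "eP v y x r'" using Mem_obtain[OF assms(2) le_refl[OF assms(3)]] by blast
 thus ?thesis using elts_forced unfolding vdom_def by blast
qed

end

section \<open>The countable chain condition along the iteration\<close>

context fsi
begin

abbreviation "compatP w == forcing.compat (P w)"

lemma compatP_def: "w:stages ==> compatP w p q <-> (EX r. sP w r p & sP w r q)" by (rule forcing.compat_def[OF forcing_P])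

lemma le_succI:
 assumes b: "v:dl" and c: "c:cP (vsucc v)" and t: "t:cP (vsucc v)"
 and r: "sP v (rst c v) (rst t v)"
 and x: "fP v (rst c v) (<|vapp c v, vapp t v|>:.lQ v)"
 shows "sP (vsucc v) c t"
proof (rule leI[OF succ_le[OF b] c t])
 have bb: "v:elts (vsucc (vsucc v))" by simp
 fix z assume "z:elts (vsucc v)"
 thus "fP z (rst c z) (<|vapp c z, vapp t z|>:.lQ z)" using x le_app[OF lt_le[OF b] r, of z] res_res[OF succ_le[OF b] c bb, of z]
 res_app[OF succ_le[OF b] c bb, of z] res_app[OF succ_le[OF b] t bb, of z] by auto
qed

lemma compat_succ:
 assumes b: "v:dl" and s: "s:cP (vsucc v)" and t: "t:cP (vsucc v)"
 and r: "sP v r (rst s v)" "sP v r (rst t v)"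
 and x: "x:vdom (cQ v)" "fP v r (x:.cQ v)"
 "fP v r (<|x, vapp s v|>:.lQ v)" "fP v r (<|x, vapp t v|>:.lQ v)"
 shows "compatP (vsucc v) s t"
proof -
 have sd: "vsucc v:stages" by (rule succ_le[OF b])
 obtain c where c: "sP (vsucc v) c s" "rst c v = r" "vapp c v = x" using extend_at[OF sd _ s r(1) x(1,2,3)] by auto
 have cc: "c:cP (vsucc v)" using forcing.le_conds[OF forcing_P[OF sd] c(1)] by blast
 have "sP (vsucc v) c t" using le_succI[OF b cc t] c r x by simp
 thus ?thesis using c(1) compatP_def[OF sd] by blast
qed

text \<open>The last coordinates of those \<open>s\<close> in \<open>S\<close> whose restriction to
  \<open>v\<close> lies in the generic filter are forced to be an antichain of the iterand, hence
  countable. An extension of \<open>rst s v\<close> decides the index of the last coordinate of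
  \<open>s\<close>. If uncountably many \<open>s\<close> had the same index, two of these extensions
  would be compatible by the chain condition at \<open>v\<close>, and a common extension would force
  the two last coordinates equal.\<close>

lemma ccc_succ:
 assumes b: "v:dl" and cb: "ccc (P v)"
 and cq: "fP v (wP v) (is_ccc (cQ v) (lQ v))"
 shows "ccc (P (vsucc v))" unfolding ccc_def
proof (intro allI impI)
 fix S assume S: "S<=cP (vsucc v)" and anti: "!s:S. !t:S. s ~= t --> ~ compatP (vsucc v) s t"
 have bd: "v:stages" and sd: "vsucc v:stages" using lt_le succ_le b by blast+
 interpret forcing "P v" by (rule forcing_P[OF bd])
 let ?F = "fP v" and ?le = "sP v" and ?nm = "nP v" and ?w = "wP v"
 have sb: "s:S ==> s:cP (vsucc v)" for s using S by blast
 note ca = cond_app[OF sd sb, of _ v]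
 have rs: "s:S ==> rst s v:cP v" for s using rst_conds[OF sd sb, of s v] by simp
 define A where "A = vset ((%s. vpair (vapp s v) (rst s v)) ` S)"
 have "small S" using S forcing.small_conds[OF forcing_P[OF sd]] small_subset by blast
 hence eA: "elts A = (%s. vpair (vapp s v) (rst s v)) ` S" unfolding A_def by (intro elts_vset' small_image)
 have nQ: "?nm (cQ v)" "?nm (lQ v)" using names b by blast+
 have nA: "?nm A"
 proof (rule nmI)
 fix z assume "z:elts A"
 then obtain s where "s:S" "z = vpair (vapp s v) (rst s v)" using eA by blast
 thus "EX y p. p:cP v & z = vpair y p & ?nm y" using ca(2) rs by auto
 qed
 have memA: "EX r s. ?le r q & s:S & ?le r (rst s v) & eP v x (vapp s v) r" if xA: "?F p (x:.A)" and qp: "?le q p" for p q x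
 proof -
 obtain r z t where r: "?le r q" "vpair z t:elts A" "?le r t" "eP v x z r" using Mem_obtain[OF xA qp] by blast
 then obtain s where "s:S" "z = vapp s v" "t = rst s v" using eA by auto
 thus ?thesis using r by blast
 qed
 have sub: "?F ?w (is_subset A (cQ v))" unfolding is_subset_def fo_AllIn
 proof (intro allI impI)
 fix x q assume x: "?nm x" "?le q ?w" "?F q (x:.A)"
 show "?F q (x:.cQ v)"
 proof (rule fo_dense)
 fix q' assume "?le q' q"
 from memA[OF x(3) this] obtain r s where r: "?le r q'" "s:S" "?le r (rst s v)"
 "eP v x (vapp s v) r" by blast
 hence "?F r (vapp s v:.cQ v)" using ca(3)[OF r(2)] fo_mono by simp
 hence "?F r (x:.cQ v)" using Mem_eq1 feq_sym[OF r(4)] by blast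
 thus "EX r. ?le r q' & ?F r (x:.cQ v)" using r by blast
 qed
 qed
 have ac: "?F ?w (!.x:.A. !.y:.A. ~. x =. y ->. ~. (?.z:.cQ v. <|z, x|>:.lQ v &. <|z, y|>:.lQ v))" unfolding fo_AllIn fo_Imp
 proof (intro allI impI)
 fix x q1 y q2 q3
 assume x: "?nm x" "?F q1 (x:.A)" and y: "?nm y" "?le q2 q1" "?F q2 (y:.A)"
 and q3: "?le q3 q2" "?F q3 (~. x =. y)"
 have False if q4: "?le q4 q3" "?F q4 (?.z:.cQ v. <|z, x|>:.lQ v &. <|z, y|>:.lQ v)" for q4
 proof -
 have le: "?le q4 q2" "?le q4 q1" using q4(1) q3(1) y(2) le_tr by blast+
 obtain r0 z where r0: "?le r0 q4" "?nm z" "?F r0 (z:.cQ v)" "?F r0 (<|z, x|>:.lQ v)"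
 "?F r0 (<|z, y|>:.lQ v)" using q4(2) le_self[OF q4(1)] unfolding fo_ExIn forces_Conj by blast
 obtain r1 s where r1: "?le r1 r0" "s:S" "?le r1 (rst s v)" "eP v x (vapp s v) r1"
 using memA[OF x(2) le_tr[OF r0(1) le(2)]] by blast
 obtain r2 t where r2: "?le r2 r1" "t:S" "?le r2 (rst t v)" "eP v y (vapp t v) r2"
 using memA[OF y(3) le_tr[OF r1(1) le_tr[OF r0(1) le(1)]]] by blast
 have zQ: "?F r2 (z:.cQ v)" using fo_mono[OF fo_mono[OF r0(3) r1(1)] r2(1)] .
 obtain r3 z' where r3: "?le r3 r2" "z':vdom (cQ v)" "?F r3 (z':.cQ v)" "eP v z z' r3"
 using dom_dense[OF b zQ] le_conds[OF r2(1)] by blast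
 have r30: "?le r3 r0" "?le r3 q3" "?le r3 r1" using r3 r2 r1 r0 q4 le_tr by blast+
 have nz': "?nm z'" using nm_dom[OF b r3(2)] .
 have e1: "eP v x (vapp s v) r3" "eP v y (vapp t v) r3" using feq_mono r1(4) r2(4) r30 r3(1) by blast+
 have "?F r3 (<|z', x|>:.lQ v)" "?F r3 (<|z', y|>:.lQ v)"
 using extD[of "%u. <|u, x|>:.lQ v", OF _ r0(2) nz' r3(4)] extD[of "%u. <|u, y|>:.lQ v", OF _ r0(2) nz' r3(4)]
 fo_mono r0(4,5) r30(1) nQ x(1) y(1) by simp_all
 hence "?F r3 (<|z', vapp s v|>:.lQ v)" "?F r3 (<|z', vapp t v|>:.lQ v)"
 using extD[of "%u. <|z', u|>:.lQ v", OF _ x(1) ca(2)[OF r1(2)] e1(1)]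
 extD[of "%u. <|z', u|>:.lQ v", OF _ y(1) ca(2)[OF r2(2)] e1(2)] nQ nz' by simp_all
 moreover have "?le r3 (rst s v)" "?le r3 (rst t v)" using r30 r1 r2 r3 le_tr by blast+
 ultimately have "compatP (vsucc v) s t" using compat_succ[OF b sb[OF r1(2)] sb[OF r2(2)]] r3(2,3) by blast
 hence "s = t" using anti r1(2) r2(2) by blast
 hence "?F r3 (x =. y)" unfolding fo_Equ using e1 feq_sym feq_trans by blast
 thus False using q3(2) r30(2) unfolding fo_Neg by blast
 qed
 thus "?F q3 (~. (?.z:.cQ v. <|z, x|>:.lQ v &. <|z, y|>:.lQ v))" unfolding fo_Neg by blast
 qed
 have ww: "?le ?w ?w" using le_refl top_in by blast
 have "?F ?w (is_countable A)" using cq nA sub ac ww unfolding is_ccc_def forces_All fo_Imp forces_Conj by blast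
 hence c1: "?F ?w (FEx (%w. is_omega w &. card_le A w))" unfolding is_countable_def .
 obtain w where w: "?nm w" "?F ?w (is_omega w &. card_le A w)"
 using max_principle[of "%w. is_omega w &. card_le A w"] c1 nA by auto
 hence c2: "?F ?w (FEx (%f. is_inj f A w))" unfolding card_le_def by simp
 obtain f where f: "?nm f" "?F ?w (is_inj f A w)" using max_principle[of "%f. is_inj f A w"] c2 nA w(1) by auto
 have "EX r n. ?le r (rst s v) & ?F r (<|vapp s v, kP v (vnat n)|>:.f)" if s: "s:S" for s
 proof -
 have sc: "rst s v:cP v" using rs[OF s] .
 have n: "?nm (vapp s v)" using ca(2)[OF s] by simp
 have "?F (rst s v) (vapp s v:.A)" by (rule elts_forced[OF _ le_refl[OF sc]]) (use eA s in blast)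
 moreover have "?F (rst s v) (is_inj f A w)" using fo_mono[OF f(2) le_top[OF sc]] .
 ultimately have "?F (rst s v) (?.y:.w. <|vapp s v, y|>:.f)" using inj_value f(1) nA w(1) n sc by blast
 then obtain r y where r: "?le r (rst s v)" "?nm y" "?F r (y:.w)" "?F r (<|vapp s v, y|>:.f)"
 unfolding fo_ExIn using le_refl[OF sc] by blast
 have "?F r (is_omega w)" using w(2) fo_mono[OF _ le_tr[OF r(1) le_top[OF sc]]] by simp
 then obtain r' n where r': "?le r' r" "eP v y (kP v (vnat n)) r'"
 using omega_elements[OF _ w(1) r(2,3) le_self[OF r(1)]] by blast
 have "?F r' (<|vapp s v, kP v (vnat n)|>:.f)"
 using extD[of "%u. <|vapp s v, u|>:.f", OF _ r(2) nm_check r'(2)] fo_mono[OF r(4) r'(1)] n f(1) by simp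
 thus ?thesis using r' r le_tr by blast
 qed
 \<comment> \<open>\<open>N s\<close> is the index of the last coordinate of \<open>s\<close> under
   the injection \<open>f\<close>, decided by the condition \<open>R s\<close>.\<close>
 then obtain R N where RN: "!!s. s:S ==> ?le (R s) (rst s v)"
 "!!s. s:S ==> ?F (R s) (<|vapp s v, kP v (vnat (N s))|>:.f)" by metis
 have "countable {s:S. N s = n}" for n
 proof (rule ccontr)
 assume "uncountable {s:S. N s = n}"
 moreover have "R s:cP v" if "s:{s:S. N s = n}" for s using RN(1) that le_conds by blast
 ultimately obtain s t where st: "s:{s:S. N s = n}" "t:{s:S. N s = n}" "s ~= t" "compat (R s) (R t)"
 using ccc_family[OF cb, of "{s:S. N s = n}" R] by blast
 then obtain r where r: "?le r (R s)" "?le r (R t)" unfolding compat_def by blast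
 have sS: "s:S" "t:S" "N s = n" "N t = n" using st by auto
 have rc: "r:cP v" using le_conds r by blast
 have rle: "?le r (rst s v)" "?le r (rst t v)" using r RN(1) sS le_tr by blast+
 have n: "?nm (vapp s v)" "?nm (vapp t v)" using ca(2)[OF sS(1)] ca(2)[OF sS(2)] by simp_all
 have "?F r (<|vapp s v, kP v (vnat n)|>:.f)" "?F r (<|vapp t v, kP v (vnat n)|>:.f)"
 using fo_mono[OF RN(2)[OF sS(1)] r(1)] fo_mono[OF RN(2)[OF sS(2)] r(2)] sS(3,4) by simp_all
 hence "eP v (vapp s v) (vapp t v) r" using inj_eq[OF fo_mono[OF f(2) le_top[OF rc]]] f(1) nA w(1) n rc by simp
 moreover have sq: "?F r (vapp s v:.cQ v)" using fo_mono[OF ca(3)[OF sS(1)] rle(1)] by simp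
 moreover have "?F r (<|vapp s v, vapp s v|>:.lQ v)" using Q_props(1)[OF b rc n(1) sq] .
 ultimately have "?F r (<|vapp s v, vapp t v|>:.lQ v)" using extD[of "%u. <|vapp s v, u|>:.lQ v", OF _ n] n nQ by simp
 hence "compatP (vsucc v) s t" using compat_succ[OF b sb[OF sS(1)] sb[OF sS(2)] rle] ca(1)[OF sS(1)] sq
 \<open>?F r (<|vapp s v, vapp s v|>:.lQ v)\<close> by simp
 thus False using anti sS st(3) by blast
 qed
 hence "countable (\<Union>n. {s:S. N s = n})" by blast
 moreover have "(\<Union>n. {s:S. N s = n}) = S" by blast
 ultimately show "countable S" by simp
qed

text \<open>From \<open>v\<close> on at most one of the two conditions is nontrivial at each
  coordinate, so \<open>amalgamation\<close> applies over a common extension of the parts below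
  \<open>v\<close>.\<close>

lemma compat_disjoint:
 assumes a: "w:stages" and b: "v:elts (vsucc w)"
 and s: "s:cP w" and t: "t:cP w"
 and c: "compatP v (rst s v) (rst t v)"
 and d: "supp w s Int supp w t<=elts v"
 shows "compatP w s t"
proof -
 obtain r where "sP v r (rst s v)" "sP v r (rst t v)" using c compatP_def[OF le_in[OF a b]] by blast
 from amalgamation[OF a b s t this] d show ?thesis unfolding compatP_def[OF a] supp_def by blast
qed

text \<open>Every support is bounded below \<open>w\<close>, so \<open>S\<close> is a countable
  union of pieces with supports inside one \<open>v\<close>; on each piece incompatibility is
  already visible at stage \<open>v\<close>.\<close>

lemma ccc_countable_limit:
 assumes a: "w:stages" and lim: "!!v. v:elts w ==> vsucc v:elts w"
 and cnt: "countable (elts w)" and IH: "!!v. v:elts w ==> ccc (P v)"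
 shows "ccc (P w)" unfolding ccc_def
proof (intro allI impI)
 fix S assume S: "S<=cP w" and anti: "!s:S. !t:S. s ~= t --> ~ compatP w s t"
 show "countable S"
 proof (cases "w = vset {}")
 \<comment> \<open>Zero counts as a limit here; all its conditions have empty domain and
   coincide.\<close>
 case True
 have "s = t" if "s:S" "t:S" for s t
 proof (rule vfunction_eqI[of _ w])
 show "vfunction s w" "vfunction t w" using S that P_eq(1)[OF a] fs_condsD(1) by blast+
 qed (simp add: True)
 hence "S<={SOME s. s:S}" by (metis singletonI someI subsetI)
 thus ?thesis using countable_subset by blast
 next
 case False
 have "S<=(UN v:elts w. {s:S. supp w s<=elts v})"
 proof
 fix s assume s: "s:S"
 have "EX v:elts w. supp w s<=elts v"
 using limit_finite_bound[OF ord_le[OF a] finite_supp[OF a] _ lim False] S s unfolding supp_def by blast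
 thus "s:(UN v:elts w. {s:S. supp w s<=elts v})" using s by blast
 qed
 moreover have "countable {s:S. supp w s<=elts v}" if b: "v:elts w" for v
 proof (rule ccontr)
 let ?I = "{s:S. supp w s<=elts v}"
 assume "uncountable ?I"
 moreover have "rst s v:cP v" if "s:?I" for s using rst_conds[OF a _ b] S that by blast
 ultimately obtain s t where st: "s:?I" "t:?I" "s ~= t" "compatP v (rst s v) (rst t v)"
 using forcing.ccc_family[OF forcing_P[OF in_le[OF a b]] IH[OF b], of ?I "%s. rst s v"] by blast
 hence "compatP w s t" using compat_disjoint[OF a, of v s t] b S by auto
 thus False using anti st by blast
 qed
 ultimately show ?thesis using cnt by (meson countable_UN countable_subset)
 qed
qed

text \<open>A counting substitute for the Delta-system lemma. Among supports of one size
  \<open>n\<close>, take the largest \<open>k\<close> such that uncountably many have at least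
  \<open>k\<close> elements below a common \<open>z\<close>. A maximal family \<open>J\<close> of
  such conditions whose supports meet pairwise only below \<open>z\<close> is uncountable: otherwise
  some condition with no support element between \<open>z\<close> and a bound of all supports in
  \<open>J\<close> could be added. Two members of \<open>J\<close> with compatible restrictions to
  \<open>z\<close> are then compatible.\<close>

lemma ccc_aleph1:
 assumes d: "sat (is_aleph1 de)" and IH: "!!v. v:dl ==> ccc (P v)"
 shows "ccc (P de)" unfolding ccc_def
proof (intro allI impI, rule ccontr)
 fix S assume S: "S<=cP de" and anti: "!s:S. !t:S. s ~= t --> ~ compatP de s t"
 and unc: "uncountable S"
 have dd: "de:stages" by simp
 have fin: "finite (supp de s)" if "s:S" for s using finite_supp[OF dd] S that by blast
 define Z where "Z k z = {s:S. k<=card (supp de s Int elts z)}" for k z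
 have "EX n. uncountable {s:S. card (supp de s) = n}"
 proof (rule ccontr)
 assume "\<nexists>n. uncountable {s:S. card (supp de s) = n}"
 hence "countable (\<Union>n. {s:S. card (supp de s) = n})" by blast
 moreover have "(\<Union>n. {s:S. card (supp de s) = n}) = S" by blast
 ultimately show False using unc by simp
 qed
 then obtain n where n: "uncountable {s:S. card (supp de s) = n}" by blast
 let ?S = "{s:S. card (supp de s) = n}"
 define Pk where "Pk k <-> (EX z:dl. uncountable {s:?S. k<=card (supp de s Int elts z)})" for k
 have "Pk 0" unfolding Pk_def using n aleph1_nonempty[OF d] by auto
 have bound: "k<=n" if "Pk k" for k
 proof -
 obtain z where "uncountable {s:?S. k<=card (supp de s Int elts z)}" using \<open>Pk k\<close> unfolding Pk_def by blast
 hence "{s:?S. k<=card (supp de s Int elts z)} ~= {}" by (metis countable_empty)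
 then obtain s where s: "s:S" "card (supp de s) = n" "k<=card (supp de s Int elts z)" by blast
 have "card (supp de s Int elts z)<=card (supp de s)" by (rule card_mono) (use fin s in auto)
 thus ?thesis using s by simp
 qed
 define k where "k = (GREATEST k. Pk k)"
 have "Pk k" unfolding k_def by (rule GreatestI_nat[of Pk 0 n]) (use \<open>Pk 0\<close> bound in auto)
 have "~ Pk (Suc k)"
 proof
 assume "Pk (Suc k)"
 hence "Suc k<=k" unfolding k_def by (rule Greatest_le_nat[of Pk _ n]) (use bound in auto)
 thus False by simp
 qed
 obtain z where g: "z:dl" "uncountable {s:?S. k<=card (supp de s Int elts z)}" using \<open>Pk k\<close> unfolding Pk_def by blast
 let ?I = "{s:?S. k<=card (supp de s Int elts z)}"
 obtain J where J: "J<=?I" "!!s t. s:J ==> t:J ==> s ~= t ==> supp de s Int supp de t<=elts z"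
 "!!s. s:?I ==> s~:J ==> EX a:J. ~ supp de s Int supp de a<=elts z"
 using maximal_pairwise[of "%s t. supp de s Int supp de t<=elts z" ?I] by (auto simp: Int_commute)
 have "uncountable J"
 proof
 assume cJ: "countable J"
 have JS: "J<=S" using J(1) by blast
 have "countable (UN s:J. supp de s)" using cJ fin JS by (intro countable_UN) (auto intro: countable_finite)
 moreover have "(UN s:J. supp de s)<=dl" unfolding supp_def by blast
 ultimately obtain z0 where g0: "z0:dl" "(UN s:J. supp de s)<=elts z0" using aleph1_bounded[OF d] by blast
 have "elts z0<=elts z \<or> elts z<=elts z0" using vord_linear[OF vord_in[OF ord_de g(1)] vord_in[OF ord_de g0(1)]]
 vord_subset[OF vord_in[OF ord_de g(1)], of z0] vord_subset[OF vord_in[OF ord_de g0(1)], of z] by auto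
 then obtain z1 where g1: "z1:dl" "elts z0<=elts z1" "elts z<=elts z1" using g(1) g0(1) by blast
 \<comment> \<open>Maximality of \<open>k\<close>: only countably many conditions have more than
   \<open>k\<close> support elements below \<open>z1\<close>, so some condition outside
   \<open>J\<close> has none between \<open>z\<close> and \<open>z1\<close>.\<close>
 have "countable {s:?S. Suc k<=card (supp de s Int elts z1)}" using \<open>~ Pk (Suc k)\<close> g1(1) unfolding Pk_def by blast
 hence "uncountable (?I - {s:?S. Suc k<=card (supp de s Int elts z1)} - J)"
 using g(2) cJ by (simp add: uncountable_minus_countable)
 hence "?I - {s:?S. Suc k<=card (supp de s Int elts z1)} - J ~= {}" by (metis countable_empty)
 then obtain s where s: "s:?I" "~ Suc k<=card (supp de s Int elts z1)" "s~:J" by blast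
 have "supp de s Int elts z = supp de s Int elts z1"
 proof (rule card_subset_eq)
 show f: "finite (supp de s Int elts z1)" using fin[of s] s(1) by blast
 show sb: "supp de s Int elts z<=supp de s Int elts z1" using g1(3) by blast
 have "k<=card (supp de s Int elts z)" using s(1) by blast
 thus "card (supp de s Int elts z) = card (supp de s Int elts z1)" using card_mono[OF f sb] s(2) by simp
 qed
 hence "!a:J. supp de s Int supp de a<=elts z" using g0(2) g1(2) by blast
 thus False using J(3)[OF s(1,3)] by blast
 qed
 have JS: "J<=cP de" using S J(1) by auto
 have "rst s z:cP z" if "s:J" for s using rst_conds[OF dd subsetD[OF JS that] g(1)] .
 from forcing.ccc_family[OF forcing_P[OF lt_le[OF g(1)]] IH[OF g(1)] \<open>uncountable J\<close>, of "%s. rst s z", OF this]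
 obtain s t where st: "s:J" "t:J" "s ~= t" "compatP z (rst s z) (rst t z)" by blast
 have "compatP de s t"
 using compat_disjoint[OF dd lt_le[OF g(1)] subsetD[OF JS st(1)] subsetD[OF JS st(2)] st(4) J(2)[OF st(1-3)]] .
 thus False using anti st J(1) by blast
qed

section \<open>Dense subsets of size at most \<open>lam\<close>\<close>

definition densesub where "densesub w D <-> D<=cP w & (!p:cP w. EX d:D. sP w d p)"

text \<open>Only the forced cardinality of the iterand is bounded, not the domain of its name, so a
  dense subset is counted in place of the set of all conditions. Its members are indexed by a
  condition \<open>d\<close> of the earlier dense set and the ordinal that an injection into
  \<open>lam\<close> assigns to the last coordinate.\<close>

lemma densesub_succ:
 assumes b: "v:dl" and D: "densesub v D" "D \<lesssim> elts lam" and inf: "infinite (elts lam)"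
 and cq: "fP v (wP v) (card_le (cQ v) (kP v lam))"
 shows "EX D. densesub (vsucc v) D & D \<lesssim> elts lam"
proof -
 have bd: "v:stages" and sd: "vsucc v:stages" using lt_le succ_le b by blast+
 have bb: "v:elts (vsucc (vsucc v))" by simp
 interpret forcing "P v" by (rule forcing_P[OF bd])
 let ?F = "fP v" and ?le = "sP v" and ?nm = "nP v" and ?w = "wP v"
 let ?c = "kP v"
 have nQ: "?nm (cQ v)" "?nm (lQ v)" using names b by blast+
 obtain h where h: "?nm h" "?F ?w (is_inj h (cQ v) (?c lam))"
 using max_principle[of "%f. is_inj f (cQ v) (?c lam)"] cq nQ unfolding card_le_def by auto
 \<comment> \<open>Conditions with the same \<open>d\<close> and \<open>xx\<close> have last
   coordinates that \<open>d\<close> forces to be equal, so choosing one condition for each pair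
   keeps the set dense.\<close>
 define C where "C d xx c <-> c:cP (vsucc v) & rst c v = d & ?F d (<|vapp c v, ?c xx|>:.h)" for d xx c
 let ?D = "(%(d, xx). SOME c. C d xx c) ` {(d, xx). d:D & xx:elts lam & (EX c. C d xx c)}"
 have some: "C d xx (SOME c. C d xx c)" if "C d xx c" for d xx c using someI[of "C d xx", OF that] .
 have "densesub (vsucc v) ?D" unfolding densesub_def
 proof (intro conjI ballI)
 show "?D<=cP (vsucc v)" using some unfolding C_def by auto
 fix p assume p: "p:cP (vsucc v)"
 have pb: "rst p v:cP v" using rst_conds[OF sd p] by simp
 have pa: "vapp p v:vdom (cQ v)" "?nm (vapp p v)" "?F (rst p v) (vapp p v:.cQ v)" using cond_app[OF sd p, of v] by simp_all
 have "?F (rst p v) (?.y:.?c lam. <|vapp p v, y|>:.h)"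
 using inj_value[OF fo_mono[OF h(2) le_top[OF pb]] pa(3) h(1) nQ(1) nm_check pa(2) pb] .
 then obtain r1 y where r1: "?le r1 (rst p v)" "?nm y" "?F r1 (y:.?c lam)" "?F r1 (<|vapp p v, y|>:.h)"
 unfolding fo_ExIn using le_refl[OF pb] by blast
 obtain r2 xx where r2: "?le r2 r1" "xx:elts lam" "eP v y (?c xx) r2"
 using r1(3) le_self[OF r1(1)] unfolding fo_Mem_check by blast
 have hx: "?F r2 (<|vapp p v, ?c xx|>:.h)"
 using extD[of "%u. <|vapp p v, u|>:.h", OF _ r1(2) nm_check r2(3)] fo_mono[OF r1(4) r2(1)] pa(2) h(1) by simp
 have "r2:cP v" using le_conds[OF r2(1)] by blast
 then obtain d where d: "d:D" "?le d r2" using D(1) unfolding densesub_def by blast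
 have dp: "?le d (rst p v)" using d(2) r2(1) r1(1) le_tr by blast
 have dc: "d:cP v" using le_conds[OF dp] by blast
 have hd: "?F d (<|vapp p v, ?c xx|>:.h)" using fo_mono[OF hx d(2)] .
 obtain c0 where c0: "sP (vsucc v) c0 p" "rst c0 v = d"
 "!z:elts (vsucc v). z~:elts v --> vapp c0 z = vapp p z" using merge[OF sd bb p dp] by blast
 have "C d xx c0" unfolding C_def using c0 hd forcing.le_conds[OF forcing_P[OF sd] c0(1)] by simp
 define c where "c = (SOME c. C d xx c)"
 have "C d xx c" unfolding c_def using some[OF \<open>C d xx c0\<close>] .
 hence c: "c:cP (vsucc v)" "rst c v = d" "?F d (<|vapp c v, ?c xx|>:.h)" unfolding C_def by blast+
 have nc: "?nm (vapp c v)" "?F d (vapp c v:.cQ v)" using cond_app[OF sd c(1), of v] c(2) by simp_all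
 have eq: "eP v (vapp c v) (vapp p v) d"
 using inj_eq[OF fo_mono[OF h(2) le_top[OF dc]] c(3) hd h(1) nQ(1) nm_check nc(1) pa(2) nm_check dc] .
 have "?F d (<|vapp c v, vapp c v|>:.lQ v)" using Q_props(1)[OF b dc nc] .
 hence "?F d (<|vapp c v, vapp p v|>:.lQ v)" using extD[of "%u. <|vapp c v, u|>:.lQ v", OF _ nc(1) pa(2) eq] nc(1) nQ(2) by simp
 hence "sP (vsucc v) c p" using le_succI[OF b c(1) p] c(2) dp by simp
 moreover have "c:?D" using d(1) r2(2) \<open>C d xx c0\<close> unfolding c_def by auto
 ultimately show "EX d:?D. sP (vsucc v) d p" by blast
 qed
 moreover have "?D \<lesssim> elts lam"
 proof -
 have "?D \<lesssim> {(d, xx). d:D & xx:elts lam & (EX c. C d xx c)}" by (rule image_lepoll)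
 also have "\<dots> \<lesssim> D \<times> elts lam" by (rule subset_imp_lepoll) blast
 also have "\<dots> \<lesssim> elts lam" using lepoll_times_same[OF inf D(2) lepoll_refl] .
 finally show ?thesis .
 qed
 ultimately show ?thesis by blast
qed

text \<open>A finite support is bounded by some \<open>v\<close> below the limit, so the members of
  the earlier dense sets, prolonged by trivial coordinates, are dense.\<close>

lemma densesub_limit:
 assumes a: "w:stages" and lim: "!!v. v:elts w ==> vsucc v:elts w"
 and IH: "!!v. v:elts w ==> EX D. densesub v D & D \<lesssim> elts lam"
 and inf: "infinite (elts lam)" and dl: "dl \<lesssim> elts lam"
 shows "EX D. densesub w D & D \<lesssim> elts lam"
proof (cases "w = vset {}")
 case True
 have F: "forcing (P w)" using forcing_P[OF a] .
 have "sP w (wP w) p" if "p:cP w" for p by (rule leI[OF a forcing.top_in[OF F] that]) (simp add: True)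
 hence "densesub w {wP w}" using forcing.top_in[OF F] unfolding densesub_def by blast
 moreover have "{wP w} \<lesssim> elts lam"
 using inf by (metis finite.emptyI insert_absorb lepoll_trans singleton_lepoll ex_in_conv)
 ultimately show ?thesis by blast
next
 case nz: False
 have F: "forcing (P w)" using forcing_P[OF a] .
 obtain D where D: "!!v. v:elts w ==> densesub v (D v)" "!!v. v:elts w ==> D v \<lesssim> elts lam" using IH by metis
 then obtain e where e: "!!v. v:elts w ==> inj_on (e v) (D v)" "!!v. v:elts w ==> e v ` D v<=elts lam"
 unfolding lepoll_def by metis
 define C where "C v d c <-> c:cP w & rst c v = d & (!z:elts w. z~:elts v --> vapp c z = tQ z)" for v d c
 let ?g = "%(v, xx). SOME c. C v (inv_into (D v) (e v) xx) c"
 let ?D = "UN v:elts w. (%d. SOME c. C v d c) ` D v"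
 have Cex: "C v d (SOME c. C v d c)" if b: "v:elts w" and d: "d:cP v" for v d
 proof -
 let ?t = "wP w"
 have b': "v:elts (vsucc w)" using b by simp
 have t: "?t:cP w" by (rule forcing.top_in[OF F])
 have "rst ?t v = wP v" unfolding P_eq[OF a] P_eq[OF in_le[OF a b]] fs_weakest_def vlam_def[symmetric]
 by (rule rst_vlam[OF vord_subset[OF ord_le[OF a] b]])
 hence "sP v d (rst ?t v)" using forcing.le_top[OF forcing_P[OF in_le[OF a b]] d] by simp
 from merge[OF a b' t this] obtain c where c: "sP w c ?t" "rst c v = d"
 "!z:elts w. z~:elts v --> vapp c z = vapp ?t z" by blast
 have "C v d c" unfolding C_def using c weakest_app[OF a] forcing.le_conds[OF F c(1)] by simp
 thus ?thesis by (rule someI)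
 qed
 have Dc: "D v<=cP v" if "v:elts w" for v using D(1)[OF that] unfolding densesub_def by blast
 have "densesub w ?D" unfolding densesub_def
 proof (intro conjI ballI)
 show "?D<=cP w"
 proof clarify
 fix v d assume "v:elts w" "d:D v"
 hence "C v d (SOME c. C v d c)" using Cex Dc by blast
 thus "(SOME c. C v d c):cP w" unfolding C_def by blast
 qed
 fix p assume p: "p:cP w"
 show "EX d:?D. sP w d p"
 proof -
 obtain v where b: "v:elts w" "supp w p<=elts v"
 using limit_finite_bound[OF ord_le[OF a] finite_supp[OF a p] _ lim nz] unfolding supp_def by blast
 have b': "v:elts (vsucc w)" using b by simp
 have ob: "vord v" using vord_in[OF ord_le[OF a] b(1)] .
 obtain d where d: "d:D v" "sP v d (rst p v)" using D(1)[OF b(1)] rst_conds[OF a p b(1)] unfolding densesub_def by blast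
 define c where "c = (SOME c. C v d c)"
 have "C v d c" unfolding c_def using Cex[OF b(1)] Dc[OF b(1)] d(1) by blast
 hence c: "c:cP w" "rst c v = d" "!!z. z:elts w ==> z~:elts v ==> vapp c z = tQ z" unfolding C_def by blast+
 have "sP w c p"
 proof (rule leI[OF a c(1) p])
 fix z assume g: "z:elts w"
 show "fP z (rst c z) (<|vapp c z, vapp p z|>:.lQ z)"
 proof (cases "z:elts v")
 case True
 thus ?thesis using le_app[OF in_le[OF a b(1)] d(2) True] res_app[OF a c(1) b' True] res_app[OF a p b' True]
 res_res[OF a c(1) b', of z] c(2) by simp
 next
 case False
 hence "vapp p z = tQ z" using g b(2) unfolding supp_def by blast
 thus ?thesis using Q_props(3)[OF in_lt[OF a g] rst_conds[OF a c(1) g] cond_app(2,3)[OF a c(1) g]] by simp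
 qed
 qed
 moreover have "c:?D" using b(1) d(1) unfolding c_def by blast
 ultimately show ?thesis by blast
 qed
 qed
 moreover have "?D \<lesssim> elts lam"
 proof -
 have "(UN v:elts w. (%d. SOME c. C v d c) ` D v)<=?g ` (elts w \<times> elts lam)"
 proof clarify
 fix v d assume h: "v:elts w" "d:D v"
 have "?g (v, e v d) = (SOME c. C v d c)" using inv_into_f_f[OF e(1)[OF h(1)] h(2)] by simp
 moreover have "(v, e v d):elts w \<times> elts lam" using h e(2) by blast
 ultimately show "(SOME c. C v d c):?g ` (elts w \<times> elts lam)" by (rule image_eqI[OF sym])
 qed
 hence "(UN v:elts w. (%d. SOME c. C v d c) ` D v) \<lesssim> ?g ` (elts w \<times> elts lam)" by (rule subset_imp_lepoll)
 also have "\<dots> \<lesssim> elts w \<times> elts lam" by (rule image_lepoll)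
 also have "\<dots> \<lesssim> elts lam"
 proof (rule lepoll_times_same[OF inf _ lepoll_refl])
 have "elts w<=dl" using in_lt[OF a] by blast
 thus "elts w \<lesssim> elts lam" using dl subset_imp_lepoll lepoll_trans by blast
 qed
 finally show ?thesis .
 qed
 ultimately show ?thesis by blast
qed

end

section \<open>Cohen forcing\<close>

context forcing
begin

lemma ext_is_cohen_condition [simp]: "tm u ==> tm v ==> tm w ==> ext (%x. is_cohen_condition (u x) (v x) (w x))"
 by (simp add: is_cohen_condition_def)

lemma decide_finitely:
 assumes "!!i q. i < n ==> q<~p ==> EX r. r<~q & Ph i r" "!!i q r. Ph i q ==> r<~q ==> Ph i r"
 and "p:CP"
 shows "EX r. r<~p & (!i<n::nat. Ph i r)" using assms(1)
proof (induction n)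
 case 0
 thus ?case using le_refl assms(3) by blast
next
 case (Suc n)
 then obtain r where r: "r<~p" "!i<n. Ph i r" by auto
 then obtain r' where r': "r'<~r" "Ph n r'" using Suc.prems[of n r] by blast
 hence "!i<Suc n. Ph i r'" using assms(2) r less_Suc_eq by metis
 thus ?case using r' r le_tr by blast
qed

end

context gmodel
begin

lemma W_finite_UN: "finite Z ==> (UN z:Z. X z):W ==> EX z:Z. X z:W"
proof (induction Z rule: finite_induct)
 case empty
 thus ?case using W_empty by simp
next
 case (insert z Z)
 show ?case
 proof (cases "X z:W")
 case False
 hence "- X z:W" using W_ultra by blast
 hence "- X z Int (UN z:insert z Z. X z):W" using W_Int insert.prems by blast
 hence "(UN z:Z. X z):W" by (rule W_up) auto
 thus ?thesis using insert.IH by blast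
 qed blast
qed

lemma el_check_finite: "finite (elts s) ==> el (kap (chk s)) = (%z. kap (chk z)) ` elts s"
proof
 assume f: "finite (elts s)"
 show "(%z. kap (chk z)) ` elts s<=el (kap (chk s))" by (auto simp: check_kap_mem)
 show "el (kap (chk s))<=(%z. kap (chk z)) ` elts s"
 proof
 fix x assume x: "x:el (kap (chk s))"
 let ?X = "%z. {q:CP. q||-nu x =. chk z}"
 have "tr (Mem (nu x) (chk s))" using x by simp
 hence "{q:CP. q||-nu x:.chk s}:W" unfolding tr_def .
 moreover have "{q:CP. q||-nu x:.chk s --> q:(UN z:elts s. ?X z)}:W"
 proof (rule W_dense)
 fix q assume "q<~p0"
 then obtain r where r: "r<~q" "r||-nu x:.chk s \<or> r||-(~. nu x:.chk s)" using fo_decide le_conds by blast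
 show "EX r. r<~q & (!r'. r'<~r --> r':{q:CP. q||-nu x:.chk s --> q:(UN z:elts s. ?X z)})"
 proof (cases "r||-nu x:.chk s")
 case True
 then obtain r1 y where r1: "r1<~r" "y:elts s" "feq r1 (nu x) (chk y)" using le_self[OF r(1)] unfolding fo_Mem_check by blast
 have "r':?X y" if "r'<~r1" for r' using that r1(3) feq_mono le_conds by (simp add: fo_Equ)
 thus ?thesis using r1 r(1) le_tr le_conds by blast
 next
 case False
 hence "~ r'||-nu x:.chk s" if "r'<~r" for r' using r(2) that unfolding fo_Neg by blast
 thus ?thesis using r(1) le_conds by blast
 qed
 qed
 ultimately have "{q:CP. q||-nu x:.chk s} \<inter>
 {q:CP. q||-nu x:.chk s --> q:(UN z:elts s. ?X z)}:W" by (rule W_Int)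
 hence "(UN z:elts s. ?X z):W" by (rule W_up) blast
 then obtain z where "z:elts s" "?X z:W" using W_finite_UN[OF f] by blast
 hence "z:elts s" "tr (Equ (nu x) (chk z))" unfolding tr_def by simp_all
 thus "x:(%z. kap (chk z)) ` elts s" by simp
 qed
qed

lemma kap_check_pair: "kap (chk (vpair x y)) = iop (kap (chk x)) (kap (chk y))"
proof -
 have "el (kap (chk (vset {x, y}))) = el (iup (kap (chk x)) (kap (chk y)))" for x y
 by (subst el_check_finite) (simp_all add: elts_doubleton)
 hence up: "kap (chk (vset {x, y})) = iup (kap (chk x)) (kap (chk y))" for x y by (simp only: el_inject)
 have up1: "kap (chk (vset {x})) = iup (kap (chk x)) (kap (chk x))" for x using up[of x x] by simp
 show ?thesis unfolding vpair_def up iop_def up1 ..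
qed

lemma tr_is_finite [simp]: "nm X ==> tr (is_finite X) <-> (EX n:el om. EX f. Fn f (kap X) n & inj_on (ap f) (el (kap X)))"
 by (auto simp: is_finite_def)

lemma tr_cohen_condition: "nm w ==> nm l ==> nm p ==> tr (is_cohen_condition w l p) <-> tr (is_finite p) &
 (!z:el (kap p). EX a:el (kap l). EX n:el (kap w). EX m:el (kap w). z = iop (iop a n) m) &
 (!u m m'. iop u m:el (kap p) & iop u m':el (kap p) --> m = m')" by (simp add: is_cohen_condition_def)

end

text \<open>Cohen conditions are handled as finite maps of HOL with natural numbers as values; this
  is the set that codes such a map in the universe.\<close>

definition cset :: "('a \<times> nat => nat option) => 'a::zfc"
 where "cset F = vset {vpair (vpair xx (vnat m)) (vnat k) |xx m k. F (xx, m) = Some k}"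

definition cfun :: "'a => ('a::zfc \<times> nat => nat option) => bool"
 where "cfun l F <-> finite (dom F) & dom F<=elts l \<times> UNIV"

lemma image_Collect3: "f ` {g a b c |a b c. R a b c} = {f (g a b c) |a b c. R a b c}" by blast

lemma finite_graph: "cfun l F ==> finite {vpair (vpair xx (vnat m)) (vnat k) |xx m k. F (xx, m) = Some k}"
proof -
 assume "cfun l F"
 hence "finite ((%(xx, m). vpair (vpair xx (vnat m)) (vnat (the (F (xx, m))))) ` dom F)" unfolding cfun_def by blast
 thus ?thesis by (rule rev_finite_subset) force
qed

lemma elts_cset: "cfun l F ==> elts (cset F) = {vpair (vpair xx (vnat m)) (vnat k) |xx m k. F (xx, m) = Some k}"
 unfolding cset_def using finite_graph by (intro elts_vset') auto

context forcing
begin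

lemma cset_condition:
 assumes "cfun l F" "p:CP"
 shows "p||-is_cohen_condition cw (chk l) (chk (cset F))"
proof (rule by_model[OF assms(2)])
 fix W assume "gmodel P p W"
 then interpret gmodel P p W .
 have fin: "finite (elts (cset F))" using elts_cset[OF assms(1)] finite_graph[OF assms(1)] by simp
 have e: "el (kap (chk (cset F))) = {iop (iop (kap (chk xx)) (num m)) (num k) |xx m k. F (xx, m) = Some k}"
 unfolding el_check_finite[OF fin] elts_cset[OF assms(1)] image_Collect3 by (simp add: kap_check_pair num_def)
 obtain g n where g: "inj_on g (elts (cset F))" "g ` elts (cset F) = {..<n::nat}"
 using finite_imp_nat_seg_image_inj_on[OF fin] by (metis bij_betw_def bij_betw_inv lessThan_def)
 \<comment> \<open>The graph of an enumeration of the finite set; its canonical name witnesses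
   finiteness inside the structure.\<close>
 define G where "G = vset ((%z. vpair z (vnat (g z))) ` elts (cset F))"
 have eG: "elts G = (%z. vpair z (vnat (g z))) ` elts (cset F)" unfolding G_def using fin by (intro elts_vset') auto
 have "el (kap (chk G)) = (%z. iop (kap (chk z)) (num (g z))) ` elts (cset F)"
 using fin by (subst el_check_finite) (auto simp: eG kap_check_pair num_def image_image)
 also have "\<dots> = (%x. iop x (num (g (THE z. kap (chk z) = x)))) ` el (kap (chk (cset F)))"
 unfolding el_check_finite[OF fin] image_image by (simp add: check_kap_eq)
 finally have G: "el (kap (chk G)) = (%x. iop x (num (g (THE z. kap (chk z) = x)))) ` el (kap (chk (cset F)))" .
 have "Fn (kap (chk G)) (kap (chk (cset F))) (num n)"
 unfolding Fn_def using isfI[OF G] g(2) by (auto simp: el_num el_check_finite[OF fin] check_kap_eq)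
 moreover have "inj_on (ap (kap (chk G))) (el (kap (chk (cset F))))"
 using isfI(2)[OF G] g(1) by (auto simp: el_check_finite[OF fin] check_kap_eq inj_on_def)
 ultimately have "tr (is_finite (chk (cset F)))" using tr_is_finite[OF nm_check] num_in_om[of n] by blast
 moreover have "!z:el (kap (chk (cset F))). EX a:el (kap (chk l)). EX n:el (kap cw). EX m:el (kap cw).
 z = iop (iop a n) m"
 proof
 fix z assume "z:el (kap (chk (cset F)))"
 then obtain xx m k where z: "z = iop (iop (kap (chk xx)) (num m)) (num k)" "F (xx, m) = Some k" using e by auto
 have "xx:elts l" using z(2) assms(1) unfolding cfun_def by blast
 hence "kap (chk xx):el (kap (chk l))" by (simp add: check_kap_mem)
 thus "EX a:el (kap (chk l)). EX n:el (kap cw). EX m:el (kap cw). z = iop (iop a n) m"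
 using z(1) num_in_om unfolding om_def by blast
 qed
 moreover have "!u m m'. iop u m:el (kap (chk (cset F))) & iop u m':el (kap (chk (cset F))) --> m = m'"
 unfolding e by (auto simp: check_kap_eq)
 ultimately show "tr (is_cohen_condition cw (chk l) (chk (cset F)))" by (simp add: tr_cohen_condition)
qed

lemma fo_ExIn_checkD:
 assumes "p||-ExIn (chk X) F" "ext F" "p:CP"
 shows "EX r y. r<~p & y:elts X & r||-F (chk y)"
proof -
 obtain q x where q: "q<~p" "nm x" "q||-x:.chk X" "q||-F x" using assms(1) le_refl[OF assms(3)] unfolding fo_ExIn by blast
 obtain r y where r: "r<~q" "y:elts X" "feq r x (chk y)" using q(3) le_self[OF q(1)] unfolding fo_Mem_check by blast
 have "r||-F (chk y)" by (rule extD[OF assms(2) q(2) nm_check r(3) fo_mono[OF q(4) r(1)]])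
 thus ?thesis using r(2) le_tr[OF r(1) q(1)] by blast
qed

text \<open>An extension decides a number \<open>i\<close> and an injection of the set into
  \<open>i\<close>; for each \<open>j\<close> below \<open>i\<close> one further decides which
  element of \<open>Z\<close>, if any, is sent to \<open>j\<close>. Finitely many decisions fix the
  whole set.\<close>

lemma finite_ground_set:
 assumes fin: "p||-is_finite x" and x: "nm x" and p: "p:CP"
 and Z: "!!q u. q<~p ==> nm u ==> q||-u:.x ==> EX r z. r<~q & z:Z & feq r u (chk z)"
 shows "EX r s. r<~p & finite s & s<=Z & feq r x (chk (vset s))"
proof -
 obtain q1 w where q1: "q1<~p" "nm w" "q1||-is_omega w" "q1||-(?.n:.w. card_le x n)"
 using fin le_refl[OF p] unfolding is_finite_def fo_Ex forces_Conj by blast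
 then obtain q2 n where q2: "q2<~q1" "nm n" "q2||-n:.w" "q2||-card_le x n" unfolding fo_ExIn using le_self[OF q1(1)] by blast
 obtain q3 i where q3: "q3<~q2" "feq q3 n (cn i)"
 using omega_elements[OF fo_mono[OF q1(3) q2(1)] q1(2) q2(2,3) le_self[OF q2(1)]] by blast
 have "q3||-card_le x (cn i)" using extD[of "card_le x", OF _ q2(2) nm_check q3(2) fo_mono[OF q2(4) q3(1)]] x by simp
 then obtain q4 h where q4: "q4<~q3" "nm h" "q4||-is_inj h x (cn i)" unfolding card_le_def fo_Ex using le_self[OF q3(1)] by blast
 have q4p: "q4<~p" using q4 q3 q2 q1 le_tr by blast
 let ?N = "%j. ~. (?.u:.x. <|u, cn j|>:.h)"
 define V where "V j r z <-> z:Z & r||-(chk z:.x &. <|chk z, cn j|>:.h)" for j r z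
 have Ph_mono: "r||-?N j \<or> (EX z. V j r z)" if "q||-?N j \<or> (EX z. V j q z)" "r<~q" for j q r
 using that fo_mono unfolding V_def by blast
 have Ph_dense: "EX r. r<~q & (r||-?N j \<or> (EX z. V j r z))" if q: "q<~q4" for j q
 proof (cases "q||-?N j")
 case True
 thus ?thesis using le_self[OF q] by blast
 next
 case False
 then obtain r1 where r1: "r1<~q" "r1||-(?.u:.x. <|u, cn j|>:.h)" unfolding fo_Neg by blast
 then obtain r2 u where r2: "r2<~r1" "nm u" "r2||-u:.x" "r2||-<|u, cn j|>:.h" unfolding fo_ExIn using le_self by blast
 have l: "r2<~q" "r2<~p" using r2(1) r1(1) q q4p le_tr by blast+
 obtain r z where r: "r<~r2" "z:Z" "feq r u (chk z)" using Z[OF l(2) r2(2,3)] by blast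
 have "r||-(chk z:.x &. <|chk z, cn j|>:.h)" by (rule extD[of "%u. u:.x &. <|u, cn j|>:.h", OF _ r2(2) nm_check r(3)])
 (use x q4(2) fo_mono[OF r2(3) r(1)] fo_mono[OF r2(4) r(1)] in simp_all)
 thus ?thesis unfolding V_def using r(2) le_tr[OF r(1) l(1)] by blast
 qed
 obtain r where r: "r<~q4" "!j<i. r||-?N j \<or> (EX z. V j r z)"
 using decide_finitely[of i q4 "%j r. r||-?N j \<or> (EX z. V j r z)"] Ph_dense Ph_mono le_conds[OF q4(1)] by blast
 have rp: "r<~p" by (rule le_tr[OF r(1) q4p])
 have rc: "r:CP" using rp le_conds by blast
 note h = fo_mono[OF q4(3) r(1)]
 define s where "s = (\<Union>j<i. Collect (V j r))"
 have un: "z = z'" if "V j r z" "V j r z'" for j z z'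
 using that inj_eq[OF h, of "chk z" "cn j" "chk z'"] x q4(2) rc check_eq[OF rc] unfolding V_def by simp
 have "finite (Collect (V j r))" for j
 by (rule finite_subset[of _ "{THE z. V j r z}"]) (use un in "auto intro!: the_equality[symmetric]")
 hence fs: "finite s" unfolding s_def by blast
 have "r||-x =. chk (vset s)"
 proof (rule by_model[OF rc])
 fix W assume "gmodel P r W"
 then interpret gmodel P r W .
 have e: "el (kap (chk (vset s))) = (%z. kap (chk z)) ` s" using fs by (subst el_check_finite) (auto simp: elts_vset')
 have inj: "Fn (kap h) (kap x) (num i)" "inj_on (ap (kap h)) (el (kap x))" using tr_fo[OF h] q4(2) x by (simp_all add: num_def)
 have V: "kap (chk z):el (kap x)" "ap (kap h) (kap (chk z)) = num j" if "V j r z" for j z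
 using tr_fo[OF conjunct2[OF that[unfolded V_def]]] x q4(2) inj(1) by (auto simp: Fn_def isf_iff num_def)
 have "z:(%z. kap (chk z)) ` s" if z: "z:el (kap x)" for z
 proof -
 obtain j where j: "j < i" "ap (kap h) z = num j" using Fn_ap[OF inj(1) z] el_num by auto
 have "~ r||-?N j"
 proof
 assume "r||-?N j"
 from tr_fo[OF this] show False using z j x q4(2) inj(1) by (auto simp: Fn_def isf_iff num_def)
 qed
 then obtain y where "V j r y" using r(2) j(1) by blast
 thus ?thesis using V[of j y] inj_onD[OF inj(2), of z "kap (chk y)"] z j unfolding s_def by auto
 qed
 hence "el (kap x) = el (kap (chk (vset s)))" unfolding e using V unfolding s_def by blast
 thus "tr (x =. chk (vset s))" using x by simp
 qed
 moreover have "s<=Z" unfolding s_def V_def by blast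
 ultimately show ?thesis using rp fs unfolding fo_Equ by blast
qed

text \<open>The elements of a Cohen condition are densely canonical names of ground triples, and
  there are finitely many of them; so the extension has no new Cohen conditions.\<close>

lemma condition_cset:
 assumes h: "p||-is_cohen_condition (cw) (chk l) x" and x: "nm x" and p: "p:CP"
 shows "EX r F. r<~p & cfun l F & feq r x (chk (cset F))"
proof -
 let ?t = "%xx m k. vpair (vpair xx (vnat m)) (vnat k)"
 have c: "p||-is_finite x" "p||-(!.z:.x. ?.a:.chk l. ?.n:.cw. ?.m:.cw. ?.u. is_pair u a n &. is_pair z u m)"
 using h unfolding is_cohen_condition_def by simp_all
 have "EX r s. r<~p & finite s & s<={?t xx m k |xx m k. xx:elts l} & feq r x (chk (vset s))"
 proof (rule finite_ground_set[OF c(1) x p])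
 fix q u assume q: "q<~p" "nm u" "q||-u:.x"
 hence "q||-(?.a:.chk l. ?.n:.cw. ?.m:.cw. ?.v. is_pair v a n &. is_pair u v m)" using c(2) unfolding fo_AllIn by blast
 from fo_ExIn_checkD[OF this] obtain r1 xx where r1: "r1<~q" "xx:elts l"
 "r1||-(?.n:.cw. ?.m:.cw. ?.v. is_pair v (chk xx) n &. is_pair u v m)" using q(2) le_conds[OF q(1)] by auto
 from fo_ExIn_checkD[OF this(3)] obtain r2 m where r2: "r2<~r1"
 "r2||-(?.k:.cw. ?.v. is_pair v (chk xx) (cn m) &. is_pair u v k)" using q(2) le_conds[OF r1(1)] by (auto simp: elts_vomega)
 from fo_ExIn_checkD[OF this(2)] obtain r3 k where r3: "r3<~r2"
 "r3||-(?.v. is_pair v (chk xx) (cn m) &. is_pair u v (cn k))" using q(2) le_conds[OF r2(1)] by (auto simp: elts_vomega)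
 have "r3:CP" using le_conds[OF r3(1)] by simp
 hence "r3||-u =. chk (?t xx m k)"
 proof (rule by_model)
 fix W assume "gmodel P r3 W"
 then interpret gmodel P r3 W .
 show "tr (u =. chk (?t xx m k))" using tr_fo[OF r3(2)] q(2) by (simp add: kap_check_pair)
 qed
 thus "EX r z. r<~q & z:{?t xx m k |xx m k. xx:elts l} & feq r u (chk z)"
 unfolding fo_Equ using le_tr[OF r3(1) le_tr[OF r2(1) r1(1)]] r1(2) by blast
 qed
 then obtain r s where r: "r<~p" "finite s" "s<={?t xx m k |xx m k. xx:elts l}" "feq r x (chk (vset s))" by blast
 have rc: "r:CP" using le_conds[OF r(1)] by simp
 have es: "elts (vset s) = s" using r(2) by (intro elts_vset') auto
 \<comment> \<open>That \<open>s\<close> is single-valued is a statement about the ground universe,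
   so one two-valued structure over \<open>r\<close> suffices to see it. Such a structure exists
   because \<open>r\<close> does not force \<open>chk l\<close> to differ from itself.\<close>
 obtain W where "gmodel P r W" using gmodel_exists[OF rc, of "Neg (chk l =. chk l)"] le_refl[OF rc] unfolding fo_Neg fo_Equ by auto
 then interpret M: gmodel P r W .
 have "M.tr (x =. chk (vset s))" by (rule M.tr_fo) (simp add: fo_Equ r(4))
 hence "M.kap x = M.kap (chk (vset s))" using x by simp
 hence in_s: "M.kap (chk z):M.el (M.kap x)" if "z:s" for z using that by (simp add: M.check_kap_mem es)
 have single: "k = k'" if k: "?t xx m k:s" "?t xx m k':s" for xx m k k'
 proof -
 have "M.tr (is_cohen_condition (cw) (chk l) x)" by (rule M.tr_fo[OF fo_mono[OF h r(1)]])
 hence "M.kap (cn k) = M.kap (cn k')"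
 using in_s[OF k(1)] in_s[OF k(2)] x unfolding M.kap_check_pair by (simp add: M.tr_cohen_condition)
 thus ?thesis by (simp add: M.check_kap_eq)
 qed
 define F where "F = (%(xx, m). if EX k. ?t xx m k:s then Some (THE k. ?t xx m k:s) else None)"
 have F: "F (xx, m) = Some k <-> ?t xx m k:s" for xx m k
 proof (cases "EX k. ?t xx m k:s")
 case True
 then obtain k' where k': "?t xx m k':s" ..
 have "(THE k. ?t xx m k:s) = k'" by (rule the_equality, rule k', rule single[OF _ k'])
 thus ?thesis unfolding F_def using True single k' by auto
 qed (simp add: F_def)
 have dF: "EX k. ?t (fst y) (snd y) k:s & F y = Some k" if "y:dom F" for y using that F[of "fst y" "snd y"] by auto
 have "finite (dom F)"
 proof (rule inj_on_finite[OF _ _ r(2)])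
 show "inj_on (%y. ?t (fst y) (snd y) (the (F y))) (dom F)" by (rule inj_onI) (simp add: prod_eq_iff)
 show "(%y. ?t (fst y) (snd y) (the (F y))) ` dom F<=s" using dF by fastforce
 qed
 moreover have "dom F<=elts l \<times> UNIV" using dF r(3) by fastforce
 moreover have "{?t xx m k |xx m k. ?t xx m k:s} = s" using r(3) by blast
 hence "cset F = vset s" unfolding cset_def F by simp
 ultimately show ?thesis unfolding cfun_def using r(1,4) by (intro exI[of _ r] exI[of _ F]) simp
qed

text \<open>Reduces the Cohen forcing of the extension to finite maps of the ground universe; these
  facts are the interface through which the Cohen iterands are used.\<close>

lemma cohen_props:
 assumes h: "!!p. p:CP ==> p||-is_cohen_forcing (chk l) Q lq t" and n: "nm Q" "nm lq" "nm t"
 shows "p:CP ==> nm x ==> p||-x:.Q ==> EX r F. r<~p & cfun l F & feq r x (chk (cset F))"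
 and "p:CP ==> cfun l F ==> p||-chk (cset F):.Q"
 and "p:CP ==> cfun l F ==> cfun l F' ==> F \<subseteq>\<^sub>m F' ==> p||-<|chk (cset F'), chk (cset F)|>:.lq"
 and "p:CP ==> nm x ==> nm y ==> p||-<|x, y|>:.lq ==> p||-is_subset y x"
proof -
 have trQ: "(!z. z:gmodel.el P W (gmodel.kap P W Q) <-> gmodel.tr P W (is_cohen_condition cw (chk l) (gmodel.nu P W z))) &
 (!z. z:gmodel.el P W (gmodel.kap P W lq) <-> (EX p:gmodel.el P W (gmodel.kap P W Q). EX q:gmodel.el P W (gmodel.kap P W Q).
 z = gmodel.iop P W p q & gmodel.el P W q<=gmodel.el P W p))" if "gmodel P p W" for p W
 proof -
 interpret gmodel P p W by (rule that)
 have "tr (is_cohen_forcing (chk l) Q lq t)" using tr_fo h p0 by blast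
 thus ?thesis unfolding is_cohen_forcing_def using n by (auto simp: tr_cohen_condition om_def)
 qed
 show "EX r F. r<~p & cfun l F & feq r x (chk (cset F))" if p: "p:CP" and x: "nm x" and m: "p||-x:.Q"
 proof (rule condition_cset[OF _ x p])
 show "p||-is_cohen_condition cw (chk l) x"
 proof (rule by_model[OF p])
 fix W assume g: "gmodel P p W"
 then interpret gmodel P p W .
 show "tr (is_cohen_condition cw (chk l) x)" using trQ[OF g] tr_fo[OF m] n x by (simp add: tr_cohen_condition)
 qed
 qed
 show inQ: "p||-chk (cset F):.Q" if p: "p:CP" and F: "cfun l F" for F
 proof (rule by_model[OF p])
 fix W assume g: "gmodel P p W"
 then interpret gmodel P p W .
 show "tr (chk (cset F):.Q)" using trQ[OF g] tr_fo[OF cset_condition[OF F p]] n by (simp add: tr_cohen_condition)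
 qed
 show "p||-<|chk (cset F'), chk (cset F)|>:.lq"
 if p: "p:CP" and F: "cfun l F" and F': "cfun l F'" and sub: "F \<subseteq>\<^sub>m F'"
 proof (rule by_model[OF p])
 fix W assume g: "gmodel P p W"
 then interpret gmodel P p W .
 have fin: "finite (elts (cset F))" "finite (elts (cset F'))"
 using elts_cset[OF F] elts_cset[OF F'] finite_graph[OF F] finite_graph[OF F'] by simp_all
 have "elts (cset F)<=elts (cset F')" unfolding elts_cset[OF F] elts_cset[OF F'] using sub by (auto simp: map_le_def dom_def)
 hence "el (kap (chk (cset F)))<=el (kap (chk (cset F')))" unfolding el_check_finite[OF fin(1)] el_check_finite[OF fin(2)] by blast
 thus "tr (<|chk (cset F'), chk (cset F)|>:.lq)" using trQ[OF g] tr_fo[OF inQ[OF p F]] tr_fo[OF inQ[OF p F']] n by simp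
 qed
 show "p||-is_subset y x" if p: "p:CP" and xy: "nm x" "nm y" "p||-<|x, y|>:.lq"
 proof (rule by_model[OF p])
 fix W assume g: "gmodel P p W"
 then interpret gmodel P p W .
 show "tr (is_subset y x)" using trQ[OF g] tr_fo[OF xy(3)] xy n by auto
 qed
qed

end

section \<open>The iteration seen from its last stage\<close>

text \<open>The properties of the last stage of the iteration on which the combinatorial argument rests:
  \<open>res w p\<close> is the part of \<open>p\<close> below stage \<open>w\<close>, and \<open>coh w xx m k\<close> is the set of conditions deciding
  that the \<open>xx\<close>-th Cohen real added at stage \<open>w\<close> has the value \<open>k\<close> at \<open>m\<close>.\<close>

definition limit where "limit w <-> (!v:elts w. vsucc v:elts w)"

locale staged = forcing P for P :: "'a::zfc forcing" +
 fixes de lam :: 'a and res :: "'a => 'a => 'a" and sup :: "'a => 'a set"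
 and coh :: "'a => 'a => nat => nat => 'a set" and D :: "'a set"
 assumes aleph1: "sat (is_aleph1 de)"
 and ccc_P: "ccc P"
 and D_sub: "D<=CP" and D_dense: "p:CP ==> EX d:D. d<~p" and D_small: "D \<lesssim> elts lam"
 and lam_seq: "{f :: nat => 'a. range f<=elts lam} \<lesssim> elts lam"
 and delta_lam: "elts de \<lesssim> elts lam"
 and sup_finite: "p:CP ==> finite (sup p)" and sup_sub: "sup p<=elts de"
 and res_weaker: "w:elts de ==> p:CP ==> p<~res w p"
 and res_mono: "w:elts de ==> p<~q ==> res w p<~res w q"
 and res_supp: "w:elts de ==> p<~q ==> sup q<=elts w ==> res w p<~q"
 and res_merge: "w:elts de ==> p:CP ==> q<~res w p ==> EX m. m<~p & m<~res w q"
 and res_res: "w:elts de ==> v:elts w ==> p:CP ==> res v (res w p) = res v p"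
 and res_idem: "w:elts de ==> p:CP ==> res w (res w p) = res w p"
 and coh_sub: "coh w xx m k<=CP"
 and coh_open: "w:elts de ==> limit w ==> p:coh w xx m k ==> q<~p ==> q:coh w xx m k"
 and coh_res: "w:elts de ==> p:coh w xx m k ==> res (vsucc w) p:coh w xx m k"
 and coh_single: "w:elts de ==> limit w ==> p:coh w xx m k ==> p:coh w xx m k' ==> k = k'"
 and coh_dense: "w:elts de ==> limit w ==> xx:elts lam ==> p:CP ==> EX q k. q<~p & q:coh w xx m k"
 and coh_step: "w:elts de ==> limit w ==> p:CP ==> EX p1 N. p1<~p &
 (!r m X k. r<~res w p1 --> N<=m --> finite X --> X<=elts lam -->
 (EX p2. p2<~p1 & p2<~res w r & (!xx:X. p2:coh w xx m (k xx))))"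

locale cohen_iteration = fsi de P Q for de :: "'a::zfc" and P Q +
 fixes lam :: 'a
 assumes aleph1: "sat (is_aleph1 de)" and lam_reg: "sat (is_regular_cardinal lam)"
 and delta_lam: "de:elts lam" and lam_pow: "sat (power_below_eq lam)"
 and Q_ccc: "w:elts de ==> P w \<tturnstile> (is_ccc (nm_conds (Q w)) (nm_le (Q w)) &.
 card_le (nm_conds (Q w)) (kP w lam))"
 and Q_cohen: "w:elts de ==> even_ordinal w ==>
 P w \<tturnstile> is_cohen_forcing (kP w lam) (nm_conds (Q w)) (nm_le (Q w)) (nm_top (Q w))"
begin

lemma top_ccc: "v:dl ==> fP v (wP v) (is_ccc (cQ v) (lQ v))"
 and top_card: "v:dl ==> fP v (wP v) (card_le (cQ v) (kP v lam))"
 using Q_ccc[of v] forcing.top_in[OF forcing_P[OF lt_le]] unfolding forced_def by auto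

lemma elts_delta_lam: "dl<=elts lam"
proof -
 have "vord lam" using lam_reg by (auto simp: is_regular_cardinal_def is_cardinal_def sat_is_ordinal)
 thus ?thesis using vord_subset delta_lam by blast
qed

lemma lam_infinite: "infinite (elts lam)"
 using elts_delta_lam aleph1 by (auto simp: sat_is_aleph1 dest: finite_subset countable_finite)

lemma ccc_all: "w:stages ==> ccc (P w)"
proof (induction w rule: mem_induct)
 case (step w)
 have IH: "ccc (P v)" if "v:elts w" for v using step.IH[OF that] in_le[OF step.prems that] .
 from ord_le[OF step.prems] show ?case
 proof (cases rule: vord_cases)
 case (succ v)
 hence "v:dl" using in_lt[OF step.prems] by simp
 thus ?thesis using ccc_succ[OF _ IH top_ccc] succ by simp
 next
 case lim
 show ?thesis
 \<comment> \<open>Limits below \<omega>1 are countable; the counting argument is reserved for the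
   last stage.\<close>
 proof (cases "w = de")
 case True
 thus ?thesis using ccc_aleph1[OF aleph1] IH by simp
 next
 case False
 hence "countable (elts w)" using aleph1 step.prems by (simp add: sat_is_aleph1)
 thus ?thesis using ccc_countable_limit[OF step.prems lim _ IH] by blast
 qed
 qed
qed

lemma densesub_all: "w:stages ==> EX D. densesub w D & D \<lesssim> elts lam"
proof (induction w rule: mem_induct)
 case (step w)
 have IH: "EX D. densesub v D & D \<lesssim> elts lam" if "v:elts w" for v using step.IH[OF that] in_le[OF step.prems that] .
 from ord_le[OF step.prems] show ?case
 proof (cases rule: vord_cases)
 case (succ v)
 hence "v:dl" using in_lt[OF step.prems] by simp
 moreover obtain D where "densesub v D" "D \<lesssim> elts lam" using IH succ by auto
 ultimately show ?thesis using densesub_succ[OF _ _ _ lam_infinite top_card] succ by simp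
 next
 case lim
 show ?thesis using densesub_limit[OF step.prems lim IH lam_infinite subset_imp_lepoll[OF elts_delta_lam]] by blast
 qed
qed

section \<open>Restrictions and Cohen coordinates, seen from the last stage\<close>

lemma dd: "de:stages" by simp

sublocale X: forcing "P de" by (rule forcing_P[OF dd])

text \<open>The part of \<open>p\<close> below \<open>w\<close> is padded with trivial coordinates
  so that it is again a condition of the last stage; a single forcing notion then serves for all
  stages.\<close>

definition rs where "rs w p = vlam de (%z. if z:elts w then vapp p z else tQ z)"

lemma rs_props:
 assumes a: "w:dl" and p: "p:cP de"
 shows "rs w p:cP de" "rst (rs w p) w = rst p w"
 "!!z. z:dl ==> z~:elts w ==> vapp (rs w p) z = tQ z"
proof -
 let ?t = "wP de"
 have t: "?t:cP de" by (rule X.top_in)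
 have a': "w:stages" using a by simp
 have "sP w (rst p w) (rst ?t w)" using res_le[OF dd X.le_top[OF p] a'] .
 from merge[OF dd a' t this] obtain c where c: "sP de c ?t" "rst c w = rst p w"
 "!z:dl. z~:elts w --> vapp c z = vapp ?t z" by blast
 have cc: "c:cP de" using X.le_conds[OF c(1)] by blast
 have fc: "vfunction c de" using cc P_eq(1)[OF dd] fs_condsD(1) by blast
 have "rs w p = vlam de (vapp c)" unfolding rs_def
 proof (rule vlam_cong)
 fix z assume g: "z:dl"
 show "(if z:elts w then vapp p z else tQ z) = vapp c z"
 using res_app[OF dd cc a', of z] res_app[OF dd p a', of z] c weakest_app[OF dd g] g by auto
 qed
 hence "rs w p = c" using vfunction_eq_vlam[OF fc] by simp
 thus "rs w p:cP de" "rst (rs w p) w = rst p w"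
 "!!z. z:dl ==> z~:elts w ==> vapp (rs w p) z = tQ z" using cc c weakest_app[OF dd] by simp_all
qed

lemma le_split:
 assumes a: "w:dl" and p: "p:cP de" and q: "q:cP de"
 and r: "sP w (rst p w) (rst q w)"
 and t: "!!z. z:dl ==> z~:elts w ==> vapp q z = tQ z"
 shows "sP de p q"
proof (rule leI[OF dd p q])
 have a': "w:stages" using a by simp
 fix z assume g: "z:dl"
 show "fP z (rst p z) (<|vapp p z, vapp q z|>:.lQ z)"
 proof (cases "z:elts w")
 case True
 thus ?thesis using le_app[OF a' r True] res_app[OF dd p a' True] res_app[OF dd q a' True] res_res[OF dd p a', of z] by simp
 next
 case False
 thus ?thesis using Q_props(3)[OF g rst_conds[OF dd p g] cond_app(2,3)[OF dd p g]] t[OF g] by simp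
 qed
qed

definition coh where "coh w xx m k = {q:cP de.
 fP w (rst q w) (kP w (vpair (vpair xx (vnat m)) (vnat k)):.vapp q w)}"

text \<open>Cohen forcing is assumed at even stages; limit stages, zero included, are among
  them.\<close>

lemma limit_even: "w:dl ==> limit w ==> even_ordinal w"
proof (rule even_ordinal.intros(1))
 assume a: "w:dl" "limit w"
 show "sat (is_ordinal w)" using vord_in[OF ord_de a(1)] by (simp add: sat_is_ordinal)
 show "\<nexists>v. w = vsucc v"
 proof
 assume "EX v. w = vsucc v"
 then obtain v where b: "w = vsucc v" by blast
 hence "v:elts w" by simp
 hence "vsucc v:elts w" using a(2) unfolding limit_def by blast
 thus False using b mem_irrefl by metis
 qed
qed

lemma cohen_at:
 assumes a: "w:dl" "limit w"
 shows "p:cP w ==> nP w x ==> fP w p (x:.cQ w) ==>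
 EX r F. sP w r p & cfun lam F & eP w x (kP w (cset F)) r"
 and "p:cP w ==> cfun lam F ==> fP w p (kP w (cset F):.cQ w)"
 and "p:cP w ==> cfun lam F ==> cfun lam F' ==> F \<subseteq>\<^sub>m F' ==>
 fP w p (<|kP w (cset F'), kP w (cset F)|>:.lQ w)"
 and "p:cP w ==> nP w x ==> nP w y ==> fP w p (<|x, y|>:.lQ w) ==>
 fP w p (is_subset y x)"
proof -
 interpret F: forcing "P w" by (rule forcing_P[OF lt_le[OF a(1)]])
 have h: "fP w p (is_cohen_forcing (kP w lam) (cQ w) (lQ w) (tQ w))" if "p:cP w" for p
 using Q_cohen[OF a(1) limit_even[OF a]] that unfolding forced_def by blast
 note c = F.cohen_props[OF h names(1,2)[OF a(1)] nm_dom[OF a(1) names(3)[OF a(1)]]]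
 show "p:cP w ==> nP w x ==> fP w p (x:.cQ w) ==>
 EX r F. sP w r p & cfun lam F & eP w x (kP w (cset F)) r" by (rule c(1))
 show "p:cP w ==> cfun lam F ==> fP w p (kP w (cset F):.cQ w)" by (rule c(2))
 show "p:cP w ==> cfun lam F ==> cfun lam F' ==> F \<subseteq>\<^sub>m F' ==>
 fP w p (<|kP w (cset F'), kP w (cset F)|>:.lQ w)" by (rule c(3))
 show "p:cP w ==> nP w x ==> nP w y ==> fP w p (<|x, y|>:.lQ w) ==>
 fP w p (is_subset y x)" by (rule c(4))
qed

text \<open>The coordinate at \<open>w\<close> is in general only a name for a finite map; here its
  value is decided to be the ground map \<open>F\<close>.\<close>

definition dec where "dec w F p <-> p:cP de & eP w (vapp p w) (kP w (cset F)) (rst p w)"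

lemma dec_exists:
 assumes a: "w:dl" "limit w" and p: "p:cP de"
 shows "EX p1 F. sP de p1 p & cfun lam F & dec w F p1"
proof -
 have a': "w:stages" using a by simp
 obtain r F where r: "sP w r (rst p w)" "cfun lam F"
 "eP w (vapp p w) (kP w (cset F)) r" using cohen_at(1)[OF a rst_conds[OF dd p a(1)] cond_app(2,3)[OF dd p a(1)]] by blast
 from merge[OF dd a' p r(1)] obtain c where c: "sP de c p" "rst c w = r"
 "!z:dl. z~:elts w --> vapp c z = vapp p z" by blast
 hence "dec w F c" unfolding dec_def using r(3) a(1) X.le_conds[OF c(1)] by simp
 thus ?thesis using c(1) r(2) by blast
qed

text \<open>The canonical name of the larger map need not lie in the domain of the iterand's name,
  so an equal name from the domain is put at coordinate \<open>w\<close>. Only the part of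
  \<open>r\<close> below \<open>w\<close> enters the new condition.\<close>

lemma dec_extend:
 assumes a: "w:dl" "limit w" and d: "dec w F p1" and F: "cfun lam F" "cfun lam F'" "F \<subseteq>\<^sub>m F'"
 and r: "sP de r (rs w p1)"
 shows "EX p2. sP de p2 p1 & sP de p2 (rs w r) & dec w F' p2"
proof -
 have a': "w:stages" using a by simp
 interpret S: forcing "P w" by (rule forcing_P[OF a'])
 have p1: "p1:cP de" using d unfolding dec_def by blast
 have rc: "r:cP de" using X.le_conds[OF r] by blast
 have ra: "sP w (rst r w) (rst p1 w)" using res_le[OF dd r a'] rs_props(2)[OF a(1) p1] by simp
 have rca: "rst r w:cP w" using rst_conds[OF dd rc a(1)] .
 obtain r' x where r': "sP w r' (rst r w)" "x:vdom (cQ w)" "fP w r' (x:.cQ w)"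
 "eP w (kP w (cset F')) x r'" using dom_dense[OF a(1) cohen_at(2)[OF a rca F(2)] rca] by blast
 have r'p: "sP w r' (rst p1 w)" using S.le_tr[OF r'(1) ra] .
 have r'c: "r':cP w" using S.le_conds[OF r'p] by blast
 have eq: "eP w (kP w (cset F)) (vapp p1 w) r'" using d S.feq_mono[OF S.feq_sym r'p] unfolding dec_def by blast
 have nx: "nP w x" "nP w (vapp p1 w)" "nP w (lQ w)"
 using nm_dom[OF a(1) r'(2)] cond_app(2)[OF dd p1 a(1)] names(2)[OF a(1)] by blast+
 have "fP w r' (<|kP w (cset F'), kP w (cset F)|>:.lQ w)" using cohen_at(3)[OF a r'c F] .
 hence "fP w r' (<|x, kP w (cset F)|>:.lQ w)"
 using S.extD[of "%u. <|u, kP w (cset F)|>:.lQ w", OF _ S.nm_check nx(1) r'(4)] nx(3) by simp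
 hence "fP w r' (<|x, vapp p1 w|>:.lQ w)" using S.extD[of "%u. <|x, u|>:.lQ w", OF _ S.nm_check nx(2) eq] nx by simp
 from extend_at[OF dd a(1) p1 r'p r'(2,3) this] obtain p2 where p2: "sP de p2 p1"
 "rst p2 w = r'" "vapp p2 w = x" by blast
 have p2c: "p2:cP de" using X.le_conds[OF p2(1)] by blast
 have "sP de p2 (rs w r)" by (rule le_split[OF a(1) p2c rs_props(1)[OF a(1) rc]]) (use p2 r'(1) rs_props[OF a(1) rc] in auto)
 moreover have "dec w F' p2" unfolding dec_def using p2 p2c S.feq_sym[OF r'(4)] by simp
 ultimately show ?thesis using p2(1) by blast
qed

lemma dec_coh:
 assumes a: "w:dl" and d: "dec w F p" and F: "cfun lam F"
 shows "F (xx, m) = Some k ==> p:coh w xx m k"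
proof -
 assume k: "F (xx, m) = Some k"
 interpret S: forcing "P w" by (rule forcing_P[OF lt_le[OF a]])
 have "vpair (vpair xx (vnat m)) (vnat k):elts (cset F)" unfolding elts_cset[OF F] using k by blast
 hence "fP w (rst p w) (kP w (vpair (vpair xx (vnat m)) (vnat k)):.vapp p w)"
 using S.Mem_eq2[OF S.check_mem S.feq_sym] d unfolding dec_def by blast
 thus ?thesis using d unfolding coh_def dec_def by blast
qed

lemma dec_coh_iff:
 assumes a: "w:dl" and d: "dec w F p" and F: "cfun lam F" and c: "p:coh w xx m k"
 shows "F (xx, m) = Some k"
proof -
 interpret S: forcing "P w" by (rule forcing_P[OF lt_le[OF a]])
 have pc: "rst p w:cP w" using rst_conds[OF dd _ a] d unfolding dec_def by blast
 have "fP w (rst p w) (kP w (vpair (vpair xx (vnat m)) (vnat k)):.kP w (cset F))"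
 using S.Mem_eq2 d c unfolding dec_def coh_def by blast
 hence "vpair (vpair xx (vnat m)) (vnat k):elts (cset F)" using S.check_mem_iff[OF pc] by blast
 thus ?thesis unfolding elts_cset[OF F] by auto
qed

lemma coh_open:
 assumes a: "w:dl" "limit w" and p: "p:coh w xx m k" and q: "sP de q p"
 shows "q:coh w xx m k"
proof -
 interpret S: forcing "P w" by (rule forcing_P[OF lt_le[OF a(1)]])
 have a': "w:stages" using a by simp
 have qc: "q:cP de" and pc: "p:cP de" using X.le_conds[OF q] by blast+
 have qa: "rst q w:cP w" using rst_conds[OF dd qc a(1)] .
 let ?t = "kP w (vpair (vpair xx (vnat m)) (vnat k))"
 have m: "fP w (rst q w) (?t:.vapp p w)" using S.fo_mono[OF _ res_le[OF dd q a']] p unfolding coh_def by blast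
 have "fP w (rst q w) (is_subset (vapp p w) (vapp q w))"
 using cohen_at(4)[OF a qa cond_app(2)[OF dd qc a(1)] cond_app(2)[OF dd pc a(1)] le_app[OF dd q a(1)]] .
 hence "fP w (rst q w) (?t:.vapp q w)" using m S.le_refl[OF qa] S.nm_check unfolding is_subset_def S.fo_AllIn by blast
 thus ?thesis using qc unfolding coh_def by blast
qed

lemma coh_single:
 assumes a: "w:dl" "limit w" and p: "p:coh w xx m k" "p:coh w xx m k'"
 shows "k = k'"
proof -
 have "p:cP de" using p unfolding coh_def by blast
 then obtain p1 F where p1: "sP de p1 p" "cfun lam F" "dec w F p1" using dec_exists[OF a] by blast
 thus ?thesis using dec_coh_iff[OF a(1) p1(3,2) coh_open[OF a p(1) p1(1)]] dec_coh_iff[OF a(1) p1(3,2) coh_open[OF a p(2) p1(1)]]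
 by simp
qed

text \<open>Let an extension decide the finite map at \<open>w\<close> to be \<open>F\<close>, and
  let \<open>N\<close> exceed every index in its domain. At an index \<open>m\<close> from
  \<open>N\<close> on, \<open>F\<close> can be enlarged by arbitrary values at finitely many reals,
  whatever happens below stage \<open>w\<close>.\<close>

lemma coh_step:
 assumes a: "w:dl" "limit w" and p: "p:cP de"
 shows "EX p1 N. sP de p1 p &
 (!r m X k. sP de r (rs w p1) --> N<=m --> finite X --> X<=elts lam -->
 (EX p2. sP de p2 p1 & sP de p2 (rs w r) & (!xx:X. p2:coh w xx m (k xx))))"
proof -
 obtain p1 F where p1: "sP de p1 p" "cfun lam F" "dec w F p1" using dec_exists[OF a p] by blast
 have "finite (snd ` dom F)" using p1(2) unfolding cfun_def by blast
 then obtain N where N: "!m:snd ` dom F. m < N" using finite_nat_set_iff_bounded by blast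
 have "EX p2. sP de p2 p1 & sP de p2 (rs w r) & (!xx:X. p2:coh w xx m (k xx))"
 if h: "sP de r (rs w p1)" "N<=m" "finite X" "X<=elts lam" for r m X and k :: "'a => nat"
 proof -
 define G where "G = (%(xx, m'). if m' = m & xx:X then Some (k xx) else None)"
 have dG: "dom G = X \<times> {m}" unfolding G_def dom_def by (auto split: if_splits)
 have "F \<subseteq>\<^sub>m F ++ G" unfolding map_le_def
 proof
 fix z assume z: "z:dom F"
 have "snd z < N" using N z by blast
 hence "z~:X \<times> {m}" using h(2) by auto
 hence "z~:dom G" using dG by simp
 thus "F z = (F ++ G) z" by (simp add: map_add_dom_app_simps)
 qed
 moreover have "cfun lam (F ++ G)" using p1(2) h dG unfolding cfun_def by auto
 ultimately obtain p2 where p2: "sP de p2 p1" "sP de p2 (rs w r)" "dec w (F ++ G) p2"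
 using dec_extend[OF a p1(3,2) _ _ h(1)] by blast
 have "(F ++ G) (xx, m) = Some (k xx)" if "xx:X" for xx using that by (simp add: map_add_def G_def)
 thus ?thesis using p2 dec_coh[OF a(1) p2(3) \<open>cfun lam (F ++ G)\<close>] by blast
 qed
 thus ?thesis using p1(1) by blast
qed

lemma coh_dense:
 assumes a: "w:dl" "limit w" and x: "xx:elts lam" and p: "p:cP de"
 shows "EX q k. sP de q p & q:coh w xx m k"
proof -
 obtain p1 F where p1: "sP de p1 p" "cfun lam F" "dec w F p1" using dec_exists[OF a p] by blast
 show ?thesis
 proof (cases "F (xx, m)")
 \<comment> \<open>An undecided value may be anything; zero is chosen.\<close>
 case None
 have p1c: "p1:cP de" using p1(3) unfolding dec_def by blast
 have "F \<subseteq>\<^sub>m F((xx, m) \<mapsto> 0)" using None by (auto simp: map_le_def)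
 moreover have "cfun lam (F((xx, m) \<mapsto> 0))" using p1(2) x unfolding cfun_def by auto
 moreover have "sP de (rs w p1) (rs w p1)" using X.le_refl[OF rs_props(1)[OF a(1) p1c]] .
 ultimately obtain p2 where "sP de p2 p1" "dec w (F((xx, m) \<mapsto> 0)) p2" using dec_extend[OF a p1(3,2)] by blast
 thus ?thesis using dec_coh[OF a(1) _ \<open>cfun lam (F((xx, m) \<mapsto> 0))\<close>, of p2 xx m 0] p1(1) X.le_tr by auto
 next
 case (Some k)
 thus ?thesis using dec_coh[OF a(1) p1(3,2)] p1(1) by blast
 qed
qed

text \<open>The value is carried by the coordinate at \<open>w\<close> itself, so the restriction
  must reach up to \<open>vsucc w\<close>.\<close>

lemma coh_res:
 assumes a: "w:dl" and p: "p:coh w xx m k"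
 shows "rs (vsucc w) p:coh w xx m k"
proof -
 have s: "vsucc w:dl" using aleph1_succ[OF aleph1 a] .
 have s': "vsucc w:stages" using s by simp
 have pc: "p:cP de" using p unfolding coh_def by blast
 note r = rs_props[OF s pc]
 have "rst (rs (vsucc w) p) w = rst p w" using res_res[OF dd r(1) s', of w] res_res[OF dd pc s', of w] r(2) by simp
 moreover have "vapp (rs (vsucc w) p) w = vapp p w" unfolding rs_def using a by simp
 ultimately show ?thesis using p r(1) unfolding coh_def by simp
qed

text \<open>From here on the iteration enters only through the properties collected in
  \<open>staged\<close>; names of iterands no longer occur.\<close>

lemma staged_last: "EX D. staged (P de) de lam rs (supp de) coh D"
proof -
 obtain D where D: "densesub de D" "D \<lesssim> elts lam" using densesub_all[OF dd] by blast
 have "staged (P de) de lam rs (supp de) coh D"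
 proof
 show "sat (is_aleph1 de)" by (rule aleph1)
 show "ccc (P de)" by (rule ccc_all[OF dd])
 show "D<=cP de" "!!p. p:cP de ==> EX d:D. sP de d p" "D \<lesssim> elts lam" using D unfolding densesub_def by blast+
 show "{f :: nat => 'a. range f<=elts lam} \<lesssim> elts lam" by (rule lam_sequences[OF aleph1 lam_reg delta_lam lam_pow])
 show "dl \<lesssim> elts lam" by (rule subset_imp_lepoll[OF elts_delta_lam])
 show "finite (supp de p)" if "p:cP de" for p using finite_supp[OF dd that] .
 show "supp de p<=dl" for p unfolding supp_def by blast
 show "sP de p (rs w p)" if a: "w:dl" and p: "p:cP de" for w p using le_split[OF a p rs_props(1)[OF a p]] rs_props[OF a p]
 forcing.le_refl[OF forcing_P[OF lt_le[OF a]] rst_conds[OF dd p a]] by simp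
 show "sP de (rs w p) (rs w q)" if a: "w:dl" and pq: "sP de p q" for w p q
 proof -
 have c: "p:cP de" "q:cP de" using X.le_conds[OF pq] by blast+
 show ?thesis using le_split[OF a rs_props(1)[OF a c(1)] rs_props(1)[OF a c(2)]] rs_props[OF a c(1)] rs_props[OF a c(2)]
 res_le[OF dd pq lt_le[OF a]] by simp
 qed
 show "sP de (rs w p) q" if a: "w:dl" and pq: "sP de p q" and s: "supp de q<=elts w" for w p q
 proof -
 have c: "p:cP de" "q:cP de" using X.le_conds[OF pq] by blast+
 have "!!z. z:dl ==> z~:elts w ==> vapp q z = tQ z" using s unfolding supp_def by blast
 thus ?thesis using le_split[OF a rs_props(1)[OF a c(1)] c(2)] rs_props[OF a c(1)] res_le[OF dd pq lt_le[OF a]] by simp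
 qed
 show "EX m. sP de m p & sP de m (rs w q)" if a: "w:dl" and p: "p:cP de" and q: "sP de q (rs w p)" for w p q
 proof -
 have qc: "q:cP de" using X.le_conds[OF q] by blast
 have qa: "sP w (rst q w) (rst p w)" using res_le[OF dd q lt_le[OF a]] rs_props(2)[OF a p] by simp
 from merge[OF dd lt_le[OF a] p qa] obtain m where m: "sP de m p" "rst m w = rst q w" by blast
 have mc: "m:cP de" using X.le_conds[OF m(1)] by blast
 have "sP de m (rs w q)" using le_split[OF a mc rs_props(1)[OF a qc]] rs_props[OF a qc] m(2)
 forcing.le_refl[OF forcing_P[OF lt_le[OF a]] rst_conds[OF dd qc a]] by simp
 thus ?thesis using m(1) by blast
 qed
 show "rs v (rs w p) = rs v p" if "w:dl" "v:elts w" "p:cP de" for w v p unfolding rs_def[of v]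
 proof (rule vlam_cong)
 fix z assume "z:dl"
 have "z:elts w" if "z:elts v" using vord_trans[OF vord_in[OF ord_de \<open>w:dl\<close>] \<open>v:elts w\<close> that] .
 thus "(if z:elts v then vapp (rs w p) z else tQ z) = (if z:elts v then vapp p z else tQ z)"
 unfolding rs_def using \<open>z:dl\<close> by simp
 qed
 show "rs w (rs w p) = rs w p" for w p unfolding rs_def by (rule vlam_cong) simp
 show "coh w xx m k<=cP de" for w xx m k unfolding coh_def by blast
 show "q:coh w xx m k" if "w:dl" "limit w" "p:coh w xx m k" "sP de q p" for w xx m k p q using coh_open that .
 show "rs (vsucc w) p:coh w xx m k" if "w:dl" "p:coh w xx m k" for w xx m k p using coh_res that .
 show "k = k'" if "w:dl" "limit w" "p:coh w xx m k" "p:coh w xx m k'" for w xx m k k' p using coh_single that .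
 show "EX q k. sP de q p & q:coh w xx m k" if "w:dl" "limit w" "xx:elts lam" "p:cP de" for w xx m p using coh_dense that .
 show "EX p1 N. sP de p1 p &
 (!r m X k. sP de r (rs w p1) --> N<=m --> finite X --> X<=elts lam -->
 (EX p2. sP de p2 p1 & sP de p2 (rs w r) & (!xx:X. p2:coh w xx m (k xx))))" if "w:dl" "limit w" "p:cP de" for w p
 using coh_step that .
 qed
 thus ?thesis by blast
qed

end

section \<open>Matching functions by Cohen reals\<close>

type_synonym 'a code = "nat => nat => 'a \<times> 'a"

context staged
begin

abbreviation "dl == elts de"

lemma ord_delta: "vord de" and delta_uncountable: "uncountable (dl)"
 and delta_countable: "w:dl ==> countable (elts w)" using aleph1 by (simp_all add: sat_is_aleph1)

lemma bounded: "countable X ==> X<=dl ==> EX w:dl. X<=elts w" using aleph1_bounded[OF aleph1] .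

lemma ord_sub: "w:dl ==> v:elts w ==> elts v<=elts w" using vord_subset[OF vord_in[OF ord_delta]] .

lemma in_delta: "w:dl ==> v:elts w ==> v:dl" using vord_trans[OF ord_delta] .

lemma ord_total: "w:dl ==> v:dl ==> w:elts v \<or> w = v \<or> v:elts w" using vord_linear vord_in[OF ord_delta] by blast

section \<open>Open sets of conditions and the stages that decide them\<close>

definition opn where "opn b <-> b<=CP & (!p:b. !q. q<~p --> q:b)"

text \<open>Regular open sets; the conditions forcing a formula form such a set.\<close>

definition regl where "regl b <-> opn b & (!p:CP. (!q. q<~p --> (EX r. r<~q & r:b)) --> p:b)"

text \<open>Measurability at stage \<open>w\<close>: whatever puts a condition into \<open>b\<close>
  is already in its part below \<open>w\<close>.\<close>

definition meas where "meas w b <-> (!p:b. res w p:b)"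

lemma opnD: "opn b ==> p:b ==> q<~p ==> q:b" unfolding opn_def by blast

lemma opn_conds: "opn b ==> p:b ==> p:CP" unfolding opn_def by blast

lemma meas_mono:
 assumes "opn b" "meas v b" "w:dl" "v:elts w \<or> v = w"
 shows "meas w b" unfolding meas_def
proof
 fix p assume p: "p:b"
 hence pc: "p:CP" using opn_conds[OF assms(1)] by blast
 show "res w p:b"
 proof (cases "v = w")
 case True
 thus ?thesis using assms(2) p unfolding meas_def by blast
 next
 case False
 hence b: "v:elts w" using assms(4) by blast
 have "res w p:CP" using res_weaker[OF assms(3) pc] le_conds by blast
 hence "res w p<~res v p" using res_weaker[OF in_delta[OF assms(3) b], of "res w p"] res_res[OF assms(3) b pc] by simp
 thus ?thesis using opnD[OF assms(1)] assms(2) p unfolding meas_def by blast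
 qed
qed

text \<open>Stated for an indexed family so that members of the antichain may carry data, such as a
  witness or a decided value.\<close>

lemma countable_antichain:
 fixes f :: "'b => 'a"
 assumes "!s:S. f s:CP"
 shows "EX A. A<=S & countable A & (!s:A. !t:A. s ~= t --> ~ compat (f s) (f t)) &
 (!s:S. EX a:A. compat (f s) (f a))"
proof (rule maximal_antichain[of S f])
 show "f s:CP" if "s:S" for s using assms that by blast
 fix A assume A: "A<=S" "!!s t. s:A ==> t:A ==> s ~= t ==> ~ compat (f s) (f t)"
 "!!s. s:S ==> EX a:A. compat (f s) (f a)"
 have "countable A"
 proof (rule ccontr)
 assume u: "uncountable A"
 have "f s:CP" if "s:A" for s using assms that A(1) by blast
 hence "EX i:A. EX j:A. i ~= j & compat (f i) (f j)" by (rule ccc_family[OF ccc_P u])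
 thus False using A(2) by (elim bexE conjE) simp
 qed
 thus ?thesis using A by (intro exI[of _ A] conjI ballI impI)
qed

lemma bounded_sup:
 assumes "countable A" "A<=CP"
 shows "EX v:dl. !a:A. sup a<=elts v"
proof -
 have "countable (UN a:A. sup a)" using assms sup_finite by (intro countable_UN) (auto intro: countable_finite)
 moreover have "(UN a:A. sup a)<=dl" using sup_sub by blast
 ultimately have "EX v:dl. (UN a:A. sup a)<=elts v" by (rule bounded)
 then obtain v where b: "v:dl" "(UN a:A. sup a)<=elts v" by (elim bexE)
 hence "!a:A. sup a<=elts v" by auto
 thus ?thesis using b(1) by (rule bexI)
qed

text \<open>A maximal antichain inside \<open>b\<close> is countable, so its finite supports lie
  below some \<open>v\<close>. For \<open>w\<close> beyond \<open>v\<close>, every extension of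
  \<open>res w p\<close> can be merged with a restriction lying below a member of the antichain; so
  \<open>b\<close> is dense below \<open>res w p\<close>, and regularity applies.\<close>

lemma meas_eventually:
 assumes b: "regl b"
 shows "EX v:dl. !w:dl. elts v<=elts w --> meas w b"
proof -
 have o: "opn b" using b unfolding regl_def by blast
 have bc: "s:b ==> s:CP" for s using opn_conds[OF o] .
 have "!s:b. s:CP" using bc by blast
 from countable_antichain[of b "%x. x", OF this]
 obtain A where A: "A<=b" "countable A" "!s:b. EX a:A. compat s a" by (elim exE conjE)
 obtain v where be: "v:dl" "!a:A. sup a<=elts v" using bounded_sup[OF A(2)] A(1) bc by blast
 have "meas w b" if a: "w:dl" "elts v<=elts w" for w unfolding meas_def
 proof
 fix p assume p: "p:b"
 have rc: "res w p:CP" using res_weaker[OF a(1) bc[OF p]] le_conds by blast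
 have "EX r. r<~q & r:b" if q: "q<~res w p" for q
 proof -
 obtain m where m: "m<~p" "m<~res w q" using res_merge[OF a(1) bc[OF p] q] by blast
 hence "m:b" using opnD[OF o p] by blast
 then obtain c where c: "c:A" "compat m c" using A(3) by blast
 then obtain s where s: "s<~m" "s<~c" unfolding compat_def by blast
 have rs: "res w s<~c" using res_supp[OF a(1) s(2)] be(2) c(1) a(2) by blast
 hence rsb: "res w s:b" using opnD[OF o] A(1) c(1) by blast
 have qc: "q:CP" using le_conds[OF q] by blast
 have "res w s<~res w q" using res_mono[OF a(1) le_tr[OF s(1) m(2)]] res_idem[OF a(1) qc] by simp
 then obtain m' where m': "m'<~q" "m'<~res w (res w s)" using res_merge[OF a(1) qc] by blast
 have "s:CP" using le_conds[OF s(1)] by blast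
 hence "m'<~res w s" using m'(2) res_idem[OF a(1)] by simp
 thus ?thesis using opnD[OF o rsb] m'(1) by blast
 qed
 thus "res w p:b" using b rc unfolding regl_def by blast
 qed
 thus ?thesis using be(1) by blast
qed

text \<open>In a maximal antichain of conditions paired with witnesses only countably many witnesses
  occur, so they are bounded; a condition below which witnesses are dense is compatible with a
  member of the antichain.\<close>

lemma witness_bound:
 assumes F: "!!x. opn (F x)"
 shows "EX v:dl. !p:CP. (!q. q<~p --> (EX r. r<~q & (EX x:dl. r:F x))) -->
 (EX r. r<~p & (EX x:elts v. r:F x))"
proof -
 let ?S = "{(q, x). x:dl & q:F x}"
 have "!s:?S. fst s:CP" using opn_conds[OF F] by auto
 from countable_antichain[of ?S fst, OF this]
 obtain A where A: "A<=?S" "countable A" "!s:?S. EX a:A. compat (fst s) (fst a)" by (elim exE conjE)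
 have "snd ` A<=dl" using A(1) by auto
 then obtain v where b: "v:dl" "snd ` A<=elts v" using bounded[of "snd ` A"] A(2) by blast
 have "EX r. r<~p & (EX x:elts v. r:F x)" if p: "p:CP" and h: "!q. q<~p --> (EX r. r<~q & (EX x:dl. r:F x))" for p
 proof -
 obtain q x where q: "q<~p" "x:dl" "q:F x" using h le_refl[OF p] by blast
 hence "(q, x):?S" by blast
 then obtain a where a: "a:A" "compat q (fst a)" using A(3) by fastforce
 then obtain r where r: "r<~q" "r<~fst a" unfolding compat_def by blast
 have "fst a:F (snd a)" using a(1) A(1) by auto
 hence "r:F (snd a)" using opnD[OF F] r(2) by blast
 moreover have "snd a:elts v" using a(1) b(2) by blast
 ultimately show ?thesis using le_tr[OF r(1) q(1)] by blast
 qed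
 thus ?thesis using b(1) by blast
qed

subsection \<open>Codes of functions\<close>

text \<open>A code \<open>tt\<close> lists for every \<open>m\<close> countably many pairs of a condition and the value at \<open>m\<close> that it
  decides.\<close>

definition cval :: "'a code => nat => 'a => 'a set" where "cval tt m x = {q. EX k. q<~fst (tt m k) & snd (tt m k) = x}"

definition proper :: "'a code => bool" where "proper tt <-> (!m k. fst (tt m k):D & snd (tt m k):dl) &
 (!m x y q. q:cval tt m x --> q:cval tt m y --> x = y) &
 (!m. !p:CP. EX q x. q<~p & q:cval tt m x)"

lemma opn_cval: "opn (cval tt m x)" unfolding opn_def cval_def using le_conds le_tr by blast

text \<open>For each \<open>m\<close> take a maximal antichain of conditions from \<open>D\<close>
  paired with values that they decide. The chain condition makes it countable, and choosing within
  \<open>D\<close> keeps the number of codes down to \<open>lam\<close>.\<close>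

lemma code_exists:
 assumes F: "!!m x. opn (F m x)"
 and d: "!!m p. p:CP ==> EX q x. q<~p & x:dl & q:F m x"
 shows "EX tt. proper tt & (!m x. cval tt m x<=F m x)"
proof -
 have "EX t::nat => 'a \<times> 'a. (!k. fst (t k):D & snd (t k):dl & fst (t k):F m (snd (t k))) &
 (!k k'. t k ~= t k' --> ~ compat (fst (t k)) (fst (t k'))) &
 (!p:CP. EX q k. q<~p & q<~fst (t k))" for m
 proof -
 let ?S = "{(q, x). q:D & x:dl & q:F m x}"
 have "!s:?S. fst s:CP" using D_sub by auto
 from countable_antichain[of ?S fst, OF this]
 obtain A where A: "A<=?S" "countable A" "!s:A. !t:A. s ~= t --> ~ compat (fst s) (fst t)"
 "!s:?S. EX a:A. compat (fst s) (fst a)" by (elim exE conjE)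
 have dn: "EX q a. q<~p & a:A & q<~fst a" if p: "p:CP" for p
 proof -
 obtain q x where q: "q<~p" "x:dl" "q:F m x" using d[OF p] by blast
 then obtain e where e: "e:D" "e<~q" using D_dense le_conds by blast
 have "(e, x):?S" using e q opnD[OF F q(3) e(2)] by blast
 then obtain a where a: "a:A" "compat e (fst a)" using A(4) by fastforce
 thus ?thesis using e q le_tr unfolding compat_def by meson
 qed
 have "A ~= {}" using dn[OF top_in] by blast
 \<comment> \<open>A finite antichain is enumerated with repetitions, so incompatibility is claimed
   for different entries, not for different indices.\<close>
 hence r: "range (from_nat_into A) = A" using range_from_nat_into[OF _ A(2)] by blast
 have in_A: "from_nat_into A k:A" for k using r by blast
 show ?thesis
 proof (rule exI[of _ "from_nat_into A"], intro conjI allI impI ballI)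
 fix k
 have "from_nat_into A k:?S" by (rule subsetD[OF A(1) in_A])
 thus "fst (from_nat_into A k):D" "snd (from_nat_into A k):dl"
 "fst (from_nat_into A k):F m (snd (from_nat_into A k))" by auto
 next
 fix k k' assume "from_nat_into A k ~= from_nat_into A k'"
 thus "~ compat (fst (from_nat_into A k)) (fst (from_nat_into A k'))" using A(3) in_A by blast
 next
 fix p assume "p:CP"
 then obtain q a where q: "q<~p" "a:A" "q<~fst a" using dn by blast
 then obtain k where "a = from_nat_into A k" using r by blast
 thus "EX q k. q<~p & q<~fst (from_nat_into A k)" using q by blast
 qed
 qed
 then obtain tt :: "nat => nat => 'a \<times> 'a" where t: "!!m k. fst (tt m k):D & snd (tt m k):dl & fst (tt m k):F m (snd (tt m k))"
 "!!m k k'. tt m k ~= tt m k' ==> ~ compat (fst (tt m k)) (fst (tt m k'))"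
 "!!m p. p:CP ==> EX q k. q<~p & q<~fst (tt m k)" by metis
 have "x = y" if "q:cval tt m x" "q:cval tt m y" for m x y q
 proof -
 obtain k k' where k: "q<~fst (tt m k)" "snd (tt m k) = x" "q<~fst (tt m k')" "snd (tt m k') = y"
 using \<open>q:cval tt m x\<close> \<open>q:cval tt m y\<close> unfolding cval_def by blast
 hence "compat (fst (tt m k)) (fst (tt m k'))" unfolding compat_def by blast
 thus ?thesis using t(2) k by metis
 qed
 moreover have "EX q x. q<~p & q:cval tt m x" if "p:CP" for p m using t(3)[OF that, of m] unfolding cval_def by blast
 ultimately have "proper tt" unfolding proper_def using t(1) by blast
 moreover have "cval tt m x<=F m x" for m x unfolding cval_def using t(1) opnD[OF F] by blast
 ultimately show ?thesis by blast
qed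

lemma infinite_lam: "infinite (elts lam)"
proof
 assume "finite (elts lam)"
 hence "finite (dl)" using delta_lam unfolding lepoll_def by (metis inj_on_finite)
 thus False using delta_uncountable countable_finite by blast
qed

text \<open>A code is a double sequence in \<open>D\<close> times \<omega>1, a set of size at most
  \<open>lam\<close>, so \<open>lam_seq\<close> counts the codes. The Boolean of a label will tell
  in which of two structures the coded function takes its values.\<close>

lemma labels_lepoll: "(UNIV :: bool set) \<times> {tt. proper tt} \<lesssim> elts lam"
proof (rule lepoll_times_same[OF infinite_lam])
 show "(UNIV :: bool set) \<lesssim> elts lam" using infinite_lam by (simp add: finite_lepoll_infinite)
 have "D \<times> dl \<lesssim> elts lam" using lepoll_times_same[OF infinite_lam D_small delta_lam] .
 then obtain e where e: "inj_on e (D \<times> dl)" "e ` (D \<times> dl)<=elts lam" unfolding lepoll_def by blast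
 let ?g = "%tt. %n. e (tt (fst (prod_decode n)) (snd (prod_decode n)))"
 have m: "tt i j:D \<times> dl" if "proper tt" for tt i j using that unfolding proper_def by (metis mem_Sigma_iff prod.collapse)
 have "inj_on ?g {tt. proper tt}"
 proof (rule inj_onI)
 fix tt tt' assume h: "tt:{tt. proper tt}" "tt':{tt. proper tt}" "?g tt = ?g tt'"
 have "tt i j = tt' i j" for i j
 proof (rule inj_onD[OF e(1)])
 show "e (tt i j) = e (tt' i j)" using fun_cong[OF h(3), of "prod_encode (i, j)"] by simp
 qed (use h m in blast)+
 thus "tt = tt'" by blast
 qed
 moreover have "?g ` {tt. proper tt}<={f :: nat => 'a. range f<=elts lam}"
 proof (intro image_subsetI CollectI)
 fix tt and n :: nat assume "tt:{tt. proper tt}"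
 thus "?g tt n:elts lam" using m e(2) by blast
 qed
 ultimately have "{tt. proper tt} \<lesssim> {f :: nat => 'a. range f<=elts lam}" unfolding lepoll_def by blast
 thus "{tt. proper tt} \<lesssim> elts lam" using lam_seq lepoll_trans by blast
qed

end

text \<open>\<open>H n L as bs\<close> stands for the set of conditions forcing that the tuples \<open>as\<close> and \<open>bs\<close> of two
  structures are equivalent in the Ehrenfeucht game of length \<open>n\<close> for the finite set \<open>L\<close> of atomic
  formulas; the newest elements come first.\<close>

locale game = staged P de lam res sup coh D for P :: "'a::zfc forcing" and de lam res sup coh D +
 fixes H :: "nat => 'l::countable => 'a list => 'a list => 'a set"
 assumes H_regl: "regl (H n L as bs)"
 and H_forth: "p:H (Suc n) L as bs ==> a:dl ==> EX q. q<~p & (EX b:dl. q:H n L (a # as) (b # bs))"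
 and H_back: "p:H (Suc n) L as bs ==> b:dl ==> EX q. q<~p & (EX a:dl. q:H n L (a # as) (b # bs))"
 and H_start: "p:CP ==> p:H n L [] []"
begin

lemma H_opn: "opn (H n L as bs)" using H_regl unfolding regl_def by blast

section \<open>Stages closed under the moves of the games\<close>

definition closed :: "'a => 'a => bool" where "closed z v <-> (!n L as bs. set as<=elts z --> set bs<=elts z -->
 (!w:dl. elts v<=elts w --> meas w (H n L as bs)) &
 (!a:elts z. !p:H (Suc n) L as bs. EX q. q<~p & (EX b:elts v. q:H n L (a # as) (b # bs))) &
 (!b:elts z. !p:H (Suc n) L as bs. EX q. q<~p & (EX a:elts v. q:H n L (a # as) (b # bs))))"

text \<open>Only countably many positions have all their entries below the countable ordinal
  \<open>z\<close>, so the bounds that \<open>meas_eventually\<close> and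
  \<open>witness_bound\<close> provide for them lie below a single \<open>v\<close>.\<close>

lemma closed_exists: "z:dl ==> EX v:dl. z:elts v & closed z v"
proof -
 assume g: "z:dl"
 let ?T = "(UNIV :: nat set) \<times> (UNIV :: 'l set) \<times> lists (elts z) \<times> lists (elts z) \<times> elts z"
 have cT: "countable ?T" using delta_countable[OF g] by (intro countable_SIGMA) auto
 have 1: "EX v:dl. !w:dl. elts v<=elts w --> meas w (H n L as bs)" for n L as bs by (rule meas_eventually[OF H_regl])
 have 2: "EX v:dl. !p:H (Suc n) L as bs. EX q. q<~p & (EX b:elts v. q:H n L (a # as) (b # bs))" if "a:dl" for n L as bs a
 proof -
 obtain v where b: "v:dl" "!p:CP. (!q. q<~p --> (EX r. r<~q & (EX x:dl. r:H n L (a # as) (x # bs)))) -->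
 (EX r. r<~p & (EX x:elts v. r:H n L (a # as) (x # bs)))" using witness_bound[of "%x. H n L (a # as) (x # bs)"] H_opn by blast
 thus ?thesis using H_forth[OF opnD[OF H_opn] that] opn_conds[OF H_opn] by blast
 qed
 have 3: "EX v:dl. !p:H (Suc n) L as bs. EX q. q<~p & (EX a:elts v. q:H n L (a # as) (b # bs))" if "b:dl" for n L as bs b
 proof -
 obtain v where "v:dl" "!p:CP. (!q. q<~p --> (EX r. r<~q & (EX x:dl. r:H n L (x # as) (b # bs)))) -->
 (EX r. r<~p & (EX x:elts v. r:H n L (x # as) (b # bs)))" using witness_bound[of "%x. H n L (x # as) (b # bs)"] H_opn by blast
 thus ?thesis using H_back[OF opnD[OF H_opn] that] opn_conds[OF H_opn] by blast
 qed
 have "!n L as bs. EX v:dl. !w:dl. elts v<=elts w --> meas w (H n L as bs)" using 1 by blast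
 then obtain f1 where f1: "!!n L as bs. f1 n L as bs:dl"
 "!!n L as bs w. w:dl ==> elts (f1 n L as bs)<=elts w ==> meas w (H n L as bs)" by metis
 have "!n L as bs. !a:dl. EX v:dl. !p:H (Suc n) L as bs. EX q. q<~p & (EX b:elts v. q:H n L (a # as) (b # bs))" using 2 by blast
 then obtain f2 where f2: "!!n L as bs a. a:dl ==> f2 n L as bs a:dl"
 "!!n L as bs a p. a:dl ==> p:H (Suc n) L as bs ==>
 EX q. q<~p & (EX b:elts (f2 n L as bs a). q:H n L (a # as) (b # bs))" by metis
 have "!n L as bs. !b:dl. EX v:dl. !p:H (Suc n) L as bs. EX q. q<~p & (EX a:elts v. q:H n L (a # as) (b # bs))" using 3 by blast
 then obtain f3 where f3: "!!n L as bs b. b:dl ==> f3 n L as bs b:dl"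
 "!!n L as bs b p. b:dl ==> p:H (Suc n) L as bs ==>
 EX q. q<~p & (EX a:elts (f3 n L as bs b). q:H n L (a # as) (b # bs))" by metis
 let ?B1 = "(%(n, L, as, bs, a). f1 n L as bs) ` (UNIV \<times> UNIV \<times> lists (elts z) \<times> lists (elts z) \<times> {()})"
 define B where "B = ?B1 Un (%(n, L, as, bs, a). f2 n L as bs a) ` ?T Un (%(n, L, as, bs, a). f3 n L as bs a) ` ?T Un {z}"
 have "countable ?B1" using delta_countable[OF g] by (intro countable_image countable_SIGMA) auto
 hence "countable B" unfolding B_def using cT by auto
 moreover have "B<=dl" unfolding B_def using f1(1) f2(1) f3(1) in_delta[OF g] g by auto
 ultimately have "EX v:dl. B<=elts v" by (rule bounded)
 then obtain v where b: "v:dl" "B<=elts v" by (elim bexE)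
 have sub: "elts x<=elts v" if "x:B" for x by (rule ord_sub[OF b(1) subsetD[OF b(2) that]])
 have "z:B" unfolding B_def by simp
 hence gb: "z:elts v" by (rule subsetD[OF b(2)])
 have "closed z v" unfolding closed_def
 proof (intro allI impI conjI ballI)
 fix n :: nat and L :: 'l and as bs assume as: "set as<=elts z" and bs: "set bs<=elts z"
 hence l: "as:lists (elts z)" "bs:lists (elts z)" by auto
 have "(n, L, as, bs, ()):UNIV \<times> UNIV \<times> lists (elts z) \<times> lists (elts z) \<times> {()}" using l by blast
 from imageI[OF this, of "%(n, L, as, bs, a). f1 n L as bs"] have "f1 n L as bs:B" unfolding B_def by simp
 hence s1: "elts (f1 n L as bs)<=elts v" by (rule sub)
 show "meas w (H n L as bs)" if "w:dl" "elts v<=elts w" for w by (rule f1(2)[OF that(1) subset_trans[OF s1 that(2)]])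
 fix a assume a: "a:elts z"
 have ad: "a:dl" using in_delta[OF g a] .
 have T: "(n, L, as, bs, a):?T" using l a by blast
 have s2: "elts (f2 n L as bs a)<=elts v"
 by (rule sub) (use imageI[OF T, of "%(n, L, as, bs, a). f2 n L as bs a"] in "simp add: B_def")
 have s3: "elts (f3 n L as bs a)<=elts v"
 by (rule sub) (use imageI[OF T, of "%(n, L, as, bs, a). f3 n L as bs a"] in "simp add: B_def")
 show "EX q. q<~p & (EX b:elts v. q:H n L (a # as) (b # bs))" if "p:H (Suc n) L as bs" for p
 using f2(2)[OF ad that] subsetD[OF s2] by meson
 show "EX q. q<~p & (EX b:elts v. q:H n L (b # as) (a # bs))" if "p:H (Suc n) L as bs" for p
 using f3(2)[OF ad that] subsetD[OF s3] by meson
 qed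
 thus ?thesis using b(1) gb by blast
qed

definition good :: "'a => bool" where "good w <-> w:dl & limit w & elts w ~= {} & (!n L as bs. set as<=elts w --> set bs<=elts w -->
 meas w (H n L as bs) &
 (!a:elts w. !p:H (Suc n) L as bs. EX q. q<~p & (EX b:elts w. q:H n L (a # as) (b # bs))) &
 (!b:elts w. !p:H (Suc n) L as bs. EX q. q<~p & (EX a:elts w. q:H n L (a # as) (b # bs))))"

text \<open>Iterate \<open>closed_exists\<close> countably often and take the union
  \<open>w\<close>, still below \<omega>1. A finite position below \<open>w\<close> lies below some
  \<open>g i\<close>, and the next step contains the answers; \<open>w\<close> is a limit because
  each \<open>g i\<close> belongs to it.\<close>

lemma good_exists:
 assumes "v:dl"
 shows "EX w. good w & elts v<=elts w"
proof -
 obtain nx where nx: "!!z. z:dl ==> nx z:dl & z:elts (nx z) & closed z (nx z)" using closed_exists by metis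
 define g where "g i = (nx ^^ i) v" for i
 have gd: "g i:dl" for i unfolding g_def by (induction i) (use assms nx in auto)
 have gs: "g i:elts (g (Suc i))" "closed (g i) (g (Suc i))" for i using nx[OF gd[of i]] unfolding g_def by simp_all
 have gm: "elts (g i)<=elts (g j)" if "i<=j" for i j
 by (rule lift_Suc_mono_le[of "%i. elts (g i)", OF _ that]) (use ord_sub[OF gd gs(1)] in blast)
 define w where "w = vset (\<Union>i. elts (g i))"
 have "countable (\<Union>i. elts (g i))" using delta_countable[OF gd] by blast
 hence ea: "elts w = (\<Union>i. elts (g i))" unfolding w_def by (intro elts_vset' small_countable)
 obtain \<epsilon> where e: "\<epsilon>:dl" "range g<=elts \<epsilon>" using bounded[of "range g"] gd by blast
 have oa: "vord w" unfolding vord_def ea using ord_sub[OF gd] vord_in[OF vord_in[OF ord_delta gd]] by (auto simp: vord_def)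
 have "elts w<=elts \<epsilon>" using e ord_sub[OF e(1)] unfolding ea by blast
 hence "w:elts \<epsilon> \<or> w = \<epsilon>" using vord_subset_cases[OF oa vord_in[OF ord_delta e(1)]] by blast
 hence ad: "w:dl" using e(1) in_delta by blast
 have gi: "g i:elts w" for i using gs(1)[of i] ea by blast
 have gsub: "elts (g i)<=elts w" for i using ea by blast
 have lim: "limit w" unfolding limit_def
 proof
 fix x assume "x:elts w"
 then obtain i where i: "x:elts (g i)" using ea by blast
 have "vord (vsucc x)" "vord (g i)" using vord_vsucc vord_in[OF ord_delta] in_delta[OF gd i] gd by blast+
 hence "vsucc x:elts (g i) \<or> vsucc x = g i" using vord_linear[of "vsucc x" "g i"] mem_asym[OF i] i by auto
 thus "vsucc x:elts w" using gi[of i] subsetD[OF gsub[of i]] by auto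
 qed
 have fin: "EX i. X<=elts (g i)" if "finite X" "X<=elts w" for X using that
 proof (induction X)
 case (insert x X)
 then obtain i j where "X<=elts (g i)" "x:elts (g j)" using ea by auto
 hence "insert x X<=elts (g (max i j))" using gm[of i "max i j"] gm[of j "max i j"] by auto
 thus ?case by blast
 qed simp
 have "good w" unfolding good_def
 proof (intro conjI allI impI ballI)
 show "elts w ~= {}" using gi by blast
 fix n :: nat and L :: 'l and as bs assume as: "set as<=elts w" and bs: "set bs<=elts w"
 obtain i where i: "set as Un set bs<=elts (g i)" using fin[of "set as Un set bs"] as bs by auto
 thus "meas w (H n L as bs)" using gs(2)[of i] ad gsub[of "Suc i"] unfolding closed_def by simp
 fix a assume a: "a:elts w"
 obtain j where j: "insert a (set as Un set bs)<=elts (g j)" using fin[of "insert a (set as Un set bs)"] as bs a by auto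
 have cl: "closed (g j) (g (Suc j))" by (rule gs(2))
 fix p assume p: "p:H (Suc n) L as bs"
 have "EX q. q<~p & (EX b:elts (g (Suc j)). q:H n L (a # as) (b # bs))" using cl j p unfolding closed_def by simp
 thus "EX q. q<~p & (EX b:elts w. q:H n L (a # as) (b # bs))" using gsub by blast
 next
 fix n :: nat and L :: 'l and as bs b p assume as: "set as<=elts w" and bs: "set bs<=elts w"
 and b: "b:elts w" and p: "p:H (Suc n) L as bs"
 obtain j where j: "insert b (set as Un set bs)<=elts (g j)" using fin[of "insert b (set as Un set bs)"] as bs b by auto
 have cl: "closed (g j) (g (Suc j))" by (rule gs(2))
 have "EX q. q<~p & (EX a:elts (g (Suc j)). q:H n L (a # as) (b # bs))" using cl j p unfolding closed_def by simp
 thus "EX q. q<~p & (EX a:elts w. q:H n L (a # as) (b # bs))" using gsub by blast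
 qed (use ad lim in blast)+
 moreover have "elts v<=elts w" using gsub[of 0] unfolding g_def by simp
 ultimately show ?thesis by blast
qed

end

section \<open>Labels, partners and their stages\<close>

context game
begin

definition st :: "'a code => 'a" where "st tt = (SOME w. good w & (!m k. sup (fst (tt m k))<=elts w & snd (tt m k):elts w))"

text \<open>The supports and the values in a code form a countable set, so some good stage lies
  above all of them.\<close>

lemma st:
 assumes "proper tt"
 shows "good (st tt)" "sup (fst (tt m k))<=elts (st tt)" "snd (tt m k):elts (st tt)"
proof -
 have t: "fst (tt m k):CP" "snd (tt m k):dl" for m k using assms subsetD[OF D_sub] unfolding proper_def by blast+
 define X where "X = (\<Union>m. \<Union>k. sup (fst (tt m k)) Un {snd (tt m k)})"
 have "countable X" unfolding X_def using countable_finite[OF sup_finite[OF t(1)]] by simp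
 moreover have "X<=dl" unfolding X_def using t sup_sub by blast
 ultimately have "EX v:dl. X<=elts v" by (rule bounded)
 then obtain v where b: "v:dl" "X<=elts v" by (elim bexE)
 obtain w where a: "good w" "elts v<=elts w" using good_exists[OF b(1)] by (elim exE conjE)
 have xa: "X<=elts w" by (rule subset_trans[OF b(2) a(2)])
 have "EX w. good w & (!m k. sup (fst (tt m k))<=elts w & snd (tt m k):elts w)"
 by (rule exI[of _ w]) (use a(1) xa in "auto simp: X_def")
 from someI_ex[OF this] show "good (st tt)" "sup (fst (tt m k))<=elts (st tt)" "snd (tt m k):elts (st tt)"
 unfolding st_def by blast+
qed

lemma goodD: "good w ==> w:dl & limit w & elts w ~= {}" unfolding good_def by blast

abbreviation "lab l == proper (snd l)"
abbreviation "stg l == st (snd l)"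

text \<open>Each label reads its own Cohen real, so that the partners of different labels at one
  stage can be prescribed independently.\<close>

definition xi :: "bool \<times> 'a code => 'a" where "xi = (SOME f. inj_on f ((UNIV :: bool set) \<times> {tt. proper tt}) &
 f ` ((UNIV :: bool set) \<times> {tt. proper tt})<=elts lam)"

lemma xi: "inj_on xi (UNIV \<times> {tt. proper tt})" "proper tt ==> xi (s, tt):elts lam"
proof -
 have "EX f. inj_on f ((UNIV :: bool set) \<times> {tt. proper tt}) & f ` ((UNIV :: bool set) \<times> {tt. proper tt})<=elts lam"
 using labels_lepoll unfolding lepoll_def .
 from someI_ex[OF this] show "inj_on xi (UNIV \<times> {tt. proper tt})" "proper tt ==> xi (s, tt):elts lam"
 unfolding xi_def[symmetric] by blast+
qed

text \<open>The partner of the function coded by \<open>tt\<close>: a Cohen real added at the stage of \<open>tt\<close>, read through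
  an enumeration of that stage.\<close>

definition partner :: "bool \<times> 'a code => nat => 'a => 'a set" where "partner l m y = {q. EX k. q:coh (stg l) (xi l) m k & from_nat_into (elts (stg l)) k = y}"

text \<open>A label \<open>(True, tt)\<close> codes a function into the first structure, and its
  partner maps into the second; for \<open>(False, tt)\<close> the roles are exchanged. The two
  kinds together let every function on either side be matched.\<close>

definition valF :: "bool \<times> 'a code => nat => 'a => 'a set" where "valF l = (if fst l then cval (snd l) else partner l)"

definition valG :: "bool \<times> 'a code => nat => 'a => 'a set" where "valG l = (if fst l then partner l else cval (snd l))"

text \<open>The partner is decided one stage later than its code, because its Cohen real is added by
  the iterand at the stage itself.\<close>

lemma partner_props:
 assumes "lab l"
 shows "opn (partner l m y)" "meas (vsucc (stg l)) (partner l m y)"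
 "q:partner l m y ==> y:elts (stg l)"
 "q:partner l m y ==> q:partner l m z ==> y = z"
 "p:CP ==> EX q y. q<~p & q:partner l m y"
proof -
 note g = goodD[OF st(1)[OF assms]]
 show "opn (partner l m y)" unfolding opn_def
 proof (intro conjI subsetI ballI allI impI)
 fix q assume "q:partner l m y"
 then obtain k where k: "q:coh (stg l) (xi l) m k" "from_nat_into (elts (stg l)) k = y" unfolding partner_def by blast
 show "q:CP" by (rule subsetD[OF coh_sub k(1)])
 fix r assume "r<~q"
 hence "r:coh (stg l) (xi l) m k" using coh_open[OF conjunct1[OF g] _ k(1)] g by simp
 thus "r:partner l m y" unfolding partner_def using k(2) by blast
 qed
 show "meas (vsucc (stg l)) (partner l m y)" unfolding meas_def partner_def using coh_res[OF conjunct1[OF g]] by blast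
 show "q:partner l m y ==> y:elts (stg l)" unfolding partner_def using from_nat_into[of "elts (stg l)"] g by auto
 show "q:partner l m y ==> q:partner l m z ==> y = z"
 unfolding partner_def using coh_single[OF conjunct1[OF g]] g by (elim CollectE exE conjE) metis
 show "EX q y. q<~p & q:partner l m y" if "p:CP"
 proof -
 have "xi l:elts lam" using xi(2)[OF assms, of "fst l"] by simp
 hence "EX q k. q<~p & q:coh (stg l) (xi l) m k" using coh_dense[OF conjunct1[OF g] _ _ that] g by simp
 thus ?thesis unfolding partner_def by blast
 qed
qed

lemma cval_props:
 assumes "proper tt"
 shows "meas (st tt) (cval tt m y)"
 "q:cval tt m y ==> y:elts (st tt)"
 "q:cval tt m y ==> q:cval tt m z ==> y = z"
 "p:CP ==> EX q y. q<~p & q:cval tt m y"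
proof -
 note g = goodD[OF st(1)[OF assms]]
 show "meas (st tt) (cval tt m y)" unfolding meas_def cval_def using res_supp[OF conjunct1[OF g] _ st(2)[OF assms]] by blast
 show "q:cval tt m y ==> y:elts (st tt)" unfolding cval_def using st(3)[OF assms] by blast
 show "q:cval tt m y ==> q:cval tt m z ==> y = z" "p:CP ==> EX q y. q<~p & q:cval tt m y"
 using assms unfolding proper_def by blast+
qed

lemma val_opn: "lab l ==> opn (valF l m y)" "lab l ==> opn (valG l m y)"
 unfolding valF_def valG_def using partner_props(1) opn_cval by auto

lemma val_in:
 "lab l ==> q:valF l m y ==> y:elts (stg l)"
 "lab l ==> q:valG l m y ==> y:elts (stg l)"
 unfolding valF_def valG_def by (auto split: if_splits intro: partner_props(3) cval_props(2))

lemma val_single: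
 "lab l ==> q:valF l m y ==> q:valF l m z ==> y = z"
 "lab l ==> q:valG l m y ==> q:valG l m z ==> y = z"
 unfolding valF_def valG_def by (auto split: if_splits dest: partner_props(4) cval_props(3))

lemma val_dense:
 "lab l ==> p:CP ==> EX q y. q<~p & q:valF l m y"
 "lab l ==> p:CP ==> EX q y. q<~p & q:valG l m y"
 unfolding valF_def valG_def using partner_props(5)[of l p m] cval_props(4)[of "snd l" p m] by simp_all

text \<open>Since \<open>w\<close> is a limit, the stage just past \<open>stg l\<close>, where the
  partner is decided, still lies below \<open>w\<close>.\<close>

lemma val_old:
 assumes l: "lab l" "stg l:elts w" and a: "good w"
 shows "meas w (valF l m y)" "meas w (valG l m y)"
proof -
 have a': "w:dl" "vsucc (stg l):elts w" using goodD[OF a] l(2) unfolding limit_def by auto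
 have "meas w (cval (snd l) m y)" "meas w (partner l m y)" using meas_mono[OF opn_cval cval_props(1)[OF l(1)] a'(1)] l(2)
 meas_mono[OF partner_props(1,2)[OF l(1)] a'(1)] a'(2) by blast+
 thus "meas w (valF l m y)" "meas w (valG l m y)" unfolding valF_def valG_def by simp_all
qed

text \<open>One round of the game is spent on each label of stage \<open>w\<close>. The value of the
  code is the move, and the answer, found below \<open>w\<close> because \<open>w\<close> is good,
  is the value that the partner will have to take. Distinctness of \<open>ln\<close> lets
  \<open>av\<close> and \<open>bv\<close> be updated one label at a time.\<close>

lemma block:
 assumes a: "good w" and l: "!l:set ln. lab l & stg l = w" and d: "distinct ln"
 and s: "set as<=elts w" "set bs<=elts w" and q: "q:H (n + length ln) L as bs"
 shows "EX q' av bv. q'<~q & (!l:set ln. av l:elts w & bv l:elts w &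
 q':cval (snd l) m (if fst l then av l else bv l)) & q':H n L (map av ln @ as) (map bv ln @ bs)" using l d q
proof (induction ln arbitrary: n)
 case Nil
 hence "q<~q" using opn_conds[OF H_opn] le_refl by blast
 thus ?case using Nil by auto
next
 case (Cons l ln)
 have "q:H (Suc n + length ln) L as bs" using Cons.prems(3) by simp
 then obtain q1 av bv where q1: "q1<~q" "!l:set ln. av l:elts w & bv l:elts w &
 q1:cval (snd l) m (if fst l then av l else bv l)" "q1:H (Suc n) L (map av ln @ as) (map bv ln @ bs)"
 using Cons.IH[of "Suc n"] Cons.prems(1,2) by auto
 have pl: "lab l" "stg l = w" using Cons.prems(1) by auto
 obtain q2 x where q2: "q2<~q1" "q2:cval (snd l) m x" using cval_props(4)[OF pl(1) opn_conds[OF H_opn q1(3)]] by blast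
 have x: "x:elts w" using cval_props(2)[OF pl(1) q2(2)] pl(2) by simp
 have h2: "q2:H (Suc n) L (map av ln @ as) (map bv ln @ bs)" using opnD[OF H_opn q1(3) q2(1)] .
 have vs: "set (map av ln @ as)<=elts w" "set (map bv ln @ bs)<=elts w" using q1(2) s by auto
 have "EX q3 y z. q3<~q2 & y:elts w & z:elts w & (if fst l then y else z) = x &
 q3:H n L (y # map av ln @ as) (z # map bv ln @ bs)"
 proof (cases "fst l")
 case True
 have "EX q. q<~q2 & (EX b:elts w. q:H n L (x # map av ln @ as) (b # map bv ln @ bs))" using a vs x h2 unfolding good_def by simp
 thus ?thesis using True x by auto
 next
 case False
 have "EX q. q<~q2 & (EX b:elts w. q:H n L (b # map av ln @ as) (x # map bv ln @ bs))" using a vs x h2 unfolding good_def by simp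
 thus ?thesis using False x by auto
 qed
 then obtain q3 y z where q3: "q3<~q2" "y:elts w" "z:elts w" "(if fst l then y else z) = x"
 "q3:H n L (y # map av ln @ as) (z # map bv ln @ bs)" by (elim exE conjE)
 have nl: "l~:set ln" using Cons.prems(2) by simp
 have m: "map (av(l := y)) ln = map av ln" "map (bv(l := z)) ln = map bv ln" using nl by (auto intro: map_cong)
 have l31: "q3<~q1" by (rule le_tr[OF q3(1) q2(1)])
 show ?case
 proof (intro exI conjI)
 show "q3<~q" by (rule le_tr[OF l31 q1(1)])
 show "!l':set (l # ln). (av(l := y)) l':elts w & (bv(l := z)) l':elts w &
 q3:cval (snd l') m (if fst l' then (av(l := y)) l' else (bv(l := z)) l')"
 proof
 fix l' assume l': "l':set (l # ln)"
 show "(av(l := y)) l':elts w & (bv(l := z)) l':elts w &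
 q3:cval (snd l') m (if fst l' then (av(l := y)) l' else (bv(l := z)) l')"
 proof (cases "l' = l")
 case True
 thus ?thesis using q3(2,3,4) opnD[OF opn_cval q2(2) q3(1)] by (simp split: if_splits)
 next
 case False
 hence "l':set ln" using l' by simp
 from bspec[OF q1(2) this] show ?thesis using False opnD[OF opn_cval _ l31] by (simp split: if_splits)
 qed
 qed
 show "q3:H n L (map (av(l := y)) (l # ln) @ as) (map (bv(l := z)) (l # ln) @ bs)"
 using q3(5) by (simp only: list.map append_Cons fun_upd_same m)
 qed
qed

lemma last_stage:
 assumes "finite X" "X ~= {}" "X<=dl"
 shows "EX w:X. !v:X. v = w \<or> v:elts w" using assms
proof (induction X rule: finite_ne_induct)
 case (insert x X)
 then obtain w where a: "w:X" "!v:X. v = w \<or> v:elts w" by auto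
 have d: "w:dl" "x:dl" using a(1) insert.prems by auto
 consider "w:elts x" | "x = w \<or> x:elts w" using ord_total[OF d] by blast
 thus ?case
 proof cases
 case 1
 hence "!v:insert x X. v = x \<or> v:elts x" using a(2) subsetD[OF ord_sub[OF d(2) 1]] by auto
 thus ?thesis by blast
 next
 case 2
 thus ?thesis using a by blast
 qed
qed simp

text \<open>Induction on the number of labels, removing those of the latest stage \<open>w\<close>.
  The older labels are played below \<open>res w p1\<close> with a reserve of one round for each new
  label, which \<open>block\<close> spends. All that is decided so far is measured at stage
  \<open>w\<close>, so it survives restriction to \<open>w\<close>, and \<open>coh_step\<close> sets
  the Cohen reals at \<open>w\<close> to the answers.\<close>

theorem matching:
 assumes "finite T" "!l:T. lab l"
 shows "EX ls. set ls = T & (!n L N. !p:CP. EX m q av bv. N<=m & q<~p &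
 (!l:T. q:valF l m (av l) & q:valG l m (bv l)) & q:H n L (map av ls) (map bv ls))" using assms
proof (induction "card T" arbitrary: T rule: less_induct)
 case less
 show ?case
 proof (cases "T = {}")
 case True
 have "EX m q av bv. N<=m & q<~p & (!l:{}. q:valF l m (av l) & q:valG l m (bv l)) &
 q:H n L (map av []) (map bv [])" if "p:CP" for n L p and N :: nat
 by (rule exI[of _ N], rule exI[of _ p]) (use le_refl[OF that] H_start[OF that] in simp)
 thus ?thesis using True by (intro exI[of _ "[]"]) simp
 next
 case False
 define S where "S = (%l. stg l) ` T"
 have "finite S" "S ~= {}" using less.prems(1) False unfolding S_def by auto
 moreover have "S<=dl" using less.prems(2) goodD[OF st(1)] unfolding S_def by blast
 ultimately obtain w where al: "w:S" "!v:S. v = w \<or> v:elts w" using last_stage[of S] by blast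
 have ga: "good w" using al(1) less.prems(2) st(1) unfolding S_def by blast
 have ad: "w:dl" and alim: "limit w" and ane: "elts w ~= {}" using goodD[OF ga] by auto
 define New where "New = {l:T. stg l = w}"
 define Old where "Old = T - New"
 have fN: "finite New" "finite Old" and TU: "T = New Un Old" using less.prems(1) unfolding New_def Old_def by auto
 have N: "!l:New. lab l & stg l = w" using less.prems(2) unfolding New_def by blast
 have O: "lab l & stg l:elts w" if "l:Old" for l
 proof -
 have "l:T" "stg l ~= w" using that unfolding Old_def New_def by simp_all
 have "stg l:S" unfolding S_def using \<open>l:T\<close> by (rule imageI)
 thus ?thesis using bspec[OF al(2) \<open>stg l:S\<close>] bspec[OF less.prems(2) \<open>l:T\<close>] \<open>stg l ~= w\<close> by simp
 qed
 obtain l0 where "l0:New" using al(1) unfolding S_def New_def by (elim imageE) simp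
 hence "card Old < card T" unfolding Old_def New_def by (intro psubset_card_mono less.prems(1)) auto
 moreover have "!l:Old. lab l" using O by blast
 ultimately obtain lo where lo: "set lo = Old" and ih: "!n L N. !p:CP. EX m q av bv. N<=m & q<~p &
 (!l:Old. q:valF l m (av l) & q:valG l m (bv l)) & q:H n L (map av lo) (map bv lo)"
 using less.hyps[OF _ fN(2)] by (elim meta_impE exE conjE)
 obtain ln where ln: "set ln = New" "distinct ln" using finite_distinct_list[OF fN(1)] by blast
 have "EX m q av bv. M<=m & q<~p & (!l:T. q:valF l m (av l) & q:valG l m (bv l)) &
 q:H n L (map av (ln @ lo)) (map bv (ln @ lo))" if p: "p:CP" for n L p and M :: nat
 proof -
 \<comment> \<open>The finite map at \<open>w\<close> is decided before \<open>m\<close> is chosen,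
   so that \<open>m\<close> can be taken beyond its domain.\<close>
 have "EX p1 N. p1<~p & (!r m X k. r<~res w p1 --> N<=m --> finite X --> X<=elts lam -->
 (EX p2. p2<~p1 & p2<~res w r & (!xx:X. p2:coh w xx m (k xx))))" by (rule coh_step[OF ad alim p])
 then obtain p1 N1 where p1: "p1<~p" and step: "!!r m X k. r<~res w p1 ==> N1<=m ==> finite X ==>
 X<=elts lam ==> EX p2. p2<~p1 & p2<~res w r & (!xx:X. p2:coh w xx m (k xx))" by (elim exE conjE) blast
 have rc: "res w p1:CP" using le_conds[OF res_weaker[OF ad]] le_conds[OF p1] by simp
 have "EX m q av bv. max M N1<=m & q<~res w p1 & (!l:Old. q:valF l m (av l) & q:valG l m (bv l)) &
 q:H (n + length ln) L (map av lo) (map bv lo)" by (rule ih[rule_format, OF rc])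
 then obtain m q av bv where mN: "max M N1<=m" and q: "q<~res w p1"
 "!l:Old. q:valF l m (av l) & q:valG l m (bv l)" "q:H (n + length ln) L (map av lo) (map bv lo)" by (elim exE conjE)
 have osub: "set (map av lo)<=elts w" "set (map bv lo)<=elts w"
 proof -
 have "av l:elts w & bv l:elts w" if "l:Old" for l using q(2) that O[OF that] val_in ord_sub[OF ad] by blast
 thus "set (map av lo)<=elts w" "set (map bv lo)<=elts w" using lo by auto
 qed
 have "EX q' av' bv'. q'<~q & (!l:set ln. av' l:elts w & bv' l:elts w &
 q':cval (snd l) m (if fst l then av' l else bv' l)) &
 q':H n L (map av' ln @ map av lo) (map bv' ln @ map bv lo)" by (rule block[OF ga _ ln(2) osub q(3)]) (use N ln(1) in simp)
 then obtain q' av' bv' where q': "q'<~q" "!l:New. av' l:elts w & bv' l:elts w &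
 q':cval (snd l) m (if fst l then av' l else bv' l)"
 "q':H n L (map av' ln @ map av lo) (map bv' ln @ map bv lo)" unfolding ln(1) by (elim exE conjE)
 define a b where "a l = (if l:New then av' l else av l)" and "b l = (if l:New then bv' l else bv l)" for l
 have ab: "map a (ln @ lo) = map av' ln @ map av lo" "map b (ln @ lo) = map bv' ln @ map bv lo"
 using ln(1) lo unfolding a_def b_def Old_def by auto
 \<comment> \<open>The number under which the enumeration of \<open>w\<close> lists the answer
   required of the label that reads the real \<open>xx\<close>.\<close>
 define k where "k xx = (let l = inv_into (UNIV \<times> {tt. proper tt}) xi xx in
 to_nat_on (elts w) (if fst l then bv' l else av' l))" for xx
 have ca: "countable (elts w)" using delta_countable[OF ad] .
 have kx: "from_nat_into (elts w) (k (xi l)) = (if fst l then bv' l else av' l)" if l: "l:New" for l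
 proof -
 have "l:UNIV \<times> {tt. proper tt}" using N l by (cases l) auto
 from inv_into_f_f[OF xi(1) this] show ?thesis
 unfolding k_def using q'(2) l from_nat_into_to_nat_on[OF ca] by (simp add: Let_def)
 qed
 have "xi l:elts lam" if "l:New" for l using xi(2)[of "snd l" "fst l"] N that by simp
 hence "xi ` New<=elts lam" by blast
 moreover have "q'<~res w p1" by (rule le_tr[OF q'(1) q(1)])
 ultimately have "EX p2. p2<~p1 & p2<~res w q' & (!xx:xi ` New. p2:coh w xx m (k xx))"
 using step[of q' m "xi ` New" k] mN fN(1) by simp
 then obtain p2 where p2: "p2<~p1" "p2<~res w q'" "!xx:xi ` New. p2:coh w xx m (k xx)" by (elim exE conjE)
 \<comment> \<open>\<open>p2\<close> need not extend \<open>q'\<close>, only its part below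
   \<open>w\<close>; membership in sets measured at \<open>w\<close> is not lost.\<close>
 have down: "p2:X" if "opn X" "meas w X" "q':X" for X by (rule opnD[OF that(1) _ p2(2)]) (use that in "simp add: meas_def")
 have new: "p2:valF l m (a l) & p2:valG l m (b l)" if l: "l:New" for l
 proof -
 have pl: "lab l" "stg l = w" using N l by auto
 have "p2:cval (snd l) m (if fst l then av' l else bv' l)"
 by (rule down[OF opn_cval]) (use cval_props(1)[OF pl(1)] pl(2) q'(2) l in auto)
 moreover have "p2:partner l m (if fst l then bv' l else av' l)" unfolding partner_def using p2(3) l kx[OF l] pl(2) by auto
 ultimately show ?thesis unfolding valF_def valG_def a_def b_def using l by auto
 qed
 have old: "p2:valF l m (a l) & p2:valG l m (b l)" if l: "l:Old" for l
 proof -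
 have "l~:New" using l unfolding Old_def by blast
 hence e: "a l = av l" "b l = bv l" unfolding a_def b_def by auto
 have pl: "lab l" "stg l:elts w" using O[OF l] by auto
 have qq: "q':valF l m (av l)" "q':valG l m (bv l)"
 using opnD[OF val_opn(1)[OF pl(1)] _ q'(1)] opnD[OF val_opn(2)[OF pl(1)] _ q'(1)] q(2) l by blast+
 show ?thesis unfolding e using down[OF val_opn(1)[OF pl(1)] val_old(1)[OF pl ga] qq(1)]
 down[OF val_opn(2)[OF pl(1)] val_old(2)[OF pl ga] qq(2)] by simp
 qed
 have s: "set (map a (ln @ lo))<=elts w" "set (map b (ln @ lo))<=elts w" unfolding ab using osub q'(2) ln(1) by auto
 have "meas w (H n L (map a (ln @ lo)) (map b (ln @ lo)))" using ga s unfolding good_def by blast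
 hence h: "p2:H n L (map a (ln @ lo)) (map b (ln @ lo))" by (rule down[OF H_opn]) (simp only: ab q'(3))
 have "M<=m" "p2<~p" using mN le_tr[OF p2(1) p1] by auto
 moreover have "!l:T. p2:valF l m (a l) & p2:valG l m (b l)" using new old TU by blast
 ultimately show ?thesis using h by (intro exI conjI)
 qed
 moreover have "set (ln @ lo) = T" using ln(1) lo TU by auto
 ultimately show ?thesis by blast
 qed
qed

end

section \<open>A name for an ultrafilter\<close>

context staged
begin

text \<open>A pair \<open>(X, q)\<close> stands for the requirement that \<open>q\<close> forces the set \<open>{m. X m meets the generic filter}\<close>
  to belong to the ultrafilter.\<close>

definition reqs :: "((nat => 'a set) \<times> 'a) set" where "reqs = {s. (!m. opn (fst s m)) & snd s:CP}"

text \<open>The bound \<open>N\<close> demands infinitely many common indices, which keeps the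
  ultrafilter nonprincipal.\<close>

definition fip :: "((nat => 'a set) \<times> 'a) set => bool"
 where "fip S <-> (!T p N. finite T --> T<=S --> p:CP --> (!s:T. p<~snd s) -->
 (EX m r. N<=m & r<~p & (!s:T. r:fst s m)))"

lemma fip_maximal:
 assumes "S0<=reqs" "fip S0"
 shows "EX S. S0<=S & S<=reqs & fip S & (!s:reqs. fip (insert s S) --> s:S)"
proof -
 let ?A = "{S. S0<=S & S<=reqs & fip S}"
 have "EX S:?A. !X:?A. S<=X --> X = S"
 proof (rule subset_Zorn_nonempty)
 show "?A ~= {}" using assms by blast
 fix C assume C: "C ~= {}" "subset.chain ?A C"
 have "fip (\<Union>C)" unfolding fip_def
 proof (intro allI impI)
 fix T p and N :: nat assume T: "finite T" "T<=\<Union>C" and p: "p:CP" "!s:T. p<~snd s"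
 obtain B where B: "B:C" "T<=B" using finite_subset_Union_chain[OF T C] by blast
 hence "fip B" using C(2) unfolding subset.chain_def by blast
 thus "EX m r. N<=m & r<~p & (!s:T. r:fst s m)" using T(1) B(2) p unfolding fip_def by simp
 qed
 moreover have "S0<=\<Union>C" "\<Union>C<=reqs" using C unfolding subset.chain_def by blast+
 ultimately show "\<Union>C:?A" by blast
 qed
 then obtain S where S: "S:?A" "!X:?A. S<=X --> X = S" by (elim bexE)
 have "s:S" if "s:reqs" "fip (insert s S)" for s
 proof -
 have "insert s S:?A" using S(1) that by auto
 hence "insert s S = S" using S(2) by auto
 thus ?thesis by auto
 qed
 thus ?thesis using S(1) by blast
qed

end

locale bultra = staged P de lam res sup coh D for P :: "'a::zfc forcing" and de lam res sup coh D +
 fixes S :: "((nat => 'a set) \<times> 'a) set"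
 assumes S_reqs: "S<=reqs" and S_fip: "fip S" and S_max: "s:reqs ==> fip (insert s S) ==> s:S"
begin

lemma S_opn: "(X, q):S ==> opn (X m) & q:CP" using subsetD[OF S_reqs] unfolding reqs_def by fastforce

text \<open>By maximality \<open>(Y, q)\<close> belongs to \<open>S\<close> as soon as, densely
  below \<open>q\<close>, finitely many requirements of \<open>S\<close> imply \<open>Y\<close> at
  all large indices.\<close>

lemma S_intro:
 assumes Y: "!!m. opn (Y m)" and q: "q:CP"
 and h: "!!p. p<~q ==> EX p' S0 N. p'<~p & finite S0 & S0<=S & (!s:S0. p'<~snd s) &
 (!m r. N<=m --> r<~p' --> (!s:S0. r:fst s m) --> (EX r'. r'<~r & r':Y m))"
 shows "(Y, q):S"
proof (rule S_max)
 show "(Y, q):reqs" using Y q unfolding reqs_def by simp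
 show "fip (insert (Y, q) S)" unfolding fip_def
 proof (intro allI impI)
 fix T p and N :: nat assume T: "finite T" "T<=insert (Y, q) S" and p: "p:CP" "!s:T. p<~snd s"
 show "EX m r. N<=m & r<~p & (!s:T. r:fst s m)"
 proof (cases "(Y, q):T")
 case False
 hence "T<=S" using T(2) by blast
 thus ?thesis using S_fip T(1) p unfolding fip_def by simp
 next
 case True
 hence "p<~q" using p(2) by fastforce
 from h[OF this] obtain p' S0 N0 where p': "p'<~p" and S0: "finite S0" "S0<=S" "!s:S0. p'<~snd s"
 "!m r. N0<=m --> r<~p' --> (!s:S0. r:fst s m) --> (EX r'. r'<~r & r':Y m)" by (elim exE conjE)
 let ?T = "(T - {(Y, q)}) Un S0"
 have "finite ?T" "?T<=S" using T S0 by auto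
 moreover have "!s:?T. p'<~snd s" using S0(3) p(2) le_tr[OF p'] by blast
 moreover have "p':CP" using le_conds[OF p'] by simp
 ultimately have "EX m r. max N N0<=m & r<~p' & (!s:?T. r:fst s m)"
 using S_fip[unfolded fip_def, rule_format, of ?T p' "max N N0"] by simp
 then obtain m r where m: "max N N0<=m" and r: "r<~p'" "!s:?T. r:fst s m" by (elim exE conjE)
 hence "EX r'. r'<~r & r':Y m" using S0(4) by simp
 then obtain r' where r': "r'<~r" "r':Y m" by (elim exE conjE)
 have "r':fst s m" if "s:T" for s
 proof (cases "s = (Y, q)")
 case False
 hence s: "s:?T" using that by blast
 hence "s:reqs" using \<open>?T<=S\<close> S_reqs by blast
 hence "opn (fst s m)" unfolding reqs_def by simp
 from opnD[OF this _ r'(1)] show ?thesis using r(2) s by blast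
 qed (use r' in simp)
 moreover have "r'<~p" using le_tr[OF r'(1) le_tr[OF r(1) p']] .
 ultimately show ?thesis using m by (intro exI[of _ m] exI[of _ r']) simp
 qed
 qed
qed

lemma S_mono:
 assumes "(X, s):S" "q<~s" "!!m. opn (Y m)" "!!m r. r<~q ==> r:X m ==> r:Y m"
 shows "(Y, q):S"
proof (rule S_intro[OF assms(3)])
 show "q:CP" using le_conds[OF assms(2)] by simp
 fix p assume p: "p<~q"
 show "EX p' S0 N. p'<~p & finite S0 & S0<=S & (!s:S0. p'<~snd s) &
 (!m r. N<=m --> r<~p' --> (!s:S0. r:fst s m) --> (EX r'. r'<~r & r':Y m))"
 proof (rule exI[of _ p], rule exI[of _ "{(X, s)}"], rule exI[of _ "0::nat"], intro conjI allI impI)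
 fix m r assume r: "r<~p" "!s:{(X, s)}. r:fst s m"
 hence "r:Y m" using assms(4)[OF le_tr[OF r(1) p]] by simp
 thus "EX r'. r'<~r & r':Y m" using le_self[OF r(1)] by blast
 qed (use assms(1) le_tr[OF p assms(2)] le_self[OF p] in simp_all)
qed

lemma S_dense:
 assumes "!!m. opn (Y m)" "q:CP" "!!p. p<~q ==> EX p'. p'<~p & (Y, p'):S"
 shows "(Y, q):S"
proof (rule S_intro[OF assms(1,2)])
 fix p assume "p<~q"
 from assms(3)[OF this] obtain p' where p': "p'<~p" "(Y, p'):S" by (elim exE conjE)
 show "EX p' S0 N. p'<~p & finite S0 & S0<=S & (!s:S0. p'<~snd s) &
 (!m r. N<=m --> r<~p' --> (!s:S0. r:fst s m) --> (EX r'. r'<~r & r':Y m))"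
 by (rule exI[of _ p'], rule exI[of _ "{(Y, p')}"], rule exI[of _ "0::nat"])
 (use p' le_self[OF p'(1)] in "auto dest: le_self")
qed

lemma S_Int:
 assumes "(X, q):S" "(Y, q):S"
 shows "(%m. X m Int Y m, q):S"
proof (rule S_intro)
 show "opn (X m Int Y m)" for m using S_opn[OF assms(1), of m] S_opn[OF assms(2), of m] unfolding opn_def by blast
 show "q:CP" using S_opn[OF assms(1)] by simp
 fix p assume "p<~q"
 thus "EX p' S0 N. p'<~p & finite S0 & S0<=S & (!s:S0. p'<~snd s) &
 (!m r. N<=m --> r<~p' --> (!s:S0. r:fst s m) --> (EX r'. r'<~r & r':X m Int Y m))"
 by (intro exI[of _ p] exI[of _ "{(X, q), (Y, q)}"] exI[of _ "0::nat"])
 (use assms in "auto dest: le_self")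
qed

lemma S_not_empty:
 assumes "(X, q):S"
 shows "EX m r. N<=m & r<~q & r:X m"
proof -
 have "EX m r. N<=m & r<~q & (!s:{(X, q)}. r:fst s m)"
 by (rule S_fip[unfolded fip_def, rule_format]) (use assms S_opn[OF assms] le_refl in auto)
 thus ?thesis by simp
qed

text \<open>If \<open>(Y, q)\<close> cannot be added, some finite set of requirements of
  \<open>S\<close> together with a condition \<open>p\<close> leaves no room for \<open>Y\<close> at
  indices from \<open>N\<close> on; below \<open>p\<close> these requirements therefore imply the
  complement.\<close>

lemma S_ultra:
 assumes Y: "!!m. opn (Y m)" and q: "q:CP" and n: "(Y, q)~:S"
 shows "EX p. p<~q & (%m. {r:CP. !r'. r'<~r --> r'~:Y m}, p):S"
proof -
 have "~ fip (insert (Y, q) S)" using S_max[of "(Y, q)"] n Y q unfolding reqs_def by auto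
 then obtain T p N where T: "finite T" "T<=insert (Y, q) S" and p: "p:CP" "!s:T. p<~snd s"
 and no: "~ (EX m r. N<=m & r<~p & (!s:T. r:fst s m))" unfolding fip_def by metis
 let ?Z = "%m. {r:CP. !r'. r'<~r --> r'~:Y m}"
 have pq: "p<~q"
 proof (cases "(Y, q):T")
 case True thus ?thesis using p(2) by fastforce
 next
 case False
 hence "T<=S" using T(2) by blast
 thus ?thesis using S_fip T(1) p no unfolding fip_def by blast
 qed
 have oZ: "opn (?Z m)" for m unfolding opn_def
 proof (intro conjI subsetI ballI allI impI)
 fix x q assume x: "x:?Z m" and q: "q<~x"
 have "r'~:Y m" if "r'<~q" for r' using x le_tr[OF that q] by blast
 thus "q:?Z m" using le_conds[OF q] by simp
 qed simp
 have "(?Z, p):S"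
 proof (rule S_intro[OF oZ p(1)])
 fix p1 assume p1: "p1<~p"
 show "EX p' S0 N. p'<~p1 & finite S0 & S0<=S & (!s:S0. p'<~snd s) &
 (!m r. N<=m --> r<~p' --> (!s:S0. r:fst s m) --> (EX r'. r'<~r & r':?Z m))"
 proof (rule exI[of _ p1], rule exI[of _ "T - {(Y, q)}"], rule exI[of _ N], intro conjI allI impI ballI)
 fix m r assume m: "N<=m" and r: "r<~p1" "!s:T - {(Y, q)}. r:fst s m"
 have "r'~:Y m" if r': "r'<~r" for r'
 proof
 assume y: "r':Y m"
 have "r':fst s m" if s: "s:T" for s
 proof (cases "s = (Y, q)")
 case False
 hence "s:S" using T(2) s by blast
 hence "opn (fst s m)" using S_reqs unfolding reqs_def by blast
 from opnD[OF this _ r'] show ?thesis using r(2) s False by blast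
 qed (use y in simp)
 moreover have "r'<~p" using le_tr[OF r' le_tr[OF r(1) p1]] .
 ultimately show False using no m by blast
 qed
 thus "EX r'. r'<~r & r':?Z m" using le_self[OF r(1)] le_conds[OF r(1)] by (intro exI[of _ r]) simp
 qed (use T le_self[OF p1] le_tr[OF p1] p(2) in auto)
 qed
 thus ?thesis using pq by (intro exI[of _ p]) simp
qed

section \<open>From requirements to a name for the ultrafilter\<close>

definition nset where "nset X = mkname (range (%m. cn m)) (%z q. EX m. z = cn m & q:X m)"

definition uname :: 'a where "uname = mkname (mkname (range (%m. cn m)) ` UNIV) (%x q. EX X. x = nset X & (X, q):S)"

text \<open>Turns an arbitrary name for a subset of \<omega> into one of the form
  \<open>nset\<close>, to which requirements apply.\<close>

definition traces where "traces x m = {r:CP. r||-cn m:.x}"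

lemma small_nat: "small (range (%m::nat. f m))" by (intro small_countable) simp

lemma nm_nset [simp]: "nm (nset X)" unfolding nset_def by (rule nm_mkname[OF small_nat]) auto

lemma nm_uname [simp]: "nm uname"
 unfolding uname_def by (rule nm_mkname[OF small_mknames[OF small_nat]]) (auto intro!: nm_mkname[OF small_nat])

lemma opn_traces: "opn (traces x m)" unfolding opn_def traces_def
proof (intro conjI subsetI ballI allI impI)
 fix p q assume "p:{r:CP. r||-cn m:.x}" "q<~p"
 thus "q:{r:CP. r||-cn m:.x}" using fo_mono[of p _ q] le_conds by blast
qed simp

lemma nsetD: "p||-x:.nset X ==> (!!m. opn (X m)) ==> q<~p ==> EX r m. r<~q & r:X m & feq r x (cn m)"
proof -
 assume "p||-x:.nset X" and o: "!!m. opn (X m)" and "q<~p"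
 hence "EX r z s. r<~q & z:range (%m. cn m) & (EX m. z = cn m & s:X m) & r<~s & feq r x z"
 unfolding nset_def fo_mkname[OF small_nat] by blast
 then obtain r s m where "r<~q" "s:X m" "r<~s" "feq r x (cn m)" by (elim exE conjE) simp
 thus ?thesis using opnD[OF o] by blast
qed

lemma nsetI: "r:X m ==> opn (X m) ==> r||-cn m:.nset X"
proof -
 assume r: "r:X m" "opn (X m)"
 hence rc: "r:CP" by (rule opn_conds[rotated])
 have "vpair (cn m) r:elts (nset X)" unfolding nset_def elts_mkname[OF small_nat] using r rc by blast
 thus ?thesis by (rule elts_forced[OF _ le_refl[OF rc]])
qed

lemma omega_member: "q||-x:.cw ==> p<~q ==> EX r m. r<~p & feq r x (cn m)" unfolding fo_Mem_check elts_vomega by blast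

lemma nset_traces:
 assumes "nm x" "q||-is_subset x cw"
 shows "feq q x (nset (traces x))"
proof (rule fo_ext[OF assms(1) nm_nset])
 fix z p assume z: "nm z" "p<~q"
 show "p||-z:.x <-> p||-z:.nset (traces x)"
 proof
 assume h: "p||-z:.x"
 have "p||-z:.cw" using assms(2) h z unfolding is_subset_def fo_AllIn by blast
 show "p||-z:.nset (traces x)"
 proof (rule fo_dense)
 fix p' assume p': "p'<~p"
 obtain r m where r: "r<~p'" "feq r z (cn m)" using omega_member[OF \<open>p||-z:.cw\<close> p'] by (elim exE conjE)
 have "r||-cn m:.x" by (rule Mem_eq1[OF fo_mono[OF h le_tr[OF r(1) p']] r(2)])
 hence "r:traces x m" unfolding traces_def using le_conds[OF r(1)] by simp
 from Mem_eq1[OF nsetI[where X = "traces x", OF this opn_traces] feq_sym[OF r(2)]]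
 show "EX r. r<~p' & r||-z:.nset (traces x)" using r(1) by blast
 qed
 next
 assume h: "p||-z:.nset (traces x)"
 show "p||-z:.x"
 proof (rule fo_dense)
 fix p' assume "p'<~p"
 from nsetD[OF h opn_traces this] obtain r m where r: "r<~p'" "r:traces x m" "feq r z (cn m)" by (elim exE conjE)
 have "r||-cn m:.x" using r(2) unfolding traces_def by simp
 from Mem_eq1[OF this feq_sym[OF r(3)]] show "EX r. r<~p' & r||-z:.x" using r(1) by blast
 qed
 qed
qed

lemma unameI: "(X, q):S ==> p<~q ==> p||-nset X:.uname"
proof -
 assume X: "(X, q):S" and p: "p<~q"
 have "vpair (nset X) q:elts uname" unfolding uname_def elts_mkname[OF small_mknames[OF small_nat]]
 using X S_opn[OF X] by (auto simp: nset_def)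
 thus ?thesis by (rule elts_forced[OF _ p])
qed

text \<open>A member of \<open>uname\<close> is densely equal to some \<open>nset X\<close> with a
  requirement in \<open>S\<close>, and \<open>S_dense\<close> collects these local requirements.
  Questions about the ultrafilter thus become questions about \<open>S\<close>.\<close>

lemma uname_iff:
 assumes x: "nm x" and q: "q:CP"
 shows "q||-x:.uname <-> q||-is_subset x cw & (traces x, q):S"
proof
 assume h: "q||-is_subset x cw & (traces x, q):S"
 hence "q||-nset (traces x):.uname" using unameI le_refl[OF q] by blast
 thus "q||-x:.uname" using Mem_eq1 feq_sym[OF nset_traces[OF x]] h by blast
next
 assume h: "q||-x:.uname"
 have ev: "EX r X s. r<~p & (X, s):S & r<~s & feq r x (nset X)" if p: "p<~q" for p
 proof -
 have "EX r z s. r<~p & z:mkname (range (%m. cn m)) ` UNIV & (EX X. z = nset X & (X, s):S) & r<~s & feq r x z"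
 using h p unfolding uname_def fo_mkname[OF small_mknames[OF small_nat]] by blast
 thus ?thesis by (elim exE conjE) metis
 qed
 have "q||-is_subset x cw" unfolding is_subset_def fo_AllIn
 proof (intro allI impI)
 fix z p assume z: "nm z" "p<~q" "p||-z:.x"
 show "p||-z:.cw"
 proof (rule fo_dense)
 fix p' assume p': "p'<~p"
 obtain r X s where r: "r<~p'" "(X, s):S" "feq r x (nset X)" using ev[OF le_tr[OF p' z(2)]] by (elim exE conjE)
 have "r||-z:.nset X" by (rule Mem_eq2[OF fo_mono[OF z(3) le_tr[OF r(1) p']] r(3)])
 from nsetD[OF this conjunct1[OF S_opn[OF r(2)]] le_self[OF r(1)]]
 obtain r' m where r': "r'<~r" "feq r' z (cn m)" by (elim exE conjE)
 have "r'||-cn m:.cw" by (rule check_mem) (simp add: elts_vomega)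
 from Mem_eq1[OF this feq_sym[OF r'(2)]] show "EX r. r<~p' & r||-z:.cw" using le_tr[OF r'(1) r(1)] by blast
 qed
 qed
 moreover have "(traces x, q):S"
 proof (rule S_dense[OF opn_traces q])
 fix p assume "p<~q"
 from ev[OF this] obtain r X s where r: "r<~p" "(X, s):S" "r<~s" "feq r x (nset X)" by (elim exE conjE)
 have "(traces x, r):S"
 proof (rule S_mono[OF r(2,3) opn_traces])
 fix m r' assume r': "r'<~r" "r':X m"
 have "r'||-cn m:.nset X" using nsetI[where X = X, OF r'(2)] S_opn[OF r(2)] by blast
 from Mem_eq2[OF this feq_sym[OF feq_mono[OF r(4) r'(1)]]]
 show "r':traces x m" unfolding traces_def using le_conds[OF r'(1)] by simp
 qed
 thus "EX p'. p'<~p & (traces x, p'):S" using r(1) by blast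
 qed
 ultimately show "q||-is_subset x cw & (traces x, q):S" by blast
qed

lemma tracesD: "r:traces x m <-> r:CP & r||-cn m:.x" unfolding traces_def by simp

theorem uname_ultrafilter:
 assumes p: "p:CP"
 shows "p||-is_nonprincipal_ultrafilter cw uname"
proof -
 let ?w = "cw"
 have top: "(%m. CP, q):S" if q: "q:CP" for q
 proof (rule S_intro[OF _ q])
 show "opn CP" unfolding opn_def using le_conds by blast
 fix p assume "p<~q"
 thus "EX p' S0 N. p'<~p & finite S0 & S0<=S & (!s:S0. p'<~snd s) &
 (!m r. N<=m --> r<~p' --> (!s:S0. r:fst s m) --> (EX r'. r'<~r & r':CP))"
 by (intro exI[of _ p] exI[of _ "{}"] exI[of _ "0::nat"]) (auto dest: le_self le_conds)
 qed
 have 1: "p||-(!.X:.uname. is_subset X ?w)" unfolding fo_AllIn using uname_iff le_conds by blast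
 have 2: "p||-?w:.uname"
 proof -
 have "p||-is_subset ?w ?w" by (simp add: is_subset_def fo_AllIn)
 moreover have "(traces ?w, p):S" by (rule S_mono[OF top[OF p] le_refl[OF p] opn_traces])
 (auto simp: tracesD elts_vomega intro!: check_mem)
 ultimately show ?thesis using uname_iff[OF nm_check p] by blast
 qed
 have 3: "p||-(!.X:.uname. !.Y. is_subset X Y &. is_subset Y ?w ->. Y:.uname)" unfolding fo_AllIn forces_All fo_Imp forces_Conj
 proof (intro allI impI, elim conjE)
 fix X q Y r assume X: "nm X" "q||-X:.uname" and Y: "nm Y" and r: "r<~q"
 and s: "r||-is_subset X Y" "r||-is_subset Y ?w"
 have rc: "r:CP" using le_conds[OF r] by simp
 have "r||-X:.uname" by (rule fo_mono[OF X(2) r])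
 hence t: "(traces X, r):S" using uname_iff[OF X(1) rc] by blast
 have "(traces Y, r):S"
 proof (rule S_mono[OF t le_refl[OF rc] opn_traces])
 fix m r' assume r': "r'<~r" "r':traces X m"
 thus "r':traces Y m" using s(1) unfolding tracesD is_subset_def fo_AllIn using nm_check by blast
 qed
 thus "r||-Y:.uname" using uname_iff[OF Y rc] s(2) by blast
 qed
 have 4: "p||-(!.X:.uname. !.Y:.uname. !.Z. is_inter Z X Y ->. Z:.uname)" unfolding fo_AllIn forces_All fo_Imp
 proof (intro allI impI)
 fix X q1 Y q Z r assume X: "nm X" "q1||-X:.uname" and Y: "nm Y" "q<~q1" "q||-Y:.uname"
 and Z: "nm Z" and r: "r<~q" "r||-is_inter Z X Y"
 have rc: "r:CP" using le_conds[OF r(1)] by simp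
 have "r||-X:.uname" "r||-Y:.uname" using fo_mono[OF X(2) le_tr[OF r(1) Y(2)]] fo_mono[OF Y(3) r(1)] by auto
 hence t: "(traces X, r):S" "(traces Y, r):S" and sX: "r||-is_subset X ?w"
 using uname_iff[OF X(1) rc] uname_iff[OF Y(1) rc] by auto
 have iff: "r'||-z:.Z <-> r'||-z:.X & r'||-z:.Y" if "nm z" "r'<~r" for z r'
 using r(2) that le_self[OF that(2)] unfolding is_inter_def forces_All fo_Iff forces_Conj by blast
 have "(traces Z, r):S" by (rule S_mono[OF S_Int[OF t] le_refl[OF rc] opn_traces]) (use iff[OF nm_check] in "auto simp: tracesD")
 moreover have "r||-is_subset Z ?w" using sX iff unfolding is_subset_def fo_AllIn by blast
 ultimately show "r||-Z:.uname" using uname_iff[OF Z rc] by blast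
 qed
 have 5: "p||-(!.X Y. is_subset X ?w &. is_diff Y ?w X ->. (X:.uname <->. ~. Y:.uname))"
 unfolding forces_All fo_Imp fo_Iff forces_Conj
 proof (intro allI impI, elim conjE)
 fix X Y q r assume X: "nm X" "nm Y" and q: "q||-is_subset X ?w" "q||-is_diff Y ?w X" and r: "r<~q"
 have rc: "r:CP" using le_conds[OF r] by simp
 have iff: "r'||-z:.Y <-> r'||-z:.?w & (!s. s<~r' --> ~ s||-z:.X)" if "nm z" "r'<~r" for z r'
 using q(2) that le_tr[OF that(2) r] unfolding is_diff_def forces_All fo_Iff forces_Conj fo_Neg by blast
 have sX: "r'||-is_subset X ?w" "r'||-is_subset Y ?w" if r': "r'<~r" for r'
 proof -
 show "r'||-is_subset X ?w" by (rule fo_mono[OF q(1) le_tr[OF r' r]])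
 show "r'||-is_subset Y ?w" unfolding is_subset_def fo_AllIn using iff le_tr[OF _ r'] by blast
 qed
 have trY: "s:traces Y m <-> s:{r:CP. !r'. r'<~r --> r'~:traces X m}" if "s<~r" for s m
 proof -
 have "s||-cn m:.?w" by (rule check_mem) (simp add: elts_vomega)
 thus ?thesis using iff[OF nm_check that] le_conds unfolding tracesD by blast
 qed
 show "r||-X:.uname <-> r||-(~. Y:.uname)"
 proof
 assume x: "r||-X:.uname"
 show "r||-(~. Y:.uname)" unfolding fo_Neg
 proof (intro allI impI notI)
 fix s assume s: "s<~r" "s||-Y:.uname"
 have sc: "s:CP" using le_conds[OF s(1)] by simp
 have "(traces X, s):S" "(traces Y, s):S" using fo_mono[OF x s(1)] s(2) uname_iff[OF X(1) sc] uname_iff[OF X(2) sc] by auto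
 from S_not_empty[OF S_Int[OF this], of 0]
 obtain m t where t: "t<~s" "t:traces X m" "t:traces Y m" by blast
 thus False using trY[OF le_tr[OF t(1) s(1)]] le_self[OF t(1)] by blast
 qed
 next
 assume y: "r||-(~. Y:.uname)"
 have "(traces X, r):S"
 proof (rule ccontr)
 assume "(traces X, r)~:S"
 from S_ultra[OF opn_traces rc this]
 obtain s where s: "s<~r" "(%m. {r:CP. !r'. r'<~r --> r'~:traces X m}, s):S" by (elim exE conjE)
 have "(traces Y, s):S"
 proof (rule S_mono[OF s(2) le_self[OF s(1)] opn_traces])
 fix m t assume t: "t<~s" "t:{r:CP. !r'. r'<~r --> r'~:traces X m}"
 show "t:traces Y m" using trY[OF le_tr[OF t(1) s(1)]] t(2) by simp
 qed
 moreover have "s:CP" using le_conds[OF s(1)] by simp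
 ultimately have "s||-Y:.uname" using uname_iff[OF X(2)] sX(2)[OF s(1)] by blast
 thus False using y s(1) unfolding fo_Neg by blast
 qed
 thus "r||-X:.uname" using uname_iff[OF X(1) rc] sX(1)[OF le_refl[OF rc]] by blast
 qed
 qed
 have 6: "p||-(!.n:.?w. !.Z. is_upair Z n n ->. ~. Z:.uname)" unfolding fo_AllIn forces_All fo_Imp fo_Neg
 proof (intro allI impI notI)
 fix n q Z r s assume n: "nm n" "q||-n:.?w" and Z: "nm Z" and r: "r<~q" "r||-is_upair Z n n"
 and s: "s<~r" "s||-Z:.uname"
 obtain t k where t: "t<~s" "feq t n (cn k)" using omega_member[OF n(2) le_tr[OF s(1) r(1)]] by (elim exE conjE)
 have tc: "t:CP" using le_conds[OF t(1)] by simp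
 have "(traces Z, t):S" using fo_mono[OF s(2) t(1)] uname_iff[OF Z tc] by blast
 \<comment> \<open>The set contains an index beyond \<open>k\<close>, so it cannot be the singleton
   of \<open>k\<close>.\<close>
 from S_not_empty[OF this, of "Suc k"] obtain m u where u: "Suc k<=m" "u<~t" "u:traces Z m" by (elim exE conjE)
 have ur: "u<~r" using le_tr[OF u(2) le_tr[OF t(1) s(1)]] .
 have "u||-(cn m =. n |. cn m =. n)" using r(2) ur u(3) unfolding is_upair_def forces_All fo_Iff tracesD using nm_check by blast
 then obtain v where v: "v<~u" "feq v (cn m) n" unfolding fo_Disj fo_Equ using le_self[OF ur] by blast
 have "feq v (cn m) (cn k)" by (rule feq_trans[OF v(2) feq_mono[OF t(2) le_tr[OF v(1) u(2)]]])
 thus False using check_eq[of v] le_conds[OF v(1)] u(1) by simp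
 qed
 show ?thesis unfolding is_nonprincipal_ultrafilter_def forces_Conj using 1 2 3 4 5 6 by (intro conjI)
qed

end

section \<open>Ehrenfeucht games and elementary equivalence\<close>

text \<open>\<open>L\<close> is a finite list of atomic formulas, given by a symbol and the positions of its arguments
  in the tuples.\<close>

primrec game_equiv :: "'b set => 'c set => ('t => 'b list => bool) => ('t => 'c list => bool) => nat =>
 ('t \<times> nat list) list => 'b list => 'c list => bool" where
 "game_equiv A B at at' 0 L as bs <-> (!(tg, is):set L. (!i:set is. i < length as & i < length bs) -->
 (at tg (map (nth as) is) <-> at' tg (map (nth bs) is)))"
 | "game_equiv A B at at' (Suc n) L as bs <->
 (!a:A. EX b:B. game_equiv A B at at' n L (a # as) (b # bs)) &
 (!b:B. EX a:A. game_equiv A B at at' n L (a # as) (b # bs))"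

text \<open>\<open>DD k\<close> holds of the pairs of \<open>k\<close>-ary relations defined in the two structures by the same formula.
  Finitely many of them suffice to win the game of length \<open>n\<close>.\<close>

lemma definable_game:
 assumes neg: "!!k X Y. DD k X Y ==> DD k (%l. ~ X l) (%l. ~ Y l)"
 and conj: "!!k X Y X' Y'. DD k X Y ==> DD k X' Y' ==> DD k (%l. X l & X' l) (%l. Y l & Y' l)"
 and triv: "!!k. DD k (%l. True) (%l. True)"
 and ex: "!!k X Y. DD (Suc k) X Y ==> DD k (%l. EX a:A. X (a # l)) (%l. EX b:B. Y (b # l))"
 and atom: "!!k tg is. !i:set is. i < k ==> DD k (%l. at tg (map (nth l) is)) (%l. at' tg (map (nth l) is))"
 and zero: "!!X Y. DD 0 X Y ==> X [] <-> Y []"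
 shows "game_equiv A B at at' n L [] []"
proof -
 have fin: "DD k (%l. !ph:Pf. fst (h ph) l) (%l. !ph:Pf. snd (h ph) l)" if "finite Pf" "!ph:Pf. DD k (fst (h ph)) (snd (h ph))"
 for k and Pf :: "(('a list => bool) \<times> ('b list => bool)) set" and h :: "(('a list => bool) \<times> ('b list => bool)) => _"
 using that by (induction Pf) (auto intro!: triv conj)
 have "EX Pf. finite Pf & (!ph:Pf. DD k (fst ph) (snd ph)) &
 (!as bs. length as = k --> length bs = k --> (!ph:Pf. fst ph as <-> snd ph bs) --> game_equiv A B at at' n L as bs)" for k
 proof (induction n arbitrary: k)
 case 0
 let ?F = "(%(tg, is). (%l. at tg (map (nth l) is), %l. at' tg (map (nth l) is))) ` {(tg, is):set L. !i:set is. i < k}"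
 show ?case
 proof (rule exI[of _ ?F], intro conjI)
 have "{(tg, is):set L. !i:set is. i < k}<=set L" by blast
 thus "finite ?F" using finite_subset by blast
 show "!ph:?F. DD k (fst ph) (snd ph)" using atom by auto
 qed fastforce
 next
 case (Suc n)
 from Suc.IH[of "Suc k"] obtain Pf where P: "finite Pf" "!ph:Pf. DD (Suc k) (fst ph) (snd ph)"
 "!!as bs. length as = Suc k ==> length bs = Suc k ==> !ph:Pf. fst ph as <-> snd ph bs ==> game_equiv A B at at' n L as bs"
 by blast
 \<comment> \<open>\<open>Ps\<close> prescribes which of the finitely many formulas found for
   \<open>n\<close> hold of the extended tuple. The formulas for \<open>Suc n\<close> say that some
   element realizes a given prescription, and there are finitely many of these.\<close>
 define X where "X Ps l <-> (EX a:A. !ph:Pf. fst ph (a # l) <-> ph:Ps)" for Ps l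
 define Y where "Y Ps l <-> (EX b:B. !ph:Pf. snd ph (b # l) <-> ph:Ps)" for Ps l
 have D: "DD k (X Ps) (Y Ps)" for Ps
 proof -
 define h where "h ph = (if ph:Ps then ph else (%l. ~ fst ph l, %l. ~ snd ph l))"
 for ph :: "('a list => bool) \<times> ('b list => bool)"
 have "!ph:Pf. DD (Suc k) (fst (h ph)) (snd (h ph))" unfolding h_def using P(2) neg by auto
 from ex[OF fin[OF P(1) this]] have "DD k (%l. EX a:A. !ph:Pf. fst (h ph) (a # l)) (%l. EX b:B. !ph:Pf. snd (h ph) (b # l))" .
 moreover have "fst (h ph) l <-> (fst ph l <-> ph:Ps)" "snd (h ph) l' <-> (snd ph l' <-> ph:Ps)" for ph l l'
 unfolding h_def by auto
 ultimately show ?thesis unfolding X_def[abs_def] Y_def[abs_def] by simp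
 qed
 show ?case
 proof (rule exI[of _ "(%Ps. (X Ps, Y Ps)) ` Pow Pf"], intro conjI allI impI)
 show "finite ((%Ps. (X Ps, Y Ps)) ` Pow Pf)" using P(1) by simp
 show "!ph:(%Ps. (X Ps, Y Ps)) ` Pow Pf. DD k (fst ph) (snd ph)" using D by auto
 fix as bs assume l: "length as = k" "length bs = k"
 and h: "!ph:(%Ps. (X Ps, Y Ps)) ` Pow Pf. fst ph as <-> snd ph bs"
 have XY: "X Ps as <-> Y Ps bs" if "Ps<=Pf" for Ps using h that by auto
 show "game_equiv A B at at' (Suc n) L as bs" unfolding game_equiv.simps
 proof (intro conjI ballI)
 fix a assume a: "a:A"
 \<comment> \<open>The prescription realized by \<open>a\<close>; since \<open>as\<close> and
   \<open>bs\<close> agree on it, the other structure realizes it by some \<open>b\<close>.\<close>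
 have "X {ph:Pf. fst ph (a # as)} as" unfolding X_def by (rule bexI[OF _ a]) auto
 hence "Y {ph:Pf. fst ph (a # as)} bs" by (subst XY[symmetric]) auto
 then obtain b where b: "b:B" "!ph:Pf. snd ph (b # bs) <-> ph:{ph:Pf. fst ph (a # as)}" unfolding Y_def by (elim bexE)
 hence "game_equiv A B at at' n L (a # as) (b # bs)" by (intro P(3)) (use l in auto)
 thus "EX b:B. game_equiv A B at at' n L (a # as) (b # bs)" using b(1) by blast
 next
 fix b assume b: "b:B"
 have "Y {ph:Pf. snd ph (b # bs)} bs" unfolding Y_def by (rule bexI[OF _ b]) auto
 hence "X {ph:Pf. snd ph (b # bs)} as" by (subst XY) auto
 then obtain a where a: "a:A" "!ph:Pf. fst ph (a # as) <-> ph:{ph:Pf. snd ph (b # bs)}" unfolding X_def by (elim bexE)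
 hence "game_equiv A B at at' n L (a # as) (b # bs)" by (intro P(3)) (use l in auto)
 thus "EX a:A. game_equiv A B at at' n L (a # as) (b # bs)" using a(1) by blast
 qed
 qed
 qed
 from this[of 0] obtain Pf where "!ph:Pf. DD 0 (fst ph) (snd ph)"
 "!!as bs. length as = 0 ==> length bs = 0 ==> !ph:Pf. fst ph as <-> snd ph bs ==> game_equiv A B at at' n L as bs" by blast
 thus ?thesis using zero by blast
qed

section \<open>Languages, structures and term evaluation inside a two-valued structure\<close>

context gmodel
begin

lemma isf_dom: "isf s X ==> isf s Y ==> X = Y" by (rule el_eqI) (metis isf_def isf_iff)

definition Struct where "Struct R F ar A I <-> el A ~= {} & (EX X. el X = el R Un el F & isf I X) &
 (!r:el R. !n V. iop r n:el ar --> iop r V:el I --> (!s:el V. Fn s n A)) &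
 (!f:el F. !n V. iop f n:el ar --> iop f V:el I --> Fn V (ifs n A) A)"

definition Lang where "Lang R F ar <-> el R Int el F = {} & (EX X. el X = el R Un el F & Fn ar X om &
 (EX f. Fn f X om & inj_on (ap f) (el X)))"

lemma ifs_iff: "el D = {f. Fn f X Y} <-> D = ifs X Y" by (metis el_ifs el_inject)

lemma tr_is_structure [simp]:
 assumes "nm R" "nm F" "nm ar" "nm A" "nm I"
 shows "tr (is_structure R F ar A I) <-> Struct (kap R) (kap F) (kap ar) (kap A) (kap I)"
 using assms unfolding is_structure_def Struct_def by (auto simp: ifs_iff)

lemma tr_is_language [simp]:
 assumes "nm R" "nm F" "nm ar"
 shows "tr (is_countable_language R F ar) <-> Lang (kap R) (kap F) (kap ar)"
 using assms unfolding is_countable_language_def Lang_def by auto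

subsection \<open>Evaluation of terms\<close>

abbreviation iVar where "iVar i == iop (num 0) i"
abbreviation iApp where "iApp f s == iop (num 1) (iop f s)"

definition closed_T where "closed_T F ar T <-> (!i:el om. iVar i:el T) &
 (!f:el F. !n s. iop f n:el ar --> Fn s n T --> iApp f s:el T)"

definition Terms where "Terms F ar T <-> closed_T F ar T & (!T'. closed_T F ar T' --> el T<=el T')"

definition Ev where "Ev T A I v e <-> Fn e T A & (!i:el om. iop (iVar i) (ap v i):el e) &
 (!f s c V a. iApp f s:el T --> el c = {iop k y |k x y. iop k x:el s & iop x y:el e} -->
 iop f V:el I --> iop c a:el V --> iop (iApp f s) a:el e)"

lemma tr_is_terms: "nm w ==> nm F ==> nm ar ==> nm T ==> kap w = om ==>
 tr (is_terms w F ar T) <-> Terms (kap F) (kap ar) (kap T)"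
 unfolding is_terms_def Terms_def closed_terms_def closed_T_def is_Var_def is_App_def by auto

lemma tr_is_evaluation: "nm w ==> nm T ==> nm A ==> nm I ==> nm v ==> nm e ==> kap w = om ==>
 isf (kap v) om ==> tr (is_evaluation w T A I v e) <-> Ev (kap T) (kap A) (kap I) (kap v) (kap e)"
 unfolding is_evaluation_def Ev_def is_Var_def is_App_def by (auto simp: tr_is_comp_iff isf_iff)

text \<open>Terms of the structure may be nonstandard, so evaluation cannot be defined by recursion
  in HOL. It is obtained by comprehension as the least relation closed under the evaluation clauses;
  minimality of \<open>T\<close> makes it total and single-valued.\<close>

lemma evaluation_exists:
 assumes T: "Terms F ar T" and I: "Struct R F ar A I" and v: "Fn v om A"
 shows "EX e. Ev T A I v e"
proof -
 define cl where "cl E <-> (!i:el om. iop (iVar i) (ap v i):el E) &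
 (!f:el F. !n s c V a. iop f n:el ar --> Fn s n T --> Fn c n A --> iop f V:el I --> iop c a:el V -->
 (!j:el n. iop (ap s j) (ap c j):el E) --> iop (iApp f s) a:el E)" for E
 \<comment> \<open>The formula version of \<open>cl\<close>, which makes the intersection of all
   closed relations an internal set.\<close>
 define clF where "clF E = ((!.i:.nu om. !.z a. is_Var z i &. <|i, a|>:.nu v ->. <|z, a|>:.E) &.
 (!.f:.nu F. !.n s. !.c V. !.a z. <|f, n|>:.nu ar &. is_fun s n (nu T) &. is_fun c n (nu A) &.
 <|f, V|>:.nu I &. <|c, a|>:.V &. is_App z f s &.
 (!.j:.n. !.t x. <|j, t|>:.s &. <|j, x|>:.c ->. <|t, x|>:.E) ->. <|z, a|>:.E))" for E
 have extclF: "ext (%x. clF (u x))" if "tm u" for u unfolding clF_def is_Var_def is_App_def using that by simp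
 have vf: "isf v om" using v unfolding Fn_def by simp
 have fpair: "(!t x. iop j t:el s & iop j x:el c --> Q t x) <-> Q (ap s j) (ap c j)"
 if "Fn s n X" "Fn c n Y" "j:el n" for s c n X Y j Q using that isf_iff unfolding Fn_def by auto
 have trclF: "tr (clF (nu E)) <-> cl E" for E
 unfolding clF_def cl_def is_Var_def is_App_def using vf by (auto simp: isf_iff fpair cong: conj_cong)
 define E where "E = irel T A (%t a. !.E'. clF E' ->. <|t, a|>:.E')"
 have elE: "iop t a:el E <-> t:el T & a:el A & (!E'. cl E' --> iop t a:el E')" for t a
 unfolding E_def using trclF by (simp add: el_irel extclF)
 have Tc: "closed_T F ar T" and Tm: "!!T'. closed_T F ar T' ==> el T<=el T'" using T unfolding Terms_def by auto
 have V: "Fn V (ifs n A) A" if "f:el F" "iop f n:el ar" "iop f V:el I" for f n V using I that unfolding Struct_def by blast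
 have VA: "a:el A" if "Fn V (ifs n A) A" "Fn c n A" "iop c a:el V" for V n c a using that isf_iff unfolding Fn_def by auto
 have clE: "cl E" unfolding cl_def
 proof (intro conjI ballI allI impI)
 fix i assume i: "i:el om"
 show "iop (iVar i) (ap v i):el E" unfolding elE using i Tc Fn_ap[OF v i] unfolding closed_T_def cl_def by blast
 next
 fix f n s c V a assume h: "f:el F" "iop f n:el ar" "Fn s n T" "Fn c n A" "iop f V:el I" "iop c a:el V"
 "!j:el n. iop (ap s j) (ap c j):el E"
 have 1: "iApp f s:el T" using Tc h(1-3) unfolding closed_T_def by blast
 have 2: "a:el A" using VA[OF V[OF h(1,2,5)] h(4,6)] .
 have 3: "iop (iApp f s) a:el E'" if E': "cl E'" for E'
 proof -
 have "!j:el n. iop (ap s j) (ap c j):el E'" using h(7) E' unfolding elE by blast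
 thus ?thesis using E' h(1-6) unfolding cl_def by blast
 qed
 show "iop (iApp f s) a:el E" unfolding elE using 1 2 3 by blast
 qed
 \<comment> \<open>Inversion: the pairs of \<open>E\<close> that arise from one of the clauses form
   a closed relation \<open>E2\<close>, so by minimality all pairs of \<open>E\<close> arise in this
   way.\<close>
 define inv where "inv t a <-> iop t a:el E & (!i:el om. t = iVar i --> a = ap v i) &
 (!f s. t = iApp f s --> f:el F & (EX n c V. iop f n:el ar & Fn s n T & Fn c n A & iop f V:el I &
 iop c a:el V & (!j:el n. iop (ap s j) (ap c j):el E)))" for t a
 define E2 where "E2 = irel T A (%t a. <|t, a|>:.nu E &. (!.i:.nu om. is_Var t i ->. <|i, a|>:.nu v) &.
 (!.f s. is_App t f s ->. f:.nu F &. (?.n c V. <|f, n|>:.nu ar &. is_fun s n (nu T) &. is_fun c n (nu A) &.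
 <|f, V|>:.nu I &. <|c, a|>:.V &. (!.j:.n. !.t x. <|j, t|>:.s &. <|j, x|>:.c ->. <|t, x|>:.nu E))))"
 have "el E2 = {iop t a |t a. t:el T & a:el A & inv t a}" unfolding E2_def inv_def is_Var_def is_App_def using vf
 by (subst el_irel) (auto simp: isf_iff fpair cong: conj_cong)
 hence elE2: "iop t a:el E2 <-> t:el T & a:el A & inv t a" for t a by auto
 have "cl E2" unfolding cl_def
 proof (intro conjI ballI allI impI)
 fix i assume i: "i:el om"
 have "iop (iVar i) (ap v i):el E" using clE i unfolding cl_def by blast
 thus "iop (iVar i) (ap v i):el E2" unfolding elE2 inv_def using elE by simp
 next
 fix f n s c V a assume h: "f:el F" "iop f n:el ar" "Fn s n T" "Fn c n A" "iop f V:el I" "iop c a:el V"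
 "!j:el n. iop (ap s j) (ap c j):el E2"
 hence j: "!j:el n. iop (ap s j) (ap c j):el E" unfolding elE2 inv_def by blast
 hence "iop (iApp f s) a:el E" using clE h(1-6) unfolding cl_def by blast
 thus "iop (iApp f s) a:el E2" unfolding elE2 inv_def using h(1-6) j elE by auto
 qed
 hence inv: "inv t a" if "iop t a:el E" for t a using that elE elE2 by blast
 \<comment> \<open>The terms with exactly one value form an internal set closed under term
   formation, so it contains all of \<open>T\<close>.\<close>
 define T' where "T' = icomp T (%t. ?.a. <|t, a|>:.nu E &. (!.b. <|t, b|>:.nu E ->. b =. a))"
 have elT': "t:el T' <-> t:el T & (EX! a. iop t a:el E)" for t unfolding T'_def by (subst el_icomp) auto
 have "closed_T F ar T'" unfolding closed_T_def
 proof (intro conjI ballI allI impI)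
 fix i assume i: "i:el om"
 have "iop (iVar i) (ap v i):el E" using clE i unfolding cl_def by blast
 moreover have "a = ap v i" if "iop (iVar i) a:el E" for a using inv[OF that] i unfolding inv_def by blast
 ultimately show "iVar i:el T'" unfolding elT' using elE by blast
 next
 fix f n s assume f: "f:el F" "iop f n:el ar" and s: "Fn s n T'"
 have sT: "Fn s n T" using s elT' unfolding Fn_def by blast
 have fs: "iApp f s:el T" using Tc f sT unfolding closed_T_def by blast
 have u: "EX! a. iop (ap s j) a:el E" if "j:el n" for j using s that elT' unfolding Fn_def by blast
 define g where "g j = (THE a. iop (ap s j) a:el E)" for j
 have g: "iop (ap s j) a:el E <-> a = g j" if "j:el n" for j a using theI'[OF u[OF that]] u[OF that] unfolding g_def by blast
 have "EX c. Fn c n A & (!j:el n. ap c j = g j)"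
 proof (rule lam_ex[of "%j a. ?.t. <|j, t|>:.nu s &. <|t, a|>:.nu E"])
 fix j assume j: "j:el n"
 have "isf s n" using sT unfolding Fn_def by simp
 moreover have "g j:el A" using g[OF j, of "g j"] elE by blast
 ultimately show "g j:el A & (!y:el A. tr (?.t. <|nu j, t|>:.nu s &. <|t, nu y|>:.nu E) <-> y = g j)"
 using g[OF j] j by (simp add: isf_iff)
 qed simp_all
 then obtain c where c: "Fn c n A" "!j:el n. ap c j = g j" by blast
 obtain V where iV: "iop f V:el I"
 proof -
 obtain X where "el X = el R Un el F" "isf I X" using I unfolding Struct_def by blast
 thus ?thesis using f(1) isf_iff that by blast
 qed
 have VV: "Fn V (ifs n A) A" by (rule V[OF f iV])
 have ca: "iop c a:el V <-> a = ap V c" for a using isf_iff[OF conjunct1[OF VV[unfolded Fn_def]]] c(1) by simp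
 have "iop (iApp f s) (ap V c):el E" using clE f sT c iV g ca unfolding cl_def by auto
 moreover have "a = ap V c" if fa: "iop (iApp f s) a:el E" for a
 proof -
 obtain n' c' V' where h: "Fn s n' T" "Fn c' n' A" "iop f V':el I" "iop c' a:el V'"
 "!j:el n'. iop (ap s j) (ap c' j):el E" using inv[OF fa] unfolding inv_def by blast
 have n: "n' = n" using h(1) sT isf_dom unfolding Fn_def by blast
 have "V' = V"
 proof -
 obtain X where "isf I X" using I unfolding Struct_def by blast
 thus ?thesis using isf_iff[of I X] h(3) iV by simp
 qed
 moreover have "c' = c" by (rule isf_eqI[of _ n]) (use h(2,5) c n g in "auto simp: Fn_def")
 ultimately show ?thesis using h(4) ca by simp
 qed
 ultimately show "iApp f s:el T'" unfolding elT' using fs by blast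
 qed
 hence un: "EX! a. iop t a:el E" if "t:el T" for t using Tm elT' that by blast
 have elEE: "z:el E ==> EX t a. z = iop t a & t:el T & a:el A" for z unfolding E_def by (auto simp: el_irel extclF)
 have "isf E T" unfolding isf_def using elEE un by blast
 hence fE: "Fn E T A" unfolding Fn_def using isf_iff elE by blast
 have "iop (iApp f s) a:el E" if h: "iApp f s:el T" "el c = {iop k y |k x y. iop k x:el s & iop x y:el E}"
 "iop f V:el I" "iop c a:el V" for f s c V a
 proof -
 have ea: "iop (iApp f s) (ap E (iApp f s)):el E" using \<open>isf E T\<close> h(1) isf_iff by blast
 obtain n c' V' where k: "f:el F" "iop f n:el ar" "Fn s n T" "Fn c' n A" "iop f V':el I"
 "iop c' (ap E (iApp f s)):el V'" "!j:el n. iop (ap s j) (ap c' j):el E" using inv[OF ea] unfolding inv_def by blast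
 obtain X where "isf I X" using I unfolding Struct_def by blast
 hence VV: "V' = V" using isf_iff[of I X] h(3) k(5) by simp
 have sn: "isf s n" using k(3) unfolding Fn_def by blast
 have uq: "iop (ap s j) y:el E <-> y = ap c' j" if "j:el n" for j y using un[OF Fn_ap[OF k(3) that]] k(7) that by blast
 have "iop j y:el c <-> (EX x. iop j x:el s & iop x y:el E)" for j y unfolding h(2) by simp
 moreover have "isf c' n" using k(4) unfolding Fn_def by blast
 ultimately have "iop j y:el c <-> iop j y:el c'" for j y using uq by (auto simp: isf_iff[OF sn] isf_iff)
 moreover have "!!z. z:el c ==> EX j y. z = iop j y" unfolding h(2) by blast
 moreover have "!!z. z:el c' ==> EX j y. z = iop j y" using \<open>isf c' n\<close> unfolding isf_def by blast
 ultimately have "c = c'" by (intro el_eqI) blast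
 moreover have "Fn V (ifs n A) A" by (rule V[OF k(1,2) h(3)])
 ultimately have "a = ap E (iApp f s)" using k(6) h(4) VV isf_iff[of V] unfolding Fn_def by auto
 thus ?thesis using ea by simp
 qed
 hence "Ev T A I v E" unfolding Ev_def using fE clE unfolding cl_def by blast
 thus ?thesis ..
qed

end

section \<open>Relations on tuples of standard length defined by formulas\<close>

context gmodel
begin

definition Tup where "Tup s xs <-> isf s (num (length xs)) & (!i<length xs. ap s (num i) = xs ! i)"

lemma Tup_iff: "Tup s xs ==> iop j x:el s <-> (EX i<length xs. j = num i & x = xs ! i)"
 unfolding Tup_def by (auto simp: isf_iff el_num)

lemma Tup_ex: "EX s. Tup s xs"
proof (induction xs rule: rev_induct)
 case Nil
 have "EX s. el s = {}" by (rule exI[of _ "num 0"]) simp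
 thus ?case unfolding Tup_def isf_def by auto
next
 case (snoc x xs)
 then obtain s where s: "Tup s xs" ..
 let ?h = "%j. if j = num (length xs) then x else ap s j"
 have i: "num (length xs)~:el (num (length xs))" by (rule om_irrefl) simp
 have "el s = (%j. iop j (ap s j)) ` el (num (length xs))" using s el_isf unfolding Tup_def by blast
 hence "el (iins (iop (num (length xs)) x) s) = (%j. iop j (?h j)) ` el (num (Suc (length xs)))" using i by (auto simp: num_Suc)
 from isfI[OF this] have "Tup (iins (iop (num (length xs)) x) s) (xs @ [x])"
 using s unfolding Tup_def by (auto simp: el_num nth_append less_Suc_eq)
 thus ?case ..
qed

lemma Tup_unique: "Tup s xs ==> Tup t xs ==> s = t"
 unfolding Tup_def by (rule isf_eqI[of s "num (length xs)"]) (auto simp: el_num)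

lemma Tup_Fn: "Tup s xs ==> Fn s (num n) Y <-> n = length xs & set xs<=el Y"
proof -
 assume s: "Tup s xs"
 have "n = length xs" if "isf s (num n)" using isf_dom[OF that, of "num (length xs)"] s unfolding Tup_def by simp
 thus ?thesis using s unfolding Fn_def Tup_def by (auto simp: el_num set_conv_nth)
qed

lemma Tup_comp:
 assumes s: "Tup s xs" and c: "Tup c (map h xs)" and e: "isf e T" "!x:set xs. iop x (h x):el e"
 shows "el c = {iop k y |k x y. iop k x:el s & iop x y:el e}"
proof -
 have "iop k y:el c <-> (EX x. iop k x:el s & iop x y:el e)" for k y
 proof -
 have "iop (xs ! i) y:el e <-> y = h (xs ! i)" if "i < length xs" for i using e that by (auto simp: isf_iff)
 thus ?thesis unfolding Tup_iff[OF s] Tup_iff[OF c] by auto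
 qed
 moreover have "!!z. z:el c ==> EX j y. z = iop j y" using c unfolding Tup_def isf_def by blast
 ultimately show ?thesis by blast
qed

text \<open>Atomic formulas: equality for \<open>k = 0\<close>, the relation \<open>rh i\<close> for \<open>k = 1\<close>, and otherwise the graph of
  the function \<open>rh i\<close>, the value coming first.\<close>

definition atomic :: "'a => 'a => (nat => 'a) => 'a => nat \<times> nat => 'a list => bool" where "atomic R F rh I tg xs <-> (case tg of (k, i) =>
 if k = 0 then EX x. xs = [x, x]
 else if k = 1 then rh i:el R & (EX s V. Tup s xs & iop (rh i) V:el I & s:el V)
 else rh i:el F & xs ~= [] & (EX s V. Tup s (tl xs) & iop (rh i) V:el I & iop s (hd xs):el V))"

lemma atomic_rel:
 assumes "rh i:el R" "Tup c xs" "iop (rh i) V:el I" "!!V'. iop (rh i) V':el I ==> V' = V"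
 shows "atomic R F rh I (1, i) xs <-> c:el V" using assms(1) by (simp add: atomic_def) (metis assms(2-4) Tup_unique)

lemma atomic_app:
 assumes "k ~= 0" "k ~= 1" "rh i:el F" "Tup c xs" "iop (rh i) V:el I" "!!V'. iop (rh i) V':el I ==> V' = V"
 shows "atomic R F rh I (k, i) (x # xs) <-> iop c x:el V" using assms(1-3) by (simp add: atomic_def) (metis assms(4-6) Tup_unique)

text \<open>The largest variable index comes first, so that quantifying variable \<open>k\<close>
  puts a new element at the head of the list, as a move of the game does.\<close>

primrec lst :: "nat => 'a => 'a list" where "lst 0 v = []" | "lst (Suc k) v = ap v (num k) # lst k v"

lemma lst_nth: "i < k ==> lst k v ! i = ap v (num (k - Suc i))"
 by (induction k arbitrary: i) (auto simp: nth_Cons split: nat.split)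

lemma lst_cong: "(!!i. i < k ==> ap v (num i) = ap v' (num i)) ==> lst k v = lst k v'" by (induction k) auto

definition Upd where "Upd v' v i a <-> el v' = {z:el v. ~ (EX b. z = iop i b)} Un {iop i a}"

lemma Upd_iff:
 assumes v: "isf v X" and i: "i:el X"
 shows "Upd v' v i a <-> isf v' X & (!x:el X. ap v' x = (if x = i then a else ap v x))"
proof -
 have u: "{z:el v. ~ (EX b. z = iop i b)} Un {iop i a} = (%x. iop x (if x = i then a else ap v x)) ` el X"
 unfolding el_isf[OF v] using i by auto
 show ?thesis
 proof
 assume "Upd v' v i a"
 hence "el v' = (%x. iop x (if x = i then a else ap v x)) ` el X" unfolding Upd_def u .
 from isfI[OF this] show "isf v' X & (!x:el X. ap v' x = (if x = i then a else ap v x))" by blast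
 next
 assume h: "isf v' X & (!x:el X. ap v' x = (if x = i then a else ap v x))"
 hence "el v' = (%x. iop x (ap v' x)) ` el X" using el_isf by blast
 also have "\<dots> = (%x. iop x (if x = i then a else ap v x)) ` el X" using h by (intro image_cong) auto
 finally show "Upd v' v i a" unfolding Upd_def u .
 qed
qed

abbreviation iRel where "iRel r s == iop (num 2) (iop r s)"
abbreviation iEqn where "iEqn t u == iop (num 3) (iop t u)"
abbreviation iNot where "iNot x == iop (num 4) x"
abbreviation iAnd where "iAnd x y == iop (num 5) (iop x y)"
abbreviation iForall where "iForall i x == iop (num 6) (iop i x)"

definition closed_X where "closed_X R ar T X <-> (!r:el R. !n s. iop r n:el ar --> Fn s n T --> iRel r s:el X) &
 (!t:el T. !u:el T. iEqn t u:el X) & (!x:el X. iNot x:el X) &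
 (!x:el X. !y:el X. iAnd x y:el X) & (!i:el om. !x:el X. iForall i x:el X)"

definition Free where "Free T X G <-> (!j:el om.
 (!i:el om. iop (iVar i) j:el G --> j = i) &
 (!f s. iApp f s:el T --> iop (iApp f s) j:el G --> (EX k t. iop k t:el s & iop t j:el G)) &
 (!r s. iRel r s:el X --> iop (iRel r s) j:el G --> (EX k t. iop k t:el s & iop t j:el G)) &
 (!t u. iEqn t u:el X --> iop (iEqn t u) j:el G --> iop t j:el G \<or> iop u j:el G) &
 (!x. iNot x:el X --> iop (iNot x) j:el G --> iop x j:el G) &
 (!x y. iAnd x y:el X --> iop (iAnd x y) j:el G --> iop x j:el G \<or> iop y j:el G) &
 (!i x. iForall i x:el X --> iop (iForall i x) j:el G --> j ~= i & iop x j:el G))"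

definition Sat where "Sat T X A I S <-> (!v e. Fn v om A --> Ev T A I v e -->
 (!r s c V. iRel r s:el X --> el c = {iop k y |k x y. iop k x:el s & iop x y:el e} --> iop r V:el I -->
 (iop (iRel r s) v:el S <-> c:el V)) &
 (!t u. iEqn t u:el X --> (iop (iEqn t u) v:el S <-> (EX a. iop t a:el e & iop u a:el e))) &
 (!x. iNot x:el X --> (iop (iNot x) v:el S <-> iop x v~:el S)) &
 (!x y. iAnd x y:el X --> (iop (iAnd x y) v:el S <-> iop x v:el S & iop y v:el S)) &
 (!i x. iForall i x:el X --> (iop (iForall i x) v:el S <->
 (!a:el A. !v'. Upd v' v i a --> iop x v':el S))))"

lemma tr_closed_formulas: "nm w ==> nm R ==> nm ar ==> nm T ==> nm X ==> kap w = om ==>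
 tr (closed_formulas w R ar T X) <-> closed_X (kap R) (kap ar) (kap T) (kap X)"
 unfolding closed_formulas_def closed_X_def is_Rel_def is_Eqn_def is_Not_def is_And_def is_Forall_def by auto

lemma tr_is_free_vars: "nm w ==> nm T ==> nm X ==> nm G ==> kap w = om ==>
 tr (is_free_vars w T X G) ==> Free (kap T) (kap X) (kap G)"
 unfolding is_free_vars_def Free_def is_Var_def is_App_def is_Rel_def is_Eqn_def is_Not_def is_And_def is_Forall_def by auto

lemma ext_is_update [simp]: "tm u ==> tm v ==> tm i ==> tm a ==> ext (%x. is_update (u x) (v x) (i x) (a x))"
 unfolding is_update_def by simp

lemma tr_is_update [simp]: "nm v' ==> nm v ==> nm i ==> nm a ==>
 tr (is_update v' v i a) <-> Upd (kap v') (kap v) (kap i) (kap a)" unfolding is_update_def Upd_def by auto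

lemma ext_is_terms [simp]: "tm w ==> tm F ==> tm ar ==> tm T ==> ext (%x. is_terms (w x) (F x) (ar x) (T x))"
 unfolding is_terms_def closed_terms_def is_Var_def is_App_def by simp

lemma ext_is_formulas [simp]: "tm w ==> tm R ==> tm ar ==> tm T ==> tm X ==>
 ext (%x. is_formulas (w x) (R x) (ar x) (T x) (X x))"
 unfolding is_formulas_def closed_formulas_def is_Rel_def is_Eqn_def is_Not_def is_And_def is_Forall_def by simp

lemma ext_is_free_vars [simp]: "tm w ==> tm T ==> tm X ==> tm G ==> ext (%x. is_free_vars (w x) (T x) (X x) (G x))"
 unfolding is_free_vars_def is_Var_def is_App_def is_Rel_def is_Eqn_def is_Not_def is_And_def is_Forall_def by simp

lemma ext_is_evaluation [simp]: "tm w ==> tm T ==> tm A ==> tm I ==> tm u ==> tm v ==>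
 ext (%x. is_evaluation (w x) (T x) (A x) (I x) (u x) (v x))" unfolding is_evaluation_def is_Var_def is_App_def by simp

lemma ext_is_satisfaction [simp]: "tm w ==> tm T ==> tm X ==> tm A ==> tm I ==> tm S ==>
 ext (%x. is_satisfaction (w x) (T x) (X x) (A x) (I x) (S x))"
 unfolding is_satisfaction_def is_Rel_def is_Eqn_def is_Not_def is_And_def is_Forall_def by simp

lemma ext_true_in [simp]: "tm w ==> tm A ==> tm S ==> tm z ==> ext (%x. true_in (w x) (A x) (S x) (z x))"
 unfolding true_in_def by simp

lemma tr_is_satisfaction:
 assumes "nm w" "nm T" "nm X" "nm A" "nm I" "nm S" "kap w = om"
 shows "tr (is_satisfaction w T X A I S) ==> Sat (kap T) (kap X) (kap A) (kap I) (kap S)"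
 unfolding is_satisfaction_def Sat_def is_Rel_def is_Eqn_def is_Not_def is_And_def is_Forall_def
 using assms by (simp add: tr_is_evaluation tr_is_comp_iff Fn_def)

definition defn where "defn A S k z Y <-> (!v. Fn v om A --> (iop z v:el S <-> Y (lst k v)))"

context
 fixes R F ar T X G :: 'a
 assumes TT: "Terms F ar T" and XX: "closed_X R ar T X" and L: "Lang R F ar" and FV: "Free T X G"
begin

definition model where "model A I S <-> Struct R F ar A I & Sat T X A I S"

text \<open>Tarski's clauses are stated for all evaluations under the assignment and would be
  vacuous without one; \<open>evaluation_exists\<close> supplies it.\<close>

lemma sat_eval:
 assumes "model A I S" "Fn v om A"
 obtains e where "Ev T A I v e"
 "!!r s c V. iRel r s:el X ==> el c = {iop k y |k x y. iop k x:el s & iop x y:el e} ==> iop r V:el I ==>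
 iop (iRel r s) v:el S <-> c:el V"
 "!!t u. iEqn t u:el X ==> iop (iEqn t u) v:el S <-> (EX a. iop t a:el e & iop u a:el e)"
 "!!x. iNot x:el X ==> iop (iNot x) v:el S <-> iop x v~:el S"
 "!!x y. iAnd x y:el X ==> iop (iAnd x y) v:el S <-> iop x v:el S & iop y v:el S"
 "!!i x. iForall i x:el X ==> iop (iForall i x) v:el S <-> (!a:el A. !v'. Upd v' v i a --> iop x v':el S)"
proof -
 obtain e where e: "Ev T A I v e" using evaluation_exists[OF TT _ assms(2)] assms(1) unfolding model_def by blast
 have "Sat T X A I S" using assms(1) unfolding model_def by simp
 note c = this[unfolded Sat_def, THEN spec, THEN spec, THEN mp, THEN mp, OF assms(2) e]
 note c1 = conjunct1[OF c] and c2 = conjunct1[OF conjunct2[OF c]] and c3 = conjunct1[OF conjunct2[OF conjunct2[OF c]]]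
 and c4 = conjunct1[OF conjunct2[OF conjunct2[OF conjunct2[OF c]]]]
 and c5 = conjunct2[OF conjunct2[OF conjunct2[OF conjunct2[OF c]]]]
 show thesis
 by (rule that[OF e]) (rule c1[rule_format] c2[rule_format] c3[rule_format] c4[rule_format] c5[rule_format]; assumption)+
qed

lemma defn_Not: "model A I S ==> z:el X ==> defn A S k z Y ==> defn A S k (iNot z) (%l. ~ Y l)" unfolding defn_def
proof (intro allI impI)
 fix v assume h: "model A I S" "z:el X" "!v. Fn v om A --> (iop z v:el S <-> Y (lst k v))" "Fn v om A"
 have "iNot z:el X" using XX h(2) unfolding closed_X_def by blast
 thus "iop (iNot z) v:el S <-> ~ Y (lst k v)" using h(3,4) by (rule_tac sat_eval[OF h(1,4)]) simp
qed

lemma defn_And: "model A I S ==> z:el X ==> z':el X ==> defn A S k z Y ==> defn A S k z' Y' ==>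
 defn A S k (iAnd z z') (%l. Y l & Y' l)" unfolding defn_def
proof (intro allI impI)
 fix v assume h: "model A I S" "z:el X" "z':el X" "!v. Fn v om A --> (iop z v:el S <-> Y (lst k v))"
 "!v. Fn v om A --> (iop z' v:el S <-> Y' (lst k v))" "Fn v om A"
 have "iAnd z z':el X" using XX h(2,3) unfolding closed_X_def by blast
 thus "iop (iAnd z z') v:el S <-> Y (lst k v) & Y' (lst k v)" using h(4-6) by (rule_tac sat_eval[OF h(1,6)]) simp
qed

lemma defn_Forall: "model A I S ==> z:el X ==> defn A S (Suc k) z Y ==>
 defn A S k (iForall (num k) z) (%l. !a:el A. Y (a # l))" unfolding defn_def
proof (intro allI impI)
 fix v assume h: "model A I S" "z:el X" "!v. Fn v om A --> (iop z v:el S <-> Y (lst (Suc k) v))" "Fn v om A"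
 have X: "iForall (num k) z:el X" using XX h(2) unfolding closed_X_def by simp
 have v: "isf v om" using h(4) unfolding Fn_def by simp
 have l: "iop z v':el S <-> Y (a # lst k v)" if "a:el A" "Upd v' v (num k) a" for a v'
 proof -
 have v': "isf v' om" "!x:el om. ap v' x = (if x = num k then a else ap v x)" using that(2) Upd_iff[OF v, of "num k"] by simp_all
 hence f: "Fn v' om A" using that(1) h(4) unfolding Fn_def by simp
 have "lst k v' = lst k v" by (rule lst_cong) (use v'(2) in simp)
 thus ?thesis using h(3) f v'(2) by simp
 qed
 have u: "EX v'. Upd v' v (num k) a" if "a:el A" for a
 using upd_ex[OF h(4) that, of "num k"] Upd_iff[OF v, of "num k"] unfolding Fn_def by auto
 show "iop (iForall (num k) z) v:el S <-> (!a:el A. Y (a # lst k v))"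
 proof (rule sat_eval[OF h(1,4)])
 assume q: "!!i x. iForall i x:el X ==> iop (iForall i x) v:el S <-> (!a:el A. !v'. Upd v' v i a --> iop x v':el S)"
 show ?thesis unfolding q[OF X] using l u by blast
 qed
qed

text \<open>Lists are read newest first, so position \<open>i\<close> of a list of length
  \<open>k\<close> belongs to the variable with index \<open>k - Suc i\<close>.\<close>

abbreviation "vr k i == iVar (num (k - Suc i))"

lemma vr: "vr k i:el T" "Ev T A I v e ==> i < k ==> iop (vr k i) (lst k v ! i):el e"
proof -
 show "vr k i:el T" using TT unfolding Terms_def closed_T_def by simp
 show "iop (vr k i) (lst k v ! i):el e" if "Ev T A I v e" "i < k" using that unfolding Ev_def by (simp add: lst_nth)
qed

lemma tuple_code:
 assumes "model A I S" "!i:set is. i < k" "Fn v om A" "Ev T A I v e" "Tup s (map (vr k) is)" "Tup c (map (nth (lst k v)) is)"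
 shows "el c = {iop k y |k x y. iop k x:el s & iop x y:el e}" "Fn c (num (length is)) A"
proof -
 have e: "isf e T" using assms(4) unfolding Ev_def Fn_def by blast
 define h where "h x = ap e x" for x
 have h: "h (vr k i) = lst k v ! i" if "i:set is" for i
 using vr(2)[OF assms(4), of i k] that assms(2) unfolding h_def isf_iff[OF e] by simp
 have "map (nth (lst k v)) is = map h (map (vr k) is)" using h by simp
 with assms(6) have c: "Tup c (map h (map (vr k) is))" by simp
 show "el c = {iop k y |k x y. iop k x:el s & iop x y:el e}"
 by (rule Tup_comp[OF assms(5) c e]) (use vr(1) in "auto simp: isf_iff[OF e] h_def")
 have "lst k v ! i:el A" if "i:set is" for i using that assms(2) Fn_ap[OF assms(3)] by (simp add: lst_nth)
 thus "Fn c (num (length is)) A" unfolding Tup_Fn[OF assms(6)] by auto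
qed

lemma I_fun: "model A I S ==> x:el R Un el F ==> EX! V. iop x V:el I"
proof -
 assume "model A I S" "x:el R Un el F"
 then obtain D where "el D = el R Un el F" "isf I D" unfolding model_def Struct_def by blast
 thus ?thesis using \<open>x:el R Un el F\<close> unfolding isf_def by blast
qed

lemma defn_Eqn:
 assumes "model A I S" "i < k" "j < k"
 shows "defn A S k (iEqn (vr k i) (vr k j)) (%l. l ! i = l ! j)" unfolding defn_def
proof (intro allI impI)
 fix v assume v: "Fn v om A"
 have X: "iEqn (vr k i) (vr k j):el X" using XX vr(1) unfolding closed_X_def by blast
 show "iop (iEqn (vr k i) (vr k j)) v:el S <-> lst k v ! i = lst k v ! j"
 proof (rule sat_eval[OF assms(1) v])
 fix e assume e: "Ev T A I v e"
 and q: "!!t u. iEqn t u:el X ==> iop (iEqn t u) v:el S <-> (EX a. iop t a:el e & iop u a:el e)"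
 have "isf e T" using e unfolding Ev_def Fn_def by blast
 thus ?thesis unfolding q[OF X] using vr(2)[OF e assms(2)] vr(2)[OF e assms(3)] by (auto simp: isf_iff)
 qed
qed

lemma defn_Rel:
 assumes "model A I S" "!i:set is. i < k" "rh i:el R" "iop (rh i) (num (length is)):el ar"
 "Tup s (map (vr k) is)"
 shows "iRel (rh i) s:el X" "defn A S k (iRel (rh i) s) (%l. atomic R F rh I (1, i) (map (nth l) is))"
proof -
 have "Fn s (num (length is)) T" using Tup_Fn[OF assms(5)] vr(1) by auto
 thus X: "iRel (rh i) s:el X" using XX assms(3,4) unfolding closed_X_def by blast
 show "defn A S k (iRel (rh i) s) (%l. atomic R F rh I (1, i) (map (nth l) is))" unfolding defn_def
 proof (intro allI impI)
 fix v assume v: "Fn v om A"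
 obtain c where c: "Tup c (map (nth (lst k v)) is)" using Tup_ex by blast
 obtain V where V: "iop (rh i) V:el I" using I_fun[OF assms(1)] assms(3) by blast
 have Vu: "V' = V" if "iop (rh i) V':el I" for V' using I_fun[OF assms(1), of "rh i"] V that assms(3) by blast
 have "atomic R F rh I (1, i) (map (nth (lst k v)) is) <-> c:el V"
 by (rule atomic_rel[where rh = rh and i = i, OF assms(3) c V Vu])
 thus "iop (iRel (rh i) s) v:el S <-> atomic R F rh I (1, i) (map (nth (lst k v)) is)"
 using tuple_code(1)[OF assms(1,2) v _ assms(5) c] X V by (rule_tac sat_eval[OF assms(1) v]) simp
 qed
qed

lemma defn_App:
 assumes "model A I S" "!i:set (m # is). i < k" "rh i:el F" "iop (rh i) (num (length is)):el ar"
 "Tup s (map (vr k) is)" "k0 ~= 0" "k0 ~= 1"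
 shows "iApp (rh i) s:el T" "defn A S k (iEqn (iApp (rh i) s) (vr k m)) (%l. atomic R F rh I (k0, i) (map (nth l) (m # is)))"
proof -
 have "Fn s (num (length is)) T" using Tup_Fn[OF assms(5)] vr(1) by auto
 thus t: "iApp (rh i) s:el T" using TT assms(3,4) unfolding Terms_def closed_T_def by blast
 hence X: "iEqn (iApp (rh i) s) (vr k m):el X" using XX vr(1) unfolding closed_X_def by blast
 have isk: "!i:set is. i < k" "m < k" using assms(2) by auto
 show "defn A S k (iEqn (iApp (rh i) s) (vr k m)) (%l. atomic R F rh I (k0, i) (map (nth l) (m # is)))" unfolding defn_def
 proof (intro allI impI)
 fix v assume v: "Fn v om A"
 obtain c where c: "Tup c (map (nth (lst k v)) is)" using Tup_ex by blast
 obtain V where V: "iop (rh i) V:el I" using I_fun[OF assms(1)] assms(3) by blast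
 have Vu: "V' = V" if "iop (rh i) V':el I" for V' using I_fun[OF assms(1), of "rh i"] V that assms(3) by blast
 have at: "atomic R F rh I (k0, i) (map (nth (lst k v)) (m # is)) <-> iop c (lst k v ! m):el V"
 unfolding list.map by (rule atomic_app[where rh = rh and i = i, OF assms(6,7,3) c V Vu])
 show "iop (iEqn (iApp (rh i) s) (vr k m)) v:el S <-> atomic R F rh I (k0, i) (map (nth (lst k v)) (m # is))"
 proof (rule sat_eval[OF assms(1) v])
 fix e assume e: "Ev T A I v e"
 and q: "!!t u. iEqn t u:el X ==> iop (iEqn t u) v:el S <-> (EX a. iop t a:el e & iop u a:el e)"
 note tc = tuple_code[OF assms(1) isk(1) v e assms(5) c]
 have fV: "Fn V (ifs (num (length is)) A) A" using assms(1,3,4) V unfolding model_def Struct_def by blast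
 hence Vc: "iop c (ap V c):el V" "!!a. iop c a:el V <-> a = ap V c" using tc(2) isf_iff[of V] unfolding Fn_def[of V] by auto
 have "isf e T" using e unfolding Ev_def Fn_def by blast
 moreover have "iop (iApp (rh i) s) (ap V c):el e" using e t tc(1) V Vc(1) unfolding Ev_def by blast
 ultimately show ?thesis unfolding q[OF X] at Vc(2) using vr(2)[OF e isk(2)] by (auto simp: isf_iff)
 qed
 qed
qed

text \<open>All free variables have index below \<open>k\<close>; for \<open>k = 0\<close> the
  formula is a sentence, to which elementary equivalence applies.\<close>

definition bvars :: "nat => 'a => bool" where "bvars k z <-> (!j:el om. iop z j:el G --> j:num ` {..<k})"

lemma bounded_vr: "i < k ==> bvars k (vr k i)"
proof -
 have "j = num (k - Suc i)" if "j:el om" "iop (vr k i) j:el G" for j using FV that unfolding Free_def by simp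
 thus "i < k ==> bvars k (vr k i)" unfolding bvars_def by (intro ballI impI image_eqI[of _ _ "k - Suc i"]) auto
qed

lemma bounded_Tup: "Tup s (map (vr k) is) ==> !i:set is. i < k ==> iop j t:el s ==> bvars k t"
 using bounded_vr by (auto simp: Tup_iff)

context
 fixes A I B J S S' :: 'a
 assumes MA: "model A I S" and MB: "model B J S'"
 and eq: "!!z. z:el X ==> (!j:el om. iop z j~:el G) ==>
 (!v. Fn v om A --> iop z v:el S) <-> (!v. Fn v om B --> iop z v:el S')"
begin

definition DD where "DD k Y Z <-> (EX z:el X. bvars k z & defn A S k z Y & defn B S' k z Z)"

lemma DD_neg: "DD k Y Z ==> DD k (%l. ~ Y l) (%l. ~ Z l)"
proof -
 assume "DD k Y Z"
 then obtain z where z: "z:el X" "bvars k z" "defn A S k z Y" "defn B S' k z Z" unfolding DD_def by blast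
 have x: "iNot z:el X" using XX z(1) unfolding closed_X_def by blast
 have "bvars k (iNot z)" using z(2) x FV unfolding bvars_def Free_def by blast
 thus ?thesis unfolding DD_def using x defn_Not[OF MA z(1,3)] defn_Not[OF MB z(1,4)] by blast
qed

lemma DD_conj: "DD k Y Z ==> DD k Y' Z' ==> DD k (%l. Y l & Y' l) (%l. Z l & Z' l)"
proof -
 assume "DD k Y Z" "DD k Y' Z'"
 then obtain z z' where z: "z:el X" "bvars k z" "defn A S k z Y" "defn B S' k z Z"
 and z': "z':el X" "bvars k z'" "defn A S k z' Y'" "defn B S' k z' Z'" unfolding DD_def by blast
 have x: "iAnd z z':el X" using XX z(1) z'(1) unfolding closed_X_def by blast
 have "bvars k (iAnd z z')" using z(2) z'(2) x FV unfolding bvars_def Free_def by blast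
 thus ?thesis unfolding DD_def using x defn_And[OF MA z(1) z'(1) z(3) z'(3)] defn_And[OF MB z(1) z'(1) z(4) z'(4)] by blast
qed

lemma DD_all: "DD (Suc k) Y Z ==> DD k (%l. !a:el A. Y (a # l)) (%l. !b:el B. Z (b # l))"
proof -
 assume "DD (Suc k) Y Z"
 then obtain z where z: "z:el X" "bvars (Suc k) z" "defn A S (Suc k) z Y" "defn B S' (Suc k) z Z" unfolding DD_def by blast
 have x: "iForall (num k) z:el X" using XX z(1) unfolding closed_X_def by simp
 have "bvars k (iForall (num k) z)" unfolding bvars_def
 proof (intro ballI impI)
 fix j assume j: "j:el om" "iop (iForall (num k) z) j:el G"
 hence "j ~= num k" "iop z j:el G" using FV x unfolding Free_def by blast+
 thus "j:num ` {..<k}" using z(2) j(1) unfolding bvars_def by (auto simp: less_Suc_eq)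
 qed
 thus ?thesis unfolding DD_def using x defn_Forall[OF MA z(1,3)] defn_Forall[OF MB z(1,4)] by blast
qed

lemma DD_ex: "DD (Suc k) Y Z ==> DD k (%l. EX a:el A. Y (a # l)) (%l. EX b:el B. Z (b # l))"
 using DD_neg[OF DD_all[OF DD_neg]] by fastforce

lemma DD_Eqn: "i < k ==> j < k ==> DD k (%l. l ! i = l ! j) (%l. l ! i = l ! j)"
proof -
 assume ij: "i < k" "j < k"
 have x: "iEqn (vr k i) (vr k j):el X" using XX vr(1) unfolding closed_X_def by blast
 have "bvars k (iEqn (vr k i) (vr k j))"
 using bounded_vr[OF ij(1)] bounded_vr[OF ij(2)] x FV unfolding bvars_def Free_def by blast
 thus ?thesis unfolding DD_def using x defn_Eqn[OF MA ij] defn_Eqn[OF MB ij] by blast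
qed

text \<open>Without variables at hand, the true relation is defined by the sentence that some
  element equals itself. Nonemptiness of both structures enters here.\<close>

lemma DD_triv: "DD k (%l. True) (%l. True)"
proof -
 have "el A ~= {}" "el B ~= {}" using MA MB unfolding model_def Struct_def by auto
 hence "DD 0 (%l. True) (%l. True)" using DD_ex[of 0 "%l. l ! 0 = l ! 0" "%l. l ! 0 = l ! 0"] DD_Eqn[of 0 1 0] by (simp add: ex_in_conv)
 thus ?thesis unfolding DD_def bvars_def defn_def by blast
qed

lemma DD_false: "DD k (%l. False) (%l. False)" using DD_neg[OF DD_triv] by simp

lemma DD_zero: "DD 0 Y Z ==> Y [] <-> Z []"
proof -
 assume "DD 0 Y Z"
 then obtain z where z: "z:el X" "bvars 0 z" "defn A S 0 z Y" "defn B S' 0 z Z" unfolding DD_def by blast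
 have "el A ~= {}" "el B ~= {}" using MA MB unfolding model_def Struct_def by auto
 hence "EX v. Fn v om A" "EX v. Fn v om B" using const_ex by blast+
 moreover have "(!v. Fn v om A --> iop z v:el S) <-> (!v. Fn v om B --> iop z v:el S')"
 using z(2) by (intro eq[OF z(1)]) (auto simp: bvars_def)
 ultimately show ?thesis using z(3,4) unfolding defn_def by auto
qed

lemma ar_num: "x:el R Un el F ==> EX n. iop x n:el ar" using L isf_iff unfolding Lang_def Fn_def by blast

text \<open>Atoms whose symbol is of the wrong sort or whose number of arguments does not fit fail
  in both structures, so a false formula defines them. The others are defined by an equation between
  variables, an atomic formula for a relation, or an equation whose left side applies a function
  symbol.\<close>

lemma DD_atomic:
 assumes "!i:set is. i < k"
 shows "DD k (%l. atomic R F rh I tg (map (nth l) is)) (%l. atomic R F rh J tg (map (nth l) is))"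
proof (cases tg)
 case (Pair k0 i)
 consider (eq) "k0 = 0" | (rel) "k0 = 1" "rh i:el R" "iop (rh i) (num (length is)):el ar"
 | (app) m js where "k0 ~= 0" "k0 ~= 1" "is = m # js" "rh i:el F" "iop (rh i) (num (length js)):el ar"
 | (no_rel) "k0 = 1" "~ (rh i:el R & iop (rh i) (num (length is)):el ar)"
 | (no_app) "k0 ~= 0" "k0 ~= 1" "~ (rh i:el F & is ~= [] & iop (rh i) (num (length (tl is))):el ar)" by (cases "is") auto
 thus ?thesis
 proof cases
 case eq
 show ?thesis
 proof (cases "length is = 2")
 case True
 then obtain m n where "is = [m, n]" by (auto simp: numeral_2_eq_2 length_Suc_conv)
 thus ?thesis using eq Pair DD_Eqn[of n k m] assms unfolding atomic_def by simp
 next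
 case False
 hence "map h is ~= [x, x]" for h :: "nat => 'a" and x by (metis length_map length_Cons list.size(3) numeral_2_eq_2)
 thus ?thesis using eq Pair DD_false unfolding atomic_def by simp
 qed
 next
 case rel
 obtain s where s: "Tup s (map (vr k) is)" using Tup_ex by blast
 note d = defn_Rel[where rh = rh and i = i, OF MA assms rel(2,3) s] defn_Rel(2)[where rh = rh and i = i, OF MB assms rel(2,3) s]
 have "bvars k (iRel (rh i) s)" using bounded_Tup[OF s assms] d(1) FV unfolding bvars_def Free_def by metis
 thus ?thesis unfolding DD_def Pair rel(1) using d by blast
 next
 case (app m js)
 have js: "!i:set (m # js). i < k" "!i:set js. i < k" "m < k" using app(3) assms by auto
 obtain s where s: "Tup s (map (vr k) js)" using Tup_ex by blast
 note d = defn_App[where rh = rh and i = i, OF MA js(1) app(4,5) s app(1,2)] defn_App(2)[where rh = rh and i = i, OF MB js(1) app(4,5) s app(1,2)]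
 have x: "iEqn (iApp (rh i) s) (vr k m):el X" using XX vr(1) d(1) unfolding closed_X_def by blast
 have "bvars k (iApp (rh i) s)" using bounded_Tup[OF s js(2)] d(1) FV unfolding bvars_def Free_def by metis
 hence "bvars k (iEqn (iApp (rh i) s) (vr k m))" using bounded_vr[OF js(3)] x FV unfolding bvars_def Free_def by blast
 thus ?thesis unfolding DD_def Pair app(3) using x d by blast
 next
 case no_rel
 have "~ atomic R F rh I' (1, i) (map h is)" if M: "model A' I' S'" for A' I' S' h
 proof
 assume "atomic R F rh I' (1, i) (map h is)"
 then obtain s V where h: "rh i:el R" "Tup s (map h is)" "iop (rh i) V:el I'" "s:el V" unfolding atomic_def by auto
 obtain n where n: "iop (rh i) n:el ar" using ar_num h(1) by blast
 hence "Fn s n A'" using M h unfolding model_def Struct_def by blast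
 hence "n = num (length is)" using isf_dom[of s n "num (length is)"] h(2) unfolding Fn_def Tup_def by simp
 thus False using no_rel(2) n h(1) by simp
 qed
 thus ?thesis unfolding Pair no_rel(1) using MA MB DD_false by simp
 next
 case no_app
 have "~ atomic R F rh I' (k0, i) (map h is)" if M: "model A' I' S'" for A' I' S' h
 proof
 assume "atomic R F rh I' (k0, i) (map h is)"
 then obtain s V where h: "rh i:el F" "is ~= []" "Tup s (tl (map h is))" "iop (rh i) V:el I'" "iop s (hd (map h is)):el V"
 using no_app(1,2) unfolding atomic_def by auto
 obtain n where n: "iop (rh i) n:el ar" using ar_num h(1) by blast
 hence "Fn V (ifs n A') A'" using M h unfolding model_def Struct_def by blast
 hence "Fn s n A'" using h(5) isf_iff[of V] unfolding Fn_def[of V] by auto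
 hence "n = num (length (tl is))" using isf_dom[of s n "num (length (tl is))"] h(3) unfolding Fn_def Tup_def by simp
 thus False using no_app(3) n h(1,2) by simp
 qed
 thus ?thesis unfolding Pair using MA MB DD_false by simp
 qed
qed

lemma elementary_game: "game_equiv (el A) (el B) (atomic R F rh I) (atomic R F rh J) n Ls [] []"
 by (rule definable_game[where DD = DD])
 (rule DD_triv | (rule DD_neg DD_conj DD_ex DD_atomic DD_zero; assumption))+

end

end

lemma equivalent_game:
 assumes "nm R" "nm F" "nm ar" "nm A" "nm I" "nm B" "nm J"
 and "tr (is_countable_language R F ar)" "tr (is_structure R F ar A I)" "tr (is_structure R F ar B J)"
 and "tr (elementarily_equivalent R F ar A I B J)"
 shows "game_equiv (el (kap A)) (el (kap B)) (atomic (kap R) (kap F) rh (kap I)) (atomic (kap R) (kap F) rh (kap J)) n L [] []"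
proof -
 obtain w T X G S S' where h: "w = om" "tr (is_terms (nu w) F ar (nu T))" "tr (is_formulas (nu w) R ar (nu T) (nu X))"
 "tr (is_free_vars (nu w) (nu T) (nu X) (nu G))"
 "tr (is_satisfaction (nu w) (nu T) (nu X) A I (nu S))" "tr (is_satisfaction (nu w) (nu T) (nu X) B J (nu S'))"
 "!z:el X. (!j:el w. iop z j~:el G) -->
 (tr (true_in (nu w) A (nu S) (nu z)) <-> tr (true_in (nu w) B (nu S') (nu z)))"
 using assms(1-7,11) unfolding elementarily_equivalent_def by auto
 have T: "Terms (kap F) (kap ar) T" using h(1,2) assms(2,3) by (simp add: tr_is_terms)
 have X: "closed_X (kap R) (kap ar) T X" using h(1,3) assms(1,3) unfolding is_formulas_def by (simp add: tr_closed_formulas)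
 have G: "Free T X G" using tr_is_free_vars[OF _ _ _ _ _ h(4)] h(1) by simp
 have M: "model (kap R) (kap F) (kap ar) T X (kap A) (kap I) S" "model (kap R) (kap F) (kap ar) T X (kap B) (kap J) S'"
 using tr_is_satisfaction[OF _ _ _ assms(4,5) _ _ h(5)] tr_is_satisfaction[OF _ _ _ assms(6,7) _ _ h(6)] h(1) assms(1-10)
 by (simp_all add: model_def[OF T X _ G])
 show ?thesis
 proof (rule elementary_game[OF T X _ G M])
 fix z assume "z:el X" "!j:el om. iop z j~:el G"
 thus "(!v. Fn v om (kap A) --> iop z v:el S) <-> (!v. Fn v om (kap B) --> iop z v:el S')"
 using h(1,7) assms(4,6) unfolding true_in_def by simp
 qed (use assms in simp)
qed

end

section \<open>Ultrapowers inside the model\<close>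

context forcing
begin

lemma ext_almost_all [simp]: "tm w ==> tm U ==> (!!y. nm y ==> ext (%x. Q x y)) ==> ext (%x. almost_all (w x) (U x) (Q x))"
 unfolding almost_all_def by simp

lemma ext_is_ultra_class [simp]: "tm w ==> tm V ==> tm A ==> tm f ==> tm c ==>
 ext (%x. is_ultra_class (w x) (V x) (A x) (f x) (c x))" unfolding is_ultra_class_def by simp

lemma ext_is_slice [simp]: "tm s ==> tm m ==> tm t ==> ext (%x. is_slice (s x) (m x) (t x))" unfolding is_slice_def by simp

lemma ext_is_representatives [simp]: "tm n ==> tm c ==> tm s ==> ext (%x. is_representatives (n x) (c x) (s x))"
 unfolding is_representatives_def by simp

lemma ext_isomorphic [simp]: "tm R ==> tm F ==> tm ar ==> tm A ==> tm I ==> tm B ==> tm J ==>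
 ext (%x. isomorphic (R x) (F x) (ar x) (A x) (I x) (B x) (J x))" unfolding isomorphic_def by simp

lemma ext_is_ultrapower [simp]: "tm w ==> tm U ==> tm R ==> tm F ==> tm ar ==> tm A ==> tm I ==> tm C ==> tm K ==>
 ext (%x. is_ultrapower (w x) (U x) (R x) (F x) (ar x) (A x) (I x) (C x) (K x))"
 unfolding is_ultrapower_def is_structure_def is_funspace_def by simp

end

context gmodel
begin

text \<open>Asks for some set of \<open>U\<close> on which \<open>Q\<close> holds, not for the set
  of all such indices, because \<open>Q\<close> may be a HOL predicate that defines no set of the
  structure.\<close>

definition large :: "'a => ('a => bool) => bool" where "large U Q <-> (EX Z:el U. !m:el Z. Q m)"

definition Filt where "Filt U <-> (!X:el U. el X<=el om) & om:el U &
 (!X:el U. !Y. el X<=el Y & el Y<=el om --> Y:el U) &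
 (!X:el U. !Y:el U. !Z. el Z = el X Int el Y --> Z:el U)"

definition Slice where "Slice n s m t <-> isf t n & (!j:el n. ap t j = ap (ap s j) m)"

abbreviation Vals where "Vals n s V g == !m:el om. EX t a. Slice n s m t & iop t a:el V & iop m a:el g"

definition Cls where "Cls U A f = {g. Fn g om A & large U (%m. ap f m = ap g m)}"

definition Rep where "Rep n c s <-> isf s n & (!j:el n. ap s j:el (ap c j))"

definition UP where "UP U R F ar A I C K <-> Struct R F ar C K & (!c. c:el C <-> (EX f. Fn f om A & el c = Cls U A f)) &
 (!r:el R. !n V V' c s. iop r n:el ar --> iop r V:el I --> iop r V':el K --> Fn c n C --> Rep n c s -->
 (c:el V' <-> large U (%m. EX t:el V. Slice n s m t))) &
 (!f:el F. !n V V' c s d. iop f n:el ar --> iop f V:el I --> iop f V':el K --> Fn c n C --> Rep n c s -->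
 iop c d:el V' --> (EX g:el d. Vals n s V g))"

lemma tr_filter: "nm w ==> nm U ==> kap w = om ==> tr (is_nonprincipal_ultrafilter w U) ==> Filt (kap U)"
proof -
 assume n: "nm w" "nm U" "kap w = om" and h: "tr (is_nonprincipal_ultrafilter w U)"
 have e: "tr (!.X:.U. is_subset X w) <-> (!X:el (kap U). el X<=el om)" "tr (w:.U) <-> om:el (kap U)"
 "tr (!.X:.U. !.Y. is_subset X Y &. is_subset Y w ->. Y:.U) <->
 (!X:el (kap U). !Y. el X<=el Y & el Y<=el om --> Y:el (kap U))"
 "tr (!.X:.U. !.Y:.U. !.Z. is_inter Z X Y ->. Z:.U) <->
 (!X:el (kap U). !Y:el (kap U). !Z. el Z = el X Int el Y --> Z:el (kap U))" using n by simp_all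
 show ?thesis using h unfolding is_nonprincipal_ultrafilter_def Filt_def tr_Conj e by (elim conjE) (intro conjI; assumption)
qed

lemma
 assumes "Filt U"
 shows Filt_om: "X:el U ==> m:el X ==> m:el om" and Filt_top: "om:el U"
 and Filt_up: "X:el U ==> el X<=el Y ==> el Y<=el om ==> Y:el U"
 and Filt_Int: "X:el U ==> Y:el U ==> el Z = el X Int el Y ==> Z:el U"
proof -
 note c = assms[unfolded Filt_def]
 show "X:el U ==> m:el X ==> m:el om" using bspec[OF conjunct1[OF c]] by (meson subsetD)
 show "om:el U" by (rule conjunct1[OF conjunct2[OF c]])
 show "X:el U ==> el X<=el Y ==> el Y<=el om ==> Y:el U"
 by (rule conjunct1[OF conjunct2[OF conjunct2[OF c]], THEN bspec, THEN spec, THEN mp]) (assumption | intro conjI)+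
 show "X:el U ==> Y:el U ==> el Z = el X Int el Y ==> Z:el U"
 by (rule conjunct2[OF conjunct2[OF conjunct2[OF c]], THEN bspec, THEN bspec, THEN spec, THEN mp])
qed

lemma large_mono: "Filt U ==> large U Q ==> (!!m. m:el om ==> Q m ==> Q' m) ==> large U Q'"
 unfolding large_def using Filt_om by blast

lemma large_cong: "Filt U ==> (!!m. m:el om ==> Q m <-> Q' m) ==> large U Q <-> large U Q'"
 using large_mono[of U Q Q'] large_mono[of U Q' Q] by blast

lemma large_conj:
 assumes "Filt U" "large U Q" "large U Q'"
 shows "large U (%m. Q m & Q' m)"
proof -
 obtain X Y where X: "X:el U" "!m:el X. Q m" and Y: "Y:el U" "!m:el Y. Q' m" using assms(2,3) unfolding large_def by blast
 have "EX Z. el Z = {x:el X. tr (nu x:.nu Y)}" by (rule comp_ex) simp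
 then obtain Z where Z: "el Z = el X Int el Y" by auto
 have "Z:el U" by (rule Filt_Int[OF assms(1) X(1) Y(1) Z])
 thus ?thesis unfolding large_def using X(2) Y(2) Z by (intro bexI[of _ Z]) auto
qed

lemma large_True: "Filt U ==> (!!m. m:el om ==> Q m) ==> large U Q" unfolding large_def using Filt_top by blast

text \<open>For a predicate given by a formula, comprehension provides the exact set of indices, and
  upward closure of the filter puts it into \<open>U\<close>.\<close>

lemma tr_almost_all:
 assumes "nm w" "nm U" "kap w = om" "Filt (kap U)" "ext Q"
 shows "tr (almost_all w U Q) <-> large (kap U) (%m. tr (Q (nu m)))"
proof -
 have "tr (almost_all w U Q) <-> (EX Z:el (kap U). !m. m:el Z <-> m:el om & tr (Q (nu m)))"
 using assms unfolding almost_all_def by simp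
 also have "\<dots> <-> large (kap U) (%m. tr (Q (nu m)))"
 proof
 assume "large (kap U) (%m. tr (Q (nu m)))"
 then obtain Z where Z: "Z:el (kap U)" "!m:el Z. tr (Q (nu m))" unfolding large_def by blast
 obtain Y where Y: "el Y = {m:el om. tr (Q (nu m))}" using comp_ex[OF assms(5)] by blast
 have "Y:el (kap U)" by (rule Filt_up[OF assms(4) Z(1)]) (use Y Z(2) Filt_om[OF assms(4) Z(1)] in auto)
 thus "EX Z:el (kap U). !m. m:el Z <-> m:el om & tr (Q (nu m))" using Y by blast
 qed (auto simp: large_def)
 finally show ?thesis .
qed

text \<open>Arities are numbers of the structure and may be nonstandard, so this finite intersection
  is an internal induction; for that the predicates must be coded by one element
  \<open>rh\<close>.\<close>

lemma large_finite:
 assumes U: "Filt U" and n: "n:el om" and h: "!!j. j:el n ==> large U (%m. iop j m:el rh)"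
 shows "large U (%m. !j:el n. iop j m:el rh)"
proof -
 let ?F = "%n. (!.j:.n. ?.Z:.nu U. !.m:.Z. <|j, m|>:.nu rh) ->. (?.Z:.nu U. !.m:.Z. !.j:.n. <|j, m|>:.nu rh)"
 have t: "tr (?F (nu n)) <-> ((!j:el n. large U (%m. iop j m:el rh)) --> large U (%m. !j:el n. iop j m:el rh))" for n
 unfolding large_def by simp
 have "tr (?F (nu n))"
 proof (rule om_induct[OF n])
 show "tr (?F (nu (num 0)))" unfolding t by (simp add: large_True[OF U])
 fix n assume "n:el om" "tr (?F (nu n))"
 thus "tr (?F (nu (isuc n)))" unfolding t using large_conj[OF U] by (auto simp: ball_conj_distrib)
 qed simp
 thus ?thesis unfolding t using h by blast
qed

text \<open>Choice along a possibly nonstandard number, again by internal induction and therefore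
  from an internal relation.\<close>

lemma choice_finite:
 assumes n: "n:el om" and h: "!!j. j:el n ==> EX y. iop j y:el rh"
 shows "EX s. isf s n & (!j:el n. iop j (ap s j):el rh)"
proof -
 let ?F = "%n. (!.j:.n. ?.y. <|j, y|>:.nu rh) ->. (?.s. is_function_on s n &. is_subset s (nu rh))"
 have t: "tr (?F (nu n)) <-> ((!j:el n. EX y. iop j y:el rh) --> (EX s. isf s n & el s<=el rh))" for n by simp
 have "tr (?F (nu n))"
 proof (rule om_induct[OF n])
 show "tr (?F (nu (num 0)))" unfolding t by (intro impI exI[of _ "num 0"]) (simp add: isf_def)
 fix n assume n: "n:el om" and ih: "tr (?F (nu n))"
 show "tr (?F (nu (isuc n)))" unfolding t
 proof
 assume a: "!j:el (isuc n). EX y. iop j y:el rh"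
 then obtain s y where s: "isf s n" "el s<=el rh" and y: "iop n y:el rh" using ih unfolding t by auto
 have "el (iins (iop n y) s) = (%j. iop j (if j = n then y else ap s j)) ` el (isuc n)"
 using el_isf[OF s(1)] om_irrefl[OF n] by auto
 from isfI(1)[OF this] have "isf (iins (iop n y) s) (isuc n)" .
 moreover have "el (iins (iop n y) s)<=el rh" using s(2) y by simp
 ultimately show "EX s. isf s (isuc n) & el s<=el rh" by blast
 qed
 qed simp
 then obtain s where s: "isf s n" "el s<=el rh" unfolding t using h by blast
 have "iop j (ap s j):el rh" if "j:el n" for j using isf_iff[OF s(1)] s(2) that by blast
 thus ?thesis using s(1) by blast
qed

lemma Fn_seq: "Fn s n (ifs om A) ==> j:el n ==> iop m y:el (ap s j) <-> m:el om & y = ap (ap s j) m"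
 using isf_iff[of "ap s j" om] unfolding Fn_def[of s] by (simp add: Fn_def)

lemma tr_is_slice:
 assumes "nm s" "nm m" "nm t" "Fn (kap s) n (ifs om A)" "kap m:el om"
 shows "tr (is_slice s m t) <-> Slice n (kap s) (kap m) (kap t)"
proof -
 have s: "isf (kap s) n" using assms(4) unfolding Fn_def by simp
 have "tr (is_slice s m t) <-> el (kap t) = {iop j a |j g a. iop j g:el (kap s) & iop (kap m) a:el g}"
 unfolding is_slice_def using assms(1-3) by (simp add: set_eq_iff, blast)
 also have "{iop j a |j g a. iop j g:el (kap s) & iop (kap m) a:el g} = (%j. iop j (ap (ap (kap s) j) (kap m))) ` el n"
 using assms(5) Fn_seq[OF assms(4)] by (auto simp: isf_iff[OF s])
 also have "el (kap t) = \<dots> <-> Slice n (kap s) (kap m) (kap t)"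
 proof
 assume "el (kap t) = (%j. iop j (ap (ap (kap s) j) (kap m))) ` el n"
 from isfI[OF this] show "Slice n (kap s) (kap m) (kap t)" unfolding Slice_def by blast
 next
 assume h: "Slice n (kap s) (kap m) (kap t)"
 hence "el (kap t) = (%j. iop j (ap (kap t) j)) ` el n" using el_isf unfolding Slice_def by blast
 thus "el (kap t) = (%j. iop j (ap (ap (kap s) j) (kap m))) ` el n" using h unfolding Slice_def by simp
 qed
 finally show ?thesis .
qed

lemma tr_is_representatives:
 assumes "nm n" "nm c" "nm s" "isf (kap c) (kap n)"
 shows "tr (is_representatives n c s) <-> Rep (kap n) (kap c) (kap s)"
 using assms unfolding is_representatives_def Rep_def by (auto simp: isf_iff)

lemma slice_exists:
 assumes "Fn s n (ifs om A)" "m:el om"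
 shows "EX t. Slice n s m t & Fn t n A"
proof -
 have s: "isf s n" "!!j. j:el n ==> ap (ap s j) m:el A" using assms unfolding Fn_def[of s] by (auto simp: Fn_def)
 have "EX t. Fn t n A & (!j:el n. ap t j = ap (ap s j) m)"
 by (rule lam_ex[of "%j a. ?.g. <|j, g|>:.nu s &. <|nu m, a|>:.g"]) (use s assms(2) Fn_seq[OF assms(1)] in "auto simp: isf_iff")
 thus ?thesis unfolding Slice_def Fn_def by blast
qed

lemma Slice_unique: "Slice n s m t ==> Slice n s m t' ==> t = t'" unfolding Slice_def by (rule isf_eqI[of t n]) auto

section \<open>Classes, representatives and the construction of ultrapowers\<close>

context
 fixes U R F ar :: 'a
 assumes U: "Filt U" and L: "Lang R F ar"
begin

lemma ar_om: "iop x n:el ar ==> n:el om & x:el R Un el F" "iop x n:el ar ==> iop x n':el ar ==> n = n'"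
proof -
 obtain X where X: "el X = el R Un el F" "Fn ar X om" using L unfolding Lang_def by blast
 show "iop x n:el ar ==> n:el om & x:el R Un el F" "iop x n:el ar ==> iop x n':el ar ==> n = n'"
 using X isf_iff[of ar X] unfolding Fn_def by auto
qed

lemma tr_is_ultra_class:
 assumes "nm w" "nm V" "nm A" "nm f" "nm c" "kap w = om" "kap V = U" "Fn (kap f) om (kap A)"
 shows "tr (is_ultra_class w V A f c) <-> el (kap c) = Cls U (kap A) (kap f)"
proof -
 have "large U (%m. EX a. iop m a:el (kap f) & iop m a:el g) <-> large U (%m. ap (kap f) m = ap g m)" if "Fn g om (kap A)" for g
 using assms(8) that unfolding Fn_def by (auto simp: isf_iff intro: large_mono[OF U])
 thus ?thesis using assms U unfolding is_ultra_class_def Cls_def by (auto simp: tr_almost_all)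
qed

lemma Cls_eq: "Fn f om A ==> g:Cls U A f ==> Cls U A g = Cls U A f"
proof -
 assume g: "g:Cls U A f"
 have "large U (%m. ap g m = ap h m) <-> large U (%m. ap f m = ap h m)" for h
 proof
 assume "large U (%m. ap g m = ap h m)"
 hence "large U (%m. ap f m = ap g m & ap g m = ap h m)" using g large_conj[OF U] unfolding Cls_def by blast
 thus "large U (%m. ap f m = ap h m)" by (rule large_mono[OF U]) metis
 next
 assume "large U (%m. ap f m = ap h m)"
 hence "large U (%m. ap f m = ap g m & ap f m = ap h m)" using g large_conj[OF U] unfolding Cls_def by blast
 thus "large U (%m. ap g m = ap h m)" by (rule large_mono[OF U]) metis
 qed
 thus ?thesis unfolding Cls_def by simp
qed

lemma Cls_self: "Fn f om A ==> f:Cls U A f" unfolding Cls_def by (simp add: large_True[OF U])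

context
 fixes A I C :: 'a
 assumes C: "!!c. c:el C <-> (EX f. Fn f om A & el c = Cls U A f)"
begin

lemma class_eq: "c:el C ==> f:el c ==> Fn f om A & el c = Cls U A f"
 using Cls_eq unfolding C by (metis (no_types, lifting) Cls_def mem_Collect_eq)

lemma class_ex: "Fn f om A ==> EX c:el C. f:el c"
proof -
 assume f: "Fn f om A"
 have "EX c. el c = {x:el (ifs om A). tr (?.Z:.nu U. !.m:.Z. ?.a. <|m, a|>:.nu f &. <|m, a|>:.nu x)}" by (rule comp_ex) simp
 moreover have "{x:el (ifs om A). tr (?.Z:.nu U. !.m:.Z. ?.a. <|m, a|>:.nu f &. <|m, a|>:.nu x)} = Cls U A f"
 proof -
 have "large U (%m. EX a. iop m a:el f & iop m a:el g) <-> large U (%m. ap f m = ap g m)" if "Fn g om A" for g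
 using f that unfolding Fn_def by (auto simp: isf_iff intro: large_mono[OF U])
 moreover have "tr (?.Z:.nu U. !.m:.Z. ?.a. <|m, a|>:.nu f &. <|m, a|>:.nu g) <->
 large U (%m. EX a. iop m a:el f & iop m a:el g)" for g unfolding large_def by simp
 ultimately show ?thesis unfolding Cls_def by auto
 qed
 ultimately obtain c where c: "el c = Cls U A f" by auto
 thus ?thesis using C f Cls_self[OF f] by blast
qed

lemma class_same: "c:el C ==> d:el C ==> f:el c ==> g:el d ==> c = d <-> large U (%m. ap f m = ap g m)"
proof
 assume h: "c:el C" "d:el C" "f:el c" "g:el d"
 note cf = class_eq[OF h(1,3)] and dg = class_eq[OF h(2,4)]
 { assume "c = d" thus "large U (%m. ap f m = ap g m)" using cf h(4) unfolding Cls_def by auto }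
 assume "large U (%m. ap f m = ap g m)"
 hence "g:Cls U A f" using dg unfolding Cls_def by simp
 hence "el d = el c" using Cls_eq cf dg by auto
 thus "c = d" by simp
qed

lemma Rep_Fn: "Fn c n C ==> Rep n c s ==> Fn s n (ifs om A)" unfolding Rep_def Fn_def[of s] Fn_def[of c] using class_eq by auto

lemma Rep_ex: "n:el om ==> Fn c n C ==> EX s. Rep n c s"
proof -
 assume n: "n:el om" and c: "Fn c n C"
 have ic: "isf c n" using c unfolding Fn_def by simp
 define rh where "rh = irel n (ifs om A) (%j g. ?.x. <|j, x|>:.nu c &. g:.x)"
 have r: "iop j g:el rh <-> j:el n & Fn g om A & g:el (ap c j)" for j g
 unfolding rh_def by (subst el_irel) (auto simp: isf_iff[OF ic])
 have "EX s. isf s n & (!j:el n. iop j (ap s j):el rh)"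
 proof (rule choice_finite[OF n])
 fix j assume j: "j:el n"
 obtain f where "Fn f om A" "el (ap c j) = Cls U A f" using Fn_ap[OF c j] C by blast
 thus "EX y. iop j y:el rh" unfolding r using j Cls_self by blast
 qed
 thus ?thesis unfolding Rep_def r by blast
qed

text \<open>Two tuples of representatives agree almost everywhere in each coordinate, and
  \<open>large_finite\<close> makes this simultaneous in all coordinates. Hence interpretations in
  the ultrapower do not depend on representatives.\<close>

lemma Rep_slices:
 assumes n: "n:el om" and c: "Fn c n C" and s: "Rep n c s" "Rep n c s'"
 shows "large U (%m. !t. Slice n s m t <-> Slice n s' m t)"
proof -
 have fs: "isf s n" "isf s' n" using s unfolding Rep_def by auto
 define rh where "rh = irel n om (%j m. ?.g g' a. <|j, g|>:.nu s &. <|j, g'|>:.nu s' &. <|m, a|>:.g &. <|m, a|>:.g')"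
 have r: "iop j m:el rh <-> j:el n & m:el om & ap (ap s j) m = ap (ap s' j) m" for j m
 unfolding rh_def using Fn_seq[OF Rep_Fn[OF c s(1)]] Fn_seq[OF Rep_Fn[OF c s(2)]]
 by (subst el_irel) (auto simp: isf_iff[OF fs(1)] isf_iff[OF fs(2)])
 have "large U (%m. !j:el n. iop j m:el rh)"
 proof (rule large_finite[OF U n])
 fix j assume j: "j:el n"
 have "large U (%m. ap (ap s j) m = ap (ap s' j) m)"
 using class_same[OF Fn_ap[OF c j] Fn_ap[OF c j]] s j unfolding Rep_def by blast
 thus "large U (%m. iop j m:el rh)" by (rule large_mono[OF U]) (simp add: r j)
 qed
 thus ?thesis by (rule large_mono[OF U]) (auto simp: r Slice_def)
qed

lemma tr_rel_clause:
 assumes "nm w" "nm V" "nm X" "nm s" "kap w = om" "kap V = U" "Fn c n C" "Rep n c (kap s)"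
 shows "tr (almost_all w V (%m. ?.t:.X. is_slice s m t)) <-> large U (%m. EX t:el (kap X). Slice n (kap s) m t)"
proof -
 have "tr (?.t:.X. is_slice s (nu m) t) <-> (EX t:el (kap X). Slice n (kap s) m t)" if "m:el om" for m
 using assms that tr_is_slice[OF _ _ _ Rep_Fn[OF assms(7,8)]] by simp
 from large_cong[OF U this] show ?thesis using assms U by (subst tr_almost_all) simp_all
qed

lemma tr_fun_clause:
 assumes "nm w" "nm V" "nm s" "nm d" "kap w = om" "Fn c n C" "Rep n c (kap s)"
 shows "tr (?.g:.d. !.m:.w. ?.t a. is_slice s m t &. <|t, a|>:.V &. <|m, a|>:.g) <->
 (EX g:el (kap d). !m:el om. EX t a. Slice n (kap s) m t & iop t a:el (kap V) & iop m a:el g)"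
 using assms tr_is_slice[OF _ _ _ Rep_Fn[OF assms(6,7)]] by simp

lemma tuple_in: "n:el om ==> Fn c n C ==> c:el (ipow (iprod om C))"
 using el_isf[of c n] om_trans unfolding Fn_def by (auto simp: el_iprod)

lemma seq_fun:
 assumes s: "Fn s n (ifs om A)" and V: "Fn V (ifs n A) A"
 shows "EX g. Fn g om A & (!m:el om. EX t. Slice n s m t & iop t (ap g m):el V)"
proof -
 have "!m:el om. EX t. Slice n s m t & Fn t n A" using slice_exists[OF s] by blast
 then obtain h where h: "!m:el om. Slice n s m (h m) & Fn (h m) n A" by metis
 have Vi: "iop (h m) a:el V <-> a = ap V (h m)" if "m:el om" for m a
 using V h that isf_iff[of V "ifs n A"] unfolding Fn_def[of V] by simp
 have "EX g. Fn g om A & (!m:el om. ap g m = ap V (h m))"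
 proof (rule lam_ex[of "%m a. ?.t. is_slice (nu s) m t &. <|t, a|>:.nu V"])
 fix m assume m: "m:el om"
 have "Slice n s m t <-> t = h m" for t using h m Slice_unique by blast
 thus "ap V (h m):el A & (!y:el A. tr (?.t. is_slice (nu s) (nu m) t &. <|t, nu y|>:.nu V) <-> y = ap V (h m))"
 using m Vi[OF m] Fn_ap[OF V] h tr_is_slice[of "nu s" "nu m" _ n] s by simp
 qed simp_all
 then obtain g where g: "Fn g om A" "!m:el om. ap g m = ap V (h m)" by blast
 hence "Slice n s m (h m) & iop (h m) (ap g m):el V" if "m:el om" for m using h Vi that by simp
 thus ?thesis using g(1) by blast
qed

lemma seq_fun_large:
 assumes n: "n:el om" and c: "Fn c n C" and s: "Rep n c s" "Rep n c s'" and V: "Fn V (ifs n A) A"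
 and g: "!m:el om. EX t a. Slice n s m t & iop t a:el V & a = ap g m"
 and g': "!m:el om. EX t a. Slice n s' m t & iop t a:el V & a = ap g' m"
 shows "large U (%m. ap g m = ap g' m)"
proof (rule large_mono[OF U Rep_slices[OF n c s]])
 fix m assume m: "m:el om" and e: "!t. Slice n s m t <-> Slice n s' m t"
 obtain t t' where t: "Slice n s m t" "iop t (ap g m):el V" "Slice n s' m t'" "iop t' (ap g' m):el V"
 using bspec[OF g m] bspec[OF g' m] by blast
 hence "t = t'" using e Slice_unique by blast
 thus "ap g m = ap g' m" using t V isf_iff[of V "ifs n A"] unfolding Fn_def[of V] by simp
qed

end

text \<open>A symbol is interpreted by asking for some tuple of representatives with the required
  property, which a formula can express. \<open>Rep_slices\<close> makes the outcome independent of
  the tuple and thereby makes the interpretations of function symbols single-valued.\<close>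

lemma UP_exists:
 assumes I: "Struct R F ar A I"
 shows "EX C K. UP U R F ar A I C K"
proof -
 have "EX C. el C = {c:el (ipow (ifs om A)). tr (?.f. is_fun f (nu om) (nu A) &. is_ultra_class (nu om) (nu U) (nu A) f (nu c))}"
 by (rule comp_ex) simp
 then obtain C where "el C = {c:el (ipow (ifs om A)). tr (?.f. is_fun f (nu om) (nu A) &. is_ultra_class (nu om) (nu U) (nu A) f (nu c))}" ..
 hence C: "c:el C <-> (EX f. Fn f om A & el c = Cls U A f)" for c by (auto simp: tr_is_ultra_class Cls_def cong: conj_cong)
 \<comment> \<open>A set that contains all tuples over \<open>C\<close> and all pairs of such a
   tuple and a value, from which comprehension cuts out each interpretation.\<close>
 define Z where "Z = iun (iup (ipow (iprod om C)) (iprod (ipow (iprod om C)) C))"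
 define qR where "qR V s = almost_all (nu om) (nu U) (%m. ?.t:.V. is_slice s m t)" for V s
 define qF where "qF V s d = (?.g:.d. !.m:.nu om. ?.t a. is_slice s m t &. <|t, a|>:.V &. <|m, a|>:.g)" for V s d
 have extq [simp]: "ext (%x. qR (u x) (v x))" "ext (%x. qF (u x) (v x) (w x))" if "tm u" "tm v" "tm w" for u v w
 unfolding qR_def qF_def using that by simp_all
 have extqR [simp]: "ext (%x. qR (u x) (v x))" if "tm u" "tm v" for u v by (rule extq(1)[OF that tm_id])
 \<comment> \<open>One formula covers relation and function symbols, so that a single internal
   function interprets the whole language.\<close>
 define Pf where "Pf x z = ((x:.nu R &. (?.n V s. <|x, n|>:.nu ar &. <|x, V|>:.nu I &. is_fun z n (nu C) &.
 is_representatives n z s &. qR V s)) |.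
 (x:.nu F &. (?.n V. ?.s c d. is_pair z c d &. <|x, n|>:.nu ar &. <|x, V|>:.nu I &. is_fun c n (nu C) &.
 d:.nu C &. is_representatives n c s &. qF V s d)))" for x z
 have extPf: "ext (%x. Pf (u x) (v x))" if "tm u" "tm v" for u v unfolding Pf_def using that by simp
 have rep: "tr (is_representatives (nu n) (nu c) (nu s)) <-> Rep n c s" if "Fn c n C" for n c s
 using that tr_is_representatives unfolding Fn_def by simp
 define KR where "KR r c <-> (EX n V s. iop r n:el ar & iop r V:el I & Fn c n C & Rep n c s &
 large U (%m. EX t:el V. Slice n s m t))" for r c
 define KF where "KF f c d <-> (EX n V s. iop f n:el ar & iop f V:el I & Fn c n C & d:el C & Rep n c s &
 (EX g:el d. Vals n s V g))" for f c d
 have trPf: "tr (Pf (nu x) (nu z)) <-> x:el R & KR x z \<or> x:el F & (EX c d. z = iop c d & KF x c d)" for x z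
 proof -
 have qR: "tr (qR (nu V) (nu s)) <-> large U (%m. EX t:el V. Slice n s m t)" if "Fn c n C" "Rep n c s" for c n V s
 unfolding qR_def using tr_rel_clause[OF C, of "nu om" "nu U" "nu V" "nu s" c n] that by simp
 have qF: "tr (qF (nu V) (nu s) (nu d)) <-> (EX g:el d. Vals n s V g)" if "Fn c n C" "Rep n c s" for c n V s d
 unfolding qF_def using tr_fun_clause[OF C, of "nu om" "nu V" "nu s" "nu d" c n] that by simp
 have "tr (Pf (nu x) (nu z)) <-> x:el R & (EX n V s. iop x n:el ar & iop x V:el I & Fn z n C & Rep n z s & tr (qR (nu V) (nu s))) \<or>
 x:el F & (EX c d n V s. z = iop c d & iop x n:el ar & iop x V:el I & Fn c n C & d:el C & Rep n c s & tr (qF (nu V) (nu s) (nu d)))"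
 unfolding Pf_def by (simp add: rep cong: conj_cong) blast
 thus ?thesis unfolding KR_def KF_def by (simp add: qR qF cong: conj_cong)
 qed
 obtain X where X: "el X = el R Un el F" "isf I X" and L': "el R Int el F = {}" using I L unfolding Struct_def Lang_def by blast
 have inY: "c:el (ipow (iprod om C))" if "iop r n:el ar" "Fn c n C" for r n c
 using tuple_in[OF C _ that(2)] ar_om(1)[OF that(1)] by blast
 have elZ: "el Z = el (ipow (iprod om C)) Un el (iprod (ipow (iprod om C)) C)" unfolding Z_def by simp
 have inZ: "c:el Z" if "KR r c" for r c using that inY unfolding KR_def elZ by blast
 have inZ': "iop c d:el Z" if "KF f c d" for f c d using that inY unfolding KF_def elZ el_iprod by blast
 have "EX K. Fn K X (ipow Z) & (!x:el X. ap K x = icomp Z (Pf (nu x)))"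
 proof (rule lam_ex[of "%x z. !.y. y:.z <->. y:.nu Z &. Pf x y"])
 fix x assume "x:el X"
 have "el (icomp Z (Pf (nu x))) = {y:el Z. tr (Pf (nu x) (nu y))}" by (rule el_icomp) (simp add: extPf)
 moreover have "tr (!.y. y:.nu z <->. y:.nu Z &. Pf (nu x) y) <-> el z = {y:el Z. tr (Pf (nu x) (nu y))}" for z
 using extPf by (auto simp: set_eq_iff)
 ultimately show "icomp Z (Pf (nu x)):el (ipow Z) & (!y:el (ipow Z).
 tr (!.ya. ya:.nu y <->. ya:.nu Z &. Pf (nu x) ya) <-> y = icomp Z (Pf (nu x)))" by (auto simp flip: el_inject)
 qed (simp_all add: extPf)
 then obtain K where K: "Fn K X (ipow Z)" "!!x. x:el X ==> el (ap K x) = {y:el Z. tr (Pf (nu x) (nu y))}"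
 using el_icomp[of "Pf (nu _)" Z] extPf by auto
 have iK: "isf K X" using K(1) unfolding Fn_def by simp
 have elKR: "c:el V <-> KR r c" if "r:el R" "iop r V:el K" for r V c using that K(2)[of r] X(1) L' inZ trPf isf_iff[OF iK] by auto
 have elKF: "z:el V <-> (EX c d. z = iop c d & KF f c d)" if "f:el F" "iop f V:el K" for f V z
 using that K(2)[of f] X(1) L' inZ' trPf isf_iff[OF iK] by auto
 have IV: "V = V'" if "iop x V:el I" "iop x V':el I" for x V V' using that isf_iff[OF X(2)] by simp
 have Ifun: "Fn V (ifs n A) A" if "f:el F" "iop f n:el ar" "iop f V:el I" for f n V using I that unfolding Struct_def by blast
 have fsame: "large U (%m. ap g m = ap g' m)"
 if "f:el F" "iop f n:el ar" "iop f V:el I" "Fn c n C" "Rep n c s" "Rep n c s'" "Fn g om A" "Fn g' om A"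
 "Vals n s V g"
 "Vals n s' V g'" for f n V c s s' g g'
 proof -
 have g: "iop m a:el g <-> m:el om & a = ap g m" "iop m a:el g' <-> m:el om & a = ap g' m" for m a
 using that(7,8) unfolding Fn_def by (simp_all add: isf_iff)
 show ?thesis by (rule seq_fun_large[OF C conjunct1[OF ar_om(1)[OF that(2)]] that(4-6) Ifun[OF that(1-3)]])
 (use that(9,10) g in auto)
 qed
 have fex: "EX g. Fn g om A & (Vals n s V g)" if h: "f:el F" "iop f n:el ar" "iop f V:el I" "Fn c n C" "Rep n c s" for f n V c s
 proof -
 obtain g where g: "Fn g om A" "!m:el om. EX t. Slice n s m t & iop t (ap g m):el V"
 using seq_fun[OF C Rep_Fn[OF C h(4,5)] Ifun[OF h(1-3)]] by blast
 thus ?thesis unfolding Fn_def by (auto simp: isf_iff)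
 qed
 have cls: "Fn g om A & el d = Cls U A g" if "d:el C" "g:el d" for d g by (rule class_eq[OF C that])
 have "Struct R F ar C K" unfolding Struct_def
 proof (intro conjI ballI allI impI)
 obtain a where "a:el A" using I unfolding Struct_def by blast
 then obtain f where "Fn f om A" using const_ex by blast
 thus "el C ~= {}" using class_ex[OF C] by blast
 show "EX X. el X = el R Un el F & isf K X" using X(1) iK by blast
 show "Fn s n C" if h: "r:el R" "iop r n:el ar" "iop r V:el K" "s:el V" for r n V s
 using h(4) ar_om(2)[OF h(2)] unfolding elKR[OF h(1,3)] KR_def by blast
 fix f n V' assume f: "f:el F" "iop f n:el ar" "iop f V':el K"
 have n: "n:el om" using ar_om(1)[OF f(2)] by simp
 obtain V where V: "iop f V:el I" using f(1) X isf_iff by blast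
 have ex: "EX d. KF f c d" if c: "Fn c n C" for c
 proof -
 obtain s where s: "Rep n c s" using Rep_ex[OF C n c] by blast
 obtain g where g: "Fn g om A" "Vals n s V g" using fex[OF f(1,2) V c s] by blast
 obtain d where "d:el C" "g:el d" using class_ex[OF C g(1)] by blast
 thus ?thesis unfolding KF_def using f(2) V c s g(2) by blast
 qed
 have un: "d = d'" if d: "KF f c d" "KF f c d'" for c d d'
 proof -
 obtain n1 V1 s g where 1: "iop f n1:el ar" "iop f V1:el I" "Fn c n1 C" "d:el C" "Rep n1 c s" "g:el d"
 "Vals n1 s V1 g" using d(1) unfolding KF_def by blast
 obtain n2 V2 s' g' where 2: "iop f n2:el ar" "iop f V2:el I" "d':el C" "Rep n2 c s'" "g':el d'"
 "Vals n2 s' V2 g'" using d(2) unfolding KF_def by blast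
 have e: "n2 = n1" "V2 = V1" using ar_om(2)[OF 2(1) 1(1)] IV[OF 2(2) 1(2)] by auto
 have "large U (%m. ap g m = ap g' m)"
 using fsame[OF f(1) 1(1,2,3,5) 2(4)[unfolded e] _ _ 1(7) 2(6)[unfolded e]] cls 1(4,6) 2(3,5) by blast
 thus ?thesis using class_same[OF C 1(4) 2(3) 1(6) 2(5)] by blast
 qed
 have dC: "Fn c n C & d:el C" if "KF f c d" for c d using that ar_om(2)[OF f(2)] unfolding KF_def by blast
 have mem: "iop c d:el V' <-> KF f c d" for c d using elKF[OF f(1,3)] by simp
 have "isf V' (ifs n C)" unfolding isf_def
 proof (intro conjI ballI)
 fix z assume "z:el V'"
 thus "EX x:el (ifs n C). EX y. z = iop x y" unfolding elKF[OF f(1,3)] using dC by auto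
 next
 fix c assume "c:el (ifs n C)"
 thus "EX! y. iop c y:el V'" unfolding mem using ex un by auto
 qed
 thus "Fn V' (ifs n C) C" unfolding Fn_def[of V'] using isf_iff[of V'] mem dC by blast
 qed
 moreover have "c:el V' <-> large U (%m. EX t:el V. Slice n s m t)"
 if h: "r:el R" "iop r n:el ar" "iop r V:el I" "iop r V':el K" "Fn c n C" "Rep n c s" for r n V V' c s unfolding elKR[OF h(1,4)]
 proof
 assume "KR r c"
 then obtain n1 V1 s1 where 1: "iop r n1:el ar" "iop r V1:el I" "Rep n1 c s1" "large U (%m. EX t:el V1. Slice n1 s1 m t)"
 unfolding KR_def by blast
 have e: "n1 = n" "V1 = V" using ar_om(2)[OF 1(1) h(2)] IV[OF 1(2) h(3)] by auto
 have "large U (%m. (EX t:el V. Slice n s1 m t) & (!t. Slice n s1 m t <-> Slice n s m t))"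
 using large_conj[OF U 1(4) Rep_slices[OF C _ h(5) 1(3)[unfolded e] h(6)]] ar_om(1)[OF h(2)] e by simp
 thus "large U (%m. EX t:el V. Slice n s m t)" by (rule large_mono[OF U]) blast
 next
 assume "large U (%m. EX t:el V. Slice n s m t)"
 thus "KR r c" unfolding KR_def using h by blast
 qed
 moreover have "EX g:el d. Vals n s V g"
 if h: "f:el F" "iop f n:el ar" "iop f V:el I" "iop f V':el K" "Fn c n C" "Rep n c s" "iop c d:el V'" for f n V V' c s d
 proof -
 have "KF f c d" using h(7) elKF[OF h(1,4)] by simp
 then obtain n1 V1 s1 g1 where 1: "iop f n1:el ar" "iop f V1:el I" "d:el C" "Rep n1 c s1" "g1:el d"
 "Vals n1 s1 V1 g1" unfolding KF_def by blast
 have e: "n1 = n" "V1 = V" using ar_om(2)[OF 1(1) h(2)] IV[OF 1(2) h(3)] by auto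
 obtain g where g: "Fn g om A" "Vals n s V g" using fex[OF h(1-3,5,6)] by blast
 have "large U (%m. ap g1 m = ap g m)"
 by (rule fsame[OF h(1-3,5) 1(4)[unfolded e] h(6) _ g(1) 1(6)[unfolded e] g(2)]) (use cls[OF 1(3,5)] in blast)
 hence "g:el d" using cls[OF 1(3,5)] g(1) unfolding Cls_def by simp
 thus ?thesis using g(2) by blast
 qed
 ultimately have "UP U R F ar A I C K" unfolding UP_def using C by blast
 thus ?thesis by blast
qed

end

end

context gmodel
begin

lemma
 assumes up: "UP U R F ar A I C K"
 shows UP_Struct: "Struct R F ar C K"
 and UP_C: "c:el C <-> (EX f. Fn f om A & el c = Cls U A f)"
 and UP_rel: "r:el R ==> iop r n:el ar ==> iop r V:el I ==> iop r V':el K ==> Fn c n C ==> Rep n c s ==>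
 c:el V' <-> large U (%m. EX t:el V. Slice n s m t)"
 and UP_fun: "f:el F ==> iop f n:el ar ==> iop f V:el I ==> iop f V':el K ==> Fn c n C ==> Rep n c s ==>
 iop c d:el V' ==> EX g:el d. Vals n s V g"
proof -
 note u = up[unfolded UP_def]
 show "Struct R F ar C K" by (rule conjunct1[OF u])
 show "c:el C <-> (EX f. Fn f om A & el c = Cls U A f)" using conjunct1[OF conjunct2[OF u]] by (rule spec)
 show "r:el R ==> iop r n:el ar ==> iop r V:el I ==> iop r V':el K ==> Fn c n C ==> Rep n c s ==>
 c:el V' <-> large U (%m. EX t:el V. Slice n s m t)" by (rule conjunct1[OF conjunct2[OF conjunct2[OF u]], rule_format])
 show "f:el F ==> iop f n:el ar ==> iop f V:el I ==> iop f V':el K ==> Fn c n C ==> Rep n c s ==>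
 iop c d:el V' ==> EX g:el d. Vals n s V g" by (rule conjunct2[OF conjunct2[OF conjunct2[OF u]], rule_format])
qed

lemma Struct_fun: "Struct R F ar A I ==> f:el F ==> iop f n:el ar ==> iop f V:el I ==> Fn V (ifs n A) A"
proof -
 assume "Struct R F ar A I"
 from conjunct2[OF conjunct2[OF conjunct2[OF this[unfolded Struct_def]]], rule_format]
 show "f:el F ==> iop f n:el ar ==> iop f V:el I ==> Fn V (ifs n A) A" .
qed

lemma Struct_ex: "Struct R F ar A I ==> x:el R Un el F ==> EX V. iop x V:el I" unfolding Struct_def using isf_iff by blast

lemma tr_is_ultrapower:
 assumes n: "nm w" "nm U" "nm R" "nm F" "nm ar" "nm A" "nm I" and w: "kap w = om"
 and U: "Filt (kap U)" and L: "Lang (kap R) (kap F) (kap ar)"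
 and up: "UP (kap U) (kap R) (kap F) (kap ar) (kap A) (kap I) C K"
 shows "tr (is_ultrapower w U R F ar A I (nu C) (nu K))"
proof -
 have C: "!!c. c:el C <-> (EX f. Fn f om (kap A) & el c = Cls (kap U) (kap A) f)" by (rule UP_C[OF up])
 have rep: "tr (is_representatives (nu n) (nu c) (nu s)) <-> Rep n c s" if "Fn c n C" for n c s
 using that tr_is_representatives unfolding Fn_def by simp
 have 1: "tr (is_structure R F ar (nu C) (nu K))" using n UP_Struct[OF up] by simp
 have 2: "tr (!.c. c:.nu C <->. (?.f. is_fun f w A &. is_ultra_class w U A f c))"
 using n w C by (simp add: tr_is_ultra_class[OF U L] cong: conj_cong)
 have "c:el V' <-> tr (almost_all w U (%m. ?.t:.nu V. is_slice (nu s) m t))"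
 if "r:el (kap R)" "iop r n:el (kap ar)" "iop r V:el (kap I)" "iop r V':el K" "Fn c n C"
 "tr (is_representatives (nu n) (nu c) (nu s))" for r n V V' c s
 using that UP_rel[OF up that(1-5)] n w by (simp add: rep tr_rel_clause[OF U L C])
 hence "!r:el (kap R). !n V V' c s. iop r n:el (kap ar) & iop r V:el (kap I) & iop r V':el K & Fn c n C &
 tr (is_representatives (nu n) (nu c) (nu s)) --> (c:el V' <-> tr (almost_all w U (%m. ?.t:.nu V. is_slice (nu s) m t)))"
 (is ?Q) by (intro ballI allI impI) (elim conjE)
 moreover have "?Q <-> tr (!.r:.R. !.n V. !.V' c s. <|r, n|>:.ar &. <|r, V|>:.I &. <|r, V'|>:.nu K &. is_fun c n (nu C) &.
 is_representatives n c s ->. (c:.V' <->. almost_all w U (%m. ?.t:.V. is_slice s m t)))" (is "_ <-> ?Q3") using n by simp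
 ultimately have 3: ?Q3 by (rule iffD1[rotated])
 have "tr (?.g:.nu d. !.m:.w. ?.t a. is_slice (nu s) m t &. <|t, a|>:.nu V &. <|m, a|>:.g)"
 if h: "f:el (kap F)" "iop f n:el (kap ar)" "iop f V:el (kap I)" "iop f V':el K" "Fn c n C"
 "tr (is_representatives (nu n) (nu c) (nu s))" "iop c d:el V'" for f n V V' c s d
 proof -
 have r: "Rep n c (kap (nu s))" using h(5,6) rep by simp
 have "EX g:el d. Vals n s V g" using UP_fun[OF up h(1-5) _ h(7)] r by simp
 thus ?thesis unfolding tr_fun_clause[OF U L C n(1) nm_nu nm_nu nm_nu w h(5) r] by simp
 qed
 hence "!f:el (kap F). !n V V' c s d. iop f n:el (kap ar) & iop f V:el (kap I) & iop f V':el K & Fn c n C &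
 tr (is_representatives (nu n) (nu c) (nu s)) & iop c d:el V' -->
 tr (?.g:.nu d. !.m:.w. ?.t a. is_slice (nu s) m t &. <|t, a|>:.nu V &. <|m, a|>:.g)" (is ?S)
 by (intro ballI allI impI) (elim conjE)
 moreover have "?S <-> tr (!.f:.F. !.n V. !.V' c. !.s d. <|f, n|>:.ar &. <|f, V|>:.I &. <|f, V'|>:.nu K &. is_fun c n (nu C) &.
 is_representatives n c s &. <|c, d|>:.V' ->.
 (?.g:.d. !.m:.w. ?.t a. is_slice s m t &. <|t, a|>:.V &. <|m, a|>:.g))" (is "_ <-> ?S4") using n by (simp del: tr_ExIn)
 ultimately have 4: ?S4 by (rule iffD1[rotated])
 show ?thesis unfolding is_ultrapower_def tr_Conj using 1 2 3 4 by (intro conjI)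
qed

text \<open>A relation between sequences that respects the atomic formulas almost everywhere induces an
  isomorphism of the ultrapowers.\<close>

context
 fixes U R F ar A I B J Pr C K D M :: 'a
 assumes U: "Filt U" and L: "Lang R F ar" and upA: "UP U R F ar A I C K" and upB: "UP U R F ar B J D M"
 and IA: "Struct R F ar A I" and IB: "Struct R F ar B J"
 and Pr: "!!z. z:el Pr ==> EX f g. z = iop f g & Fn f om A & Fn g om B"
 and P1: "!!f. Fn f om A ==> EX g. iop f g:el Pr" and P2: "!!g. Fn g om B ==> EX f. iop f g:el Pr"
 and P3: "!!f g f' g'. iop f g:el Pr ==> iop f' g':el Pr ==> large U (%m. ap f m = ap f' m <-> ap g m = ap g' m)"
 and P4: "!!r n V V' s t. r:el R ==> iop r n:el ar ==> iop r V:el I ==> iop r V':el J ==> isf s n ==> isf t n ==>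
 !j:el n. iop (ap s j) (ap t j):el Pr ==>
 large U (%m. !a b. Slice n s m a --> Slice n t m b --> (a:el V <-> b:el V'))"
 and P5: "!!f n V V' s t x y. f:el F ==> iop f n:el ar ==> iop f V:el I ==> iop f V':el J ==> isf s n ==> isf t n ==>
 !j:el n. iop (ap s j) (ap t j):el Pr ==> iop x y:el Pr ==>
 large U (%m. !a b. Slice n s m a --> Slice n t m b --> (iop a (ap x m):el V <-> iop b (ap y m):el V'))"
begin

lemma CD: "c:el C <-> (EX f. Fn f om A & el c = Cls U A f)" "d:el D <-> (EX f. Fn f om B & el d = Cls U B f)"
 by (rule UP_C[OF upA], rule UP_C[OF upB])

lemma PrD: "iop f g:el Pr ==> Fn f om A & Fn g om B" using Pr by fastforce

lemma Pr_large: "iop f g:el Pr ==> iop f' g':el Pr ==>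
 large U (%m. ap f m = ap f' m) <-> large U (%m. ap g m = ap g' m)"
proof -
 assume "iop f g:el Pr" "iop f' g':el Pr"
 note p = P3[OF this]
 show ?thesis
 proof
 assume "large U (%m. ap f m = ap f' m)"
 from large_conj[OF U p this] show "large U (%m. ap g m = ap g' m)" by (rule large_mono[OF U]) blast
 next
 assume "large U (%m. ap g m = ap g' m)"
 from large_conj[OF U p this] show "large U (%m. ap f m = ap f' m)" by (rule large_mono[OF U]) blast
 qed
qed

definition hh :: 'a where "hh = irel C D (%c d. ?.f:.c. ?.g:.d. <|f, g|>:.nu Pr)"

lemma el_hh: "el hh = {iop c d |c d. c:el C & d:el D & (EX f:el c. EX g:el d. iop f g:el Pr)}"
 unfolding hh_def by (subst el_irel) auto

lemma hh_iff: "iop c d:el hh <-> c:el C & d:el D & (EX f:el c. EX g:el d. iop f g:el Pr)" unfolding el_hh by auto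

lemma hh_same: "iop c d:el hh ==> iop c' d':el hh ==> c = c' <-> d = d'"
proof -
 assume "iop c d:el hh" "iop c' d':el hh"
 then obtain f g f' g' where h: "c:el C" "c':el C" "f:el c" "f':el c'" "d:el D" "d':el D" "g:el d" "g':el d'"
 "iop f g:el Pr" "iop f' g':el Pr" unfolding hh_iff by (elim conjE bexE)
 show ?thesis using class_same[OF U L CD(1) h(1-4)] class_same[OF U L CD(2) h(5-8)] Pr_large[OF h(9,10)] by simp
qed

lemma hh_fun: "Fn hh C D" "bij_betw (ap hh) (el C) (el D)"
proof -
 have ex: "EX d. iop c d:el hh" if c: "c:el C" for c
 proof -
 obtain f where "Fn f om A" "el c = Cls U A f" using c CD(1) by blast
 hence f: "Fn f om A" "f:el c" using Cls_self[OF U L] by auto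
 obtain g where g: "iop f g:el Pr" using P1[OF f(1)] by blast
 obtain d where "d:el D" "g:el d" using class_ex[OF U L CD(2)] PrD[OF g] by blast
 thus ?thesis unfolding hh_iff using c f(2) g by blast
 qed
 have ex': "EX c. iop c d:el hh" if d: "d:el D" for d
 proof -
 obtain g where "Fn g om B" "el d = Cls U B g" using d CD(2) by blast
 hence g: "Fn g om B" "g:el d" using Cls_self[OF U L] by auto
 obtain f where f: "iop f g:el Pr" using P2[OF g(1)] by blast
 obtain c where "c:el C" "f:el c" using class_ex[OF U L CD(1)] PrD[OF f] by blast
 thus ?thesis unfolding hh_iff using d f g(2) by blast
 qed
 have f: "isf hh C" unfolding isf_def
 proof (intro conjI ballI)
 show "EX x:el C. EX y. z = iop x y" if "z:el hh" for z using that unfolding el_hh by blast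
 show "EX! d. iop c d:el hh" if "c:el C" for c using ex[OF that] hh_same by blast
 qed
 hence a: "iop c (ap hh c):el hh" if "c:el C" for c using isf_iff that by blast
 show F: "Fn hh C D" unfolding Fn_def using f a hh_iff by blast
 show "bij_betw (ap hh) (el C) (el D)" unfolding bij_betw_def
 proof
 show "inj_on (ap hh) (el C)" using a hh_same by (metis inj_onI)
 show "ap hh ` el C = el D" using F ex' isf_iff[OF f] unfolding Fn_def by blast
 qed
qed

text \<open>\<open>Pr\<close> need not match arbitrary representatives of two corresponding classes,
  so representatives for both tuples are chosen simultaneously, as pairs in
  \<open>Pr\<close>.\<close>

lemma reps_pair:
 assumes n: "n:el om" and s: "Fn s n C" and t: "Fn t n D" and st: "!!j. j:el n ==> iop (ap s j) (ap t j):el hh"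
 shows "EX s' t'. Rep n s s' & Rep n t t' & (!j:el n. iop (ap s' j) (ap t' j):el Pr)"
proof -
 have ist: "isf s n" "isf t n" using s t unfolding Fn_def by auto
 define rh where "rh = irel n Pr (%j z. ?.f g. ?.c d. is_pair z f g &. <|j, c|>:.nu s &. <|j, d|>:.nu t &. f:.c &. g:.d)"
 have r: "iop j z:el rh <-> j:el n & z:el Pr & (EX f g. z = iop f g & f:el (ap s j) & g:el (ap t j))" for j z
 unfolding rh_def by (subst el_irel) (auto simp: isf_iff[OF ist(1)] isf_iff[OF ist(2)])
 have "EX u. isf u n & (!j:el n. iop j (ap u j):el rh)" by (rule choice_finite[OF n]) (use st in "unfold r hh_iff, blast")
 then obtain u where u: "isf u n" "!j:el n. iop j (ap u j):el rh" by blast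
 have "!j:el n. EX f g. ap u j = iop f g & iop f g:el Pr & f:el (ap s j) & g:el (ap t j)" using u(2) unfolding r by auto
 then obtain f g where fg: "!!j. j:el n ==> ap u j = iop (f j) (g j) & iop (f j) (g j):el Pr & f j:el (ap s j) & g j:el (ap t j)"
 by metis
 have "EX s'. Fn s' n (ifs om A) & (!j:el n. ap s' j = f j)"
 by (rule lam_ex[of "%j x. ?.y z. <|j, z|>:.nu u &. is_pair z x y"]) (use fg PrD in "auto simp: isf_iff[OF u(1)]")
 moreover have "EX t'. Fn t' n (ifs om B) & (!j:el n. ap t' j = g j)"
 by (rule lam_ex[of "%j y. ?.x z. <|j, z|>:.nu u &. is_pair z x y"]) (use fg PrD in "auto simp: isf_iff[OF u(1)]")
 ultimately obtain s' t' where "Fn s' n (ifs om A)" "!j:el n. ap s' j = f j" "Fn t' n (ifs om B)" "!j:el n. ap t' j = g j" by blast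
 thus ?thesis unfolding Rep_def Fn_def using fg by (intro exI[of _ s'] exI[of _ t']) auto
qed

lemma tuple_h:
 assumes "Fn s n C" "tr (is_comp (nu t) (nu hh) (nu s))"
 shows "Fn t n D & (!j:el n. iop (ap s j) (ap t j):el hh)"
proof -
 have t: "isf t n & (!j:el n. ap t j = ap hh (ap s j))" using assms tr_is_comp[of "nu t" "nu hh" "nu s" n C D] hh_fun(1) by simp
 moreover have "isf hh C" using hh_fun(1) unfolding Fn_def by simp
 ultimately show ?thesis using Fn_ap[OF assms(1)] Fn_ap[OF hh_fun(1)] unfolding Fn_def[of t] by (simp add: isf_iff)
qed

lemma hh_rel:
 assumes r: "r:el R" "iop r n:el ar" "iop r V:el K" "iop r V':el M" "Fn s n C" "tr (is_comp (nu t) (nu hh) (nu s))"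
 shows "s:el V <-> t:el V'"
proof -
 have t: "Fn t n D" "!!j. j:el n ==> iop (ap s j) (ap t j):el hh" using tuple_h[OF r(5,6)] by auto
 have n: "n:el om" using ar_om(1)[OF U L r(2)] by simp
 obtain s' t' where st: "Rep n s s'" "Rep n t t'" "!j:el n. iop (ap s' j) (ap t' j):el Pr" using reps_pair[OF n r(5) t] by blast
 obtain V0 V1 where V: "iop r V0:el I" "iop r V1:el J" using Struct_ex[OF IA] Struct_ex[OF IB] r(1) by blast
 have "isf s' n" "isf t' n" using st unfolding Rep_def by auto
 note p = P4[OF r(1,2) V this st(3)]
 have sl: "EX a. Slice n s' m a" "EX b. Slice n t' m b" if "m:el om" for m
 using slice_exists[OF Rep_Fn[OF U L CD(1) r(5) st(1)] that] slice_exists[OF Rep_Fn[OF U L CD(2) t(1) st(2)] that] by auto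
 have "s:el V <-> large U (%m. EX a:el V0. Slice n s' m a)" by (rule UP_rel[OF upA r(1,2) V(1) r(3,5) st(1)])
 also have "\<dots> <-> large U (%m. EX b:el V1. Slice n t' m b)"
 proof
 assume "large U (%m. EX a:el V0. Slice n s' m a)"
 from large_conj[OF U p this] show "large U (%m. EX b:el V1. Slice n t' m b)" by (rule large_mono[OF U]) (use sl in blast)
 next
 assume "large U (%m. EX b:el V1. Slice n t' m b)"
 from large_conj[OF U p this] show "large U (%m. EX a:el V0. Slice n s' m a)" by (rule large_mono[OF U]) (use sl in blast)
 qed
 also have "\<dots> <-> t:el V'" by (rule UP_rel[OF upB r(1,2) V(2) r(4) t(1) st(2), symmetric])
 finally show ?thesis .
qed

lemma hh_app:
 assumes f: "f:el F" "iop f V:el K" "iop f V':el M" "tr (is_comp (nu t) (nu hh) (nu s))" "iop s a:el V" "iop t b:el V'"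
 shows "iop a b:el hh"
proof -
 obtain n where n: "iop f n:el ar"
 proof -
 obtain X where "el X = el R Un el F" "Fn ar X om" using L unfolding Lang_def by blast
 thus ?thesis using f(1) isf_iff[of ar X] that unfolding Fn_def by auto
 qed
 have "Fn V (ifs n C) C" "Fn V' (ifs n D) D"
 using Struct_fun[OF UP_Struct[OF upA] f(1) n f(2)] Struct_fun[OF UP_Struct[OF upB] f(1) n f(3)] by auto
 hence s: "Fn s n C" "a:el C" "b:el D"
 using f(5,6) isf_iff[of V "ifs n C"] isf_iff[of V' "ifs n D"] unfolding Fn_def[of V] Fn_def[of V'] by auto
 have t: "Fn t n D" "!!j. j:el n ==> iop (ap s j) (ap t j):el hh" using tuple_h[OF s(1) f(4)] by auto
 have nom: "n:el om" using ar_om(1)[OF U L n] by simp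
 obtain s' t' where st: "Rep n s s'" "Rep n t t'" "!j:el n. iop (ap s' j) (ap t' j):el Pr" using reps_pair[OF nom s(1) t] by blast
 obtain V0 V1 where V: "iop f V0:el I" "iop f V1:el J" using Struct_ex[OF IA] Struct_ex[OF IB] f(1) by blast
 have ist: "isf s' n" "isf t' n" using st unfolding Rep_def by auto
 have "EX g:el a. Vals n s' V0 g" by (rule UP_fun[OF upA f(1) n V(1) f(2) s(1) st(1) f(5)])
 then obtain g where g: "g:el a" "Vals n s' V0 g" by blast
 have "EX g:el b. Vals n t' V1 g" by (rule UP_fun[OF upB f(1) n V(2) f(3) t(1) st(2) f(6)])
 then obtain g' where g': "g':el b" "Vals n t' V1 g'" by blast
 have gA: "Fn g om A" and gB: "Fn g' om B" "el b = Cls U B g'"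
 using class_eq[OF U L CD(1) s(2) g(1)] class_eq[OF U L CD(2) s(3) g'(1)] by auto
 \<comment> \<open>A partner of the representative \<open>g\<close> of the first value;
   \<open>P5\<close> will show that it agrees almost everywhere with the representative
   \<open>g'\<close> of the second value.\<close>
 obtain h where h: "iop g h:el Pr" using P1[OF gA] by blast
 have V1f: "Fn V1 (ifs n B) B" by (rule Struct_fun[OF IB f(1) n V(2)])
 have "large U (%m. ap g' m = ap h m)"
 proof (rule large_mono[OF U P5[OF f(1) n V ist st(3) h]])
 fix m assume m: "m:el om"
 and e: "!a b. Slice n s' m a --> Slice n t' m b --> (iop a (ap g m):el V0 <-> iop b (ap h m):el V1)"
 obtain x y where x: "Slice n s' m x" "iop x y:el V0" "iop m y:el g" using g(2) m by blast
 obtain x' y' where x': "Slice n t' m x'" "iop x' y':el V1" "iop m y':el g'" using g'(2) m by blast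
 have "y = ap g m" "y' = ap g' m" using x(3) x'(3) gA gB(1) isf_iff[of g om] isf_iff[of g' om] unfolding Fn_def by auto
 hence "iop x' (ap h m):el V1" "iop x' (ap g' m):el V1" using e x x' by auto
 thus "ap g' m = ap h m" using V1f isf_iff[of V1 "ifs n B"] unfolding Fn_def[of V1] by auto
 qed
 hence "h:el b" unfolding gB(2) Cls_def using PrD[OF h] by simp
 thus ?thesis unfolding hh_iff using s(2,3) g(1) h by blast
qed

lemma ultrapowers_isomorphic: "tr (isomorphic (nu R) (nu F) (nu ar) (nu C) (nu K) (nu D) (nu M))"
proof -
 have 1: "tr (is_bij (nu hh) (nu C) (nu D))" using hh_fun by simp
 have "!r:el R. !n V V' s t. iop r n:el ar & iop r V:el K & iop r V':el M & Fn s n C &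
 tr (is_comp (nu t) (nu hh) (nu s)) --> (s:el V <-> t:el V')" (is ?Q) by (intro ballI allI impI) (elim conjE, rule hh_rel)
 moreover have "?Q <-> tr (!.r:.nu R. !.n V. !.V' s t. <|r, n|>:.nu ar &. <|r, V|>:.nu K &. <|r, V'|>:.nu M &.
 is_fun s n (nu C) &. is_comp t (nu hh) s ->. (s:.V <->. t:.V'))" (is "_ <-> ?Q2") by simp
 ultimately have 2: ?Q2 by (rule iffD1[rotated])
 have "!f:el F. !V V' s t a b. iop f V:el K & iop f V':el M & tr (is_comp (nu t) (nu hh) (nu s)) &
 iop s a:el V & iop t b:el V' --> iop a b:el hh" (is ?S) by (intro ballI allI impI) (elim conjE, rule hh_app)
 moreover have "?S <-> tr (!.f:.nu F. !.V V'. !.s t. !.a b. <|f, V|>:.nu K &. <|f, V'|>:.nu M &. is_comp t (nu hh) s &.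
 <|s, a|>:.V &. <|t, b|>:.V' ->. <|a, b|>:.nu hh)" (is "_ <-> ?S3") by simp
 ultimately have 3: ?S3 by (rule iffD1[rotated])
 show ?thesis unfolding isomorphic_def by (rule tr_Ex[THEN iffD2]) (simp, rule exI[of _ hh], use 1 2 3 in "simp only: tr_Conj")
qed

end

end

section \<open>The ultrafilter for two equivalent structures\<close>

context forcing
begin

primrec tupF :: "'a => nat => 'a list => 'a fm" where
 "tupF s i [] = is_function_on s (cn i)"
 | "tupF s i (x # xs) = (<|cn i, x|>:.s &. tupF s (Suc i) xs)"

text \<open>The formula counterpart of \<open>atomic\<close>, with names as parameters;
  \<open>~. R =. R\<close> stands for falsity.\<close>

definition atomF :: "'a => 'a => (nat => 'a) => 'a => nat \<times> nat => 'a list => 'a fm" where "atomF R F rh I tg xs = (case tg of (k, i) =>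
 if k = 0 then if length xs = 2 then xs ! 0 =. xs ! 1 else ~. R =. R
 else if k = 1 then rh i:.R &. (?.s V. tupF s 0 xs &. <|rh i, V|>:.I &. s:.V)
 else if xs = [] then ~. R =. R
 else rh i:.F &. (?.s V. tupF s 0 (tl xs) &. <|rh i, V|>:.I &. <|s, hd xs|>:.V))"

text \<open>The formula counterpart of \<open>game_equiv\<close>, built by recursion in HOL on the
  standard number of rounds; forcing it will give the sets required by the locale
  \<open>game\<close>.\<close>

primrec equivF :: "'a => 'a => ('t => 'a list => 'a fm) => ('t => 'a list => 'a fm) => nat => ('t \<times> nat list) list =>
 'a list => 'a list => 'a fm" where
 "equivF A B at at' 0 L as bs = foldr (%(tg, is) G. (if !i:set is. i < length as & i < length bs
 then at tg (map (nth as) is) <->. at' tg (map (nth bs) is) else A =. A) &. G) L (A =. A)"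
 | "equivF A B at at' (Suc n) L as bs =
 ((!.a:.A. ?.b:.B. equivF A B at at' n L (a # as) (b # bs)) &.
 (!.b:.B. ?.a:.A. equivF A B at at' n L (a # as) (b # bs)))"

lemma equivF_0: "p||-equivF A B at at' 0 L as bs <-> (!(tg, is):set L. (!i:set is. i < length as & i < length bs) -->
 p||-(at tg (map (nth as) is) <->. at' tg (map (nth bs) is)))" by (induction L) (auto simp: fo_Equ split: if_splits)

lemma ext_tupF [simp]: "tm s ==> (!!u. u:set us ==> tm u) ==> ext (%x. tupF (s x) i (map (%u. u x) us))"
 by (induction us arbitrary: i) auto

lemma ext_atomF:
 assumes "nm R" "nm F" "nm I" "!!i. nm (rh i)" "!!u. u:set us ==> tm u"
 shows "ext (%x. atomF R F rh I tg (map (%u. u x) us))"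
proof (cases tg)
 case (Pair k i)
 have 2: "tm (us ! j)" if "j < length us" for j using assms(5) that by simp
 consider "k = 0" "length us = 2" | "k = 0" "length us ~= 2" | "k = 1" | "k ~= 0" "k ~= 1" "us = []"
 | u vs where "k ~= 0" "k ~= 1" "us = u # vs" by (cases us) auto
 thus ?thesis using assms 2 unfolding atomF_def Pair prod.case by cases simp_all
qed

lemma ext_equivF:
 assumes "nm A" "nm B"
 and at: "!!tg us. (!!u. u:set us ==> tm u) ==> ext (%x. at tg (map (%u. u x) us))"
 and at': "!!tg us. (!!u. u:set us ==> tm u) ==> ext (%x. at' tg (map (%u. u x) us))"
 shows "(!!u. u:set us ==> tm u) ==> (!!u. u:set vs ==> tm u) ==>
 ext (%x. equivF A B at at' n L (map (%u. u x) us) (map (%u. u x) vs))"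
proof (induction n arbitrary: us vs)
 case 0
 have m: "map (nth (map (%u. u x) ws)) is = map (%u. u x) (map (nth ws) is)" if "!i:set is. i < length ws"
 for ws :: "('a => 'a) list" and "is" and x using that by simp
 have t: "u:set (map (nth ws) is) ==> tm u" if "!i:set is. i < length ws" "!!u. u:set ws ==> tm u" for ws "is" u
 using that by auto
 have "ext (%x. if !i:set is. i < length (map (%u. u x) us) & i < length (map (%u. u x) vs)
 then at tg (map (nth (map (%u. u x) us)) is) <->. at' tg (map (nth (map (%u. u x) vs)) is) else A =. A)" for tg "is"
 proof (cases "!i:set is. i < length us & i < length vs")
 case True
 hence T: "!i:set is. i < length us" "!i:set is. i < length vs" by auto
 have "ext (%x. at tg (map (%u. u x) (map (nth us) is)) <->. at' tg (map (%u. u x) (map (nth vs) is)))"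
 by (intro ext_Iff at at') (use t[OF T(1) 0(1)] t[OF T(2) 0(2)] in auto)
 thus ?thesis using True unfolding m[OF T(1)] m[OF T(2)] by simp
 next
 case False
 thus ?thesis using assms(1) by (simp del: ball_simps add: if_not_P)
 qed
 thus ?case unfolding equivF.simps by (induction L) (use assms(1) in "auto simp: split_beta")
next
 case (Suc n)
 have "ext (%x. equivF A B at at' n L (a # map (%u. u x) us) (b # map (%u. u x) vs))" if "nm a" "nm b" for a b
 proof -
 have "!!u. u:set ((%x. a) # us) ==> tm u" "!!u. u:set ((%x. b) # vs) ==> tm u" using Suc.prems that by auto
 from Suc.IH[of "(%x. a) # us" "(%x. b) # vs", OF this] show ?thesis by simp
 qed
 thus ?case unfolding equivF.simps using assms(1,2) by simp
qed

lemma ext_equivF_Cons: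
 assumes "nm A" "nm B"
 and at: "!!tg us. (!!u. u:set us ==> tm u) ==> ext (%x. at tg (map (%u. u x) us))"
 and at': "!!tg us. (!!u. u:set us ==> tm u) ==> ext (%x. at' tg (map (%u. u x) us))"
 and "tm u" "tm v" "!x:set as. nm x" "!x:set bs. nm x"
 shows "ext (%x. equivF A B at at' n L (u x # as) (v x # bs))"
proof -
 have "!!w. w:set (u # map (%y x. y) as) ==> tm w" "!!w. w:set (v # map (%y x. y) bs) ==> tm w" using assms by auto
 from ext_equivF[where at = at and at' = at', OF assms(1,2) at at',
 of "u # map (%y x. y) as" "v # map (%y x. y) bs", OF _ _ this, where n = n and L = L]
 show ?thesis by (simp add: comp_def)
qed

definition nop where "nop x y = nup (nup x x) (nup x y)"

lemma nm_nop [simp]: "nm x ==> nm y ==> nm (nop x y)" unfolding nop_def by simp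

end

context gmodel
begin

lemma kap_nup: "nm x ==> nm y ==> kap (nup x y) = iup (kap x) (kap y)" using tr_fo[OF nup_upair] by (metis nm_nup tr_is_upair)

lemma kap_nop [simp]: "nm x ==> nm y ==> kap (nop x y) = iop (kap x) (kap y)" unfolding nop_def iop_def by (simp add: kap_nup)

lemma kap_chk_vnat: "kap (cn n) = num n" unfolding num_def ..

lemma tr_tupF:
 assumes "nm s" "!x:set xs. nm x"
 shows "tr (tupF s 0 xs) <-> Tup (kap s) (map kap xs)"
proof -
 have "tr (tupF s i xs) <-> isf (kap s) (num (i + length xs)) & (!k<length xs. iop (num (i + k)) (kap (xs ! k)):el (kap s))" for i
 using assms(2)
 proof (induction xs arbitrary: i)
 case (Cons x xs)
 have "(!k<length (x # xs). iop (num (i + k)) (kap ((x # xs) ! k)):el (kap s)) <->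
 iop (num i) (kap x):el (kap s) & (!k<length xs. iop (num (Suc i + k)) (kap (xs ! k)):el (kap s))"
 by (auto simp: All_less_Suc2)
 thus ?case using Cons assms(1) by (auto simp: kap_chk_vnat)
 qed (use assms(1) in "simp add: kap_chk_vnat")
 from this[of 0] show ?thesis unfolding Tup_def by (auto simp: isf_iff el_num)
qed

lemma tr_atomF:
 assumes "nm R" "nm F" "nm I" "!!i. nm (rh i)" "!x:set xs. nm x"
 shows "tr (atomF R F rh I tg xs) <-> atomic (kap R) (kap F) (%i. kap (rh i)) (kap I) tg (map kap xs)"
proof (cases tg)
 case (Pair k i)
 have e: "ext (%x. tupF x 0 ys)" if "!x:set ys. nm x" for ys
 proof -
 have "!!u. u:set (map (%y x. y) ys) ==> tm u" using that by auto
 from ext_tupF[of "%x. x" "map (%y x. y) ys" 0, OF tm_id this] show ?thesis by (simp add: comp_def)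
 qed
 have tl: "!x:set (tl xs). nm x" "xs ~= [] ==> nm (hd xs)" using assms(5) by (cases xs; auto)+
 have two: "(EX x. map kap xs = [x, x]) <-> length xs = 2 & kap (xs ! 0) = kap (xs ! 1)"
 by (cases xs rule: list.exhaust[case_product list.exhaust, of _ "tl xs"]) (auto simp: numeral_2_eq_2 length_Suc_conv)
 show ?thesis
 proof (cases "k = 0")
 case True
 have "nm (xs ! 0) & nm (xs ! 1)" if "length xs = 2" using assms(5) that by simp
 thus ?thesis using True Pair two assms(1) unfolding atomF_def atomic_def by auto
 next
 case False
 thus ?thesis unfolding atomF_def atomic_def Pair using assms e tl tr_tupF by (auto simp: map_tl hd_map)
 qed
qed

lemma tr_equivF:
 assumes AB: "nm A" "nm B"
 and at: "!!tg us. (!!u. u:set us ==> tm u) ==> ext (%x. at tg (map (%u. u x) us))"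
 and at': "!!tg us. (!!u. u:set us ==> tm u) ==> ext (%x. at' tg (map (%u. u x) us))"
 and t: "!!tg xs. !x:set xs. nm x ==> tr (at tg xs) <-> a0 tg (map kap xs)"
 and t': "!!tg xs. !x:set xs. nm x ==> tr (at' tg xs) <-> b0 tg (map kap xs)"
 shows "!x:set as. nm x ==> !x:set bs. nm x ==> tr (equivF A B at at' n L as bs) <->
 game_equiv (el (kap A)) (el (kap B)) a0 b0 n L (map kap as) (map kap bs)"
proof (induction n arbitrary: as bs)
 case 0
 have "tr (at tg (map (nth as) is)) <-> a0 tg (map (nth (map kap as)) is)" if "!i:set is. i < length as" for tg "is"
 proof -
 have e: "map kap (map (nth as) is) = map (nth (map kap as)) is" using that by simp
 have "!x:set (map (nth as) is). nm x" using 0(1) that by auto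
 from t[OF this] show ?thesis unfolding e .
 qed
 moreover have "tr (at' tg (map (nth bs) is)) <-> b0 tg (map (nth (map kap bs)) is)" if "!i:set is. i < length bs" for tg "is"
 proof -
 have e: "map kap (map (nth bs) is) = map (nth (map kap bs)) is" using that by simp
 have "!x:set (map (nth bs) is). nm x" using 0(2) that by auto
 from t'[OF this] show ?thesis unfolding e .
 qed
 ultimately show ?case unfolding equivF.simps game_equiv.simps by (induction L) (use AB in "auto split: if_splits")
next
 case (Suc n)
 have e: "ext (%x. equivF A B at at' n L (u x # as) (v x # bs))" if "tm u" "tm v" for u v
 by (rule ext_equivF_Cons[where at = at and at' = at', OF AB at at' that Suc.prems])
 show ?case unfolding equivF.simps game_equiv.simps using Suc.prems AB e Suc.IH by simp
qed

end

section \<open>Names that enumerate the structures and the game between them\<close>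

context forcing
begin

text \<open>\<open>na xx\<close> denotes the element that the injection sends to \<open>xx\<close>
  if there is one, and otherwise any element of \<open>X\<close> if \<open>X\<close> is nonempty.
  The enumeration thus consists of names fixed in advance and indexed by ground sets.\<close>

lemma enumerating_names:
 assumes n: "nm X" "nm f" and p0: "p0:CP" and f: "p0||-is_inj f X (chk E)"
 shows "EX na. (!xx. nm (na xx)) & (!xx. p0||-((?.y. y:.X) ->. na xx:.X)) &
 (!q x. q<~p0 --> nm x --> q||-x:.X --> (EX r xx. r<~q & xx:elts E & feq r x (na xx)))"
proof -
 \<comment> \<open>The two premises make \<open>FEx (?G xx)\<close> forced outright, whether or not
   \<open>X\<close> is empty or \<open>xx\<close> is a value of \<open>f\<close>.\<close>
 let ?G = "%xx x. ((?.y. y:.X) ->. x:.X) &. ((?.y:.X. <|y, chk xx|>:.f) ->. <|x, chk xx|>:.f)"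
 have e: "ext (?G xx)" for xx using n by simp
 have "EX x. nm x & (p0||-FEx (?G xx) --> p0||-?G xx x)" for xx
 proof (rule max_principle[OF e[of xx]])
 fix x assume x: "nm x" and h: "!!p. p||-FEx (?G xx) ==> p||-?G xx x"
 show ?thesis by (rule exI[of _ x], rule conjI[OF x], rule impI, rule h)
 qed
 hence "EX na. !xx. nm (na xx) & (p0||-FEx (?G xx) --> p0||-?G xx (na xx))" by (intro choice) (rule allI)
 then obtain na where na': "!xx. nm (na xx) & (p0||-FEx (?G xx) --> p0||-?G xx (na xx))" ..
 have na: "nm (na xx)" "p0||-FEx (?G xx) ==> p0||-?G xx (na xx)" for xx
 using spec[OF na', of xx] by (rule conjunct1, elim conjE) (erule mp)
 have "p0||-FEx (?G xx)" for xx
 proof (rule by_model[OF p0])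
 fix W assume "gmodel P p0 W"
 then interpret gmodel P p0 W .
 show "tr (FEx (?G xx))"
 proof (cases "EX y:el (kap X). iop y (kap (chk xx)):el (kap f)")
 case True
 thus ?thesis using n by (subst tr_Ex[OF e]) auto
 next
 case False
 thus ?thesis using n by (subst tr_Ex[OF e]) auto
 qed
 qed
 note G = na(2)[OF this]
 have "EX r xx. r<~q & xx:elts E & feq r x (na xx)" if q: "q<~p0" and x: "nm x" "q||-x:.X" for q x
 proof -
 have qc: "q:CP" using le_conds[OF q] by simp
 have fq: "q||-is_inj f X (chk E)" by (rule fo_mono[OF f q])
 have "q||-(?.y:.chk E. <|x, y|>:.f)" by (rule inj_value[OF fq x(2) n(2,1) nm_check x(1) qc])
 then obtain r y where r: "r<~q" "nm y" "r||-y:.chk E" "r||-<|x, y|>:.f" unfolding fo_ExIn using le_refl[OF qc] by blast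
 obtain s xx where s: "s<~r" "xx:elts E" "feq s y (chk xx)" using r(3) le_self[OF r(1)] unfolding fo_Mem_check by blast
 have sq: "s<~q" by (rule le_tr[OF s(1) r(1)])
 have xs: "s||-<|x, chk xx|>:.f"
 by (rule extD[of "%y. <|x, y|>:.f", OF _ r(2) nm_check s(3) fo_mono[OF r(4) s(1)]]) (simp add: x n)
 have "s||-(?.y:.X. <|y, chk xx|>:.f)" unfolding fo_ExIn using xs fo_mono[OF x(2) sq] fo_mono le_self x(1) by blast
 hence "s||-<|na xx, chk xx|>:.f" using G[of xx] le_tr[OF sq q] le_self[OF sq] unfolding forces_Conj fo_Imp by blast
 hence "feq s x (na xx)" using inj_eq[OF fo_mono[OF fq sq] xs] n x(1) na(1) le_conds[OF s(1)] by simp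
 thus ?thesis using sq s(2) by blast
 qed
 thus ?thesis using na(1) G unfolding forces_Conj by blast
qed

end

locale similar_structures = staged P de lam res sup coh D for P :: "'a::zfc forcing" and de lam res sup coh D +
 fixes p0 R F ar A I B J :: 'a and na nb :: "'a => 'a" and rh :: "nat => 'a"
 assumes p0: "p0:CP"
 and nms [simp]: "nm R" "nm F" "nm ar" "nm A" "nm I" "nm B" "nm J" "nm (na xx)" "nm (nb xx)" "nm (rh i)"
 and lang: "p0||-is_countable_language R F ar"
 and strA: "p0||-is_structure R F ar A I" and strB: "p0||-is_structure R F ar B J"
 and equiv: "p0||-elementarily_equivalent R F ar A I B J"
 and na_in: "p0||-na xx:.A" and nb_in: "p0||-nb xx:.B"
 and na_enum: "q<~p0 ==> nm x ==> q||-x:.A ==> EX r xx. r<~q & xx:dl & feq r x (na xx)"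
 and nb_enum: "q<~p0 ==> nm x ==> q||-x:.B ==> EX r xx. r<~q & xx:dl & feq r x (nb xx)"
 and rho_enum: "q<~p0 ==> nm x ==> q||-(x:.R |. x:.F) ==> EX r i. r<~q & feq r x (rh i)"
begin

abbreviation "atA == atomF R F rh I"
abbreviation "atB == atomF R F rh J"

text \<open>What is known about the structures is forced by \<open>p0\<close> only, while the games
  live on all conditions; conditions incompatible with \<open>p0\<close> belong to every such set
  vacuously.\<close>

definition HH :: "nat => ((nat \<times> nat) \<times> nat list) list => 'a list => 'a list => 'a set" where "HH n L as bs = {p:CP. !q. q<~p --> q<~p0 --> q||-equivF A B atA atB n L (map na as) (map nb bs)}"

lemma HH_opn: "p:HH n L as bs ==> q<~p ==> q:HH n L as bs"
proof -
 assume p: "p:HH n L as bs" "q<~p"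
 have "r||-equivF A B atA atB n L (map na as) (map nb bs)" if "r<~q" "r<~p0" for r
 using p(1) le_tr[OF that(1) p(2)] that(2) unfolding HH_def by blast
 thus ?thesis unfolding HH_def using le_conds[OF p(2)] by blast
qed

lemma HH_I: "q<~p0 ==> q||-equivF A B atA atB n L (map na as) (map nb bs) ==> q:HH n L as bs"
proof -
 assume q: "q<~p0" "q||-equivF A B atA atB n L (map na as) (map nb bs)"
 have "r||-equivF A B atA atB n L (map na as) (map nb bs)" if "r<~q" for r by (rule fo_mono[OF q(2) that])
 thus ?thesis unfolding HH_def using le_conds[OF q(1)] by blast
qed

lemma HH_none: "p:CP ==> !q. q<~p --> ~ q<~p0 ==> p:HH n L as bs" unfolding HH_def by blast

lemma ext_at: "(!!u. u:set us ==> tm u) ==> ext (%x. atA tg (map (%u. u x) us))"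
 "(!!u. u:set us ==> tm u) ==> ext (%x. atB tg (map (%u. u x) us))" by (rule ext_atomF; simp)+

lemma ext_eq: "tm u ==> tm v ==> ext (%x. equivF A B atA atB n L (u x # map na as) (v x # map nb bs))"
 by (rule ext_equivF_Cons[where at = atA and at' = atB, OF _ _ ext_at]) auto

text \<open>A move unwinds one quantifier of \<open>equivF\<close>, and the enumerations replace the
  witness by one of the fixed names. The starting position is won by
  \<open>equivalent_game\<close>.\<close>

sublocale game P de lam res sup coh D HH
proof unfold_locales
 fix n :: nat and L and as bs :: "'a list" and p
 let ?E = "equivF A B atA atB n L (map na as) (map nb bs)"
 show "regl (HH n L as bs)" unfolding regl_def opn_def
 proof (intro conjI subsetI ballI allI impI)
 show "x:CP" if "x:HH n L as bs" for x using that unfolding HH_def by blast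
 show "q:HH n L as bs" if "x:HH n L as bs" "q<~x" for x q using HH_opn[OF that] .
 fix x assume x: "x:CP" "!q. q<~x --> (EX r. r<~q & r:HH n L as bs)"
 have "q||-?E" if q: "q<~x" "q<~p0" for q
 proof (rule fo_dense)
 fix q' assume q': "q'<~q"
 then obtain r where r: "r<~q'" "r:HH n L as bs" using x(2) le_tr[OF q' q(1)] by blast
 have "r<~p0" using le_tr[OF r(1) le_tr[OF q' q(2)]] .
 thus "EX r. r<~q' & r||-?E" using r le_self[OF r(1)] unfolding HH_def by blast
 qed
 thus "x:HH n L as bs" unfolding HH_def using x(1) by blast
 qed
 show "p:HH n L [] []" if p: "p:CP"
 proof -
 have "q||-equivF A B atA atB n L [] []" if q: "q<~p0" for q
 proof (rule by_model_le[OF q])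
 fix W assume "gmodel P q W"
 then interpret gmodel P q W .
 have t: "tr X" if "p0||-X" for X by (rule tr_fo[OF fo_mono[OF that q]])
 have "game_equiv (el (kap A)) (el (kap B)) (atomic (kap R) (kap F) (%i. kap (rh i)) (kap I))
 (atomic (kap R) (kap F) (%i. kap (rh i)) (kap J)) n L [] []"
 by (rule equivalent_game[OF _ _ _ _ _ _ _ t[OF lang] t[OF strA] t[OF strB] t[OF equiv]]) simp_all
 thus "tr (equivF A B atA atB n L [] [])"
 by (subst tr_equivF[where at = atA and at' = atB, OF _ _ ext_at tr_atomF tr_atomF]) simp_all
 qed
 thus ?thesis unfolding HH_def using p by simp
 qed
 fix a assume a: "a:dl" and p: "p:HH (Suc n) L as bs"
 have pc: "p:CP" using p unfolding HH_def by blast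
 show "EX q. q<~p & (EX b:dl. q:HH n L (a # as) (b # bs))"
 proof (cases "EX q. q<~p & q<~p0")
 case False
 thus ?thesis using HH_none[OF pc] le_refl[OF pc] a by blast
 next
 case True
 then obtain q where q: "q<~p" "q<~p0" by blast
 hence "q||-equivF A B atA atB (Suc n) L (map na as) (map nb bs)" using p unfolding HH_def by blast
 hence "q||-(!.a:.A. ?.b:.B. equivF A B atA atB n L (a # map na as) (b # map nb bs))" by simp
 hence "q||-(?.b:.B. equivF A B atA atB n L (na a # map na as) (b # map nb bs))"
 unfolding fo_AllIn using nms(8) le_self[OF q(1)] fo_mono[OF na_in q(2)] by blast
 then obtain r y where r: "r<~q" "nm y" "r||-y:.B" "r||-equivF A B atA atB n L (na a # map na as) (y # map nb bs)"
 unfolding fo_ExIn using le_self[OF q(1)] by blast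
 obtain s b where s: "s<~r" "b:dl" "feq s y (nb b)" using nb_enum[OF le_tr[OF r(1) q(2)] r(2,3)] by blast
 have "s||-equivF A B atA atB n L (map na (a # as)) (map nb (b # bs))"
 using extD[OF ext_eq[of "%x. na a" "%x. x"] r(2) nms(9) s(3) fo_mono[OF r(4) s(1)]] by simp
 hence "s:HH n L (a # as) (b # bs)" by (rule HH_I[rotated]) (rule le_tr[OF s(1) le_tr[OF r(1) q(2)]])
 thus ?thesis using le_tr[OF s(1) le_tr[OF r(1) q(1)]] s(2) by blast
 qed
 show "EX q. q<~p & (EX b:dl. q:HH n L (b # as) (a # bs))"
 proof (cases "EX q. q<~p & q<~p0")
 case False
 thus ?thesis using HH_none[OF pc] le_refl[OF pc] a by blast
 next
 case True
 then obtain q where q: "q<~p" "q<~p0" by blast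
 hence "q||-equivF A B atA atB (Suc n) L (map na as) (map nb bs)" using p unfolding HH_def by blast
 hence "q||-(!.b:.B. ?.a:.A. equivF A B atA atB n L (a # map na as) (b # map nb bs))" by simp
 hence "q||-(?.x:.A. equivF A B atA atB n L (x # map na as) (nb a # map nb bs))"
 unfolding fo_AllIn using nms(9) le_self[OF q(1)] fo_mono[OF nb_in q(2)] by blast
 then obtain r y where r: "r<~q" "nm y" "r||-y:.A" "r||-equivF A B atA atB n L (y # map na as) (nb a # map nb bs)"
 unfolding fo_ExIn using le_self[OF q(1)] by blast
 obtain s b where s: "s<~r" "b:dl" "feq s y (na b)" using na_enum[OF le_tr[OF r(1) q(2)] r(2,3)] by blast
 have "s||-equivF A B atA atB n L (map na (b # as)) (map nb (a # bs))"
 using extD[OF ext_eq[of "%x. x" "%x. nb a"] r(2) nms(8) s(3) fo_mono[OF r(4) s(1)]] by simp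
 hence "s:HH n L (b # as) (a # bs)" by (rule HH_I[rotated]) (rule le_tr[OF s(1) le_tr[OF r(1) q(2)]])
 thus ?thesis using le_tr[OF s(1) le_tr[OF r(1) q(1)]] s(2) by blast
 qed
qed

text \<open>One requirement for each atomic formula and finite list of labels; it makes the matching
  respect that formula modulo the ultrafilter.\<close>

definition req :: "nat \<times> nat => (bool \<times> 'a code) list => nat => 'a set" where "req tg ls m = {q:CP. EX av bv. (!l:set ls. q:valF l m (av l) & q:valG l m (bv l)) &
 (!r. r<~q --> r<~p0 --> r||-(atA tg (map (%l. na (av l)) ls) <->. atB tg (map (%l. nb (bv l)) ls)))}"

lemma opn_req: "!l:set ls. lab l ==> opn (req tg ls m)" unfolding opn_def
proof (intro conjI subsetI ballI allI impI)
 fix q r assume ls: "!l:set ls. lab l" and q: "q:req tg ls m" and r: "r<~q"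
 then obtain av bv where ab: "!l:set ls. q:valF l m (av l) & q:valG l m (bv l)"
 "!r. r<~q --> r<~p0 --> r||-(atA tg (map (%l. na (av l)) ls) <->. atB tg (map (%l. nb (bv l)) ls))" unfolding req_def by blast
 have "!l:set ls. r:valF l m (av l) & r:valG l m (bv l)" using ab(1) ls opnD[OF val_opn(1) _ r] opnD[OF val_opn(2) _ r] by blast
 moreover have "!s. s<~r --> s<~p0 --> s||-(atA tg (map (%l. na (av l)) ls) <->. atB tg (map (%l. nb (bv l)) ls))"
 using ab(2) le_tr[OF _ r] by blast
 ultimately show "r:req tg ls m" unfolding req_def using le_conds[OF r] by blast
qed (simp add: req_def)

definition reqs0 :: "((nat => 'a set) \<times> 'a) set"
 where "reqs0 = (%(tg, ls). (req tg ls, weakest P)) ` {(tg, ls). !l:set ls. lab l}"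

text \<open>Finitely many requirements mention finitely many labels, and \<open>matching\<close>,
  with no round left to play and with their atomic formulas as the list \<open>L\<close>, meets all
  of them at one index.\<close>

lemma reqs0: "reqs0<=reqs" "fip reqs0"
proof -
 show "reqs0<=reqs" unfolding reqs0_def reqs_def using opn_req top_in by auto
 show "fip reqs0" unfolding fip_def
 proof (intro allI impI)
 fix T p and N :: nat assume T: "finite T" "T<=reqs0" and p: "p:CP"
 obtain Th where Th: "Th<={(tg, ls). !l:set ls. lab l}" "finite Th" "T = (%(tg, ls). (req tg ls, weakest P)) ` Th"
 using finite_subset_image[OF T[unfolded reqs0_def]] by blast
 have "finite (UN (tg, ls):Th. set ls)" "!l:(UN (tg, ls):Th. set ls). lab l" using Th(1,2) by auto
 from matching[OF this] obtain ls where ls: "set ls = (UN (tg, ls):Th. set ls)"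
 and m: "!n L N. !p:CP. EX m q av bv. N<=m & q<~p &
 (!l:(UN (tg, ls):Th. set ls). q:valF l m (av l) & q:valG l m (bv l)) & q:HH n L (map av ls) (map bv ls)" by (elim exE conjE)
 have "EX is. (!i:set is. i < length ls) & map (nth ls) is = ks" if "set ks<=set ls" for ks using that
 proof (induction ks)
 case (Cons k ks)
 then obtain "is" i where "!i:set is. i < length ls" "map (nth ls) is = ks" "i < length ls" "ls ! i = k"
 by (auto simp: in_set_conv_nth)
 thus ?case by (intro exI[of _ "i # is"]) auto
 qed auto
 \<comment> \<open>The labels of a requirement are rewritten as positions in the common list
   \<open>ls\<close>, the form in which games take their atomic formulas.\<close>
 then obtain pos where pos: "!!ks. set ks<=set ls ==> (!i:set (pos ks). i < length ls) & map (nth ls) (pos ks) = ks" by metis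
 obtain L where L: "set L = (%(tg, ks). (tg, pos ks)) ` Th" using finite_list[of "(%(tg, ks). (tg, pos ks)) ` Th"] Th(2) by blast
 obtain m q av bv where q: "N<=m" "q<~p" "!l:set ls. q:valF l m (av l) & q:valG l m (bv l)"
 "q:HH 0 L (map av ls) (map bv ls)" using m p unfolding ls by blast
 have "q:req tg ks m" if k: "(tg, ks):Th" for tg ks
 proof -
 have ks: "set ks<=set ls" using k ls by auto
 have inL: "(tg, pos ks):set L" unfolding L using k by auto
 have e: "map (nth (map na (map av ls))) (pos ks) = map (%l. na (av l)) ks"
 "map (nth (map nb (map bv ls))) (pos ks) = map (%l. nb (bv l)) ks"
 proof -
 have "map (nth (map h (map g ls))) (pos ks) = map (%l. h (g l)) ks" for h :: "'a => 'a" and g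
 proof -
 have "map (nth (map h (map g ls))) (pos ks) = map (%i. h (g (ls ! i))) (pos ks)" by (rule map_cong) (use pos[OF ks] in auto)
 also have "\<dots> = map (%l. h (g l)) (map (nth ls) (pos ks))" by simp
 finally show ?thesis using pos[OF ks] by simp
 qed
 thus "map (nth (map na (map av ls))) (pos ks) = map (%l. na (av l)) ks"
 "map (nth (map nb (map bv ls))) (pos ks) = map (%l. nb (bv l)) ks" by blast+
 qed
 have "r||-(atA tg (map (%l. na (av l)) ks) <->. atB tg (map (%l. nb (bv l)) ks))" if "r<~q" "r<~p0" for r
 proof -
 have "r||-equivF A B atA atB 0 L (map na (map av ls)) (map nb (map bv ls))" using q(4) that unfolding HH_def by blast
 from bspec[OF this[unfolded equivF_0] inL] show ?thesis using pos[OF ks] e by simp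
 qed
 thus ?thesis unfolding req_def using le_conds[OF q(2)] q(3) ks by blast
 qed
 thus "EX m r. N<=m & r<~p & (!s:T. r:fst s m)" using q(1,2) Th(3) by (intro exI[of _ m] exI[of _ q]) auto
 qed
qed

end

section \<open>Names for matching sequences\<close>

context forcing
begin

lemma fo_nop:
 assumes "nm x" "nm y" "nm f" "p:CP"
 shows "p||-nop x y:.f <-> p||-<|x, y|>:.f"
proof
 assume h: "p||-nop x y:.f"
 show "p||-<|x, y|>:.f"
 proof (rule by_model[OF assms(4)])
 fix W assume "gmodel P p W"
 then interpret gmodel P p W .
 show "tr (<|x, y|>:.f)" using tr_fo[OF h] assms by simp
 qed
next
 assume h: "p||-<|x, y|>:.f"
 show "p||-nop x y:.f"
 proof (rule by_model[OF assms(4)])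
 fix W assume "gmodel P p W"
 then interpret gmodel P p W .
 show "tr (nop x y:.f)" using tr_fo[OF h] assms by simp
 qed
qed

lemma nop_eqD:
 assumes "feq p (nop x y) (nop x' y')" "nm x" "nm y" "nm x'" "nm y'" "p:CP"
 shows "feq p x x'" "feq p y y'"
proof -
 have h: "p||-nop x y =. nop x' y'" using assms(1) by (simp add: fo_Equ)
 have "p||-(x =. x' &. y =. y')"
 proof (rule by_model[OF assms(6)])
 fix W assume "gmodel P p W"
 then interpret gmodel P p W .
 show "tr (x =. x' &. y =. y')" using tr_fo[OF h] assms(2-5) by simp
 qed
 thus "feq p x x'" "feq p y y'" by (simp_all add: fo_Equ)
qed

lemma fo_ExI: "nm x ==> p||-F x ==> p||-FEx F" unfolding fo_Ex using fo_mono le_self by blast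

end

context staged
begin

definition fdom where "fdom nn = (UN xx:dl. range (%m. nop (cn m) (nn xx)))"

definition fname where "fname v nn = mkname (fdom nn) (%z q. EX m xx. z = nop (cn m) (nn xx) & xx:dl & q:v m xx)"

definition value_sets where "value_sets v <-> (!m xx. opn (v m xx)) & (!m xx et q. q:v m xx --> q:v m et --> xx = et) &
 (!m. !p:CP. EX q xx. q<~p & xx:dl & q:v m xx)"

lemma small_fdom: "small (fdom nn)" unfolding fdom_def by (intro small_UN small_elts small_countable) simp

context
 fixes v :: "nat => 'a => 'a set" and nn :: "'a => 'a"
 assumes v: "value_sets v" and nn: "!!xx. nm (nn xx)"
begin

lemma v_opn: "opn (v m xx)" and v_single: "q:v m xx ==> q:v m et ==> xx = et"
 and v_dense: "p:CP ==> EX q xx. q<~p & xx:dl & q:v m xx" using v unfolding value_sets_def by blast+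

lemma nm_fname: "nm (fname v nn)" unfolding fname_def by (rule nm_mkname[OF small_fdom]) (auto simp: fdom_def nn)

lemma fnameI: "r:v m xx ==> xx:dl ==> r||-<|cn m, nn xx|>:.fname v nn"
proof -
 assume r: "r:v m xx" "xx:dl"
 have rc: "r:CP" by (rule opn_conds[OF v_opn r(1)])
 have "vpair (nop (cn m) (nn xx)) r:elts (fname v nn)"
 proof -
 have "nop (cn m) (nn xx):fdom nn" unfolding fdom_def using r(2) by blast
 thus ?thesis unfolding fname_def elts_mkname[OF small_fdom] using r rc by blast
 qed
 from elts_forced[OF this le_refl[OF rc]] show ?thesis using fo_nop[OF nm_check nn nm_fname rc] by simp
qed

lemma fnameD: "p||-z:.fname v nn ==> q<~p ==>
 EX r m xx. r<~q & r:v m xx & xx:dl & feq r z (nop (cn m) (nn xx))"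
proof -
 assume "p||-z:.fname v nn" "q<~p"
 hence "EX r x s. r<~q & x:fdom nn & (EX m xx. x = nop (cn m) (nn xx) & xx:dl & s:v m xx) & r<~s & feq r z x"
 unfolding fname_def fo_mkname[OF small_fdom] by blast
 then obtain r s m xx where r: "r<~q" "xx:dl" "s:v m xx" "r<~s" "feq r z (nop (cn m) (nn xx))" by (elim exE conjE) simp
 have "r:v m xx" by (rule opnD[OF v_opn r(3,4)])
 thus ?thesis using r by (intro exI conjI)
qed

lemma fnameD_pair:
 assumes "p||-<|x, y|>:.fname v nn" "nm x" "nm y" "q<~p"
 shows "EX r m xx. r<~q & r:v m xx & xx:dl & feq r x (cn m) & feq r y (nn xx)"
proof -
 have "p:CP" using le_conds[OF assms(4)] by simp
 hence "p||-nop x y:.fname v nn" using fo_nop[OF assms(2,3) nm_fname] assms(1) by simp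
 from fnameD[OF this assms(4)] obtain r m xx where r: "r<~q" "r:v m xx" "xx:dl" "feq r (nop x y) (nop (cn m) (nn xx))"
 by (elim exE conjE)
 have "r:CP" using le_conds[OF r(1)] by simp
 from nop_eqD[OF r(4) assms(2,3) nm_check nn this] show ?thesis using r(1-3) by blast
qed

lemma fname_total: "p:CP ==> p||-(!.x:.cw. ?.y. <|x, y|>:.fname v nn)"
proof -
 assume p: "p:CP"
 have "p||-(?.y. <|cn m, y|>:.fname v nn)" for m
 proof (rule fo_dense)
 fix q assume q: "q<~p"
 then obtain r xx where r: "r<~q" "xx:dl" "r:v m xx" using v_dense[of q m] le_conds by blast
 thus "EX r. r<~q & r||-(?.y. <|cn m, y|>:.fname v nn)"
 using fo_ExI[where F = "%y. <|cn m, y|>:.fname v nn", OF nn fnameI] by blast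
 qed
 thus ?thesis by (subst fo_AllIn_check) (auto simp: elts_vomega nm_fname)
qed

lemma fname_fun:
 assumes p: "p<~p0" and A: "nm A" "!!xx. p0||-nn xx:.A"
 shows "p||-is_fun (fname v nn) cw A"
proof -
 let ?f = "fname v nn"
 have pc: "p:CP" using le_conds[OF p] by simp
 have 1: "p||-(!.z:.?f. ?.x:.cw. ?.y. is_pair z x y)" unfolding fo_AllIn
 proof (intro allI impI)
 fix z q assume z: "nm z" "q<~p" "q||-z:.?f"
 show "q||-(?.x:.cw. ?.y. is_pair z x y)"
 proof (rule fo_dense)
 fix q' assume "q'<~q"
 from fnameD[OF z(3) this] obtain r m xx where r: "r<~q'" "feq r z (nop (cn m) (nn xx))" by (elim exE conjE)
 have "r||-(?.x:.cw. ?.y. is_pair z x y)"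
 proof (rule by_model_le[OF r(1)])
 fix W assume "gmodel P r W"
 then interpret gmodel P r W .
 have "tr (z =. nop (cn m) (nn xx))" by (rule tr_fo) (use r(2) in "simp add: fo_Equ")
 hence "kap z = iop (num m) (kap (nn xx))" using z(1) nn by (simp add: kap_chk_vnat)
 thus "tr (?.x:.cw. ?.y. is_pair z x y)" using z(1) num_in_om[of m] by (auto simp: om_def[symmetric])
 qed
 thus "EX r. r<~q' & r||-(?.x:.cw. ?.y. is_pair z x y)" using r(1) by blast
 qed
 qed
 have 2: "p||-(!.x y y'. <|x, y|>:.?f &. <|x, y'|>:.?f ->. y =. y')" unfolding forces_All fo_Imp forces_Conj
 proof (intro allI impI, elim conjE)
 fix x y y' q assume n: "nm x" "nm y" "nm y'" and q: "q<~p" "q||-<|x, y|>:.?f" "q||-<|x, y'|>:.?f"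
 show "q||-y =. y'"
 proof (rule fo_dense)
 fix q' assume q': "q'<~q"
 obtain r m xx where r: "r<~q'" "r:v m xx" "feq r x (cn m)" "feq r y (nn xx)"
 using fnameD_pair[OF q(2) n(1,2) q'] by (elim exE conjE)
 obtain s k et where s: "s<~r" "s:v k et" "feq s x (cn k)" "feq s y' (nn et)"
 using fnameD_pair[OF q(3) n(1,3) le_tr[OF r(1) q']] by (elim exE conjE)
 have "feq s (cn m) (cn k)" by (rule feq_trans[OF feq_sym[OF feq_mono[OF r(3) s(1)]] s(3)])
 hence k: "k = m" using check_eq le_conds[OF s(1)] by simp
 have "xx = et" using v_single[OF opnD[OF v_opn r(2) s(1)] s(2)[unfolded k]] .
 hence "feq s y y'" using feq_trans[OF feq_mono[OF r(4) s(1)] feq_sym[OF s(4)[folded \<open>xx = et\<close>]]] by simp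
 thus "EX r. r<~q' & r||-y =. y'" using le_tr[OF s(1) r(1)] by (auto simp: fo_Equ)
 qed
 qed
 have 3: "p||-(!.x y. <|x, y|>:.?f ->. y:.A)" unfolding forces_All fo_Imp
 proof (intro allI impI)
 fix x y q assume n: "nm x" "nm y" and q: "q<~p" "q||-<|x, y|>:.?f"
 show "q||-y:.A"
 proof (rule fo_dense)
 fix q' assume q': "q'<~q"
 obtain r m xx where r: "r<~q'" "feq r y (nn xx)" using fnameD_pair[OF q(2) n q'] by (elim exE conjE)
 have "r<~p0" using le_tr[OF r(1) le_tr[OF q' le_tr[OF q(1) p]]] .
 from Mem_eq1[OF fo_mono[OF A(2) this] feq_sym[OF r(2)]] show "EX r. r<~q' & r||-y:.A" using r(1) by blast
 qed
 qed
 show ?thesis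
 proof (rule by_model[OF pc])
 fix W assume "gmodel P p W"
 then interpret gmodel P p W .
 note t = tr_fo[OF 1] tr_fo[OF 2] tr_fo[OF 3] tr_fo[OF fname_total[OF pc]]
 have i: "isf (kap ?f) om" unfolding isf_def using t(1,2,4) nm_fname A(1) by (simp add: om_def[symmetric]) blast
 moreover have "!x y. iop x y:el (kap ?f) --> y:el (kap A)" using t(3) nm_fname A(1) by simp
 ultimately show "tr (is_fun ?f cw A)" using nm_fname A(1) by (simp add: Fn_def om_def[symmetric] isf_iff)
 qed
qed

text \<open>Quantification over \<open>cw\<close> reduces to numerals, and at each numeral the two
  functions agree densely below \<open>q\<close>.\<close>

lemma fname_eq:
 assumes q: "q<~p0" and A: "nm A" "!!xx. p0||-nn xx:.A" and x: "nm x" "q||-is_fun x cw A"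
 and h: "!!m xx r. r<~q ==> r:v m xx ==> r||-<|cn m, nn xx|>:.x"
 shows "feq q x (fname v nn)"
proof -
 let ?f = "fname v nn"
 have "q||-(?.y. <|cn m, y|>:.x &. <|cn m, y|>:.?f)" for m
 proof (rule fo_dense)
 fix p assume p: "p<~q"
 then obtain r xx where r: "r<~p" "xx:dl" "r:v m xx" using v_dense[of p m] le_conds by blast
 have "r||-<|cn m, nn xx|>:.x" "r||-<|cn m, nn xx|>:.?f" using h[OF le_tr[OF r(1) p] r(3)] fnameI[OF r(3,2)] by auto
 hence "r||-(?.y. <|cn m, y|>:.x &. <|cn m, y|>:.?f)" by (intro fo_ExI[OF nn[of xx]]) simp
 thus "EX r. r<~p & r||-(?.y. <|cn m, y|>:.x &. <|cn m, y|>:.?f)" using r(1) by blast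
 qed
 hence c: "q||-(!.m:.cw. ?.y. <|m, y|>:.x &. <|m, y|>:.?f)" by (subst fo_AllIn_check) (auto simp: elts_vomega nm_fname x(1))
 have "q||-x =. ?f"
 proof (rule by_model_le[OF q])
 fix W assume "gmodel P q W"
 then interpret gmodel P q W .
 have f: "isf (kap x) om" "isf (kap ?f) om"
 using tr_fo[OF x(2)] tr_fo[OF fname_fun[OF q A]] x(1) A(1) nm_fname by (simp_all add: om_def[symmetric] Fn_def)
 have "!m:el om. EX y. iop m y:el (kap x) & iop m y:el (kap ?f)" using tr_fo[OF c] x(1) nm_fname by (simp add: om_def[symmetric])
 hence "kap x = kap ?f" by (intro isf_eqI[OF f]) (auto simp: isf_iff[OF f(1)] isf_iff[OF f(2)])
 thus "tr (x =. ?f)" using x(1) nm_fname by simp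
 qed
 thus ?thesis by (simp add: fo_Equ)
qed

end

text \<open>Below \<open>q\<close> the conditions deciding the value of \<open>x\<close> at
  \<open>m\<close> as some enumerated name are dense, and \<open>code_exists\<close> thins them out
  to a code.\<close>

lemma code_of:
 assumes q: "q<~p0" and A: "nm A" "!!xx. p0||-nn xx:.A" and nn: "!!xx. nm (nn xx)"
 and enum: "!!q x. q<~p0 ==> nm x ==> q||-x:.A ==> EX r xx. r<~q & xx:dl & feq r x (nn xx)"
 and x: "nm x" "q||-is_fun x cw A"
 shows "EX tt. proper tt & (!m xx r. r<~q --> r:cval tt m xx --> r||-<|cn m, nn xx|>:.x)"
proof -
 define G where "G m xx = {r:CP. !s. s<~r --> s<~q --> s||-<|cn m, nn xx|>:.x}" for m xx
 have G: "opn (G m xx)" for m xx unfolding opn_def G_def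
 proof (intro conjI subsetI ballI allI impI)
 fix p r assume p: "p:{r:CP. !s. s<~r --> s<~q --> s||-<|cn m, nn xx|>:.x}" and r: "r<~p"
 have "!s. s<~r --> s<~q --> s||-<|cn m, nn xx|>:.x" using p le_tr[OF _ r] by blast
 thus "r:{r:CP. !s. s<~r --> s<~q --> s||-<|cn m, nn xx|>:.x}" using le_conds[OF r] by blast
 qed simp
 have d: "EX r xx. r<~p & xx:dl & r:G m xx" if p: "p:CP" for m p
 proof (cases "EX r. r<~p & r<~q")
 case False
 \<comment> \<open>A condition incompatible with \<open>q\<close> says nothing about
   \<open>x\<close>; the default value zero keeps the code defined there.\<close>
 hence "p:G m (vset {})" unfolding G_def using p by blast
 thus ?thesis using le_refl[OF p] aleph1_nonempty[OF aleph1] by blast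
 next
 case True
 then obtain r where r: "r<~p" "r<~q" by blast
 have "r||-(?.y:.A. <|cn m, y|>:.x)"
 proof (rule by_model_le[OF r(1)])
 fix W assume "gmodel P r W"
 then interpret gmodel P r W .
 have "Fn (kap x) om (kap A)" using tr_fo[OF fo_mono[OF x(2) r(2)]] x(1) A(1) by (simp add: om_def[symmetric])
 thus "tr (?.y:.A. <|cn m, y|>:.x)" using x(1) A(1) unfolding Fn_def by (auto simp: kap_chk_vnat isf_iff)
 qed
 then obtain s y where s: "s<~r" "nm y" "s||-y:.A" "s||-<|cn m, y|>:.x" unfolding fo_ExIn using le_self[OF r(1)] by blast
 obtain t xx where t: "t<~s" "xx:dl" "feq t y (nn xx)" using enum[OF le_tr[OF s(1) le_tr[OF r(2) q]] s(2,3)] by blast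
 have "t||-<|cn m, nn xx|>:.x" by (rule extD[of "%y. <|cn m, y|>:.x", OF _ s(2) nn t(3) fo_mono[OF s(4) t(1)]]) (simp add: x(1))
 hence "t:G m xx" unfolding G_def using fo_mono le_conds[OF t(1)] by blast
 thus ?thesis using le_tr[OF t(1) le_tr[OF s(1) r(1)]] t(2) by blast
 qed
 have "EX tt. proper tt & (!m x. cval tt m x<=G m x)" by (rule code_exists) (rule G, erule d)
 then obtain tt where t: "proper tt" "!m x. cval tt m x<=G m x" by (elim exE conjE)
 have "r||-<|cn m, nn xx|>:.x" if r: "r<~q" "r:cval tt m xx" for m xx r
 proof -
 have "r:G m xx" using t(2) r(2) by blast
 thus ?thesis unfolding G_def using r(1) le_self[OF r(1)] by blast
 qed
 thus ?thesis using t(1) by blast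
qed

end

context gmodel
begin

lemma slice_Tup:
 assumes s: "isf s (num k)" "!!i. i < k ==> iop (num i) (f i):el s" and f: "!!i. i < k ==> Fn (f i) om A"
 and c: "!!i. i < k ==> iop (num m) (c i):el (f i)"
 shows "Fn s (num k) (ifs om A)" "Slice (num k) s (num m) a ==> Tup a (map c [0..<k])"
proof -
 have sf: "ap s (num i) = f i" if "i < k" for i using s that by (simp add: isf_iff)
 have fc: "ap (f i) (num m) = c i" if "i < k" for i using c[OF that] f[OF that] unfolding Fn_def by (auto simp: isf_iff)
 show "Fn s (num k) (ifs om A)" unfolding Fn_def[of s] using s(1) sf f by (auto simp: el_num)
 show "Slice (num k) s (num m) a ==> Tup a (map c [0..<k])" unfolding Slice_def Tup_def using sf fc by (auto simp: el_num)
qed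

end

locale matched_structures = similar_structures P de lam res sup coh D p0 R F ar A I B J na nb rh +
 bultra P de lam res sup coh D S for P :: "'a::zfc forcing" and de lam res sup coh D p0 R F ar A I B J na nb rh S +
 assumes reqs0_S: "reqs0<=S"
begin

lemma label_values:
 assumes l: "lab l"
 shows "value_sets (valF l)" "value_sets (valG l)"
proof -
 have d: "y:dl" if "y:elts (stg l)" for y using in_delta goodD[OF st(1)[OF l]] that by blast
 show "value_sets (valF l)" unfolding value_sets_def
 using val_opn(1)[OF l] val_single(1)[OF l] val_dense(1)[OF l] val_in(1)[OF l] d by meson
 show "value_sets (valG l)" unfolding value_sets_def
 using val_opn(2)[OF l] val_single(2)[OF l] val_dense(2)[OF l] val_in(2)[OF l] d by meson
qed

definition Xn where "Xn l = fname (valF l) na"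
definition Yn where "Yn l = fname (valG l) nb"

lemma XY:
 assumes l: "lab l"
 shows "nm (Xn l)" "nm (Yn l)" "q<~p0 ==> q||-is_fun (Xn l) cw A" "q<~p0 ==> q||-is_fun (Yn l) cw B"
 "r:valF l m xx ==> r||-<|cn m, na xx|>:.Xn l" "r:valG l m xx ==> r||-<|cn m, nb xx|>:.Yn l"
proof -
 note v = label_values[OF l]
 have d: "y:dl" if "y:elts (stg l)" for y using in_delta goodD[OF st(1)[OF l]] that by blast
 show "nm (Xn l)" "nm (Yn l)" unfolding Xn_def Yn_def using nm_fname[OF v(1)] nm_fname[OF v(2)] by simp_all
 show "q<~p0 ==> q||-is_fun (Xn l) cw A" "q<~p0 ==> q||-is_fun (Yn l) cw B"
 unfolding Xn_def Yn_def using fname_fun[OF v(1) _ _ _ na_in] fname_fun[OF v(2) _ _ _ nb_in] by simp_all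
 show "r:valF l m xx ==> r||-<|cn m, na xx|>:.Xn l" "r:valG l m xx ==> r||-<|cn m, nb xx|>:.Yn l"
 unfolding Xn_def Yn_def using fnameI[OF v(1)] fnameI[OF v(2)] d val_in[OF l] by simp_all
qed

text \<open>A function into the first structure is coded under \<open>True\<close>, one into the
  second under \<open>False\<close>, so that it is the coded side of its pair.\<close>

lemma covers:
 assumes q: "q<~p0" and x: "nm x"
 shows "q||-is_fun x cw A ==> EX l. lab l & feq q x (Xn l)"
 "q||-is_fun x cw B ==> EX l. lab l & feq q x (Yn l)"
proof -
 assume f: "q||-is_fun x cw A"
 obtain tt where t: "proper tt" "!m xx r. r<~q --> r:cval tt m xx --> r||-<|cn m, na xx|>:.x"
 using code_of[OF q nms(4) na_in nms(8) na_enum x f] by blast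
 have v: "value_sets (valF (True, tt))" by (rule label_values) (simp add: t(1))
 have "feq q x (Xn (True, tt))"
 unfolding Xn_def by (rule fname_eq[OF v nms(8) q nms(4) na_in x f]) (use t(2) in "simp add: valF_def")
 thus "EX l. lab l & feq q x (Xn l)" using t(1) by (intro exI[of _ "(True, tt)"]) simp
next
 assume f: "q||-is_fun x cw B"
 obtain tt where t: "proper tt" "!m xx r. r<~q --> r:cval tt m xx --> r||-<|cn m, nb xx|>:.x"
 using code_of[OF q nms(6) nb_in nms(9) nb_enum x f] by blast
 have v: "value_sets (valG (False, tt))" by (rule label_values) (simp add: t(1))
 have "feq q x (Yn (False, tt))"
 unfolding Yn_def by (rule fname_eq[OF v nms(9) q nms(6) nb_in x f]) (use t(2) in "simp add: valG_def")
 thus "EX l. lab l & feq q x (Yn l)" using t(1) by (intro exI[of _ "(False, tt)"]) simp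
qed

text \<open>Labels are HOL functions and do not index a set directly. The names \<open>Xn l\<close>
  and \<open>Yn l\<close>, however, are all cut out of the fixed domains \<open>fdom na\<close> and
  \<open>fdom nb\<close>, so a set contains every pair of them.\<close>

definition pdom where "pdom = (UN x:mkname (fdom na) ` UNIV. nop x ` (mkname (fdom nb) ` UNIV))"

definition prn :: 'a where "prn = mkname (pdom Int Collect nm) (%z q. EX l. lab l & z = nop (Xn l) (Yn l))"

lemma small_pdom: "small (pdom Int Collect nm)"
proof -
 have "small pdom" unfolding pdom_def by (intro small_UN small_image small_mknames small_fdom)
 thus ?thesis by (rule small_subset) blast
qed

lemma nm_prn [simp]: "nm prn" unfolding prn_def by (rule nm_mkname[OF small_pdom]) blast

lemma prnI: "lab l ==> r:CP ==> r||-<|Xn l, Yn l|>:.prn"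
proof -
 assume l: "lab l" and r: "r:CP"
 have "nop (Xn l) (Yn l):pdom Int Collect nm" unfolding pdom_def using XY(1,2)[OF l] by (auto simp: Xn_def Yn_def fname_def)
 hence "vpair (nop (Xn l) (Yn l)) r:elts prn" unfolding prn_def elts_mkname[OF small_pdom] using l r by blast
 from elts_forced[OF this le_refl[OF r]] show ?thesis using fo_nop[OF XY(1,2)[OF l] nm_prn r] by simp
qed

lemma prnD: "p||-z:.prn ==> q<~p ==> EX r l. r<~q & lab l & feq r z (nop (Xn l) (Yn l))"
proof -
 assume "p||-z:.prn" "q<~p"
 hence "EX r x s. r<~q & x:pdom Int Collect nm & (EX l. lab l & x = nop (Xn l) (Yn l)) & r<~s & feq r z x"
 unfolding prn_def fo_mkname[OF small_pdom] by blast
 thus ?thesis by (elim exE conjE) blast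
qed

lemma prnD_pair:
 assumes "p||-<|x, y|>:.prn" "nm x" "nm y" "q<~p"
 shows "EX r l. r<~q & lab l & feq r x (Xn l) & feq r y (Yn l)"
proof -
 have "p:CP" using le_conds[OF assms(4)] by simp
 hence "p||-nop x y:.prn" using fo_nop[OF assms(2,3) nm_prn] assms(1) by simp
 from prnD[OF this assms(4)] obtain r l where r: "r<~q" "lab l" "feq r (nop x y) (nop (Xn l) (Yn l))" by (elim exE conjE)
 have "r:CP" using le_conds[OF r(1)] by simp
 from nop_eqD[OF r(3) assms(2,3) XY(1,2)[OF r(2)] this] show ?thesis using r(1,2) by blast
qed

text \<open>The requirement for \<open>tg\<close> and \<open>ls\<close> puts into the ultrafilter a
  set at whose members the listed labels have decided values on which the atomic formula agrees;
  \<open>Ps\<close> is checked on that set.\<close>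

lemma transfer:
 assumes q: "q<~p0" and ls: "!l:set ls. lab l" and e: "ext Ps"
 and h: "!!m r av bv. r<~q ==> !l:set ls. r:valF l m (av l) & r:valG l m (bv l) ==>
 r||-(atA tg (map (%l. na (av l)) ls) <->. atB tg (map (%l. nb (bv l)) ls)) ==> r||-Ps (cn m)"
 shows "q||-(?.Z:.uname. !.m:.Z. Ps m)"
proof -
 have qc: "q:CP" using le_conds[OF q] by simp
 have "(req tg ls, weakest P):S" using reqs0_S ls unfolding reqs0_def by blast
 hence Z: "q||-nset (req tg ls):.uname" by (rule unameI) (rule le_top[OF qc])
 have "q||-(!.m:.nset (req tg ls). Ps m)" unfolding fo_AllIn
 proof (intro allI impI)
 fix x p assume x: "nm x" "p<~q" "p||-x:.nset (req tg ls)"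
 show "p||-Ps x"
 proof (rule fo_dense)
 fix p' assume p': "p'<~p"
 obtain r m where r: "r<~p'" "r:req tg ls m" "feq r x (cn m)" using nsetD[OF x(3) opn_req[OF ls] p'] by (elim exE conjE)
 obtain av bv where ab: "!l:set ls. r:valF l m (av l) & r:valG l m (bv l)"
 "!s. s<~r --> s<~p0 --> s||-(atA tg (map (%l. na (av l)) ls) <->. atB tg (map (%l. nb (bv l)) ls))"
 using r(2) unfolding req_def by blast
 have rq: "r<~q" by (rule le_tr[OF r(1) le_tr[OF p' x(2)]])
 have "r||-Ps (cn m)" by (rule h[OF rq ab(1)]) (use ab(2) le_self[OF rq] le_tr[OF rq q] in blast)
 from extD[OF e nm_check x(1) feq_sym[OF r(3)] this] show "EX r. r<~p' & r||-Ps x" using r(1) by blast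
 qed
 qed
 thus ?thesis unfolding fo_ExIn using Z fo_mono nm_nset le_self by blast
qed

text \<open>The tuples have standard length \<open>k\<close>, so their entries are matched with
  labels one at a time, each step passing to an extension.\<close>

lemma tuple_labels:
 assumes q: "q<~p0" and n: "nm s" "nm t"
 and s: "q||-is_function_on s (cn k)" and t: "q||-is_function_on t (cn k)"
 and st: "q||-(!.j:.cn k. !.x y. <|j, x|>:.s &. <|j, y|>:.t ->. <|x, y|>:.prn)"
 shows "EX r ls. r<~q & length ls = k & (!l:set ls. lab l) &
 (!i<k. r||-<|cn i, Xn (ls ! i)|>:.s & r||-<|cn i, Yn (ls ! i)|>:.t)"
proof -
 have "EX r ls. r<~q & length ls = k' & (!l:set ls. lab l) &
 (!i<k'. r||-<|cn i, Xn (ls ! i)|>:.s & r||-<|cn i, Yn (ls ! i)|>:.t)" if "k'<=k" for k' using that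
 proof (induction k')
 case 0
 show ?case by (rule exI[of _ q], rule exI[of _ "[]"]) (use le_self[OF le_refl] le_conds[OF q] in simp)
 next
 case (Suc k')
 hence k': "k' < k" by simp
 obtain r ls where r: "r<~q" "length ls = k'" "!l:set ls. lab l"
 "!i<k'. r||-<|cn i, Xn (ls ! i)|>:.s & r||-<|cn i, Yn (ls ! i)|>:.t" using Suc.IH Suc_leD[OF Suc.prems] by blast
 have "r||-(?.x y. <|cn k', x|>:.s &. <|cn k', y|>:.t &. <|x, y|>:.prn)"
 proof (rule by_model_le[OF r(1)])
 fix W assume "gmodel P r W"
 then interpret gmodel P r W .
 have i: "isf (kap s) (num k)" "isf (kap t) (num k)"
 using tr_fo[OF fo_mono[OF s r(1)]] tr_fo[OF fo_mono[OF t r(1)]] n by (simp_all add: kap_chk_vnat)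
 have p: "!j:el (num k). !x y. iop j x:el (kap s) & iop j y:el (kap t) --> iop x y:el (kap prn)"
 using tr_fo[OF fo_mono[OF st r(1)]] n by (simp add: kap_chk_vnat)
 have j: "num k':el (num k)" using k' by (simp add: el_num)
 hence "iop (num k') (ap (kap s) (num k')):el (kap s)" "iop (num k') (ap (kap t) (num k')):el (kap t)"
 using i by (simp_all add: isf_iff)
 moreover from this have "iop (ap (kap s) (num k')) (ap (kap t) (num k')):el (kap prn)" using p j by blast
 ultimately show "tr (?.x y. <|cn k', x|>:.s &. <|cn k', y|>:.t &. <|x, y|>:.prn)" using n by (auto simp: kap_chk_vnat)
 qed
 then obtain r1 x where r1: "r1<~r" "nm x" "r1||-(?.y. <|cn k', x|>:.s &. <|cn k', y|>:.t &. <|x, y|>:.prn)"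
 unfolding fo_Ex[of r] using le_self[OF r(1)] by blast
 then obtain r2 y where r2: "r2<~r1" "nm y" "r2||-<|cn k', x|>:.s" "r2||-<|cn k', y|>:.t" "r2||-<|x, y|>:.prn"
 unfolding fo_Ex[of r1] forces_Conj using le_self[OF r1(1)] by blast
 obtain r3 l where r3: "r3<~r2" "lab l" "feq r3 x (Xn l)" "feq r3 y (Yn l)"
 using prnD_pair[OF r2(5) r1(2) r2(2) le_self[OF r2(1)]] by blast
 have a: "r3||-<|cn k', Xn l|>:.s"
 by (rule extD[of "%x. <|cn k', x|>:.s", OF _ r1(2) XY(1)[OF r3(2)] r3(3) fo_mono[OF r2(3) r3(1)]]) (simp add: n)
 have b: "r3||-<|cn k', Yn l|>:.t"
 by (rule extD[of "%x. <|cn k', x|>:.t", OF _ r2(2) XY(2)[OF r3(2)] r3(4) fo_mono[OF r2(4) r3(1)]]) (simp add: n)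
 have l3: "r3<~r" by (rule le_tr[OF r3(1) le_tr[OF r2(1) r1(1)]])
 have "r3||-<|cn i, Xn ((ls @ [l]) ! i)|>:.s & r3||-<|cn i, Yn ((ls @ [l]) ! i)|>:.t" if "i < Suc k'" for i
 proof (cases "i = k'")
 case True
 thus ?thesis using a b r(2) by (simp add: nth_append)
 next
 case False
 hence "i < k'" using that by simp
 thus ?thesis using r(4) fo_mono[OF _ l3] r(2) by (simp add: nth_append)
 qed
 thus ?case using r(2,3) r3(2) le_tr[OF l3 r(1)] by (intro exI[of _ r3] exI[of _ "ls @ [l]"]) auto
 qed
 thus ?thesis by blast
qed

definition related where "related n s t = (is_function_on s n &. is_function_on t n &.
 (!.j:.n. !.x y. <|j, x|>:.s &. <|j, y|>:.t ->. <|x, y|>:.prn))"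

lemma ext_related [simp]: "tm n ==> tm s ==> tm t ==> ext (%x. related (n x) (s x) (t x))" unfolding related_def by simp

text \<open>Decides by forcing everything that a two-valued structure could leave nonstandard: the
  arity becomes a numeral, the symbol some \<open>rh i\<close>, and the entries of the tuples
  labelled pairs.\<close>

lemma tuple_setup:
 assumes q: "q<~p0" and n: "nm r" "nm n" "nm s" "nm t" and r: "q||-(r:.R |. r:.F)" "q||-<|r, n|>:.ar"
 and st: "q||-related n s t"
 shows "EX q' i ls. q'<~q & (!l:set ls. lab l) & feq q' r (rh i) & feq q' n (cn (length ls)) &
 q'||-related (cn (length ls)) s t &
 (!i<length ls. q'||-<|cn i, Xn (ls ! i)|>:.s & q'||-<|cn i, Yn (ls ! i)|>:.t)"
proof -
 have qc: "q:CP" using le_conds[OF q] by simp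
 have "q||-n:.cw"
 proof (rule by_model[OF qc])
 fix W assume "gmodel P q W"
 then interpret gmodel P q W .
 obtain X where "Fn (kap ar) X om" using tr_fo[OF fo_mono[OF lang q]] by (auto simp: Lang_def)
 moreover have "iop (kap r) (kap n):el (kap ar)" using tr_fo[OF r(2)] n by simp
 ultimately have "kap n:el om" using isf_iff[of "kap ar" X] unfolding Fn_def by auto
 thus "tr (n:.cw)" using n by (simp add: om_def)
 qed
 from omega_member[OF this le_refl[OF qc]] obtain q1 k where q1: "q1<~q" "feq q1 n (cn k)" by (elim exE conjE)
 obtain q2 i where q2: "q2<~q1" "feq q2 r (rh i)" using rho_enum[OF le_tr[OF q1(1) q] n(1) fo_mono[OF r(1) q1(1)]] by blast
 have q20: "q2<~q" by (rule le_tr[OF q2(1) q1(1)])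
 have rl: "q2||-related (cn k) s t"
 by (rule extD[of "%n. related n s t", OF _ n(2) nm_check feq_mono[OF q1(2) q2(1)] fo_mono[OF st q20]]) (simp add: n)
 then obtain q3 ls where q3: "q3<~q2" "length ls = k" "!l:set ls. lab l"
 "!i<k. q3||-<|cn i, Xn (ls ! i)|>:.s & q3||-<|cn i, Yn (ls ! i)|>:.t"
 using tuple_labels[OF le_tr[OF q20 q] n(3,4)] unfolding related_def forces_Conj by blast
 have "q3<~q" "feq q3 r (rh i)" "feq q3 n (cn (length ls))" "q3||-related (cn (length ls)) s t"
 using le_tr[OF q3(1) q20] feq_mono[OF q2(2) q3(1)] feq_mono[OF q1(2) le_tr[OF q3(1) q2(1)]] fo_mono[OF rl q3(1)] q3(2) by auto
 thus ?thesis using q3(2-4) by (intro exI[of _ q3] exI[of _ i] exI[of _ ls]) simp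
qed

end

context gmodel
begin

lemma Struct_unique: "Struct R F ar A I ==> iop x V:el I ==> iop x V':el I ==> V' = V"
 unfolding Struct_def by (auto simp: isf_iff)

end

section \<open>The matching respects atomic formulas almost everywhere\<close>

context matched_structures
begin

lemma label_model:
 assumes W: "gmodel P t W" and t: "t<~p0" and l: "lab l"
 shows "gmodel.Fn P W (gmodel.kap P W (Xn l)) (gmodel.om P W) (gmodel.kap P W A)"
 "gmodel.Fn P W (gmodel.kap P W (Yn l)) (gmodel.om P W) (gmodel.kap P W B)"
 "t:valF l m xx ==> gmodel.iop P W (gmodel.num P W m) (gmodel.kap P W (na xx)):gmodel.el P W (gmodel.kap P W (Xn l))"
 "t:valG l m xx ==> gmodel.iop P W (gmodel.num P W m) (gmodel.kap P W (nb xx)):gmodel.el P W (gmodel.kap P W (Yn l))"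
proof -
 interpret gmodel P t W by (rule W)
 note XY = XY[OF l]
 show "Fn (kap (Xn l)) om (kap A)" "Fn (kap (Yn l)) om (kap B)"
 using tr_fo[OF XY(3)[OF t]] tr_fo[OF XY(4)[OF t]] XY(1,2) by (simp_all add: om_def[symmetric])
 show "t:valF l m xx ==> iop (num m) (kap (na xx)):el (kap (Xn l))" using tr_fo[OF XY(5)] XY(1) by (simp add: kap_chk_vnat)
 show "t:valG l m xx ==> iop (num m) (kap (nb xx)):el (kap (Yn l))" using tr_fo[OF XY(6)] XY(2) by (simp add: kap_chk_vnat)
qed

lemma slices_model:
 assumes W: "gmodel P r W" and q: "r<~q" "q<~p0" and n: "nm s" "nm t" and ls: "!l:set ls. lab l"
 and rl: "q||-related (cn (length ls)) s t"
 and st: "!i<length ls. q||-<|cn i, Xn (ls ! i)|>:.s & q||-<|cn i, Yn (ls ! i)|>:.t"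
 and ab: "!l:set ls. r:valF l m (av l) & r:valG l m (bv l)"
 shows "gmodel.tr P W (is_slice s (cn m) (gmodel.nu P W a)) ==> gmodel.Tup P W a (map (gmodel.kap P W) (map (%l. na (av l)) ls))"
 "gmodel.tr P W (is_slice t (cn m) (gmodel.nu P W b)) ==> gmodel.Tup P W b (map (gmodel.kap P W) (map (%l. nb (bv l)) ls))"
proof -
 interpret gmodel P r W by (rule W)
 have rp: "r<~p0" by (rule le_tr[OF q])
 let ?k = "length ls"
 have i: "isf (kap s) (num ?k)" "isf (kap t) (num ?k)"
 using tr_fo[OF fo_mono[OF rl q(1)]] n unfolding related_def by (simp_all add: kap_chk_vnat)
 have pl: "proper (snd (ls ! i))" if "i < ?k" for i using ls that by simp
 note m = label_model[OF W rp pl]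
 have s: "iop (num i) (kap (Xn (ls ! i))):el (kap s)" "iop (num i) (kap (Yn (ls ! i))):el (kap t)" if "i < ?k" for i
 using tr_fo[OF fo_mono[OF conjunct1[OF st[rule_format, OF that]] q(1)]] tr_fo[OF fo_mono[OF conjunct2[OF st[rule_format, OF that]] q(1)]]
 n XY(1,2)[OF pl[OF that]] by (simp_all add: kap_chk_vnat)
 have v: "iop (num m) (kap (na (av (ls ! i)))):el (kap (Xn (ls ! i)))" "iop (num m) (kap (nb (bv (ls ! i)))):el (kap (Yn (ls ! i)))"
 if "i < ?k" for i using m(3,4)[OF that] ab that by simp_all
 have e: "map (%i. kap (h (ls ! i))) [0..<?k] = map kap (map h ls)" for h :: "_ => 'a" by (rule nth_equalityI) simp_all
 note S = slice_Tup[OF i(1) s(1) m(1) v(1)] slice_Tup[OF i(2) s(2) m(2) v(2)]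
 show "tr (is_slice s (cn m) (nu a)) ==> Tup a (map kap (map (%l. na (av l)) ls))"
 using S(2) tr_is_slice[OF n(1) nm_check nm_nu S(1)] e[of "%l. na (av l)"] by (simp add: kap_chk_vnat)
 show "tr (is_slice t (cn m) (nu b)) ==> Tup b (map kap (map (%l. nb (bv l)) ls))"
 using S(4) tr_is_slice[OF n(2) nm_check nm_nu S(3)] e[of "%l. nb (bv l)"] by (simp add: kap_chk_vnat)
qed

text \<open>Stated as a forced formula, because matched functions are given by labels only densely;
  once labels are found, \<open>transfer\<close> with the equality atom applies.\<close>

lemma equal_transfer:
 "p0||-(!.f g. !.f' g'. <|f, g|>:.prn &. <|f', g'|>:.prn ->. (?.Z:.uname. !.m:.Z.
 !.a a'. !.b b'. <|m, a|>:.f &. <|m, a'|>:.f' &. <|m, b|>:.g &. <|m, b'|>:.g' ->. (a =. a' <->. b =. b')))"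
 unfolding forces_All fo_Imp forces_Conj
proof (intro allI impI, elim conjE)
 fix f g f' g' q assume n: "nm f" "nm g" "nm f'" "nm g'" and q: "q<~p0" "q||-<|f, g|>:.prn" "q||-<|f', g'|>:.prn"
 let ?Ps = "%m. !.a a'. !.b b'. <|m, a|>:.f &. <|m, a'|>:.f' &. <|m, b|>:.g &. <|m, b'|>:.g' ->. (a =. a' <->. b =. b')"
 have e: "ext ?Ps" using n by simp
 show "q||-(?.Z:.uname. !.m:.Z. ?Ps m)"
 proof (rule fo_dense)
 fix q' assume q': "q'<~q"
 obtain r l where r: "r<~q'" "lab l" "feq r f (Xn l)" "feq r g (Yn l)" using prnD_pair[OF q(2) n(1,2) q'] by blast
 obtain s l' where s: "s<~r" "proper (snd l')" "feq s f' (Xn l')" "feq s g' (Yn l')"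
 using prnD_pair[OF q(3) n(3,4) le_tr[OF r(1) q']] by blast
 have sp: "s<~p0" using le_tr[OF s(1) le_tr[OF r(1) le_tr[OF q' q(1)]]] .
 have "s||-(?.Z:.uname. !.m:.Z. ?Ps m)"
 proof (rule transfer[OF sp _ e, of "[l, l']" "(0, 0)"])
 show "!l:set [l, l']. lab l" using r(2) s(2) by simp
 fix m t av bv assume t: "t<~s" and ab: "!l:set [l, l']. t:valF l m (av l) & t:valG l m (bv l)"
 and at: "t||-(atA (0, 0) (map (%l. na (av l)) [l, l']) <->. atB (0, 0) (map (%l. nb (bv l)) [l, l']))"
 show "t||-?Ps (cn m)"
 proof (rule by_model_le[OF t])
 fix W assume W: "gmodel P t W"
 then interpret gmodel P t W .
 have tp: "t<~p0" by (rule le_tr[OF t sp])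
 have k: "kap f = kap (Xn l)" "kap g = kap (Yn l)" "kap f' = kap (Xn l')" "kap g' = kap (Yn l')"
 using feq_mono[OF r(3) le_tr[OF t s(1)]] feq_mono[OF r(4) le_tr[OF t s(1)]] feq_mono[OF s(3) t] feq_mono[OF s(4) t]
 tr_fo[unfolded fo_Equ] n XY(1,2)[OF r(2)] XY(1,2)[OF s(2)] by (auto simp flip: tr_Equ fo_Equ intro: tr_fo)
 note m = label_model[OF W tp r(2)] label_model[OF W tp s(2)]
 have v: "iop (num m) a:el (kap f) <-> a = kap (na (av l))" "iop (num m) a:el (kap f') <-> a = kap (na (av l'))"
 "iop (num m) a:el (kap g) <-> a = kap (nb (bv l))" "iop (num m) a:el (kap g') <-> a = kap (nb (bv l'))" for a
 unfolding k using m ab unfolding Fn_def by (auto simp: isf_iff)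
 have "kap (na (av l)) = kap (na (av l')) <-> kap (nb (bv l)) = kap (nb (bv l'))" using tr_fo[OF at] by (simp add: atomF_def)
 thus "tr (?Ps (cn m))" using n v by (simp add: kap_chk_vnat)
 qed
 qed
 thus "EX r. r<~q' & r||-(?.Z:.uname. !.m:.Z. ?Ps m)" using le_tr[OF s(1) r(1)] by blast
 qed
qed

lemma rel_transfer:
 "p0||-(!.r:.R. !.n V. !.V' s t. <|r, n|>:.ar &. <|r, V|>:.I &. <|r, V'|>:.J &. related n s t ->.
 (?.Z:.uname. !.m:.Z. !.a b. is_slice s m a &. is_slice t m b ->. (a:.V <->. b:.V')))"
 unfolding fo_AllIn forces_All fo_Imp forces_Conj
proof (intro allI impI, elim conjE)
 fix r q1 n V V' s t q assume nr: "nm r" and rR: "q1||-r:.R" and n: "nm n" "nm V" "nm V'" "nm s" "nm t"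
 and q1: "q1<~p0" and q: "q<~q1"
 and h: "q||-<|r, n|>:.ar" "q||-<|r, V|>:.I" "q||-<|r, V'|>:.J" "q||-related n s t"
 let ?Ps = "%m. !.a b. is_slice s m a &. is_slice t m b ->. (a:.V <->. b:.V')"
 have e: "ext ?Ps" using n by simp
 show "q||-(?.Z:.uname. !.m:.Z. ?Ps m)"
 proof (rule fo_dense)
 fix q2 assume q2: "q2<~q"
 have q2p: "q2<~p0" by (rule le_tr[OF q2 le_tr[OF q q1]])
 obtain q' i ls where q': "q'<~q2" and ls: "!l:set ls. lab l" and ri: "feq q' r (rh i)"
 and rl: "q'||-related (cn (length ls)) s t"
 and st: "!i<length ls. q'||-<|cn i, Xn (ls ! i)|>:.s & q'||-<|cn i, Yn (ls ! i)|>:.t"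
 using tuple_setup[OF q2p nr n(1,4,5) fo_DisjI1[OF fo_mono[OF rR le_tr[OF q2 q]]] fo_mono[OF h(1) q2] fo_mono[OF h(4) q2]] by blast
 have q'p: "q'<~p0" by (rule le_tr[OF q' q2p])
 have "q'||-(?.Z:.uname. !.m:.Z. ?Ps m)"
 proof (rule transfer[OF q'p ls e, of "(1, i)"])
 fix m u av bv assume u: "u<~q'" and ab: "!l:set ls. u:valF l m (av l) & u:valG l m (bv l)"
 and at: "u||-(atA (1, i) (map (%l. na (av l)) ls) <->. atB (1, i) (map (%l. nb (bv l)) ls))"
 show "u||-?Ps (cn m)"
 proof (rule by_model_le[OF u])
 fix W assume W: "gmodel P u W"
 then interpret gmodel P u W .
 have uq: "u<~q" by (rule le_tr[OF u le_tr[OF q' q2]])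
 have up: "u<~p0" by (rule le_tr[OF u q'p])
 have "tr (r =. rh i)" by (rule tr_fo) (simp add: fo_Equ feq_mono[OF ri u])
 hence k: "kap r = kap (rh i)" using nr by simp
 have f: "kap (rh i):el (kap R)" "iop (kap (rh i)) (kap V):el (kap I)" "iop (kap (rh i)) (kap V'):el (kap J)"
 using tr_fo[OF fo_mono[OF rR le_tr[OF uq q]]] tr_fo[OF fo_mono[OF h(2) uq]] tr_fo[OF fo_mono[OF h(3) uq]] n nr k by simp_all
 have st': "Struct (kap R) (kap F) (kap ar) (kap A) (kap I)" "Struct (kap R) (kap F) (kap ar) (kap B) (kap J)"
 using tr_fo[OF fo_mono[OF strA up]] tr_fo[OF fo_mono[OF strB up]] by simp_all
 have un: "X = kap V" if "iop (kap (rh i)) X:el (kap I)" for X by (rule Struct_unique[OF st'(1) f(2) that])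
 have un': "X = kap V'" if "iop (kap (rh i)) X:el (kap J)" for X by (rule Struct_unique[OF st'(2) f(3) that])
 note sl = slices_model[OF W u q'p n(4,5) ls rl st ab]
 have "atomic (kap R) (kap F) (%i. kap (rh i)) (kap I) (1, i) (map kap (map (%l. na (av l)) ls)) <->
 atomic (kap R) (kap F) (%i. kap (rh i)) (kap J) (1, i) (map kap (map (%l. nb (bv l)) ls))"
 using tr_fo[OF at] by (simp add: tr_atomF)
 hence "a:el (kap V) <-> b:el (kap V')" if "tr (is_slice s (cn m) (nu a))" "tr (is_slice t (cn m) (nu b))" for a b
 using atomic_rel[where rh = "%i. kap (rh i)" and i = i, OF f(1) sl(1)[OF that(1)] f(2) un]
 atomic_rel[where rh = "%i. kap (rh i)" and i = i, OF f(1) sl(2)[OF that(2)] f(3) un'] by blast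
 thus "tr (?Ps (cn m))" using n by simp
 qed
 qed
 thus "EX r. r<~q2 & r||-(?.Z:.uname. !.m:.Z. ?Ps m)" using q' by blast
 qed
qed

lemma app_transfer:
 "p0||-(!.r:.F. !.n V. !.V' s. !.t x y. <|r, n|>:.ar &. <|r, V|>:.I &. <|r, V'|>:.J &. related n s t &. <|x, y|>:.prn ->.
 (?.Z:.uname. !.m:.Z. !.a b. !.c d. is_slice s m a &. is_slice t m b &. <|m, c|>:.x &. <|m, d|>:.y ->.
 (<|a, c|>:.V <->. <|b, d|>:.V')))" unfolding fo_AllIn forces_All fo_Imp forces_Conj
proof (intro allI impI, elim conjE)
 fix r q1 n V V' s t x y q assume nr: "nm r" and rR: "q1||-r:.F" and n: "nm n" "nm V" "nm V'" "nm s" "nm t" "nm x" "nm y"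
 and q1: "q1<~p0" and q: "q<~q1"
 and h: "q||-<|r, n|>:.ar" "q||-<|r, V|>:.I" "q||-<|r, V'|>:.J" "q||-related n s t" "q||-<|x, y|>:.prn"
 let ?Ps = "%m. !.a b. !.c d. is_slice s m a &. is_slice t m b &. <|m, c|>:.x &. <|m, d|>:.y ->. (<|a, c|>:.V <->. <|b, d|>:.V')"
 have e: "ext ?Ps" using n by simp
 show "q||-(?.Z:.uname. !.m:.Z. ?Ps m)"
 proof (rule fo_dense)
 fix q0 assume q0: "q0<~q"
 obtain q2 l where q2: "q2<~q0" "lab l" "feq q2 x (Xn l)" "feq q2 y (Yn l)" using prnD_pair[OF h(5) n(6,7) q0] by blast
 have q2q: "q2<~q" by (rule le_tr[OF q2(1) q0])
 have q2p: "q2<~p0" by (rule le_tr[OF q2q le_tr[OF q q1]])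
 obtain q' i ls where q': "q'<~q2" and ls: "!l:set ls. lab l" and ri: "feq q' r (rh i)"
 and rl: "q'||-related (cn (length ls)) s t"
 and st: "!i<length ls. q'||-<|cn i, Xn (ls ! i)|>:.s & q'||-<|cn i, Yn (ls ! i)|>:.t"
 using tuple_setup[OF q2p nr n(1,4,5) fo_DisjI2[OF fo_mono[OF rR le_tr[OF q2q q]]] fo_mono[OF h(1) q2q] fo_mono[OF h(4) q2q]] by blast
 have q'p: "q'<~p0" by (rule le_tr[OF q' q2p])
 have lls: "!k:set (l # ls). proper (snd k)" using ls q2(2) by simp
 have "q'||-(?.Z:.uname. !.m:.Z. ?Ps m)"
 \<comment> \<open>A tag beyond 1 stands for the graph of the function \<open>rh i\<close>, and the
   label of the value comes first in the list.\<close>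
 proof (rule transfer[OF q'p lls e, of "(2, i)"])
 fix m u av bv assume u: "u<~q'" and ab: "!l:set (l # ls). u:valF l m (av l) & u:valG l m (bv l)"
 and at: "u||-(atA (2, i) (map (%l. na (av l)) (l # ls)) <->. atB (2, i) (map (%l. nb (bv l)) (l # ls)))"
 have ab': "!l:set ls. u:valF l m (av l) & u:valG l m (bv l)" using ab by simp
 show "u||-?Ps (cn m)"
 proof (rule by_model_le[OF u])
 fix W assume W: "gmodel P u W"
 then interpret gmodel P u W .
 have uq: "u<~q" by (rule le_tr[OF u le_tr[OF q' q2q]])
 have up: "u<~p0" by (rule le_tr[OF u q'p])
 have "tr (r =. rh i)" "tr (x =. Xn l)" "tr (y =. Yn l)"
 by (rule tr_fo; simp add: fo_Equ feq_mono[OF ri u] feq_mono[OF q2(3) le_tr[OF u q']] feq_mono[OF q2(4) le_tr[OF u q']])+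
 hence k: "kap r = kap (rh i)" "kap x = kap (Xn l)" "kap y = kap (Yn l)" using nr n XY(1,2)[OF q2(2)] by simp_all
 note m = label_model[OF W up q2(2)]
 have v: "iop (num m) c:el (kap x) <-> c = kap (na (av l))" "iop (num m) c:el (kap y) <-> c = kap (nb (bv l))" for c
 unfolding k using m ab unfolding Fn_def by (auto simp: isf_iff)
 have f: "kap (rh i):el (kap F)" "iop (kap (rh i)) (kap V):el (kap I)" "iop (kap (rh i)) (kap V'):el (kap J)"
 using tr_fo[OF fo_mono[OF rR le_tr[OF uq q]]] tr_fo[OF fo_mono[OF h(2) uq]] tr_fo[OF fo_mono[OF h(3) uq]] n nr k by simp_all
 have st': "Struct (kap R) (kap F) (kap ar) (kap A) (kap I)" "Struct (kap R) (kap F) (kap ar) (kap B) (kap J)"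
 using tr_fo[OF fo_mono[OF strA up]] tr_fo[OF fo_mono[OF strB up]] by simp_all
 have un: "X = kap V" if "iop (kap (rh i)) X:el (kap I)" for X by (rule Struct_unique[OF st'(1) f(2) that])
 have un': "X = kap V'" if "iop (kap (rh i)) X:el (kap J)" for X by (rule Struct_unique[OF st'(2) f(3) that])
 note sl = slices_model[OF W u q'p n(4,5) ls rl st ab']
 have two: "(2::nat) ~= 0" "(2::nat) ~= 1" by simp_all
 have "atomic (kap R) (kap F) (%i. kap (rh i)) (kap I) (2, i) (kap (na (av l)) # map kap (map (%l. na (av l)) ls)) <->
 atomic (kap R) (kap F) (%i. kap (rh i)) (kap J) (2, i) (kap (nb (bv l)) # map kap (map (%l. nb (bv l)) ls))"
 using tr_fo[OF at] by (simp add: tr_atomF)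
 hence "iop a (kap (na (av l))):el (kap V) <-> iop b (kap (nb (bv l))):el (kap V')"
 if "tr (is_slice s (cn m) (nu a))" "tr (is_slice t (cn m) (nu b))" for a b
 using atomic_app[where rh = "%i. kap (rh i)" and i = i, OF two f(1) sl(1)[OF that(1)] f(2) un]
 atomic_app[where rh = "%i. kap (rh i)" and i = i, OF two f(1) sl(2)[OF that(2)] f(3) un'] by blast
 thus "tr (?Ps (cn m))" using n v by (simp add: kap_chk_vnat)
 qed
 qed
 thus "EX r. r<~q0 & r||-(?.Z:.uname. !.m:.Z. ?Ps m)" using le_tr[OF q' q2(1)] by blast
 qed
qed

lemma prn_total1:
 "p0||-(!.f. is_fun f cw A ->. (?.g. <|f, g|>:.prn))" unfolding forces_All fo_Imp
proof (intro allI impI)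
 fix f q assume f: "nm f" and q: "q<~p0" "q||-is_fun f cw A"
 obtain l where l: "lab l" "feq q f (Xn l)" using covers(1)[OF q(1) f q(2)] by blast
 have "q:CP" using le_conds[OF q(1)] by simp
 from extD[of "%x. <|x, Yn l|>:.prn", OF _ XY(1)[OF l(1)] f feq_sym[OF l(2)] prnI[OF l(1) this]]
 have "q||-<|f, Yn l|>:.prn" using XY(2)[OF l(1)] by simp
 thus "q||-(?.g. <|f, g|>:.prn)" by (rule fo_ExI[OF XY(2)[OF l(1)]])
qed

lemma prn_total2:
 "p0||-(!.g. is_fun g cw B ->. (?.f. <|f, g|>:.prn))" unfolding forces_All fo_Imp
proof (intro allI impI)
 fix g q assume g: "nm g" and q: "q<~p0" "q||-is_fun g cw B"
 obtain l where l: "lab l" "feq q g (Yn l)" using covers(2)[OF q(1) g q(2)] by blast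
 have "q:CP" using le_conds[OF q(1)] by simp
 from extD[of "%y. <|Xn l, y|>:.prn", OF _ XY(2)[OF l(1)] g feq_sym[OF l(2)] prnI[OF l(1) this]]
 have "q||-<|Xn l, g|>:.prn" using XY(1)[OF l(1)] by simp
 thus "q||-(?.f. <|f, g|>:.prn)" by (rule fo_ExI[OF XY(1)[OF l(1)]])
qed

lemma prn_pairs: "p0||-(!.z:.prn. ?.f g. is_pair z f g &. is_fun f cw A &. is_fun g cw B)" (is "p0||-AllIn prn ?G")
 unfolding fo_AllIn
proof (intro allI impI)
 fix z q assume z: "nm z" "q<~p0" "q||-z:.prn"
 show "q||-?G z"
 proof (rule fo_dense)
 fix q' assume q': "q'<~q"
 obtain r l where r: "r<~q'" "lab l" "feq r z (nop (Xn l) (Yn l))" using prnD[OF z(3) q'] by blast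
 have rp: "r<~p0" by (rule le_tr[OF r(1) le_tr[OF q' z(2)]])
 have "r||-?G z"
 proof (rule by_model_le[OF rp])
 fix W assume W: "gmodel P r W"
 then interpret gmodel P r W .
 have "tr (z =. nop (Xn l) (Yn l))" by (rule tr_fo) (simp add: fo_Equ r(3))
 hence "kap z = iop (kap (Xn l)) (kap (Yn l))" using z(1) XY(1,2)[OF r(2)] by simp
 thus "tr (?G z)" using label_model(1,2)[OF W rp r(2)] z(1) by (simp add: om_def[symmetric])
 qed
 thus "EX r. r<~q' & r||-?G z" using r(1) by blast
 qed
qed

end

context gmodel
begin

lemma tr_ExI: "tr (F (nu m)) ==> ext F ==> tr (FEx F)" using tr_Ex by blast

lemma isomorphic_names:
 assumes n: "nm R" "nm F" "nm ar" and t: "tr (isomorphic (nu (kap R)) (nu (kap F)) (nu (kap ar)) (nu A) (nu I) (nu B) (nu J))"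
 shows "tr (isomorphic R F ar (nu A) (nu I) (nu B) (nu J))"
 using t tr_kap_ext[of "%x. isomorphic x (nu (kap F)) (nu (kap ar)) (nu A) (nu I) (nu B) (nu J)" R]
 tr_kap_ext[of "%x. isomorphic R x (nu (kap ar)) (nu A) (nu I) (nu B) (nu J)" F]
 tr_kap_ext[of "%x. isomorphic R F x (nu A) (nu I) (nu B) (nu J)" ar] n by simp

end

context matched_structures
begin

text \<open>Read in a structure over \<open>p0\<close>, the forced transfer statements become the
  hypotheses on \<open>Pr\<close> under which the ultrapowers are isomorphic.\<close>

lemma isomorphic_ultrapowers:
 "p0||-(?.C K. ?.D M. is_ultrapower cw uname R F ar A I C K &.
 is_ultrapower cw uname R F ar B J D M &. isomorphic R F ar C K D M)"
proof (rule by_model[OF p0])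
 fix W assume "gmodel P p0 W"
 then interpret gmodel P p0 W .
 note [simp] = nm_uname
 have U: "Filt (kap uname)" by (rule tr_filter[OF nm_check nm_uname om_def[symmetric] tr_fo[OF uname_ultrafilter[OF p0]]])
 have L: "Lang (kap R) (kap F) (kap ar)" using tr_fo[OF lang] by simp
 have IA: "Struct (kap R) (kap F) (kap ar) (kap A) (kap I)" using tr_fo[OF strA] by simp
 have IB: "Struct (kap R) (kap F) (kap ar) (kap B) (kap J)" using tr_fo[OF strB] by simp
 obtain C K where upA: "UP (kap uname) (kap R) (kap F) (kap ar) (kap A) (kap I) C K" using UP_exists[OF U L IA] by blast
 obtain D M where upB: "UP (kap uname) (kap R) (kap F) (kap ar) (kap B) (kap J) D M" using UP_exists[OF U L IB] by blast
 have Pr: "!z:el (kap prn). EX f g. z = iop f g & Fn f om (kap A) & Fn g om (kap B)"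
 using tr_fo[OF prn_pairs] by (simp add: om_def[symmetric])
 have PrD: "Fn f om (kap A)" "Fn g om (kap B)" if "iop f g:el (kap prn)" for f g using Pr that by fastforce+
 have P1: "EX g. iop f g:el (kap prn)" if "Fn f om (kap A)" for f using tr_fo[OF prn_total1] that by (simp add: om_def[symmetric])
 have P2: "EX f. iop f g:el (kap prn)" if "Fn g om (kap B)" for g using tr_fo[OF prn_total2] that by (simp add: om_def[symmetric])
 have apI: "iop m (ap f m):el f" if "Fn f om X" "m:el om" for f m X using that isf_iff[of f om] unfolding Fn_def by auto
 have P3: "large (kap uname) (%m. ap f m = ap f' m <-> ap g m = ap g' m)"
 if h: "iop f g:el (kap prn)" "iop f' g':el (kap prn)" for f g f' g'
 proof -
 have "!f g f' g'. iop f g:el (kap prn) & iop f' g':el (kap prn) --> (EX Z:el (kap uname). !m:el Z. !a a' b b'.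
 iop m a:el f & iop m a':el f' & iop m b:el g & iop m b':el g' --> (a = a' <-> b = b'))" using tr_fo[OF equal_transfer] by simp
 with h have "large (kap uname) (%m. !a a' b b'. iop m a:el f & iop m a':el f' & iop m b:el g & iop m b':el g' --> (a = a' <-> b = b'))"
 unfolding large_def by blast
 thus ?thesis
 by (rule large_mono[OF U]) (use apI[OF PrD(1)[OF h(1)]] apI[OF PrD(2)[OF h(1)]] apI[OF PrD(1)[OF h(2)]] apI[OF PrD(2)[OF h(2)]] in blast)
 qed
 have rl: "tr (related (nu n) (nu s) (nu t))" if "isf s n" "isf t n" "!j:el n. iop (ap s j) (ap t j):el (kap prn)" for n s t
 using that unfolding related_def by (auto simp: isf_iff)
 have sl: "tr (is_slice (nu s) (nu m) (nu a)) <-> Slice n s m a" "tr (is_slice (nu t) (nu m) (nu a)) <-> Slice n t m a"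
 if h: "isf s n" "isf t n" "!j:el n. iop (ap s j) (ap t j):el (kap prn)" and m: "m:el om" for n s t m a
 proof -
 have "Fn s n (ifs om (kap A))" "Fn t n (ifs om (kap B))" using h PrD unfolding Fn_def[of s] Fn_def[of t] by auto
 thus "tr (is_slice (nu s) (nu m) (nu a)) <-> Slice n s m a" "tr (is_slice (nu t) (nu m) (nu a)) <-> Slice n t m a"
 using tr_is_slice[of "nu s" "nu m" "nu a" n "kap A"] tr_is_slice[of "nu t" "nu m" "nu a" n "kap B"] m by simp_all
 qed
 have P4: "large (kap uname) (%m. !a b. Slice n s m a --> Slice n t m b --> (a:el V <-> b:el V'))"
 if r: "r:el (kap R)" "iop r n:el (kap ar)" "iop r V:el (kap I)" "iop r V':el (kap J)"
 and st: "isf s n" "isf t n" "!j:el n. iop (ap s j) (ap t j):el (kap prn)" for r n V V' s t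
 proof -
 have "!r:el (kap R). !n V V' s t. iop r n:el (kap ar) & iop r V:el (kap I) & iop r V':el (kap J) &
 tr (related (nu n) (nu s) (nu t)) --> (EX Z:el (kap uname). !m:el Z. !a b.
 tr (is_slice (nu s) (nu m) (nu a)) & tr (is_slice (nu t) (nu m) (nu b)) --> (a:el V <-> b:el V'))"
 using tr_fo[OF rel_transfer] by simp
 with r rl[OF st] have "large (kap uname) (%m. !a b.
 tr (is_slice (nu s) (nu m) (nu a)) & tr (is_slice (nu t) (nu m) (nu b)) --> (a:el V <-> b:el V'))" unfolding large_def by blast
 thus ?thesis by (rule large_mono[OF U]) (simp add: sl[OF st])
 qed
 have P5: "large (kap uname) (%m. !a b. Slice n s m a --> Slice n t m b --> (iop a (ap x m):el V <-> iop b (ap y m):el V'))"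
 if r: "f:el (kap F)" "iop f n:el (kap ar)" "iop f V:el (kap I)" "iop f V':el (kap J)"
 and st: "isf s n" "isf t n" "!j:el n. iop (ap s j) (ap t j):el (kap prn)" and x: "iop x y:el (kap prn)" for f n V V' s t x y
 proof -
 have "!r:el (kap F). !n V V' s t x y. iop r n:el (kap ar) & iop r V:el (kap I) & iop r V':el (kap J) &
 tr (related (nu n) (nu s) (nu t)) & iop x y:el (kap prn) --> (EX Z:el (kap uname). !m:el Z. !a b c d.
 tr (is_slice (nu s) (nu m) (nu a)) & tr (is_slice (nu t) (nu m) (nu b)) & iop m c:el x & iop m d:el y -->
 (iop a c:el V <-> iop b d:el V'))" using tr_fo[OF app_transfer] by simp
 with r rl[OF st] x have "large (kap uname) (%m. !a b c d.
 tr (is_slice (nu s) (nu m) (nu a)) & tr (is_slice (nu t) (nu m) (nu b)) & iop m c:el x & iop m d:el y -->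
 (iop a c:el V <-> iop b d:el V'))" unfolding large_def by blast
 thus ?thesis by (rule large_mono[OF U]) (use sl[OF st] apI[OF PrD(1)[OF x]] apI[OF PrD(2)[OF x]] in blast)
 qed
 have "tr (isomorphic (nu (kap R)) (nu (kap F)) (nu (kap ar)) (nu C) (nu K) (nu D) (nu M))"
 by (rule ultrapowers_isomorphic[where Pr = "kap prn", OF U L upA upB IA IB Pr[rule_format]])
 ((assumption | rule P1 P2 P3 P4 P5)+)
 note iso = isomorphic_names[OF nms(1-3) this]
 have "tr (is_ultrapower cw uname R F ar A I (nu C) (nu K))" "tr (is_ultrapower cw uname R F ar B J (nu D) (nu M))"
 by (rule tr_is_ultrapower; simp add: U L upA upB om_def[symmetric])+
 with iso have "tr (is_ultrapower cw uname R F ar A I (nu C) (nu K) &.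
 is_ultrapower cw uname R F ar B J (nu D) (nu M) &. isomorphic R F ar (nu C) (nu K) (nu D) (nu M))" unfolding tr_Conj by blast
 thus "tr (?.C K. ?.D M. is_ultrapower cw uname R F ar A I C K &.
 is_ultrapower cw uname R F ar B J D M &. isomorphic R F ar C K D M)" (is "tr ?Pf")
 by (rule tr_ExI[OF tr_ExI[OF tr_ExI[OF tr_ExI]]]) simp_all
qed

end

section \<open>The ground \<omega>1 remains \<omega>1\<close>

context forcing
begin

lemma fo_pair_check: "p:CP ==> p||-<|chk x, chk y|>:.chk G <-> vpair x y:elts G"
proof -
 assume p: "p:CP"
 have "p||-<|chk x, chk y|>:.chk G <-> p||-chk (vpair x y):.chk G"
 proof
 assume h: "p||-<|chk x, chk y|>:.chk G"
 show "p||-chk (vpair x y):.chk G"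
 proof (rule by_model[OF p])
 fix W assume "gmodel P p W"
 then interpret gmodel P p W .
 show "tr (chk (vpair x y):.chk G)" using tr_fo[OF h] by (simp add: kap_check_pair)
 qed
 next
 assume h: "p||-chk (vpair x y):.chk G"
 show "p||-<|chk x, chk y|>:.chk G"
 proof (rule by_model[OF p])
 fix W assume "gmodel P p W"
 then interpret gmodel P p W .
 show "tr (<|chk x, chk y|>:.chk G)" using tr_fo[OF h] by (simp add: kap_check_pair)
 qed
 qed
 thus ?thesis using check_mem_iff[OF p] by simp
qed

lemma check_inj:
 assumes p: "p:CP" and g: "inj_on g (elts X)" "g ` elts X<=elts Y"
 shows "EX f. nm f & p||-is_inj f (chk X) (chk Y)"
proof -
 define G where "G = vset ((%x. vpair x (g x)) ` elts X)"
 have G: "elts G = (%x. vpair x (g x)) ` elts X" unfolding G_def by (rule elts_vset') simp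
 have pG: "vpair x y:elts G <-> x:elts X & y = g x" for x y unfolding G by auto
 have 1: "p||-(!.z:.chk G. ?.x:.chk X. ?.y:.chk Y. is_pair z x y)"
 proof (subst fo_AllIn_check, simp, rule ballI)
 fix z assume "z:elts G"
 then obtain x where x: "x:elts X" "z = vpair x (g x)" unfolding G by blast
 have "p||-is_pair (chk z) (chk x) (chk (g x))"
 proof (rule by_model[OF p])
 fix W assume "gmodel P p W"
 then interpret gmodel P p W .
 show "tr (is_pair (chk z) (chk x) (chk (g x)))" by (simp add: x kap_check_pair)
 qed
 thus "p||-(?.x:.chk X. ?.y:.chk Y. is_pair (chk z) x y)"
 using fo_ExIn_checkI[of "g x" Y p "is_pair (chk z) (chk x)"] fo_ExIn_checkI[of x X p "%x. ?.y:.chk Y. is_pair (chk z) x y"] x g by blast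
 qed
 have 2: "p||-(!.x:.chk X. ?.y:.chk Y. <|x, y|>:.chk G)"
 proof (subst fo_AllIn_check, simp, rule ballI)
 fix x assume x: "x:elts X"
 have "p||-<|chk x, chk (g x)|>:.chk G" using fo_pair_check[OF p] pG x by simp
 thus "p||-(?.y:.chk Y. <|chk x, y|>:.chk G)" by (rule fo_ExIn_checkI[rotated]) (use x g in blast)
 qed
 have 3: "p||-(!.x:.chk X. !.x':.chk X. !.y:.chk Y. !.y':.chk Y. <|x, y|>:.chk G &. <|x', y'|>:.chk G ->. (x =. x' <->. y =. y'))"
 proof (simp add: fo_AllIn_check, intro ballI)
 fix x x' y y' assume x: "x:elts X" "x':elts X"
 show "p||-(<|chk x, chk y|>:.chk G &. <|chk x', chk y'|>:.chk G ->. (chk x =. chk x' <->. chk y =. chk y'))"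
 proof (rule by_model[OF p])
 fix W assume "gmodel P p W"
 then interpret gmodel P p W .
 show "tr (<|chk x, chk y|>:.chk G &. <|chk x', chk y'|>:.chk G ->. (chk x =. chk x' <->. chk y =. chk y'))"
 using pG inj_onD[OF g(1) _ x] by (auto simp: check_kap_mem check_kap_eq simp flip: kap_check_pair)
 qed
 qed
 have "p||-is_inj (chk G) (chk X) (chk Y)"
 proof (rule by_model[OF p])
 fix W assume "gmodel P p W"
 then interpret gmodel P p W .
 let ?X = "el (kap (chk X))" and ?Y = "el (kap (chk Y))" and ?G = "el (kap (chk G))"
 have a: "!z:?G. EX x:?X. EX y:?Y. z = iop x y" "!x:?X. EX y:?Y. iop x y:?G"
 "!x:?X. !x':?X. !y:?Y. !y':?Y. iop x y:?G & iop x' y':?G --> (x = x' <-> y = y')"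
 using tr_fo[OF 1] tr_fo[OF 2] tr_fo[OF 3] by simp_all
 have m: "x:?X & y:?Y" if "iop x y:?G" for x y using a(1) that by fastforce
 have f: "isf (kap (chk G)) (kap (chk X))" unfolding isf_def using a m by blast
 have e: "iop x (ap (kap (chk G)) x):?G" if "x:?X" for x using isf_iff[OF f] that by blast
 have "Fn (kap (chk G)) (kap (chk X)) (kap (chk Y))" unfolding Fn_def using f e m by blast
 moreover have "x = x'" if "iop x y:?G" "iop x' y:?G" for x x' y using that a(3) m by blast
 ultimately show "tr (is_inj (chk G) (chk X) (chk Y))" unfolding is_inj_def by simp blast
 qed
 thus ?thesis by (intro exI[of _ "chk G"]) simp
qed

end

context staged
begin

text \<open>Smaller ordinals keep their ground enumerations. Given a forced injection of \<omega>1
  into \<omega>, uncountably many ordinals would have conditions deciding the same value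
  \<open>k\<close>; two of these conditions are compatible, and a common extension would identify
  two ordinals.\<close>

lemma fo_aleph1_check:
 assumes p: "p:CP"
 shows "p||-is_aleph1 (chk de)"
proof -
 have "p||-is_countable (chk a)" if a: "a:dl" for a
 proof -
 have c: "countable (elts a)" by (rule delta_countable[OF a])
 have "inj_on (%x. vnat (to_nat_on (elts a) x)) (elts a)" using inj_on_to_nat_on[OF c] by (simp add: inj_on_def)
 hence "EX f. nm f & p||-is_inj f (chk a) cw" by (rule check_inj[OF p]) (auto simp: elts_vomega)
 then obtain f where f: "nm f" "p||-is_inj f (chk a) cw" by blast
 show ?thesis unfolding is_countable_def card_le_def
 by (rule fo_ExI[of "cw"]) (simp_all add: fo_omega_check fo_ExI[of f p "%f. is_inj f (chk a) cw", OF f])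
 qed
 moreover have "p||-(~. is_countable (chk de))" unfolding fo_Neg
 proof (intro allI impI notI)
 fix q assume q: "q<~p" "q||-is_countable (chk de)"
 have qc: "q:CP" using le_conds[OF q(1)] by simp
 have "q||-(?.f. is_inj f (chk de) cw)"
 proof (rule by_model[OF qc])
 fix W assume "gmodel P q W"
 then interpret gmodel P q W .
 show "tr (?.f. is_inj f (chk de) cw)" using tr_fo[OF q(2)]  by (auto simp: is_countable_def card_le_def om_def[symmetric])
 qed
 moreover obtain f where f0: "nm f" "!!p. p||-(?.f. is_inj f (chk de) cw) ==> p||-is_inj f (chk de) cw"
 by (rule max_principle[of "%f. is_inj f (chk de) cw"]) simp_all
 ultimately have f: "q||-is_inj f (chk de) cw" by blast
 have "EX m r. r<~q & r||-<|chk xx, cn m|>:.f" if x: "xx:dl" for xx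
 proof -
 have "q||-(?.y:.cw. <|chk xx, y|>:.f)" by (rule inj_value[OF f check_mem[OF x] f0(1)]) (simp_all add: qc)
 then obtain r y where r: "r<~q" "nm y" "r||-y:.cw" "r||-<|chk xx, y|>:.f" unfolding fo_ExIn using le_refl[OF qc] by blast
 obtain s m where s: "s<~r" "feq s y (cn m)" using r(3) le_self[OF r(1)] unfolding fo_Mem_check elts_vomega by blast
 have "s||-<|chk xx, cn m|>:.f"
 by (rule extD[of "%y. <|chk xx, y|>:.f", OF _ r(2) nm_check s(2) fo_mono[OF r(4) s(1)]]) (simp add: f0)
 thus ?thesis using le_tr[OF s(1) r(1)] by blast
 qed
 then obtain m r where mr: "!!xx. xx:dl ==> r xx<~q & r xx||-<|chk xx, cn (m xx)|>:.f" by metis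
 have "dl = (\<Union>k. {xx:dl. m xx = k})" by blast
 hence "EX k. uncountable {xx:dl. m xx = k}" using delta_uncountable countable_UN[of UNIV "%k. {xx:dl. m xx = k}"] by fastforce
 then obtain k where k: "uncountable {xx:dl. m xx = k}" by blast
 have "EX i:{xx:dl. m xx = k}. EX j:{xx:dl. m xx = k}. i ~= j & compat (r i) (r j)"
 by (rule ccc_family[OF ccc_P k]) (use mr le_conds in blast)
 then obtain i j where ij: "i:dl" "m i = k" "j:dl" "m j = k" "i ~= j" "compat (r i) (r j)" by blast
 then obtain t where t: "t<~r i" "t<~r j" unfolding compat_def by blast
 have tc: "t:CP" using le_conds[OF t(1)] by simp
 have "feq t (chk i) (chk j)"
 proof (rule inj_eq[OF fo_mono[OF f]])
 show "t<~q" using le_tr[OF t(1)] mr[OF ij(1)] by blast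
 show "t||-<|chk i, cn k|>:.f" "t||-<|chk j, cn k|>:.f"
 using fo_mono[OF conjunct2[OF mr[OF ij(1)]] t(1)] fo_mono[OF conjunct2[OF mr[OF ij(3)]] t(2)] ij by simp_all
 qed (simp_all add: f0 tc)
 thus False using check_eq[OF tc] ij(5) by simp
 qed
 ultimately show ?thesis unfolding is_aleph1_def forces_Conj using fo_ordinal_check[OF ord_delta] by (simp add: fo_AllIn_check)
qed

end

section \<open>The ultrafilter for one instance, and the conclusion\<close>

context similar_structures
begin

text \<open>The maximal family \<open>S\<close> depends on the structures and on \<open>p0\<close>,
  so an ultrafilter is found separately for each instance.\<close>

lemma common_ultrapowers:
 "p0||-(?.w U. is_omega w &. is_nonprincipal_ultrafilter w U &. (?.C K. ?.D M.
 is_ultrapower w U R F ar A I C K &. is_ultrapower w U R F ar B J D M &. isomorphic R F ar C K D M))"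
proof -
 obtain S where S: "reqs0<=S" "S<=reqs" "fip S" "!s:reqs. fip (insert s S) --> s:S" using fip_maximal[OF reqs0] by blast
 interpret matched_structures P de lam res sup coh D p0 R F ar A I B J na nb rh S by unfold_locales (use S in blast)+
 show ?thesis by (rule fo_ExI[OF nm_check[of vomega]], rule fo_ExI[OF nm_uname])
 (simp add: fo_omega_check uname_ultrafilter[OF p0] isomorphic_ultrapowers)
qed

end

context staged
begin

lemma enumerated_structure:
 assumes n: "nm R" "nm F" "nm ar" "nm A" "nm I" and p: "p:CP"
 and s: "p||-is_structure R F ar A I" and c: "p||-card_le A (chk de)"
 shows "EX na. (!xx. nm (na xx) & p||-na xx:.A) &
 (!q x. q<~p --> nm x --> q||-x:.A --> (EX r xx. r<~q & xx:dl & feq r x (na xx)))"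
proof -
 have a: "p||-(?.a. a:.A)" using s unfolding is_structure_def forces_Conj by blast
 obtain f where f: "nm f" "!!p. p||-(?.f. is_inj f A (chk de)) ==> p||-is_inj f A (chk de)"
 by (rule max_principle[of "%f. is_inj f A (chk de)"]) (simp_all add: n)
 obtain na :: "'a => 'a" where na: "!xx. nm (na xx)" "!xx. p||-((?.y. y:.A) ->. na xx:.A)"
 "!q x. q<~p --> nm x --> q||-x:.A --> (EX r xx. r<~q & xx:dl & feq r x (na xx))"
 using enumerating_names[OF n(4) f(1) p f(2)[OF c[unfolded card_le_def]]] by blast
 have "p||-na xx:.A" for xx using na(2) a le_refl[OF p] unfolding fo_Imp by blast
 thus ?thesis using na(1,3) by blast
qed

lemma enumerated_symbols:
 assumes n: "nm R" "nm F" "nm ar" and p: "p:CP" and L: "p||-is_countable_language R F ar"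
 shows "EX rh. (!i. nm (rh i)) &
 (!q x. q<~p --> nm x --> q||-(x:.R |. x:.F) --> (EX r i. r<~q & feq r x (rh (i :: nat))))"
proof -
 have "p||-(?.X f. is_union X R F &. is_inj f X cw)"
 proof (rule by_model[OF p])
 fix W assume "gmodel P p W"
 then interpret gmodel P p W .
 show "tr (?.X f. is_union X R F &. is_inj f X cw)"
 using tr_fo[OF L] n by (auto simp: is_countable_language_def is_countable_def card_le_def om_def[symmetric] simp del: tr_is_language)
 qed
 moreover obtain X where X: "nm X" "!!p. p||-(?.X f. is_union X R F &. is_inj f X cw) ==>
 p||-(?.f. is_union X R F &. is_inj f X cw)"
 by (rule max_principle[of "%X. ?.f. is_union X R F &. is_inj f X cw"]) (simp_all add: n)
 moreover obtain f where f: "nm f" "!!p. p||-(?.f. is_union X R F &. is_inj f X cw) ==>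
 p||-(is_union X R F &. is_inj f X cw)" by (rule max_principle[of "%f. is_union X R F &. is_inj f X cw"]) (simp_all add: n X)
 ultimately have u: "p||-is_union X R F" "p||-is_inj f X cw" by auto
 obtain na :: "'a => 'a" where na: "!xx. nm (na xx)" "!xx. p||-((?.y. y:.X) ->. na xx:.X)"
 "!q x. q<~p --> nm x --> q||-x:.X --> (EX r xx. r<~q & xx:elts vomega & feq r x (na xx))"
 using enumerating_names[OF X(1) f(1) p u(2)] by blast
 have "EX r i. r<~q & feq r x (na (vnat i))" if q: "q<~p" "nm x" "q||-(x:.R |. x:.F)" for q x
 proof -
 have "q:CP" using le_conds[OF q(1)] by simp
 hence "q||-x:.X"
 proof (rule by_model)
 fix W assume "gmodel P q W"
 then interpret gmodel P q W .
 show "tr (x:.X)" using tr_fo[OF q(3)] tr_fo[OF fo_mono[OF u(1) q(1)]] n q(2) X(1) by simp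
 qed
 thus ?thesis using na(3) q by (fastforce simp: elts_vomega)
 qed
 thus ?thesis using na(1) by (intro exI[of _ "%i. na (vnat i)"]) simp
qed

text \<open>The condition \<open>q'\<close> that forces the hypotheses of an instance takes the
  place of \<open>p0\<close>; the bounds by aleph_1 provide the enumerations \<open>na\<close> and
  \<open>nb\<close>, and countability of the language provides \<open>rh\<close>.\<close>

lemma KT_check:
 assumes p: "p:CP"
 shows "p||-KT (chk de)" unfolding KT_def forces_All fo_Imp forces_Conj
proof (intro allI impI, elim conjE)
 fix R F ar q A I B J q' assume n: "nm R" "nm F" "nm ar" "nm A" "nm I" "nm B" "nm J" and q: "q<~p" "q'<~q"
 and L: "q||-is_countable_language R F ar"
 and h: "q'||-is_structure R F ar A I" "q'||-card_le A (chk de)" "q'||-is_structure R F ar B J" "q'||-card_le B (chk de)"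
 "q'||-elementarily_equivalent R F ar A I B J"
 have qc: "q':CP" using le_conds[OF q(2)] by simp
 obtain na where na: "!xx. nm (na xx) & q'||-na xx:.A"
 "!q x. q<~q' --> nm x --> q||-x:.A --> (EX r xx. r<~q & xx:dl & feq r x (na xx))"
 using enumerated_structure[OF n(1-5) qc h(1,2)] by blast
 obtain nb where nb: "!xx. nm (nb xx) & q'||-nb xx:.B"
 "!q x. q<~q' --> nm x --> q||-x:.B --> (EX r xx. r<~q & xx:dl & feq r x (nb xx))"
 using enumerated_structure[OF n(1-3,6,7) qc h(3,4)] by blast
 note L' = fo_mono[OF L q(2)]
 obtain rh :: "nat => 'a" where rh: "!i. nm (rh i)"
 "!q x. q<~q' --> nm x --> q||-(x:.R |. x:.F) --> (EX r i. r<~q & feq r x (rh i))"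
 using enumerated_symbols[OF n(1-3) qc L'] by blast
 interpret similar_structures P de lam res sup coh D q' R F ar A I B J na nb rh
 by unfold_locales (use n qc L' h na(1) nb(1) rh(1) in simp_all, (use na(2) nb(2) rh(2) in simp_all)?)
 show "q'||-(?.w U. is_omega w &. is_nonprincipal_ultrafilter w U &. (?.C K. ?.D M.
 is_ultrapower w U R F ar A I C K &. is_ultrapower w U R F ar B J D M &. isomorphic R F ar C K D M))"
 by (rule common_ultrapowers)
qed

lemma KT_aleph1_forced: "P \<tturnstile> KT_aleph1" unfolding forced_def KT_aleph1_def
 by (intro ballI fo_ExI[OF nm_check[of de]]) (simp add: fo_aleph1_check KT_check)

end

theorem theorem5p1:
  fixes lam \<omega>1 :: "'a::zfc"
    and P :: "'a \<Rightarrow> 'a forcing"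
    and Q :: "'a \<Rightarrow> 'a forcing_name"
  assumes "sat (is_aleph1 \<omega>1)"
    and "sat (is_regular_cardinal lam)" and "\<omega>1 \<in> elts lam" and "sat (power_below_eq lam)"
    and "fs_iteration \<omega>1 P Q"
    and "\<And>\<alpha>. \<alpha> \<in> elts \<omega>1 \<Longrightarrow>
      P \<alpha> \<tturnstile> (is_ccc (nm_conds (Q \<alpha>)) (nm_le (Q \<alpha>)) \<^bold>\<and>
        card_le (nm_conds (Q \<alpha>)) (check (P \<alpha>) lam))"
    and "\<And>\<alpha>. \<alpha> \<in> elts \<omega>1 \<Longrightarrow> even_ordinal \<alpha> \<Longrightarrow>
      P \<alpha> \<tturnstile> is_cohen_forcing (check (P \<alpha>) lam)
        (nm_conds (Q \<alpha>)) (nm_le (Q \<alpha>)) (nm_top (Q \<alpha>))"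
  shows "P \<omega>1 \<tturnstile> KT_aleph1"
proof -
 interpret cohen_iteration \<omega>1 P Q lam by unfold_locales (use assms in "auto simp: sat_is_aleph1")
 obtain D where "staged (P \<omega>1) \<omega>1 lam rs (supp \<omega>1) coh D" using staged_last by blast
 then interpret S: staged "P \<omega>1" \<omega>1 lam rs "supp \<omega>1" coh D .
 show ?thesis by (rule S.KT_aleph1_forced)
qed

end
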